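(* Let $(D;A,B;M)_C$ be a double vector bundle with core $C$, with associated DVB sequence $0\to C\xrightarrow{\mathfrak e}\mathfrak C(D)\xrightarrow{\mathfrak p}A\otimes B\to0$ and let $0\to A^*\otimes B^*\xrightarrow{i}\mathfrak X(D)\xrightarrow{j}C^*\to0$ be the associated exact sequence of double-linear functions. Then setting $$\langle[d],\sigma\rangle:=\sigma(d),\qquad d\in D_m,\ \sigma\in\mathfrak X(D)_m,\ m\in M,$$ gives a well-defined nondegenerate pairing $\langle\cdot,\cdot\rangle:\mathfrak C(D)\times_M\mathfrak X(D)\to\mathbb R$, satisfying $$\langle\omega,i(\theta)\rangle=\langle\mathfrak p(\omega),\theta\rangle\quad\forall\,\omega\in\mathfrak C(D)_m,\ \theta\in A_m^*\otimes B_m^*,\qquad \langle\mathfrak e(c),\sigma\rangle=\langle c,j(\sigma)\rangle\quad\forall\,c\in C_m,\ \sigma\in\mathfrak X(D)_m.$$ Consequently the sequence $0\to A^*\otimes B^*\xrightarrow{i}\mathfrak X(D)\xrightarrow{j}C^*\to0$ is identified with the dual $0\to A^*\otimes B^*\xrightarrow{\mathfrak p^*}\mathfrak C(D)^*\xrightarrow{\mathfrak e^*}C^*\to0$ of the associated DVB sequence.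
   Context: All manifolds and vector bundles are smooth, real, of finite dimension/rank. Double vector bundle: a double vector bundle $(D;A,B;M)$ consists of vector bundles $q_A:A\to M$, $q_B:B\to M$ and a manifold $D$ with two vector bundle structures $q^D_A:D\to A$ (operations $+_A,\cdot_A$) and $q^D_B:D\to B$ (operations $+_B,\cdot_B$), with $q_A\circ q^D_A=q_B\circ q^D_B$, such that each of the structure maps (bundle projection, zero section, addition, scalar multiplication) of each vector bundle structure on $D$ is a morphism of vector bundles with respect to the other structures. For $m\in M$ the slice is $D_m=(q^D_A)^{-1}(A_m)=(q^D_B)^{-1}(B_m)$. The core $C=\{c\in D:\exists m\in M,\ q^D_A(c)=0^A_m,\ q^D_B(c)=0^B_m\}$ is a vector bundle over $M$; the two linear structures of $D$ coincide on it. An element $c\in C$ regarded as an element of $D$ is written $\overline c$. The associated DVB sequence: let $\widetilde D_m$ be the free real vector space generated by the set $D_m$, and $\overline D_m$ the subspace generated by all elements $d_1+d_2-(d_1+_Ad_2)$, $d_3+d_4-(d_3+_Bd_4)$, $r\cdot d-(r\cdot_Ad)$, $r\cdot d-(r\cdot_Bd)$ (with $q^D_A(d_1)=q^D_A(d_2)$, $q^D_B(d_3)=q^D_B(d_4)$, $r\in\mathbb R$). Then $\mathfrak C(D)_m=\widetilde D_m/\overline D_m$, $[d]$ is the class of $d$, $\mathfrak C(D)=\bigcup_m\mathfrak C(D)_m$ is a vector bundle over $M$; $\mathfrak p$ is induced by $[d]\mapsto q^D_A(d)\otimes q^D_B(d)$ and $\mathfrak e(c)=[\overline c]$. Double-linear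 functions: a function $\sigma:D_m\to\mathbb R$ is double-linear if $\sigma(d_1+_Ad_2)=\sigma(d_1)+\sigma(d_2)$ whenever $q^D_A(d_1)=q^D_A(d_2)$, $\sigma(d_3+_Bd_4)=\sigma(d_3)+\sigma(d_4)$ whenever $q^D_B(d_3)=q^D_B(d_4)$, and $\sigma(r\cdot_Ad)=\sigma(r\cdot_Bd)=r\sigma(d)$. $\mathfrak X(D)_m$ is the vector space of double-linear functions on $D_m$, and $\mathfrak X(D)=\bigcup_m\mathfrak X(D)_m$, a vector bundle over $M$. For $\theta\in A^*_m\otimes B^*_m$, $i(\theta)(d)=\langle\theta,q^D_A(d)\otimes q^D_B(d)\rangle$; for $\sigma\in\mathfrak X(D)_m$, $j(\sigma)\in C_m^*$ is given by $\langle j(\sigma),c\rangle=\sigma(\overline c)$. *)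

theory Defs
  imports "HOL-Analysis.Analysis" "HOL-Library.Poly_Mapping"
begin

section \<open>Smooth manifolds\<close>

text \<open>Model spaces are finite-dimensional types of class \<^class>\<open>real_normed_vector\<close> rather than
  of class \<^class>\<open>euclidean_space\<close>: the latter has a non-empty basis, which would exclude base
  manifolds of dimension \<open>0\<close> and bundles of rank \<open>0\<close>.\<close>

definition finite_dim :: "'e::real_normed_vector itself \<Rightarrow> bool" where
  "finite_dim _ \<longleftrightarrow> (\<exists>B::'e set. finite B \<and> span B = UNIV)"

text \<open>Only used on open sets of finite-dimensional spaces, where testing the derivative on each
  fixed vector suffices.\<close>

primrec Ck_on :: "nat \<Rightarrow> 'e::real_normed_vector set \<Rightarrow> ('e \<Rightarrow> 'f::real_normed_vector) \<Rightarrow> bool" where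
  "Ck_on 0 S f \<longleftrightarrow> continuous_on S f"
| "Ck_on (Suc k) S f \<longleftrightarrow>
     (\<exists>f'. (\<forall>x\<in>S. (f has_derivative f' x) (at x)) \<and> (\<forall>v. Ck_on k S (\<lambda>x. f' x v)))"

definition smooth_on :: "'e::real_normed_vector set \<Rightarrow> ('e \<Rightarrow> 'f::real_normed_vector) \<Rightarrow> bool" where
  "smooth_on S f \<longleftrightarrow> (\<forall>k. Ck_on k S f)"

text \<open>An atlas is a set of charts \<open>(U, \<phi>)\<close> with \<open>\<phi>\<close> defined on \<open>U\<close>. The manifold is the union of
  the chart domains, with the topology in which these are open and the charts are homeomorphisms
  onto their images.\<close>

type_synonym ('x, 'e) atlas = "('x set \<times> ('x \<Rightarrow> 'e)) set"

definition points :: "('x, 'e) atlas \<Rightarrow> 'x set" where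
  "points \<A> = (\<Union>(U, \<phi>)\<in>\<A>. U)"

definition mopen :: "('x, 'e::real_normed_vector) atlas \<Rightarrow> 'x set \<Rightarrow> bool" where
  "mopen \<A> W \<longleftrightarrow> W \<subseteq> points \<A> \<and> (\<forall>(U, \<phi>)\<in>\<A>. open (\<phi> ` (U \<inter> W)))"

definition smooth_manifold :: "('x, 'e::real_normed_vector) atlas \<Rightarrow> bool" where
  "smooth_manifold \<A> \<longleftrightarrow>
     finite_dim TYPE('e) \<and>
     (\<forall>(U, \<phi>)\<in>\<A>. inj_on \<phi> U \<and> open (\<phi> ` U)) \<and>
     (\<forall>(U, \<phi>)\<in>\<A>. \<forall>(V, \<psi>)\<in>\<A>. open (\<phi> ` (U \<inter> V)) \<and>
        smooth_on (\<phi> ` (U \<inter> V)) (\<psi> \<circ> inv_into U \<phi>)) \<and>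
     Hausdorff_space (topology (mopen \<A>)) \<and>
     second_countable (topology (mopen \<A>))"

definition product_atlas ::
    "('x, 'e) atlas \<Rightarrow> ('y, 'f) atlas \<Rightarrow> ('x \<times> 'y, 'e \<times> 'f) atlas" where
  "product_atlas \<A> \<B> = {(U \<times> V, map_prod \<phi> \<psi>) | U \<phi> V \<psi>. (U, \<phi>) \<in> \<A> \<and> (V, \<psi>) \<in> \<B>}"

definition vs_atlas :: "('e::real_normed_vector, 'e) atlas" where
  "vs_atlas = {(UNIV, id)}"

definition msmooth_on :: "'x set \<Rightarrow> ('x, 'e::real_normed_vector) atlas \<Rightarrow>
    ('y, 'f::real_normed_vector) atlas \<Rightarrow> ('x \<Rightarrow> 'y) \<Rightarrow> bool" where
  "msmooth_on W \<A> \<B> f \<longleftrightarrow> mopen \<A> W \<and> f ` W \<subseteq> points \<B> \<and>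
     (\<forall>x\<in>W. \<exists>(U, \<phi>)\<in>\<A>. \<exists>(V, \<psi>)\<in>\<B>. \<exists>U'. mopen \<A> U' \<and> x \<in> U' \<and> U' \<subseteq> W \<inter> U \<and>
        f ` U' \<subseteq> V \<and> smooth_on (\<phi> ` U') (\<psi> \<circ> f \<circ> inv_into U \<phi>))"


section \<open>Real vector spaces with a carrier\<close>

record 'v rvs =
  carr :: "'v set"
  vzero :: 'v
  vadd :: "'v \<Rightarrow> 'v \<Rightarrow> 'v"
  vscl :: "real \<Rightarrow> 'v \<Rightarrow> 'v"

definition real_vs :: "'v rvs \<Rightarrow> bool" where
  "real_vs V \<longleftrightarrow>
     vzero V \<in> carr V \<and>
     (\<forall>x\<in>carr V. \<forall>y\<in>carr V. vadd V x y \<in> carr V) \<and>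
     (\<forall>r. \<forall>x\<in>carr V. vscl V r x \<in> carr V) \<and>
     (\<forall>x\<in>carr V. \<forall>y\<in>carr V. \<forall>z\<in>carr V. vadd V (vadd V x y) z = vadd V x (vadd V y z)) \<and>
     (\<forall>x\<in>carr V. \<forall>y\<in>carr V. vadd V x y = vadd V y x) \<and>
     (\<forall>x\<in>carr V. vadd V (vzero V) x = x) \<and>
     (\<forall>x\<in>carr V. \<exists>y\<in>carr V. vadd V x y = vzero V) \<and>
     (\<forall>r. \<forall>x\<in>carr V. \<forall>y\<in>carr V. vscl V r (vadd V x y) = vadd V (vscl V r x) (vscl V r y)) \<and>
     (\<forall>r s. \<forall>x\<in>carr V. vscl V (r + s) x = vadd V (vscl V r x) (vscl V s x)) \<and>
     (\<forall>r s. \<forall>x\<in>carr V. vscl V (r * s) x = vscl V r (vscl V s x)) \<and>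
     (\<forall>x\<in>carr V. vscl V 1 x = x)"

definition type_vs :: "'v::real_vector rvs" where
  "type_vs = \<lparr>carr = UNIV, vzero = 0, vadd = (+), vscl = (*\<^sub>R)\<rparr>"

definition linear_map :: "'v rvs \<Rightarrow> 'w rvs \<Rightarrow> ('v \<Rightarrow> 'w) \<Rightarrow> bool" where
  "linear_map V W f \<longleftrightarrow>
     (\<forall>x\<in>carr V. f x \<in> carr W) \<and>
     (\<forall>x\<in>carr V. \<forall>y\<in>carr V. f (vadd V x y) = vadd W (f x) (f y)) \<and>
     (\<forall>r. \<forall>x\<in>carr V. f (vscl V r x) = vscl W r (f x))"

definition linear_iso :: "'v rvs \<Rightarrow> 'w rvs \<Rightarrow> ('v \<Rightarrow> 'w) \<Rightarrow> bool" where
  "linear_iso V W f \<longleftrightarrow> linear_map V W f \<and> bij_betw f (carr V) (carr W)"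

definition short_exact ::
    "'u rvs \<Rightarrow> 'v rvs \<Rightarrow> 'w rvs \<Rightarrow> ('u \<Rightarrow> 'v) \<Rightarrow> ('v \<Rightarrow> 'w) \<Rightarrow> bool" where
  "short_exact U V W f g \<longleftrightarrow> linear_map U V f \<and> linear_map V W g \<and>
     inj_on f (carr U) \<and> f ` carr U = {x \<in> carr V. g x = vzero W} \<and> g ` carr V = carr W"

definition bilinear_form :: "'v rvs \<Rightarrow> 'w rvs \<Rightarrow> ('v \<Rightarrow> 'w \<Rightarrow> real) \<Rightarrow> bool" where
  "bilinear_form V W b \<longleftrightarrow>
     (\<forall>y\<in>carr W. linear_map V type_vs (\<lambda>x. b x y)) \<and>
     (\<forall>x\<in>carr V. linear_map W type_vs (b x))"

definition nondegenerate :: "'v rvs \<Rightarrow> 'w rvs \<Rightarrow> ('v \<Rightarrow> 'w \<Rightarrow> real) \<Rightarrow> bool" where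
  "nondegenerate V W b \<longleftrightarrow>
     (\<forall>x\<in>carr V. (\<forall>y\<in>carr W. b x y = 0) \<longrightarrow> x = vzero V) \<and>
     (\<forall>y\<in>carr W. (\<forall>x\<in>carr V. b x y = 0) \<longrightarrow> y = vzero W)"

primrec lincomb :: "'v rvs \<Rightarrow> (nat \<Rightarrow> real) \<Rightarrow> (nat \<Rightarrow> 'v) \<Rightarrow> nat \<Rightarrow> 'v" where
  "lincomb V c e 0 = vzero V"
| "lincomb V c e (Suc n) = vadd V (lincomb V c e n) (vscl V (c n) (e n))"

text \<open>Spaces of real functions on a set \<open>S\<close>; being \<open>undefined\<close> off \<open>S\<close> makes equality of functions
  agree with equality on \<open>S\<close>.\<close>

definition fun_vs :: "'x set \<Rightarrow> ('x \<Rightarrow> real) set \<Rightarrow> ('x \<Rightarrow> real) rvs" where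
  "fun_vs S F = \<lparr>carr = {f \<in> extensional S. f \<in> F},
     vzero = restrict (\<lambda>x. 0) S,
     vadd = (\<lambda>f g. restrict (\<lambda>x. f x + g x) S),
     vscl = (\<lambda>r f. restrict (\<lambda>x. r * f x) S)\<rparr>"

definition dual_vs :: "'v rvs \<Rightarrow> ('v \<Rightarrow> real) rvs" where
  "dual_vs V = fun_vs (carr V) {f. linear_map V type_vs f}"

definition transpose_map :: "'v rvs \<Rightarrow> ('v \<Rightarrow> 'w) \<Rightarrow> ('w \<Rightarrow> real) \<Rightarrow> ('v \<Rightarrow> real)" where
  "transpose_map V f \<xi> = restrict (\<lambda>x. \<xi> (f x)) (carr V)"


section \<open>Quotients of free vector spaces and tensor products\<close>

text \<open>Finitely supported functions form the free real vector space; its elements supported in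
  \<open>S\<close> form the free vector space generated by \<open>S\<close>.\<close>

instantiation poly_mapping :: (type, real_vector) real_vector
begin

lift_definition scaleR_poly_mapping :: "real \<Rightarrow> ('a \<Rightarrow>\<^sub>0 'b) \<Rightarrow> 'a \<Rightarrow>\<^sub>0 'b"
  is "\<lambda>r f x. r *\<^sub>R f x"
  by (rule finite_subset) auto

instance
  by standard (transfer; auto simp: algebra_simps)+

end

definition free_on :: "'x set \<Rightarrow> ('x \<Rightarrow>\<^sub>0 real) set" where
  "free_on S = {p. Poly_Mapping.keys p \<subseteq> S}"

abbreviation gen :: "'x \<Rightarrow> ('x \<Rightarrow>\<^sub>0 real)" where
  "gen x \<equiv> Poly_Mapping.single x 1"

definition lin_ext :: "('x \<Rightarrow> 'v::real_vector) \<Rightarrow> ('x \<Rightarrow>\<^sub>0 real) \<Rightarrow> 'v" where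
  "lin_ext f p = (\<Sum>x\<in>Poly_Mapping.keys p. Poly_Mapping.lookup p x *\<^sub>R f x)"

definition coset :: "'v::real_vector set \<Rightarrow> 'v \<Rightarrow> 'v set" where
  "coset N p = {p + n | n. n \<in> N}"

definition quot_vs :: "'v::real_vector set \<Rightarrow> 'v set \<Rightarrow> 'v set rvs" where
  "quot_vs F N = \<lparr>carr = coset N ` F,
     vzero = coset N 0,
     vadd = (\<lambda>X Y. {x + y | x y. x \<in> X \<and> y \<in> Y}),
     vscl = (\<lambda>r X. {r *\<^sub>R x + n | x n. x \<in> X \<and> n \<in> N})\<rparr>"

text \<open>The value at a coset \<open>X\<close> of the map induced by \<open>g\<close> on the quotient.\<close>

definition induced :: "('v \<Rightarrow> 'w) \<Rightarrow> 'v set \<Rightarrow> 'w" where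
  "induced g X = (THE y. \<forall>x\<in>X. g x = y)"

definition bilin_rel :: "'v rvs \<Rightarrow> 'w rvs \<Rightarrow> ('v \<times> 'w \<Rightarrow>\<^sub>0 real) set" where
  "bilin_rel V W =
     {gen (v, w) + gen (v', w) - gen (vadd V v v', w) | v v' w.
        v \<in> carr V \<and> v' \<in> carr V \<and> w \<in> carr W} \<union>
     {gen (v, w) + gen (v, w') - gen (v, vadd W w w') | v w w'.
        v \<in> carr V \<and> w \<in> carr W \<and> w' \<in> carr W} \<union>
     {r *\<^sub>R gen (v, w) - gen (vscl V r v, w) | r v w. v \<in> carr V \<and> w \<in> carr W} \<union>
     {r *\<^sub>R gen (v, w) - gen (v, vscl W r w) | r v w. v \<in> carr V \<and> w \<in> carr W}"

definition tensor_vs :: "'v rvs \<Rightarrow> 'w rvs \<Rightarrow> ('v \<times> 'w \<Rightarrow>\<^sub>0 real) set rvs" where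
  "tensor_vs V W = quot_vs (free_on (carr V \<times> carr W)) (span (bilin_rel V W))"

definition tensor :: "'v rvs \<Rightarrow> 'w rvs \<Rightarrow> 'v \<Rightarrow> 'w \<Rightarrow> ('v \<times> 'w \<Rightarrow>\<^sub>0 real) set" where
  "tensor V W v w = coset (span (bilin_rel V W)) (gen (v, w))"

text \<open>The canonical pairing of \<open>V \<otimes> W\<close> with \<open>V\<^sup>* \<otimes> W\<^sup>*\<close>, determined by
  \<open>\<langle>v \<otimes> w, f \<otimes> g\<rangle> = f v * g w\<close>.\<close>

definition tensor_pairing ::
    "('v \<times> 'w \<Rightarrow>\<^sub>0 real) set \<Rightarrow> (('v \<Rightarrow> real) \<times> ('w \<Rightarrow> real) \<Rightarrow>\<^sub>0 real) set \<Rightarrow> real" where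
  "tensor_pairing T \<theta> =
     induced (\<lambda>u. induced (lin_ext (\<lambda>(v, w). lin_ext (\<lambda>(f, g). f v * g w) u)) T) \<theta>"


section \<open>Vector bundles\<close>

text \<open>The algebraic part of a bundle of vector spaces: \<open>fadd\<close> and \<open>fscl\<close> are the fibrewise
  operations on the total space.\<close>

record ('x, 'm) vfamily =
  tot :: "'x set"
  base :: "'m set"
  proj :: "'x \<Rightarrow> 'm"
  fzero :: "'m \<Rightarrow> 'x"
  fadd :: "'x \<Rightarrow> 'x \<Rightarrow> 'x"
  fscl :: "real \<Rightarrow> 'x \<Rightarrow> 'x"

record ('x, 'e, 'm, 'n) vbundle = "('x, 'm) vfamily" +
  tot_atlas :: "('x, 'e) atlas"
  base_atlas :: "('m, 'n) atlas"

definition over :: "('x, 'm, 'z) vfamily_scheme \<Rightarrow> 'm set \<Rightarrow> 'x set" where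
  "over E U = {x \<in> tot E. proj E x \<in> U}"

definition fibre :: "('x, 'm, 'z) vfamily_scheme \<Rightarrow> 'm \<Rightarrow> 'x rvs" where
  "fibre E m = \<lparr>carr = over E {m}, vzero = fzero E m, vadd = fadd E, vscl = fscl E\<rparr>"

definition family_morphism :: "('x, 'm, 'z) vfamily_scheme \<Rightarrow> ('y, 'n, 'w) vfamily_scheme \<Rightarrow>
    ('x \<Rightarrow> 'y) \<Rightarrow> ('m \<Rightarrow> 'n) \<Rightarrow> bool" where
  "family_morphism E E' F f \<longleftrightarrow>
     (\<forall>m\<in>base E. f m \<in> base E' \<and> linear_map (fibre E m) (fibre E' (f m)) F)"

definition vector_bundle :: "'f::real_normed_vector itself \<Rightarrow>
    ('x, 'e::real_normed_vector, 'm, 'n::real_normed_vector) vbundle \<Rightarrow> bool" where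
  \<comment> \<open>\<open>'f\<close> is the typical fibre.\<close>
  "vector_bundle _ E \<longleftrightarrow>
     finite_dim TYPE('f) \<and>
     smooth_manifold (tot_atlas E) \<and> tot E = points (tot_atlas E) \<and>
     smooth_manifold (base_atlas E) \<and> base E = points (base_atlas E) \<and>
     msmooth_on (tot E) (tot_atlas E) (base_atlas E) (proj E) \<and>
     (\<forall>m\<in>base E. real_vs (fibre E m)) \<and>
     (\<forall>m\<in>base E. \<exists>U. \<exists>\<Psi>::'x \<Rightarrow> 'f. mopen (base_atlas E) U \<and> m \<in> U \<and>
        (\<forall>x\<in>U. linear_iso (fibre E x) type_vs \<Psi>) \<and>
        msmooth_on (over E U) (tot_atlas E) (product_atlas (base_atlas E) vs_atlas)
          (\<lambda>x. (proj E x, \<Psi> x)) \<and>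
        msmooth_on (U \<times> UNIV) (product_atlas (base_atlas E) vs_atlas) (tot_atlas E)
          (inv_into (over E U) (\<lambda>x. (proj E x, \<Psi> x))))"

definition vb_morphism :: "('x, 'e::real_normed_vector, 'm, 'n::real_normed_vector) vbundle \<Rightarrow>
    ('y, 'f::real_normed_vector, 'k, 'l::real_normed_vector) vbundle \<Rightarrow>
    ('x \<Rightarrow> 'y) \<Rightarrow> ('m \<Rightarrow> 'k) \<Rightarrow> bool" where
  "vb_morphism E E' F f \<longleftrightarrow> family_morphism E E' F f \<and>
     msmooth_on (tot E) (tot_atlas E) (tot_atlas E') F \<and>
     msmooth_on (base E) (base_atlas E) (base_atlas E') f"


section \<open>Double vector bundles\<close>

record ('d, 'ed, 'a, 'ea, 'b, 'eb, 'm, 'em) dvb =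
  DA :: "('d, 'ed, 'a, 'ea) vbundle"
  DB :: "('d, 'ed, 'b, 'eb) vbundle"
  sideA :: "('a, 'ea, 'm, 'em) vbundle"
  sideB :: "('b, 'eb, 'm, 'em) vbundle"

text \<open>For bundle structures \<open>E\<close> over (the total space of) \<open>A\<close> and \<open>E'\<close> over \<open>B\<close> on one manifold
  \<open>D\<close>, the domain of the addition of \<open>E\<close> is the bundle \<open>D \<times>\<^sub>A D \<rightarrow> B \<times>\<^sub>M B\<close> with the
  operations of \<open>E'\<close>.\<close>

definition fibre_product :: "('d, 'a, 'z) vfamily_scheme \<Rightarrow> ('d, 'b, 'w) vfamily_scheme \<Rightarrow>
    ('b, 'm, 'v) vfamily_scheme \<Rightarrow> ('d \<times> 'd, 'b \<times> 'b) vfamily" where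
  "fibre_product E E' B = \<lparr>
     tot = {(x, y). x \<in> tot E \<and> y \<in> tot E \<and> proj E x = proj E y},
     base = {(b, c). b \<in> tot B \<and> c \<in> tot B \<and> proj B b = proj B c},
     proj = map_prod (proj E') (proj E'),
     fzero = map_prod (fzero E') (fzero E'),
     fadd = (\<lambda>(x, y) (x', y'). (fadd E' x x', fadd E' y y')),
     fscl = (\<lambda>r. map_prod (fscl E' r) (fscl E' r))\<rparr>"

text \<open>The structure maps of \<open>E\<close> are morphisms with respect to \<open>E'\<close>, in the order projection, zero
  section, addition, scalar multiplication. Smoothness of the addition is not repeated: it
  follows from local triviality of \<open>E\<close> and \<open>B\<close>.\<close>

definition structure_maps_linear ::
    "('d, 'ed::real_normed_vector, 'a, 'ea::real_normed_vector) vbundle \<Rightarrow>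
     ('d, 'ed, 'b, 'eb::real_normed_vector) vbundle \<Rightarrow>
     ('a, 'ea, 'm, 'em::real_normed_vector) vbundle \<Rightarrow>
     ('b, 'eb, 'm, 'em) vbundle \<Rightarrow> bool" where
  "structure_maps_linear E E' A B \<longleftrightarrow>
     vb_morphism E' A (proj E) (proj B) \<and>
     vb_morphism A E' (fzero E) (fzero B) \<and>
     family_morphism (fibre_product E E' B) E' (\<lambda>(x, y). fadd E x y) (\<lambda>(b, c). fadd B b c) \<and>
     (\<forall>r. vb_morphism E' E' (fscl E r) (fscl B r))"

definition double_vector_bundle ::
    "'fa::real_normed_vector itself \<Rightarrow> 'fb::real_normed_vector itself \<Rightarrow>
     'fda::real_normed_vector itself \<Rightarrow> 'fdb::real_normed_vector itself \<Rightarrow>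
     ('d, 'ed::real_normed_vector, 'a, 'ea::real_normed_vector,
      'b, 'eb::real_normed_vector, 'm, 'em::real_normed_vector) dvb \<Rightarrow> bool" where
  \<comment> \<open>\<open>'fa\<close>, \<open>'fb\<close>, \<open>'fda\<close>, \<open>'fdb\<close> are the typical fibres of
     \<open>A \<rightarrow> M\<close>, \<open>B \<rightarrow> M\<close>, \<open>D \<rightarrow> A\<close>, \<open>D \<rightarrow> B\<close>.\<close>
  "double_vector_bundle TA TB TDA TDB D \<longleftrightarrow>
     vector_bundle TA (sideA D) \<and> vector_bundle TB (sideB D) \<and>
     vector_bundle TDA (DA D) \<and> vector_bundle TDB (DB D) \<and>
     base_atlas (sideA D) = base_atlas (sideB D) \<and>
     tot_atlas (DA D) = tot_atlas (DB D) \<and>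
     base_atlas (DA D) = tot_atlas (sideA D) \<and>
     base_atlas (DB D) = tot_atlas (sideB D) \<and>
     (\<forall>d\<in>tot (DA D). proj (sideA D) (proj (DA D) d) = proj (sideB D) (proj (DB D) d)) \<and>
     structure_maps_linear (DA D) (DB D) (sideA D) (sideB D) \<and>
     structure_maps_linear (DB D) (DA D) (sideB D) (sideA D)"

abbreviation M_atlas :: "('d, 'ed, 'a, 'ea, 'b, 'eb, 'm, 'em) dvb \<Rightarrow> ('m, 'em) atlas" where
  "M_atlas D \<equiv> base_atlas (sideA D)"

abbreviation D_atlas :: "('d, 'ed, 'a, 'ea, 'b, 'eb, 'm, 'em) dvb \<Rightarrow> ('d, 'ed) atlas" where
  "D_atlas D \<equiv> tot_atlas (DA D)"

definition projM :: "('d, 'ed, 'a, 'ea, 'b, 'eb, 'm, 'em) dvb \<Rightarrow> 'd \<Rightarrow> 'm" where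
  "projM D d = proj (sideA D) (proj (DA D) d)"

definition D_over :: "('d, 'ed, 'a, 'ea, 'b, 'eb, 'm, 'em) dvb \<Rightarrow> 'm set \<Rightarrow> 'd set" where
  "D_over D U = {d \<in> tot (DA D). projM D d \<in> U}"

abbreviation slice :: "('d, 'ed, 'a, 'ea, 'b, 'eb, 'm, 'em) dvb \<Rightarrow> 'm \<Rightarrow> 'd set" where
  "slice D m \<equiv> D_over D {m}"

definition core_fib :: "('d, 'ed, 'a, 'ea, 'b, 'eb, 'm, 'em) dvb \<Rightarrow> 'm \<Rightarrow> 'd rvs" where
  "core_fib D m = \<lparr>
     carr = {c \<in> tot (DA D). proj (DA D) c = fzero (sideA D) m \<and> proj (DB D) c = fzero (sideB D) m},
     vzero = fzero (DA D) (fzero (sideA D) m),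
     vadd = fadd (DA D), vscl = fscl (DA D)\<rparr>"


section \<open>Vector bundles presented by their smooth local sections\<close>

text \<open>For the bundles constructed fibrewise from \<open>D\<close>, the smooth structure is given by
  specifying which local sections are smooth. \<open>is_vb\<close> requires that smoothness of sections is a
  local condition and that there are local frames in which a section is smooth iff its
  coefficients are; this determines the total space as a smooth vector bundle of rank \<open>k\<close>.\<close>

record ('m, 'v) sbundle =
  fib :: "'m \<Rightarrow> 'v rvs"
  smooth_sec :: "'m set \<Rightarrow> ('m \<Rightarrow> 'v) \<Rightarrow> bool"

definition is_section :: "('m, 'v) sbundle \<Rightarrow> 'm set \<Rightarrow> ('m \<Rightarrow> 'v) \<Rightarrow> bool" where
  "is_section S U s \<longleftrightarrow> (\<forall>x\<in>U. s x \<in> carr (fib S x))"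

abbreviation smooth_fun ::
    "('x, 'e::real_normed_vector) atlas \<Rightarrow> 'x set \<Rightarrow> ('x \<Rightarrow> real) \<Rightarrow> bool" where
  "smooth_fun \<A> U f \<equiv> msmooth_on U \<A> vs_atlas f"

definition smooth_frame :: "('m, 'e::real_normed_vector) atlas \<Rightarrow> ('m, 'v) sbundle \<Rightarrow>
    'm set \<Rightarrow> nat \<Rightarrow> (nat \<Rightarrow> 'm \<Rightarrow> 'v) \<Rightarrow> bool" where
  "smooth_frame \<A> S U k e \<longleftrightarrow>
     (\<forall>i<k. is_section S U (e i)) \<and>
     (\<forall>x\<in>U. \<forall>v\<in>carr (fib S x).
        \<exists>!c. c \<in> extensional {..<k} \<and> v = lincomb (fib S x) c (\<lambda>i. e i x) k) \<and>
     (\<forall>V s. mopen \<A> V \<and> V \<subseteq> U \<and> is_section S V s \<longrightarrow>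
        (smooth_sec S V s \<longleftrightarrow>
          (\<exists>c. (\<forall>i<k. smooth_fun \<A> V (c i)) \<and>
               (\<forall>x\<in>V. s x = lincomb (fib S x) (\<lambda>i. c i x) (\<lambda>i. e i x) k))))"

definition is_vb :: "('m, 'e::real_normed_vector) atlas \<Rightarrow> ('m, 'v) sbundle \<Rightarrow> bool" where
  "is_vb \<A> S \<longleftrightarrow>
     (\<forall>m\<in>points \<A>. real_vs (fib S m)) \<and>
     (\<forall>U s. smooth_sec S U s \<longrightarrow> mopen \<A> U \<and> is_section S U s) \<and>
     (\<forall>U s. mopen \<A> U \<longrightarrow>
        (smooth_sec S U s \<longleftrightarrow> (\<forall>x\<in>U. \<exists>V. x \<in> V \<and> V \<subseteq> U \<and> smooth_sec S V s))) \<and>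
     (\<exists>k. \<forall>m\<in>points \<A>. \<exists>U e. mopen \<A> U \<and> m \<in> U \<and> smooth_frame \<A> S U k e)"

definition vb_iso :: "('m, 'e::real_normed_vector) atlas \<Rightarrow> ('m, 'v) sbundle \<Rightarrow>
    ('m, 'w) sbundle \<Rightarrow> ('m \<Rightarrow> 'v \<Rightarrow> 'w) \<Rightarrow> bool" where
  "vb_iso \<A> S T \<Phi> \<longleftrightarrow> is_vb \<A> S \<and> is_vb \<A> T \<and>
     (\<forall>m\<in>points \<A>. linear_iso (fib S m) (fib T m) (\<Phi> m)) \<and>
     (\<forall>U s. mopen \<A> U \<and> is_section S U s \<longrightarrow>
        (smooth_sec S U s \<longleftrightarrow> smooth_sec T U (\<lambda>x. \<Phi> x (s x))))"

definition vb_pairing :: "('m, 'e::real_normed_vector) atlas \<Rightarrow> ('m, 'v) sbundle \<Rightarrow>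
    ('m, 'w) sbundle \<Rightarrow> ('m \<Rightarrow> 'v \<Rightarrow> 'w \<Rightarrow> real) \<Rightarrow> bool" where
  "vb_pairing \<A> S T b \<longleftrightarrow> is_vb \<A> S \<and> is_vb \<A> T \<and>
     (\<forall>m\<in>points \<A>. bilinear_form (fib S m) (fib T m) (b m)) \<and>
     (\<forall>U s t. smooth_sec S U s \<and> smooth_sec T U t \<longrightarrow> smooth_fun \<A> U (\<lambda>x. b x (s x) (t x)))"

definition dual_bundle :: "('m, 'e::real_normed_vector) atlas \<Rightarrow> ('m, 'v) sbundle \<Rightarrow>
    ('m, 'v \<Rightarrow> real) sbundle" where
  "dual_bundle \<A> S = \<lparr>
     fib = (\<lambda>m. dual_vs (fib S m)),
     smooth_sec = (\<lambda>U \<xi>. mopen \<A> U \<and> (\<forall>x\<in>U. \<xi> x \<in> carr (dual_vs (fib S x))) \<and>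
       (\<forall>V s. V \<subseteq> U \<and> smooth_sec S V s \<longrightarrow> smooth_fun \<A> V (\<lambda>x. \<xi> x (s x))))\<rparr>"


section \<open>The two associated sequences\<close>

definition dvb_rel :: "('d, 'ed, 'a, 'ea, 'b, 'eb, 'm, 'em) dvb \<Rightarrow> 'm \<Rightarrow> ('d \<Rightarrow>\<^sub>0 real) set" where
  "dvb_rel D m =
     {gen x + gen y - gen (fadd (DA D) x y) | x y.
        x \<in> slice D m \<and> y \<in> slice D m \<and> proj (DA D) x = proj (DA D) y} \<union>
     {gen x + gen y - gen (fadd (DB D) x y) | x y.
        x \<in> slice D m \<and> y \<in> slice D m \<and> proj (DB D) x = proj (DB D) y} \<union>
     {r *\<^sub>R gen x - gen (fscl (DA D) r x) | r x. x \<in> slice D m} \<union>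
     {r *\<^sub>R gen x - gen (fscl (DB D) r x) | r x. x \<in> slice D m}"

definition CD_fib :: "('d, 'ed, 'a, 'ea, 'b, 'eb, 'm, 'em) dvb \<Rightarrow> 'm \<Rightarrow> ('d \<Rightarrow>\<^sub>0 real) set rvs" where
  "CD_fib D m = quot_vs (free_on (slice D m)) (span (dvb_rel D m))"

definition cls :: "('d, 'ed, 'a, 'ea, 'b, 'eb, 'm, 'em) dvb \<Rightarrow> 'm \<Rightarrow> 'd \<Rightarrow> ('d \<Rightarrow>\<^sub>0 real) set" where
  "cls D m d = coset (span (dvb_rel D m)) (gen d)"

text \<open>The smooth sections of \<open>\<CC>(D)\<close> are those locally generated, over the smooth functions, by the
  classes of smooth local sections \<open>t\<close> of \<open>D \<rightarrow> M\<close>. This gives the only smooth vector bundle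
  structure on the fibres \<open>CD_fib\<close> for which \<open>d \<mapsto> [d]\<close> is smooth.\<close>

definition CD :: "('d, 'ed::real_normed_vector, 'a, 'ea, 'b, 'eb, 'm, 'em::real_normed_vector) dvb \<Rightarrow>
    ('m, ('d \<Rightarrow>\<^sub>0 real) set) sbundle" where
  "CD D = \<lparr>
     fib = CD_fib D,
     smooth_sec = (\<lambda>U s. mopen (M_atlas D) U \<and> (\<forall>x\<in>U. \<exists>V n f t.
       mopen (M_atlas D) V \<and> x \<in> V \<and> V \<subseteq> U \<and>
       (\<forall>i<n. smooth_fun (M_atlas D) V (f i) \<and> msmooth_on V (M_atlas D) (D_atlas D) (t i) \<and>
          (\<forall>y\<in>V. projM D (t i y) = y)) \<and>
       (\<forall>y\<in>V. s y = lincomb (CD_fib D y) (\<lambda>i. f i y) (\<lambda>i. cls D y (t i y)) n)))\<rparr>"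

definition double_linear ::
    "('d, 'ed, 'a, 'ea, 'b, 'eb, 'm, 'em) dvb \<Rightarrow> 'm \<Rightarrow> ('d \<Rightarrow> real) \<Rightarrow> bool" where
  "double_linear D m \<sigma> \<longleftrightarrow>
     (\<forall>x\<in>slice D m. \<forall>y\<in>slice D m. proj (DA D) x = proj (DA D) y \<longrightarrow>
        \<sigma> (fadd (DA D) x y) = \<sigma> x + \<sigma> y) \<and>
     (\<forall>x\<in>slice D m. \<forall>y\<in>slice D m. proj (DB D) x = proj (DB D) y \<longrightarrow>
        \<sigma> (fadd (DB D) x y) = \<sigma> x + \<sigma> y) \<and>
     (\<forall>r. \<forall>x\<in>slice D m. \<sigma> (fscl (DA D) r x) = r * \<sigma> x \<and> \<sigma> (fscl (DB D) r x) = r * \<sigma> x)"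

definition XD_fib :: "('d, 'ed, 'a, 'ea, 'b, 'eb, 'm, 'em) dvb \<Rightarrow> 'm \<Rightarrow> ('d \<Rightarrow> real) rvs" where
  "XD_fib D m = fun_vs (slice D m) {\<sigma>. double_linear D m \<sigma>}"

text \<open>A local section of \<open>\<XX>(D)\<close> over \<open>U\<close> is smooth iff the function it defines on the part of \<open>D\<close>
  over \<open>U\<close> is.\<close>

definition XD :: "('d, 'ed::real_normed_vector, 'a, 'ea, 'b, 'eb, 'm, 'em::real_normed_vector) dvb \<Rightarrow>
    ('m, 'd \<Rightarrow> real) sbundle" where
  "XD D = \<lparr>
     fib = XD_fib D,
     smooth_sec = (\<lambda>U s. mopen (M_atlas D) U \<and> (\<forall>x\<in>U. s x \<in> carr (XD_fib D x)) \<and>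
       smooth_fun (D_atlas D) (D_over D U) (\<lambda>d. s (projM D d) d))\<rparr>"

definition AB_fib :: "('d, 'ed, 'a, 'ea, 'b, 'eb, 'm, 'em) dvb \<Rightarrow> 'm \<Rightarrow> ('a \<times> 'b \<Rightarrow>\<^sub>0 real) set rvs" where
  "AB_fib D m = tensor_vs (fibre (sideA D) m) (fibre (sideB D) m)"

definition AB_dual_fib :: "('d, 'ed, 'a, 'ea, 'b, 'eb, 'm, 'em) dvb \<Rightarrow> 'm \<Rightarrow>
    (('a \<Rightarrow> real) \<times> ('b \<Rightarrow> real) \<Rightarrow>\<^sub>0 real) set rvs" where
  "AB_dual_fib D m = tensor_vs (dual_vs (fibre (sideA D) m)) (dual_vs (fibre (sideB D) m))"

definition AB_tensor :: "('d, 'ed, 'a, 'ea, 'b, 'eb, 'm, 'em) dvb \<Rightarrow> 'm \<Rightarrow> 'd \<Rightarrow>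
    ('a \<times> 'b \<Rightarrow>\<^sub>0 real) set" where
  "AB_tensor D m d = tensor (fibre (sideA D) m) (fibre (sideB D) m) (proj (DA D) d) (proj (DB D) d)"

definition map_p :: "('d, 'ed, 'a, 'ea, 'b, 'eb, 'm, 'em) dvb \<Rightarrow> 'm \<Rightarrow>
    ('d \<Rightarrow>\<^sub>0 real) set \<Rightarrow> ('a \<times> 'b \<Rightarrow>\<^sub>0 real) set" where
  "map_p D m = induced (\<lambda>p. coset (span (bilin_rel (fibre (sideA D) m) (fibre (sideB D) m)))
     (lin_ext (\<lambda>d. gen (proj (DA D) d, proj (DB D) d)) p))"

definition map_e :: "('d, 'ed, 'a, 'ea, 'b, 'eb, 'm, 'em) dvb \<Rightarrow> 'm \<Rightarrow> 'd \<Rightarrow> ('d \<Rightarrow>\<^sub>0 real) set" where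
  "map_e D m c = cls D m c"

definition map_i :: "('d, 'ed, 'a, 'ea, 'b, 'eb, 'm, 'em) dvb \<Rightarrow> 'm \<Rightarrow>
    (('a \<Rightarrow> real) \<times> ('b \<Rightarrow> real) \<Rightarrow>\<^sub>0 real) set \<Rightarrow> ('d \<Rightarrow> real)" where
  "map_i D m \<theta> = restrict (\<lambda>d. tensor_pairing (AB_tensor D m d) \<theta>) (slice D m)"

definition map_j :: "('d, 'ed, 'a, 'ea, 'b, 'eb, 'm, 'em) dvb \<Rightarrow> 'm \<Rightarrow> ('d \<Rightarrow> real) \<Rightarrow> ('d \<Rightarrow> real)" where
  "map_j D m \<sigma> = restrict \<sigma> (carr (core_fib D m))"

text \<open>In the dual of \<open>map_p\<close>, \<open>A\<^sup>* \<otimes> B\<^sup>*\<close> acts on \<open>A \<otimes> B\<close> by \<open>tensor_pairing\<close>.\<close>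

definition map_p_dual :: "('d, 'ed, 'a, 'ea, 'b, 'eb, 'm, 'em) dvb \<Rightarrow> 'm \<Rightarrow>
    (('a \<Rightarrow> real) \<times> ('b \<Rightarrow> real) \<Rightarrow>\<^sub>0 real) set \<Rightarrow> (('d \<Rightarrow>\<^sub>0 real) set \<Rightarrow> real)" where
  "map_p_dual D m \<theta> = transpose_map (CD_fib D m) (map_p D m) (\<lambda>\<tau>. tensor_pairing \<tau> \<theta>)"

definition map_e_dual :: "('d, 'ed, 'a, 'ea, 'b, 'eb, 'm, 'em) dvb \<Rightarrow> 'm \<Rightarrow>
    (('d \<Rightarrow>\<^sub>0 real) set \<Rightarrow> real) \<Rightarrow> ('d \<Rightarrow> real)" where
  "map_e_dual D m = transpose_map (core_fib D m) (map_e D m)"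

end

theory Submission
  imports Defs
begin

text \<open>
  The pairing is well defined because a double-linear function on \<open>D\<^sub>m\<close>, extended linearly to the free
  vector space, is zero on the relations of \<open>\<CC>(D)\<^sub>m\<close>. Conversely a linear functional on \<open>\<CC>(D)\<^sub>m\<close> is
  determined by its values on the classes \<open>[d]\<close>, and these values are a double-linear function of \<open>d\<close>.
  So \<open>\<XX>(D)\<^sub>m\<close> is the algebraic dual of \<open>\<CC>(D)\<^sub>m\<close> (\<open>XD_dual_iso\<close>). As linear functionals separate the
  points of a vector space, the pairing is nondegenerate (\<open>cls_pairing_nondegenerate\<close>), and the two
  compatibilities with \<open>i\<close>, \<open>\<pp>\<close> and \<open>j\<close>, \<open>\<ee>\<close> hold because they hold on classes \<open>[d]\<close>.

  What needs work is that the fibres are finite-dimensional and fit together to smooth vector bundles.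
  A double vector bundle is not assumed to be locally decomposable, so enough smooth double-linear
  functions have to be constructed. Products of fibre coordinates of \<open>A\<close> and \<open>B\<close> are double-linear. The
  remaining ones come from \<open>core_extension\<close>: a functional on the core of \<open>D\<^sub>m\<close> extends to a function
  near the zero section of \<open>D \<rightarrow> B\<close> that is linear over \<open>A\<close>, and the derivative of this function along
  the fibres of \<open>D \<rightarrow> B\<close> is linear over \<open>A\<close> and over \<open>B\<close>. It restricts to the given functional on the core.

  On a fibre of \<open>D \<rightarrow> A\<close>, such extensions of a basis of functionals on the core, together with the
  projection to \<open>B\<close>, are injective. As all fibres of \<open>D \<rightarrow> A\<close> have the same dimension, they are
  surjective as well (\<open>fibre_splitting\<close>). Hence there are elements of \<open>D\<close> over each pair \<open>(a, b)\<close>, and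
  the products of coordinates together with the extensions form a basis of \<open>\<XX>(D)\<^sub>m\<close> that is dual to
  finitely many elements of \<open>D\<^sub>m\<close>, the number of which does not depend on \<open>m\<close> (\<open>fibre_dual_basis\<close>).
  Elements of \<open>D\<^sub>m\<close> extend to smooth local sections of \<open>D \<rightarrow> M\<close>. An elimination with smooth coefficients
  makes these sections and the double-linear functions dual to each other at all points near \<open>m\<close>
  (\<open>local_dual_frames\<close>). They are then frames of \<open>\<CC>(D)\<close> and of \<open>\<XX>(D)\<close> in which the coefficients of a
  section are its pairings with the dual frame, and with respect to which \<open>\<XX>(D)\<close> is the dual bundle
  (\<open>CD_frame\<close>, \<open>XD_frame\<close>, \<open>to_dual_vb_iso\<close>).

  The same constructions give the exactness of the sequence of double-linear functions
  (\<open>exact_sequence\<close>), and the isomorphism of \<open>\<XX>(D)\<close> with \<open>\<CC>(D)\<^sup>*\<close> carries it to the dual of the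
  associated sequence.
\<close>

section \<open>Smooth calculus on open subsets of normed spaces\<close>

lemma Ck_on_cong:
  assumes "open S" "\<And>x. x \<in> S \<Longrightarrow> f x = g x" "Ck_on k S f"
  shows "Ck_on k S g"
proof (cases k)
  case 0
  then show ?thesis using assms by (simp cong: continuous_on_cong)
next
  case (Suc j)
  then obtain f' where f': "\<And>x. x \<in> S \<Longrightarrow> (f has_derivative f' x) (at x)"
    "\<And>v. Ck_on j S (\<lambda>x. f' x v)" using assms by auto
  have "(g has_derivative f' x) (at x)" if "x \<in> S" for x
    using has_derivative_transform_within_open[OF f'(1)[OF that] assms(1) that] assms(2) by blast
  then show ?thesis using Suc f'(2) by auto
qed

lemma Ck_on_subset: "Ck_on k S f \<Longrightarrow> T \<subseteq> S \<Longrightarrow> Ck_on k T f"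
proof (induction k arbitrary: f)
  case 0
  then show ?case by (auto intro: continuous_on_subset)
next
  case (Suc k)
  then obtain f' where "\<forall>x\<in>S. (f has_derivative f' x) (at x)" "\<forall>v. Ck_on k S (\<lambda>x. f' x v)"
    by auto
  then have "\<forall>x\<in>T. (f has_derivative f' x) (at x)" "\<forall>v. Ck_on k T (\<lambda>x. f' x v)"
    using Suc by auto
  then show ?case by auto
qed

lemma Ck_on_SucD: "Ck_on (Suc k) S f \<Longrightarrow> Ck_on k S f"
proof (induction k arbitrary: f)
  case 0
  then show ?case
    by (auto intro!: continuous_at_imp_continuous_on dest: has_derivative_continuous)
next
  case (Suc k)
  obtain f' where f': "\<forall>x\<in>S. (f has_derivative f' x) (at x)" "\<forall>v. Ck_on (Suc k) S (\<lambda>x. f' x v)"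
    using Suc.prems unfolding Ck_on.simps(2)[of "Suc k"] by blast
  then show ?case using Suc.IH unfolding Ck_on.simps(2)[of k] by blast
qed

text \<open>The derivatives on the various \<open>T\<close> agree because a derivative at a point is unique.\<close>

lemma Ck_on_local:
  assumes "\<And>x. x \<in> S \<Longrightarrow> \<exists>T. open T \<and> x \<in> T \<and> Ck_on k T f"
  shows "Ck_on k S f"
  using assms
proof (induction k arbitrary: f)
  case 0
  have "isCont f x" if "x \<in> S" for x
    using 0[OF that] by (auto simp: continuous_on_eq_continuous_at)
  then show ?case by (auto intro: continuous_at_imp_continuous_on)
next
  case (Suc j)
  let ?f' = "\<lambda>x. frechet_derivative f (at x)"
  have *: "\<exists>T. open T \<and> x \<in> T \<and> (\<forall>x\<in>T. (f has_derivative ?f' x) (at x)) \<and> (\<forall>v. Ck_on j T (\<lambda>x. ?f' x v))"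
    if x: "x \<in> S" for x
  proof -
    obtain T f' where T: "open T" "x \<in> T" and f': "\<And>x. x \<in> T \<Longrightarrow> (f has_derivative f' x) (at x)"
      "\<And>v. Ck_on j T (\<lambda>x. f' x v)"
      using Suc.prems[OF x] by auto
    have eq: "f' x = ?f' x" if "x \<in> T" for x
      using frechet_derivative_at[OF f'(1)[OF that]] .
    have "Ck_on j T (\<lambda>x. ?f' x v)" for v
      using Ck_on_cong[OF T(1) _ f'(2)] eq by force
    then show ?thesis using T f' eq by metis
  qed
  have "Ck_on j S (\<lambda>x. ?f' x v)" for v
    by (rule Suc.IH) (use * in blast)
  moreover have "\<forall>x\<in>S. (f has_derivative ?f' x) (at x)" using * by blast
  ultimately show ?case by (auto intro!: exI[of _ ?f'])
qed

lemma Ck_on_const: "Ck_on k S (\<lambda>x. c)"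
proof (induction k arbitrary: c)
  case (Suc k)
  then show ?case by (auto intro!: exI[of _ "\<lambda>x v. 0"] derivative_eq_intros)
qed auto

lemma Ck_on_bounded_linear:
  assumes "bounded_linear h"
  shows "Ck_on k S f \<Longrightarrow> Ck_on k S (\<lambda>x. h (f x))"
proof (induction k arbitrary: f)
  case 0
  then show ?case using assms by (auto intro: bounded_linear.continuous_on)
next
  case (Suc k)
  then obtain f' where f': "\<forall>x\<in>S. (f has_derivative f' x) (at x)" "\<forall>v. Ck_on k S (\<lambda>x. f' x v)"
    by auto
  have "\<forall>x\<in>S. ((\<lambda>x. h (f x)) has_derivative (\<lambda>v. h (f' x v))) (at x)"
    using f'(1) bounded_linear.has_derivative[OF assms] by blast
  then show ?case using Suc.IH f'(2)
    by (auto intro!: exI[of _ "\<lambda>x v. h (f' x v)"])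
qed

lemma Ck_on_id: "Ck_on k S (\<lambda>x. x)"
proof (cases k)
  case (Suc j)
  have "\<forall>x\<in>S. ((\<lambda>x. x) has_derivative (\<lambda>v. v)) (at x)" by (auto intro: derivative_intros)
  then show ?thesis using Suc Ck_on_const unfolding Suc Ck_on.simps
    by (intro exI[of _ "\<lambda>x v. v"]) auto
qed auto

lemma Ck_on_add: "Ck_on k S f \<Longrightarrow> Ck_on k S g \<Longrightarrow> Ck_on k S (\<lambda>x. f x + g x)"
proof (induction k arbitrary: f g)
  case 0
  then show ?case by (auto intro: continuous_on_add)
next
  case (Suc k)
  then obtain f' g' where f': "\<forall>x\<in>S. (f has_derivative f' x) (at x)" "\<forall>v. Ck_on k S (\<lambda>x. f' x v)"
    and g': "\<forall>x\<in>S. (g has_derivative g' x) (at x)" "\<forall>v. Ck_on k S (\<lambda>x. g' x v)"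
    by auto
  then show ?case using Suc.IH
    by (auto intro!: exI[of _ "\<lambda>x v. f' x v + g' x v"] has_derivative_add)
qed

lemma Ck_on_sum: "(\<And>i. i \<in> I \<Longrightarrow> Ck_on k S (f i)) \<Longrightarrow> Ck_on k S (\<lambda>x. \<Sum>i\<in>I. f i x)"
  by (induction I rule: infinite_finite_induct) (auto intro: Ck_on_const Ck_on_add)

lemma Ck_on_scaleR:
  "Ck_on k S f \<Longrightarrow> Ck_on k S g \<Longrightarrow> Ck_on k S (\<lambda>x. f x *\<^sub>R g x)"
proof (induction k arbitrary: f g)
  case 0
  then show ?case by (auto intro: continuous_on_scaleR)
next
  case (Suc k)
  then obtain f' g' where f': "\<forall>x\<in>S. (f has_derivative f' x) (at x)" "\<forall>v. Ck_on k S (\<lambda>x. f' x v)"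
    and g': "\<forall>x\<in>S. (g has_derivative g' x) (at x)" "\<forall>v. Ck_on k S (\<lambda>x. g' x v)"
    by auto
  have "Ck_on k S f" "Ck_on k S g" using Suc.prems Ck_on_SucD by auto
  then have "Ck_on k S (\<lambda>x. f x *\<^sub>R g' x v + f' x v *\<^sub>R g x)" for v
    using Suc.IH f' g' by (intro Ck_on_add) auto
  moreover have "\<forall>x\<in>S. ((\<lambda>x. f x *\<^sub>R g x) has_derivative (\<lambda>v. f x *\<^sub>R g' x v + f' x v *\<^sub>R g x)) (at x)"
    using f' g' by (auto intro!: has_derivative_scaleR)
  ultimately show ?case unfolding Ck_on.simps
    by (intro exI[of _ "\<lambda>x v. f x *\<^sub>R g' x v + f' x v *\<^sub>R g x"]) auto
qed

lemma Ck_on_Pair: "Ck_on k S f \<Longrightarrow> Ck_on k S g \<Longrightarrow> Ck_on k S (\<lambda>x. (f x, g x))"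
proof -
  assume "Ck_on k S f" "Ck_on k S g"
  then have "Ck_on k S (\<lambda>x. (f x, 0) + (0, g x))"
    by (intro Ck_on_add Ck_on_bounded_linear[of "\<lambda>x. (x, 0)"] Ck_on_bounded_linear[of "\<lambda>x. (0, x)"])
      (auto intro!: bounded_linear_intros)
  then show ?thesis by simp
qed

lemma Ck_on_inverse:
  fixes f :: "_ \<Rightarrow> real"
  shows "Ck_on k S f \<Longrightarrow> (\<And>x. x \<in> S \<Longrightarrow> f x \<noteq> 0) \<Longrightarrow> Ck_on k S (\<lambda>x. inverse (f x))"
proof (induction k)
  case 0
  then show ?case by (auto intro: continuous_on_inverse)
next
  case (Suc k)
  then obtain f' where f': "\<forall>x\<in>S. (f has_derivative f' x) (at x)" "\<forall>v. Ck_on k S (\<lambda>x. f' x v)"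
    by auto
  have "Ck_on k S (\<lambda>x. inverse (f x))" using Suc.IH Suc.prems Ck_on_SucD by blast
  then have "Ck_on k S (\<lambda>x. (- 1) *\<^sub>R (inverse (f x) *\<^sub>R (f' x v *\<^sub>R inverse (f x))))" for v
    using f' by (intro Ck_on_scaleR Ck_on_const) auto
  moreover have "\<forall>x\<in>S. ((\<lambda>x. inverse (f x)) has_derivative (\<lambda>v. - (inverse (f x) * f' x v * inverse (f x)))) (at x)"
    using f' Suc.prems by (auto intro!: has_derivative_inverse)
  ultimately show ?case unfolding Ck_on.simps
    by (intro exI[of _ "\<lambda>x v. - (inverse (f x) * f' x v * inverse (f x))"])
      (auto simp: mult.assoc)
qed

subsection \<open>Finite-dimensional normed spaces\<close>

text \<open>Induction on \<open>B\<close>: when \<open>x\<close> is added, its coefficient is bounded by the norm of the vector divided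
  by the distance of \<open>x\<close> from the closed subspace \<open>span B\<close>.\<close>

lemma complete_span_finite:
  fixes B :: "'a::real_normed_vector set"
  assumes "finite B"
  shows "complete (span B)"
  using assms
proof (induction B)
  case empty
  have "f \<longlonglongrightarrow> 0" if "\<forall>n. f n = 0" for f :: "nat \<Rightarrow> 'a"
  proof -
    have "f = (\<lambda>n. 0)" using that by auto
    then show ?thesis by simp
  qed
  then show ?case by (auto simp: complete_def)
next
  case (insert x B)
  show ?case
  proof (cases "x \<in> span B")
    case True
    then show ?thesis using insert.IH by (simp add: span_redundant)
  next
    case False
    have cl: "closed (span B)" using insert.IH by (rule complete_imp_closed)
    define \<delta> where "\<delta> = infdist x (span B)"
    have ne: "span B \<noteq> {}" using span_zero by blast
    have \<delta>: "\<delta> > 0"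
      using in_closed_iff_infdist_zero[OF cl ne, of x] False infdist_nonneg[of x "span B"]
      unfolding \<delta>_def by linarith
    have bd: "\<bar>c\<bar> * \<delta> \<le> norm (c *\<^sub>R x + s)" if s: "s \<in> span B" for c s
    proof (cases "c = 0")
      case False
      have "(- 1 / c) *\<^sub>R s \<in> span B" using s by (rule span_scale)
      then have "\<delta> \<le> dist x ((- 1 / c) *\<^sub>R s)" unfolding \<delta>_def by (rule infdist_le)
      also have "\<dots> = norm ((1 / c) *\<^sub>R (c *\<^sub>R x + s))"
        using False by (simp add: dist_norm algebra_simps)
      also have "\<dots> = norm (c *\<^sub>R x + s) / \<bar>c\<bar>" by simp
      finally show ?thesis using False by (simp add: field_simps)
    qed auto
    show ?thesis
    proof (rule completeI)
      fix y :: "nat \<Rightarrow> 'a" assume y: "\<forall>n. y n \<in> span (insert x B)" "Cauchy y"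
      then obtain c where c: "\<And>n. y n - c n *\<^sub>R x \<in> span B"
        unfolding span_breakdown_eq by metis
      define s where "s n = y n - c n *\<^sub>R x" for n
      have "Cauchy c"
      proof (rule metric_CauchyI)
        fix e :: real assume "e > 0"
        then obtain N where N: "\<And>m n. m \<ge> N \<Longrightarrow> n \<ge> N \<Longrightarrow> dist (y m) (y n) < e * \<delta>"
          using \<delta> y(2) metric_CauchyD[of y "e * \<delta>"] by (metis mult_pos_pos)
        have "dist (c m) (c n) < e" if "m \<ge> N" "n \<ge> N" for m n
        proof -
          have "\<bar>c m - c n\<bar> * \<delta> \<le> norm ((c m - c n) *\<^sub>R x + (s m - s n))"
            by (rule bd) (auto simp: s_def c intro: span_diff)
          also have "\<dots> = dist (y m) (y n)"
            by (simp add: dist_norm s_def algebra_simps)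
          also have "\<dots> < e * \<delta>" using N that by blast
          finally show ?thesis using \<delta> by (simp add: dist_real_def)
        qed
        then show "\<exists>M. \<forall>m\<ge>M. \<forall>n\<ge>M. dist (c m) (c n) < e" by blast
      qed
      then obtain c0 where c0: "c \<longlonglongrightarrow> c0" using Cauchy_convergent convergent_def by blast
      then have "(\<lambda>n. c n *\<^sub>R x) \<longlonglongrightarrow> c0 *\<^sub>R x" by (intro tendsto_intros)
      then have "Cauchy (\<lambda>n. c n *\<^sub>R x)" using LIMSEQ_imp_Cauchy by blast
      have "Cauchy s"
      proof (rule metric_CauchyI)
        fix e :: real assume "e > 0"
        then have "e / 2 > 0" by simp
        obtain N1 where N1: "\<And>m n. m \<ge> N1 \<Longrightarrow> n \<ge> N1 \<Longrightarrow> dist (y m) (y n) < e / 2"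
          using metric_CauchyD[OF y(2) \<open>e / 2 > 0\<close>] by blast
        obtain N2 where N2: "\<And>m n. m \<ge> N2 \<Longrightarrow> n \<ge> N2 \<Longrightarrow> dist (c m *\<^sub>R x) (c n *\<^sub>R x) < e / 2"
          using metric_CauchyD[OF \<open>Cauchy (\<lambda>n. c n *\<^sub>R x)\<close> \<open>e / 2 > 0\<close>] by blast
        have le: "dist (s m) (s n) \<le> dist (y m) (y n) + dist (c m *\<^sub>R x) (c n *\<^sub>R x)" for m n
          using norm_triangle_ineq4[of "y m - y n" "c m *\<^sub>R x - c n *\<^sub>R x"]
          by (simp add: dist_norm s_def algebra_simps)
        have "dist (s m) (s n) < e" if "m \<ge> max N1 N2" "n \<ge> max N1 N2" for m n
          using le[of m n] N1[of m n] N2[of m n] that by simp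
        then show "\<exists>M. \<forall>m\<ge>M. \<forall>n\<ge>M. dist (s m) (s n) < e" by blast
      qed
      then obtain s0 where s0: "s0 \<in> span B" "s \<longlonglongrightarrow> s0"
        using completeE[OF insert.IH, of s] c unfolding s_def by blast
      have "(\<lambda>n. c n *\<^sub>R x + s n) \<longlonglongrightarrow> c0 *\<^sub>R x + s0"
        using c0 s0 by (intro tendsto_intros)
      then have "y \<longlonglongrightarrow> c0 *\<^sub>R x + s0" by (simp add: s_def)
      moreover have "c0 *\<^sub>R x + s0 \<in> span (insert x B)"
        using s0 by (auto simp: span_breakdown_eq intro!: exI[of _ c0])
      ultimately show "\<exists>l\<in>span (insert x B). y \<longlonglongrightarrow> l" by blast
    qed
  qed
qed

text \<open>A finite basis together with its coordinate functions, required to be continuous.\<close>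

definition coord_basis :: "'e::real_normed_vector set \<Rightarrow> ('e \<Rightarrow> 'e \<Rightarrow> real) \<Rightarrow> bool" where
  "coord_basis B crd \<longleftrightarrow> finite B \<and> independent B \<and> span B = UNIV \<and>
     (\<forall>b\<in>B. bounded_linear (crd b)) \<and> (\<forall>v. (\<Sum>b\<in>B. crd b v *\<^sub>R b) = v) \<and>
     (\<forall>b\<in>B. \<forall>c\<in>B. crd b c = (if b = c then 1 else 0))"

lemma finite_dim_coordinates:
  assumes "finite_dim TYPE('e::real_normed_vector)"
  shows "\<exists>(B :: 'e set) crd. coord_basis B crd"
proof -
  obtain B0 :: "'e set" where B0: "finite B0" "span B0 = UNIV"
    using assms unfolding finite_dim_def by auto
  obtain B where B: "B \<subseteq> B0" "independent B" "B0 \<subseteq> span B"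
    using maximal_independent_subset[of B0] by auto
  have spB: "span B = UNIV" using B(3) B0(2) span_mono[of B0 "span B"] by (simp add: span_span top.extremum_uniqueI)
  have fB: "finite B" using B(1) B0(1) finite_subset by blast
  define crd where "crd b v = representation B v b" for b v
  have lin: "linear (crd b)" for b
    unfolding crd_def
    by (intro linearI) (simp_all add: representation_add representation_scale B spB)
  have sum: "v = (\<Sum>b\<in>B. crd b v *\<^sub>R b)" for v
    unfolding crd_def using sum_representation_eq[OF B(2) _ fB subset_refl, of v] spB by simp
  have delta: "crd b c = (if b = c then 1 else 0)" if "c \<in> B" for b c
    unfolding crd_def using representation_basis[OF B(2) that] by auto
  have "bounded_linear (crd b)" if b: "b \<in> B" for b
  proof -
    let ?S = "span (B - {b})"
    have cl: "closed ?S" using complete_span_finite[of "B - {b}"] fB complete_imp_closed by auto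
    have nb: "b \<notin> ?S" using B(2) b unfolding dependent_def by blast
    have ne: "?S \<noteq> {}" using span_zero by blast
    define \<delta> where "\<delta> = infdist b ?S"
    have \<delta>: "\<delta> > 0"
      using in_closed_iff_infdist_zero[OF cl ne, of b] nb infdist_nonneg[of b ?S]
      unfolding \<delta>_def by linarith
    have bd: "\<bar>crd b v\<bar> * \<delta> \<le> norm v" for v
    proof (cases "crd b v = 0")
      case False
      let ?c = "crd b v"
      have "v - ?c *\<^sub>R b = (\<Sum>a\<in>B - {b}. crd a v *\<^sub>R a)"
        using sum[of v] sum.remove[OF fB b, of "\<lambda>a. crd a v *\<^sub>R a"] by (simp add: algebra_simps)
      also have "\<dots> \<in> ?S" by (intro span_sum span_scale span_base)
      finally have "(- 1 / ?c) *\<^sub>R (v - ?c *\<^sub>R b) \<in> ?S" by (rule span_scale)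
      then have "\<delta> \<le> dist b ((- 1 / ?c) *\<^sub>R (v - ?c *\<^sub>R b))" unfolding \<delta>_def by (rule infdist_le)
      also have "\<dots> = norm ((1 / ?c) *\<^sub>R v)"
        using False by (simp add: dist_norm algebra_simps)
      also have "\<dots> = norm v / \<bar>?c\<bar>" by simp
      finally show ?thesis using False by (simp add: field_simps)
    qed auto
    show ?thesis
      using lin bd \<delta>
      by (intro bounded_linear_intro[of _ "1 / \<delta>"])
        (auto simp: linear_add linear_cmul field_simps)
  qed
  then show ?thesis unfolding coord_basis_def using fB B(2) spB sum[symmetric] delta by (intro exI[of _ B] exI[of _ crd]) simp
qed

lemma linear_bounded_finite_dim:
  assumes "finite_dim TYPE('e::real_normed_vector)" "linear (f :: 'e \<Rightarrow> 'f::real_normed_vector)"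
  shows "bounded_linear f"
proof -
  obtain B and crd :: "'e \<Rightarrow> 'e \<Rightarrow> real" where "coord_basis B crd"
    using finite_dim_coordinates[OF assms(1)] by blast
  then have B: "\<And>b. b \<in> B \<Longrightarrow> bounded_linear (crd b)" "\<And>v. (\<Sum>b\<in>B. crd b v *\<^sub>R b) = v"
    unfolding coord_basis_def by auto
  have "f v = f (\<Sum>b\<in>B. crd b v *\<^sub>R b)" for v by (rule arg_cong[OF B(2)[symmetric]])
  also have "f (\<Sum>b\<in>B. crd b v *\<^sub>R b) = (\<Sum>b\<in>B. crd b v *\<^sub>R f b)" for v
    using assms(2) by (simp add: linear_sum linear_cmul)
  finally have "f = (\<lambda>v. \<Sum>b\<in>B. crd b v *\<^sub>R f b)" by (rule ext)
  moreover have "bounded_linear (\<lambda>v. \<Sum>b\<in>B. crd b v *\<^sub>R f b)"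
    using B(1) by (intro bounded_linear_sum bounded_linear_scaleR_const) auto
  ultimately show ?thesis by simp
qed

lemma finite_dim_Pair:
  assumes "finite_dim TYPE('e::real_normed_vector)" "finite_dim TYPE('f::real_normed_vector)"
  shows "finite_dim TYPE('e \<times> 'f)"
proof -
  obtain B :: "'e set" and C :: "'f set"
    where B: "finite B" "span B = UNIV" and C: "finite C" "span C = UNIV"
    using assms unfolding finite_dim_def by auto
  have "finite ((\<lambda>x. (x, 0)) ` B \<union> (\<lambda>y. (0, y)) ` C)" using B C by auto
  moreover have "span ((\<lambda>x. (x, 0)) ` B \<union> (\<lambda>y. (0, y)) ` C) = (UNIV :: ('e \<times> 'f) set)"
  proof -
    have 1: "linear (\<lambda>x. (x, 0 :: 'f))" "linear (\<lambda>y. (0 :: 'e, y))"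
      by (auto intro!: linearI)
    have "(x, y) \<in> span ((\<lambda>x. (x, 0)) ` B \<union> (\<lambda>y. (0, y)) ` C)" for x :: 'e and y :: 'f
    proof -
      have "(x, 0) \<in> span ((\<lambda>x. (x, 0 :: 'f)) ` B)" "(0, y) \<in> span ((\<lambda>y. (0 :: 'e, y)) ` C)"
        using B(2) C(2) span_linear_image[OF 1(1), of B] span_linear_image[OF 1(2), of C] by blast+
      then have "(x, 0) + (0, y) \<in> span ((\<lambda>x. (x, 0 :: 'f)) ` B \<union> (\<lambda>y. (0 :: 'e, y)) ` C)"
        by (meson span_add span_mono Un_upper1 Un_upper2 subsetD)
      then show ?thesis by simp
    qed
    then show ?thesis by auto
  qed
  ultimately show ?thesis unfolding finite_dim_def by blast
qed

subsection \<open>Composition\<close>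

text \<open>In the chain rule the derivative of \<open>f\<close> is applied to a vector that depends on the point, whereas
  \<^const>\<open>Ck_on\<close> only speaks of derivatives along fixed vectors. Expanding in a basis of the space in
  the middle reduces the former to the latter.\<close>

lemma Ck_on_compose:
  fixes g :: "'e::real_normed_vector \<Rightarrow> 'f::real_normed_vector"
  assumes fd: "finite_dim TYPE('f)" and "g ` S \<subseteq> T"
  shows "Ck_on k S g \<Longrightarrow> Ck_on k T f \<Longrightarrow> Ck_on k S (\<lambda>x. f (g x))"
proof (induction k arbitrary: f)
  case 0
  then show ?case using assms(2) continuous_on_compose2[of T f S g] by auto
next
  case (Suc k)
  obtain B and crd :: "'f \<Rightarrow> 'f \<Rightarrow> real" where "coord_basis B crd"
    using finite_dim_coordinates[OF fd] by blast
  then have B: "\<And>b. b \<in> B \<Longrightarrow> bounded_linear (crd b)" "\<And>v. (\<Sum>b\<in>B. crd b v *\<^sub>R b) = v"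
    unfolding coord_basis_def by auto
  obtain f' g' where f': "\<forall>x\<in>T. (f has_derivative f' x) (at x)" "\<forall>v. Ck_on k T (\<lambda>x. f' x v)"
    and g': "\<forall>x\<in>S. (g has_derivative g' x) (at x)" "\<forall>v. Ck_on k S (\<lambda>x. g' x v)"
    using Suc.prems by auto
  have gk: "Ck_on k S g" using Suc.prems Ck_on_SucD by blast
  have d: "((\<lambda>x. f (g x)) has_derivative (\<lambda>v. f' (g x) (g' x v))) (at x)" if "x \<in> S" for x
    using f'(1) g'(1) that assms(2) has_derivative_compose[of g "g' x" x UNIV f "f' (g x)"] by auto
  have eq: "f' (g x) (g' x v) = (\<Sum>b\<in>B. crd b (g' x v) *\<^sub>R f' (g x) b)" if "x \<in> S" for x v
  proof -
    have l: "linear (f' (g x))"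
      using f'(1) that assms(2) has_derivative_linear by blast
    have "f' (g x) (g' x v) = f' (g x) (\<Sum>b\<in>B. crd b (g' x v) *\<^sub>R b)" by (rule arg_cong[OF B(2)[symmetric]])
    also have "\<dots> = (\<Sum>b\<in>B. crd b (g' x v) *\<^sub>R f' (g x) b)"
      using l by (simp add: linear_sum linear_cmul)
    finally show ?thesis .
  qed
  have "Ck_on k S (\<lambda>x. \<Sum>b\<in>B. crd b (g' x v) *\<^sub>R f' (g x) b)" for v
  proof (intro Ck_on_sum Ck_on_scaleR)
    show "Ck_on k S (\<lambda>x. crd b (g' x v))" if "b \<in> B" for b
      using Ck_on_bounded_linear[OF B(1)[OF that]] g'(2) by blast
    show "Ck_on k S (\<lambda>x. f' (g x) b)" for b
      using Suc.IH[OF gk, of "\<lambda>y. f' y b"] f'(2) by blast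
  qed
  moreover have "((\<lambda>x. f (g x)) has_derivative (\<lambda>v. \<Sum>b\<in>B. crd b (g' x v) *\<^sub>R f' (g x) b)) (at x)"
    if "x \<in> S" for x
    using d[OF that] eq[OF that] by simp
  ultimately show ?case unfolding Ck_on.simps
    by (intro exI[of _ "\<lambda>x v. \<Sum>b\<in>B. crd b (g' x v) *\<^sub>R f' (g x) b"]) auto
qed

lemma smooth_on_cong:
  "open S \<Longrightarrow> (\<And>x. x \<in> S \<Longrightarrow> f x = g x) \<Longrightarrow> smooth_on S f \<Longrightarrow> smooth_on S g"
  unfolding smooth_on_def using Ck_on_cong by blast

lemma smooth_on_subset: "smooth_on S f \<Longrightarrow> T \<subseteq> S \<Longrightarrow> smooth_on T f"
  unfolding smooth_on_def using Ck_on_subset by blast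

lemma smooth_on_local:
  "(\<And>x. x \<in> S \<Longrightarrow> \<exists>T. open T \<and> x \<in> T \<and> smooth_on T f) \<Longrightarrow> smooth_on S f"
  unfolding smooth_on_def by (meson Ck_on_local)

lemma smooth_on_compose:
  fixes g :: "'e::real_normed_vector \<Rightarrow> 'f::real_normed_vector"
  assumes "finite_dim TYPE('f)" "smooth_on S g" "smooth_on T f" "g ` S \<subseteq> T"
  shows "smooth_on S (\<lambda>x. f (g x))"
  using assms Ck_on_compose unfolding smooth_on_def by blast

lemma smooth_on_const: "smooth_on S (\<lambda>x. c)"
  and smooth_on_id: "smooth_on S (\<lambda>x. x)"
  and smooth_on_bounded_linear: "bounded_linear h \<Longrightarrow> smooth_on S f \<Longrightarrow> smooth_on S (\<lambda>x. h (f x))"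
  and smooth_on_add: "smooth_on S f \<Longrightarrow> smooth_on S g \<Longrightarrow> smooth_on S (\<lambda>x. f x + g x)"
  and smooth_on_scaleR: "smooth_on S a \<Longrightarrow> smooth_on S f \<Longrightarrow> smooth_on S (\<lambda>x. a x *\<^sub>R f x)"
  and smooth_on_Pair: "smooth_on S f \<Longrightarrow> smooth_on S h' \<Longrightarrow> smooth_on S (\<lambda>x. (f x, h' x))"
  and smooth_on_inverse: "smooth_on S a \<Longrightarrow> (\<And>x. x \<in> S \<Longrightarrow> a x \<noteq> 0) \<Longrightarrow> smooth_on S (\<lambda>x. inverse (a x))"
  unfolding smooth_on_def
  by (simp_all add: Ck_on_const Ck_on_id Ck_on_bounded_linear Ck_on_add Ck_on_scaleR Ck_on_Pair Ck_on_inverse)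

lemma smooth_on_imp_continuous_on: "smooth_on S f \<Longrightarrow> continuous_on S f"
  unfolding smooth_on_def using Ck_on.simps(1) by blast

lemma smooth_on_has_derivative:
  assumes "smooth_on S f" "open S"
  obtains f' where "\<And>x. x \<in> S \<Longrightarrow> (f has_derivative f' x) (at x)" "\<And>v. smooth_on S (\<lambda>x. f' x v)"
proof -
  let ?f' = "\<lambda>x. frechet_derivative f (at x)"
  have 1: "(f has_derivative ?f' x) (at x)" if "x \<in> S" for x
  proof -
    have "Ck_on (Suc 0) S f" using assms unfolding smooth_on_def by blast
    then show ?thesis
      using that frechet_derivative_works[of f "at x"] unfolding Ck_on.simps differentiable_def by blast
  qed
  have "Ck_on k S (\<lambda>x. ?f' x v)" for k v
  proof -
    have "Ck_on (Suc k) S f" using assms unfolding smooth_on_def by blast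
    then obtain f' where f': "\<forall>x\<in>S. (f has_derivative f' x) (at x)" "\<forall>v. Ck_on k S (\<lambda>x. f' x v)"
      by auto
    then have "f' x v = ?f' x v" if "x \<in> S" for x
      using that frechet_derivative_at[of f "f' x" x] by auto
    then show ?thesis by (rule Ck_on_cong[OF assms(2) _ f'(2)[rule_format]])
  qed
  then have "smooth_on S (\<lambda>x. ?f' x v)" for v unfolding smooth_on_def by blast
  from that[OF 1 this] show ?thesis .
qed

section \<open>Charts and smooth maps between manifolds\<close>

text \<open>The part of the definition of a smooth manifold that is not about its topology; unlike the
  Hausdorff property and second countability it is all that local arguments need, and it passes
  to products at once.\<close>

definition charts_compat :: "('x, 'e::real_normed_vector) atlas \<Rightarrow> bool" where
  "charts_compat \<A> \<longleftrightarrow> finite_dim TYPE('e) \<and>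
     (\<forall>(U, \<phi>)\<in>\<A>. inj_on \<phi> U \<and> open (\<phi> ` U)) \<and>
     (\<forall>(U, \<phi>)\<in>\<A>. \<forall>(V, \<psi>)\<in>\<A>. open (\<phi> ` (U \<inter> V)) \<and>
        smooth_on (\<phi> ` (U \<inter> V)) (\<psi> \<circ> inv_into U \<phi>))"

lemma smooth_manifold_charts_compat: "smooth_manifold \<A> \<Longrightarrow> charts_compat \<A>"
  unfolding smooth_manifold_def charts_compat_def by blast

lemma charts_compatD:
  assumes "charts_compat (\<A> :: ('x, 'e::real_normed_vector) atlas)"
  shows "finite_dim TYPE('e)"
    "(U, \<phi>) \<in> \<A> \<Longrightarrow> inj_on \<phi> U" "(U, \<phi>) \<in> \<A> \<Longrightarrow> open (\<phi> ` U)"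
    "(U, \<phi>) \<in> \<A> \<Longrightarrow> (V, \<psi>) \<in> \<A> \<Longrightarrow> open (\<phi> ` (U \<inter> V))"
    "(U, \<phi>) \<in> \<A> \<Longrightarrow> (V, \<psi>) \<in> \<A> \<Longrightarrow> smooth_on (\<phi> ` (U \<inter> V)) (\<psi> \<circ> inv_into U \<phi>)"
  using assms unfolding charts_compat_def by blast+

lemma mopen_subset_points: "mopen \<A> W \<Longrightarrow> W \<subseteq> points \<A>"
  unfolding mopen_def by blast

lemma mopenD: "mopen \<A> W \<Longrightarrow> (U, \<phi>) \<in> \<A> \<Longrightarrow> open (\<phi> ` (U \<inter> W))"
  unfolding mopen_def by blast

lemma mopenI:
  "W \<subseteq> points \<A> \<Longrightarrow> (\<And>U \<phi>. (U, \<phi>) \<in> \<A> \<Longrightarrow> open (\<phi> ` (U \<inter> W))) \<Longrightarrow> mopen \<A> W"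
  unfolding mopen_def by auto

lemma mopen_image: "mopen \<A> W \<Longrightarrow> (U, \<phi>) \<in> \<A> \<Longrightarrow> W \<subseteq> U \<Longrightarrow> open (\<phi> ` W)"
  using mopenD[of \<A> W U \<phi>] by (simp add: Int_absorb1)

lemma points_chart: "x \<in> points \<A> \<Longrightarrow> \<exists>U \<phi>. (U, \<phi>) \<in> \<A> \<and> x \<in> U"
  unfolding points_def by auto

lemma points_Union: "(U, \<phi>) \<in> \<A> \<Longrightarrow> U \<subseteq> points \<A>"
  unfolding points_def by auto

lemma mopen_chart: "charts_compat \<A> \<Longrightarrow> (U, \<phi>) \<in> \<A> \<Longrightarrow> mopen \<A> U"
  by (intro mopenI points_Union charts_compatD(4))

lemma mopen_local:
  assumes "\<And>x. x \<in> W \<Longrightarrow> \<exists>N. mopen \<A> N \<and> x \<in> N \<and> N \<subseteq> W"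
  shows "mopen \<A> W"
proof -
  have "W \<subseteq> points \<A>" using assms mopen_subset_points by blast
  moreover have "open (\<phi> ` (U \<inter> W))" if "(U, \<phi>) \<in> \<A>" for U \<phi>
  proof -
    have "W = \<Union> {N. mopen \<A> N \<and> N \<subseteq> W}" using assms by auto
    then have "\<phi> ` (U \<inter> W) = \<phi> ` (\<Union>N\<in>{N. mopen \<A> N \<and> N \<subseteq> W}. U \<inter> N)" by auto
    also have "\<dots> = (\<Union>N\<in>{N. mopen \<A> N \<and> N \<subseteq> W}. \<phi> ` (U \<inter> N))" by (rule image_UN)
    finally have "\<phi> ` (U \<inter> W) = (\<Union>N\<in>{N. mopen \<A> N \<and> N \<subseteq> W}. \<phi> ` (U \<inter> N))" .
    moreover have "open \<dots>" using mopenD[OF _ that] by (intro open_UN) auto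
    ultimately show ?thesis by simp
  qed
  ultimately show ?thesis by (rule mopenI)
qed

lemma mopen_Int:
  assumes "charts_compat \<A>" "mopen \<A> V" "mopen \<A> W"
  shows "mopen \<A> (V \<inter> W)"
proof -
  have "open (\<phi> ` (U \<inter> (V \<inter> W)))" if U: "(U, \<phi>) \<in> \<A>" for U \<phi>
  proof -
    have "\<phi> ` (U \<inter> (V \<inter> W)) = \<phi> ` (U \<inter> V) \<inter> \<phi> ` (U \<inter> W)"
      using charts_compatD(2)[OF assms(1) U] unfolding inj_on_def by blast
    then show ?thesis using mopenD[OF assms(2) U] mopenD[OF assms(3) U] by auto
  qed
  then show ?thesis using mopen_subset_points[OF assms(2)] by (intro mopenI) auto
qed

lemma mopen_chart_preimage:
  assumes A: "charts_compat \<A>" and U: "(U, \<phi>) \<in> \<A>" and S: "open S"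
  shows "mopen \<A> {x \<in> U. \<phi> x \<in> S}"
proof -
  have "open (\<psi> ` (V \<inter> {x \<in> U. \<phi> x \<in> S}))" if V: "(V, \<psi>) \<in> \<A>" for V \<psi>
  proof -
    have "\<psi> ` (V \<inter> {x \<in> U. \<phi> x \<in> S}) = \<psi> ` (V \<inter> U) \<inter> (\<phi> \<circ> inv_into V \<psi>) -` S"
      using charts_compatD(2)[OF A V] by (auto simp: inv_into_f_f)
    moreover have "open \<dots>"
      using charts_compatD(4)[OF A V U] charts_compatD(5)[OF A V U] S
      by (intro continuous_open_preimage smooth_on_imp_continuous_on)
    ultimately show ?thesis by simp
  qed
  then show ?thesis using points_Union[OF U] by (intro mopenI) auto
qed

subsection \<open>Smoothness in charts\<close>

lemma msmooth_on_mopen: "msmooth_on W \<A> \<B> f \<Longrightarrow> mopen \<A> W"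
  and msmooth_on_points: "msmooth_on W \<A> \<B> f \<Longrightarrow> x \<in> W \<Longrightarrow> f x \<in> points \<B>"
  unfolding msmooth_on_def by auto

lemma msmooth_onE:
  assumes "msmooth_on W \<A> \<B> f" "x \<in> W"
  obtains U \<phi> V \<psi> U' where "(U, \<phi>) \<in> \<A>" "(V, \<psi>) \<in> \<B>" "mopen \<A> U'" "x \<in> U'" "U' \<subseteq> W" "U' \<subseteq> U"
    "f ` U' \<subseteq> V" "smooth_on (\<phi> ` U') (\<psi> \<circ> f \<circ> inv_into U \<phi>)"
proof -
  have "\<exists>a\<in>\<A>. \<exists>b\<in>\<B>. \<exists>U'. mopen \<A> U' \<and> x \<in> U' \<and> U' \<subseteq> W \<inter> fst a \<and> f ` U' \<subseteq> fst b \<and>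
      smooth_on (snd a ` U') (snd b \<circ> f \<circ> inv_into (fst a) (snd a))"
    using assms unfolding msmooth_on_def by (auto simp: case_prod_unfold)
  then obtain a b U' where "a \<in> \<A>" "b \<in> \<B>" "mopen \<A> U'" "x \<in> U'" "U' \<subseteq> W \<inter> fst a" "f ` U' \<subseteq> fst b"
      "smooth_on (snd a ` U') (snd b \<circ> f \<circ> inv_into (fst a) (snd a))" by blast
  then show ?thesis using that[of "fst a" "snd a" "fst b" "snd b" U'] by simp
qed

lemma msmooth_onI:
  assumes "mopen \<A> W"
    "\<And>x. x \<in> W \<Longrightarrow> \<exists>U \<phi> V \<psi> U'. (U, \<phi>) \<in> \<A> \<and> (V, \<psi>) \<in> \<B> \<and> mopen \<A> U' \<and> x \<in> U' \<and> U' \<subseteq> W \<and>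
       U' \<subseteq> U \<and> f ` U' \<subseteq> V \<and> smooth_on (\<phi> ` U') (\<psi> \<circ> f \<circ> inv_into U \<phi>)"
  shows "msmooth_on W \<A> \<B> f"
proof -
  have "f x \<in> points \<B>" if "x \<in> W" for x
    using assms(2)[OF that] points_Union[of _ _ \<B>] by blast
  moreover have "\<exists>(U, \<phi>)\<in>\<A>. \<exists>(V, \<psi>)\<in>\<B>. \<exists>U'. mopen \<A> U' \<and> x \<in> U' \<and> U' \<subseteq> W \<inter> U \<and>
        f ` U' \<subseteq> V \<and> smooth_on (\<phi> ` U') (\<psi> \<circ> f \<circ> inv_into U \<phi>)" if x: "x \<in> W" for x
  proof -
    obtain U \<phi> V \<psi> U' where "(U, \<phi>) \<in> \<A>" "(V, \<psi>) \<in> \<B>" "mopen \<A> U'" "x \<in> U'" "U' \<subseteq> W"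
       "U' \<subseteq> U" "f ` U' \<subseteq> V" "smooth_on (\<phi> ` U') (\<psi> \<circ> f \<circ> inv_into U \<phi>)"
      using assms(2)[OF x] by (elim exE conjE)
    then show ?thesis by (intro bexI[of _ "(U, \<phi>)"] bexI[of _ "(V, \<psi>)"] case_prodI exI[of _ U']) auto
  qed
  ultimately show ?thesis using assms(1) unfolding msmooth_on_def by blast
qed

lemma msmooth_on_local:
  assumes "\<And>x. x \<in> W \<Longrightarrow> \<exists>N. x \<in> N \<and> N \<subseteq> W \<and> msmooth_on N \<A> \<B> f"
  shows "msmooth_on W \<A> \<B> f"
proof (rule msmooth_onI)
  show "mopen \<A> W" by (rule mopen_local) (use assms msmooth_on_mopen in blast)
  fix x assume "x \<in> W"
  then obtain N where N: "x \<in> N" "N \<subseteq> W" "msmooth_on N \<A> \<B> f" using assms by blast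
  from msmooth_onE[OF N(3,1)] obtain U \<phi> V \<psi> U' where "(U, \<phi>) \<in> \<A>" "(V, \<psi>) \<in> \<B>" "mopen \<A> U'" "x \<in> U'" "U' \<subseteq> N" "U' \<subseteq> U"
    "f ` U' \<subseteq> V" "smooth_on (\<phi> ` U') (\<psi> \<circ> f \<circ> inv_into U \<phi>)" .
  then show "\<exists>U \<phi> V \<psi> U'. (U, \<phi>) \<in> \<A> \<and> (V, \<psi>) \<in> \<B> \<and> mopen \<A> U' \<and> x \<in> U' \<and> U' \<subseteq> W \<and>
       U' \<subseteq> U \<and> f ` U' \<subseteq> V \<and> smooth_on (\<phi> ` U') (\<psi> \<circ> f \<circ> inv_into U \<phi>)"
    using N(2) by (intro exI[of _ U] exI[of _ \<phi>] exI[of _ V] exI[of _ \<psi>] exI[of _ U']) auto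
qed

lemma msmooth_on_subset:
  assumes "charts_compat \<A>" "msmooth_on W \<A> \<B> f" "mopen \<A> N" "N \<subseteq> W"
  shows "msmooth_on N \<A> \<B> f"
proof (rule msmooth_onI[OF assms(3)])
  fix x assume x: "x \<in> N"
  then have "x \<in> W" using assms by blast
  from msmooth_onE[OF assms(2) this] obtain U \<phi> V \<psi> U' where *: "(U, \<phi>) \<in> \<A>" "(V, \<psi>) \<in> \<B>"
    "mopen \<A> U'" "x \<in> U'" "U' \<subseteq> W" "U' \<subseteq> U"
    "f ` U' \<subseteq> V" "smooth_on (\<phi> ` U') (\<psi> \<circ> f \<circ> inv_into U \<phi>)" .
  have "mopen \<A> (N \<inter> U')" using mopen_Int assms * by blast
  moreover have "smooth_on (\<phi> ` (N \<inter> U')) (\<psi> \<circ> f \<circ> inv_into U \<phi>)"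
    by (rule smooth_on_subset[OF *(8)]) auto
  ultimately show "\<exists>U \<phi> V \<psi> U'. (U, \<phi>) \<in> \<A> \<and> (V, \<psi>) \<in> \<B> \<and> mopen \<A> U' \<and> x \<in> U' \<and> U' \<subseteq> N \<and>
       U' \<subseteq> U \<and> f ` U' \<subseteq> V \<and> smooth_on (\<phi> ` U') (\<psi> \<circ> f \<circ> inv_into U \<phi>)"
    using * x by (intro exI[of _ U] exI[of _ \<phi>] exI[of _ V] exI[of _ \<psi>] exI[of _ "N \<inter> U'"]) auto
qed

lemma msmooth_on_cong:
  assumes A: "charts_compat \<A>" and f: "msmooth_on W \<A> \<B> f" and eq: "\<And>x. x \<in> W \<Longrightarrow> f x = g x"
  shows "msmooth_on W \<A> \<B> g"
proof (rule msmooth_onI)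
  show "mopen \<A> W" using f msmooth_on_mopen by blast
  fix x assume x: "x \<in> W"
  from msmooth_onE[OF f x] obtain U \<phi> V \<psi> U' where *: "(U, \<phi>) \<in> \<A>" "(V, \<psi>) \<in> \<B>"
    "mopen \<A> U'" "x \<in> U'" "U' \<subseteq> W" "U' \<subseteq> U"
    "f ` U' \<subseteq> V" "smooth_on (\<phi> ` U') (\<psi> \<circ> f \<circ> inv_into U \<phi>)" .
  have inj: "inj_on \<phi> U" using charts_compatD(2)[OF A *(1)] .
  have "smooth_on (\<phi> ` U') (\<psi> \<circ> g \<circ> inv_into U \<phi>)"
  proof (rule smooth_on_cong[OF _ _ *(8)])
    show "open (\<phi> ` U')" using mopen_image * by blast
    fix y assume "y \<in> \<phi> ` U'"
    then obtain z where "z \<in> U'" "y = \<phi> z" by blast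
    then show "(\<psi> \<circ> f \<circ> inv_into U \<phi>) y = (\<psi> \<circ> g \<circ> inv_into U \<phi>) y"
      using *(5,6) eq inj by (simp add: inv_into_f_f subset_iff)
  qed
  moreover have "g ` U' \<subseteq> V"
  proof
    fix y assume "y \<in> g ` U'"
    then obtain z where z: "z \<in> U'" "y = g z" by blast
    then have "y = f z" using eq *(5) by auto
    then show "y \<in> V" using *(7) z by blast
  qed
  ultimately show "\<exists>U \<phi> V \<psi> U'. (U, \<phi>) \<in> \<A> \<and> (V, \<psi>) \<in> \<B> \<and> mopen \<A> U' \<and> x \<in> U' \<and> U' \<subseteq> W \<and>
       U' \<subseteq> U \<and> g ` U' \<subseteq> V \<and> smooth_on (\<phi> ` U') (\<psi> \<circ> g \<circ> inv_into U \<phi>)"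
    using * by (intro exI[of _ U] exI[of _ \<phi>] exI[of _ V] exI[of _ \<psi>] exI[of _ U']) auto
qed

text \<open>Smoothness may be tested in any charts.\<close>

lemma msmooth_on_any_charts:
  assumes A: "charts_compat \<A>" and B: "charts_compat \<B>" and f: "msmooth_on W \<A> \<B> f"
    and U: "(U, \<phi>) \<in> \<A>" and V: "(V, \<psi>) \<in> \<B>"
    and N: "mopen \<A> N" "N \<subseteq> W" "N \<subseteq> U" "f ` N \<subseteq> V"
  shows "smooth_on (\<phi> ` N) (\<psi> \<circ> f \<circ> inv_into U \<phi>)"
proof (rule smooth_on_local)
  fix y assume "y \<in> \<phi> ` N"
  then obtain x where x: "x \<in> N" "y = \<phi> x" by blast
  then have "x \<in> W" using N by blast
  from msmooth_onE[OF f this] obtain U1 \<phi>1 V1 \<psi>1 U' where *: "(U1, \<phi>1) \<in> \<A>" "(V1, \<psi>1) \<in> \<B>"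
    "mopen \<A> U'" "x \<in> U'" "U' \<subseteq> W" "U' \<subseteq> U1"
    "f ` U' \<subseteq> V1" "smooth_on (\<phi>1 ` U') (\<psi>1 \<circ> f \<circ> inv_into U1 \<phi>1)" .
  let ?T = "\<phi> ` (N \<inter> U')"
  have inj: "inj_on \<phi> U" "inj_on \<phi>1 U1" "inj_on \<psi>1 V1"
    using charts_compatD(2) A B U *(1,2) by blast+
  have "mopen \<A> (N \<inter> U')" using mopen_Int A N * by blast
  then have oT: "open ?T" using mopen_image U N by blast
  have 1: "smooth_on ?T (\<phi>1 \<circ> inv_into U \<phi>)"
    using charts_compatD(5)[OF A U *(1)] by (rule smooth_on_subset) (use N * in blast)
  have 2: "smooth_on (\<psi>1 ` (V1 \<inter> V)) (\<psi> \<circ> inv_into V1 \<psi>1)"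
    by (rule charts_compatD(5)[OF B *(2) V])
  have i: "inv_into U \<phi> (\<phi> z) = z" "inv_into U1 \<phi>1 (\<phi>1 z) = z" "inv_into V1 \<psi>1 (\<psi>1 (f z)) = f z"
    if "z \<in> N \<inter> U'" for z
    using that inj N * by (auto intro!: inv_into_f_f)
  have 3: "smooth_on ?T (\<lambda>p. (\<psi>1 \<circ> f \<circ> inv_into U1 \<phi>1) ((\<phi>1 \<circ> inv_into U \<phi>) p))"
    by (rule smooth_on_compose[OF charts_compatD(1)[OF A] 1 *(8)]) (auto simp: i)
  have 4: "smooth_on ?T (\<lambda>p. (\<psi> \<circ> inv_into V1 \<psi>1) ((\<psi>1 \<circ> f \<circ> inv_into U1 \<phi>1) ((\<phi>1 \<circ> inv_into U \<phi>) p)))"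
  proof (rule smooth_on_compose[OF charts_compatD(1)[OF B] 3 2])
    show "(\<lambda>p. (\<psi>1 \<circ> f \<circ> inv_into U1 \<phi>1) ((\<phi>1 \<circ> inv_into U \<phi>) p)) ` ?T \<subseteq> \<psi>1 ` (V1 \<inter> V)"
    proof (rule image_subsetI)
      fix p assume "p \<in> ?T"
      then obtain z where z: "z \<in> N \<inter> U'" "p = \<phi> z" by blast
      then have "f z \<in> V1 \<inter> V" using N(4) *(7) by blast
      then show "(\<psi>1 \<circ> f \<circ> inv_into U1 \<phi>1) ((\<phi>1 \<circ> inv_into U \<phi>) p) \<in> \<psi>1 ` (V1 \<inter> V)"
        using i[OF z(1)] z(2) by auto
    qed
  qed
  have "smooth_on ?T (\<psi> \<circ> f \<circ> inv_into U \<phi>)"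
    by (rule smooth_on_cong[OF oT _ 4]) (auto simp: i)
  then show "\<exists>T. open T \<and> y \<in> T \<and> smooth_on T (\<psi> \<circ> f \<circ> inv_into U \<phi>)"
    using oT x * by (intro exI[of _ ?T]) auto
qed

lemma msmooth_on_preimage:
  assumes A: "charts_compat \<A>" and B: "charts_compat \<B>"
    and f: "msmooth_on W \<A> \<B> f" and N: "mopen \<B> N"
  shows "mopen \<A> {x \<in> W. f x \<in> N}"
proof (rule mopen_local)
  fix x assume "x \<in> {x \<in> W. f x \<in> N}"
  then have x: "x \<in> W" "f x \<in> N" by auto
  from msmooth_onE[OF f x(1)] obtain U \<phi> V \<psi> U' where *: "(U, \<phi>) \<in> \<A>" "(V, \<psi>) \<in> \<B>"
    "mopen \<A> U'" "x \<in> U'" "U' \<subseteq> W" "U' \<subseteq> U"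
    "f ` U' \<subseteq> V" "smooth_on (\<phi> ` U') (\<psi> \<circ> f \<circ> inv_into U \<phi>)" .
  let ?g = "\<psi> \<circ> f \<circ> inv_into U \<phi>"
  let ?S = "\<phi> ` U' \<inter> ?g -` (\<psi> ` (V \<inter> N))"
  have "open (\<psi> ` (V \<inter> N))" using mopenD N * by blast
  moreover have "open (\<phi> ` U')" using mopen_image * by blast
  ultimately have oS: "open ?S"
    using *(8) by (intro continuous_open_preimage smooth_on_imp_continuous_on)
  let ?M = "{z \<in> U. \<phi> z \<in> ?S}"
  have inj: "inj_on \<phi> U" "inj_on \<psi> V" using charts_compatD(2) A B *(1,2) by blast+
  have i: "inv_into U \<phi> (\<phi> z) = z" if "z \<in> U" for z using inj(1) that by (rule inv_into_f_f)
  have "f z \<in> N \<and> z \<in> W" if z: "z \<in> ?M" for z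
  proof -
    have zU: "z \<in> U'" using z inj(1) *(6) unfolding inj_on_def by blast
    have "\<psi> (f z) \<in> \<psi> ` (V \<inter> N)" using z i[of z] by simp
    then obtain w where w: "w \<in> V \<inter> N" "\<psi> (f z) = \<psi> w" by blast
    have "f z \<in> V" using zU *(7) by blast
    then have "f z = w" using inj_onD[OF inj(2) w(2)] w(1) by blast
    then show ?thesis using w zU *(5) by blast
  qed
  moreover have "mopen \<A> ?M" using mopen_chart_preimage[OF A *(1) oS] .
  moreover have "x \<in> ?M"
  proof -
    have "inv_into U \<phi> (\<phi> x) = x" using i *(4,6) by blast
    moreover have "f x \<in> V" using *(4,7) by blast
    ultimately show ?thesis using x * by auto
  qed
  ultimately show "\<exists>M. mopen \<A> M \<and> x \<in> M \<and> M \<subseteq> {x \<in> W. f x \<in> N}" by blast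
qed

lemma msmooth_on_compose:
  assumes A: "charts_compat \<A>" and B: "charts_compat \<B>" and C: "charts_compat \<C>"
    and f: "msmooth_on W \<A> \<B> f" and g: "msmooth_on W' \<B> \<C> g" and sub: "f ` W \<subseteq> W'"
  shows "msmooth_on W \<A> \<C> (\<lambda>x. g (f x))"
proof (rule msmooth_onI)
  show W: "mopen \<A> W" using f msmooth_on_mopen by blast
  fix x assume x: "x \<in> W"
  then have fx: "f x \<in> W'" using sub by blast
  obtain U \<phi> where U: "(U, \<phi>) \<in> \<A>" "x \<in> U"
    using points_chart[OF subsetD[OF mopen_subset_points[OF W] x]] by auto
  obtain V \<psi> where V: "(V, \<psi>) \<in> \<B>" "f x \<in> V"
    using points_chart[OF msmooth_on_points[OF f x]] by auto
  obtain Z \<zeta> where Z: "(Z, \<zeta>) \<in> \<C>" "g (f x) \<in> Z"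
    using points_chart[OF msmooth_on_points[OF g fx]] by auto
  let ?N2 = "V \<inter> {z \<in> W'. g z \<in> Z}"
  have N2: "mopen \<B> ?N2"
    by (intro mopen_Int B mopen_chart[OF B V(1)] msmooth_on_preimage[OF B C g] mopen_chart[OF C Z(1)])
  let ?N = "U \<inter> {x \<in> W. f x \<in> ?N2}"
  have N: "mopen \<A> ?N"
    by (intro mopen_Int A mopen_chart[OF A U(1)] msmooth_on_preimage[OF A B f] N2)
  have 1: "smooth_on (\<phi> ` ?N) (\<psi> \<circ> f \<circ> inv_into U \<phi>)"
    by (rule msmooth_on_any_charts[OF A B f U(1) V(1) N]) auto
  have 2: "smooth_on (\<psi> ` ?N2) (\<zeta> \<circ> g \<circ> inv_into V \<psi>)"
    by (rule msmooth_on_any_charts[OF B C g V(1) Z(1) N2]) auto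
  have inj: "inj_on \<phi> U" "inj_on \<psi> V" using charts_compatD(2) A B U(1) V(1) by blast+
  have i: "inv_into U \<phi> (\<phi> z) = z" "inv_into V \<psi> (\<psi> (f z)) = f z" if "z \<in> ?N" for z
    using that inj by (auto intro!: inv_into_f_f)
  have 3: "smooth_on (\<phi> ` ?N) (\<lambda>p. (\<zeta> \<circ> g \<circ> inv_into V \<psi>) ((\<psi> \<circ> f \<circ> inv_into U \<phi>) p))"
    by (rule smooth_on_compose[OF charts_compatD(1)[OF B] 1 2]) (auto simp: i)
  have "smooth_on (\<phi> ` ?N) (\<zeta> \<circ> (\<lambda>x. g (f x)) \<circ> inv_into U \<phi>)"
  proof (rule smooth_on_cong[OF _ _ 3])
    show "open (\<phi> ` ?N)" using mopen_image[OF N U(1)] by blast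
  qed (auto simp: i)
  then show "\<exists>U \<phi> V \<psi> U'. (U, \<phi>) \<in> \<A> \<and> (V, \<psi>) \<in> \<C> \<and> mopen \<A> U' \<and> x \<in> U' \<and> U' \<subseteq> W \<and>
       U' \<subseteq> U \<and> (\<lambda>x. g (f x)) ` U' \<subseteq> V \<and> smooth_on (\<phi> ` U') (\<psi> \<circ> (\<lambda>x. g (f x)) \<circ> inv_into U \<phi>)"
    using N U Z V x fx
    by (intro exI[of _ U] exI[of _ \<phi>] exI[of _ Z] exI[of _ \<zeta>] exI[of _ ?N]) auto
qed

lemma msmooth_on_id:
  assumes A: "charts_compat \<A>" and W: "mopen \<A> W"
  shows "msmooth_on W \<A> \<A> (\<lambda>x. x)"
proof (rule msmooth_onI[OF W])
  fix x assume x: "x \<in> W"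
  then obtain U \<phi> where U: "(U, \<phi>) \<in> \<A>" "x \<in> U"
    using points_chart[OF subsetD[OF mopen_subset_points[OF W] x]] by auto
  have N: "mopen \<A> (U \<inter> W)" using mopen_Int A mopen_chart U W by blast
  have "smooth_on (\<phi> ` (U \<inter> W)) (\<phi> \<circ> (\<lambda>x. x) \<circ> inv_into U \<phi>)"
  proof (rule smooth_on_cong[OF _ _ smooth_on_id])
    show "open (\<phi> ` (U \<inter> W))" using mopen_image[OF N U(1)] by blast
  qed (use charts_compatD(2)[OF A U(1)] in \<open>auto simp: inv_into_f_f\<close>)
  then show "\<exists>U \<phi> V \<psi> U'. (U, \<phi>) \<in> \<A> \<and> (V, \<psi>) \<in> \<A> \<and> mopen \<A> U' \<and> x \<in> U' \<and> U' \<subseteq> W \<and>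
       U' \<subseteq> U \<and> (\<lambda>x. x) ` U' \<subseteq> V \<and> smooth_on (\<phi> ` U') (\<psi> \<circ> (\<lambda>x. x) \<circ> inv_into U \<phi>)"
    using U N x by (intro exI[of _ U] exI[of _ \<phi>] exI[of _ U] exI[of _ \<phi>] exI[of _ "U \<inter> W"]) auto
qed

subsection \<open>Maps to vector spaces\<close>

lemma charts_compat_vs: "finite_dim TYPE('e::real_normed_vector) \<Longrightarrow> charts_compat (vs_atlas :: ('e, 'e) atlas)"
  unfolding charts_compat_def vs_atlas_def
  by (auto intro!: smooth_on_cong[OF _ _ smooth_on_id] simp: inv_into_f_f)

lemma mopen_vs [simp]: "mopen vs_atlas W \<longleftrightarrow> open W"
  and points_vs [simp]: "points vs_atlas = UNIV"
  unfolding mopen_def points_def vs_atlas_def by auto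

lemma finite_dim_real: "finite_dim TYPE(real)"
  unfolding finite_dim_def by (intro exI[of _ "{1}"]) (auto simp: span_singleton intro!: image_eqI)

lemma msmooth_on_vs_iff:
  fixes f :: "'x \<Rightarrow> 'f::real_normed_vector"
  assumes A: "charts_compat \<A>" and F: "finite_dim TYPE('f)"
  shows "msmooth_on W \<A> vs_atlas f \<longleftrightarrow>
    mopen \<A> W \<and> (\<forall>U \<phi>. (U, \<phi>) \<in> \<A> \<longrightarrow> smooth_on (\<phi> ` (U \<inter> W)) (\<lambda>p. f (inv_into U \<phi> p)))"
    (is "?L \<longleftrightarrow> ?R")
proof
  assume L: ?L
  have "smooth_on (\<phi> ` (U \<inter> W)) (\<lambda>p. f (inv_into U \<phi> p))" if U: "(U, \<phi>) \<in> \<A>" for U \<phi>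
  proof -
    have "mopen \<A> (U \<inter> W)" using mopen_Int A mopen_chart U msmooth_on_mopen L by blast
    then have "smooth_on (\<phi> ` (U \<inter> W)) (id \<circ> f \<circ> inv_into U \<phi>)"
      by (intro msmooth_on_any_charts[OF A charts_compat_vs[OF F] L U]) (auto simp: vs_atlas_def)
    then show ?thesis by (simp add: o_def)
  qed
  then show ?R using msmooth_on_mopen[OF L] by blast
next
  assume R: ?R
  show ?L
  proof (rule msmooth_onI)
    show "mopen \<A> W" using R by blast
    fix x assume x: "x \<in> W"
    then obtain U \<phi> where U: "(U, \<phi>) \<in> \<A>" "x \<in> U"
      using R points_chart[OF subsetD[OF mopen_subset_points x], of \<A>] by auto
    then have "smooth_on (\<phi> ` (U \<inter> W)) (id \<circ> f \<circ> inv_into U \<phi>)" using R by (simp add: o_def)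
    moreover have "mopen \<A> (U \<inter> W)" using mopen_Int A mopen_chart U R by blast
    ultimately show "\<exists>U \<phi> V \<psi> U'. (U, \<phi>) \<in> \<A> \<and> (V, \<psi>) \<in> vs_atlas \<and> mopen \<A> U' \<and> x \<in> U' \<and> U' \<subseteq> W \<and>
       U' \<subseteq> U \<and> f ` U' \<subseteq> V \<and> smooth_on (\<phi> ` U') (\<psi> \<circ> f \<circ> inv_into U \<phi>)"
      using U x
      by (intro exI[of _ U] exI[of _ \<phi>] exI[of _ UNIV] exI[of _ id] exI[of _ "U \<inter> W"])
        (auto simp: vs_atlas_def)
  qed
qed

context
  fixes \<A> :: "('x, 'e::real_normed_vector) atlas"
  assumes A: "charts_compat \<A>"
begin

lemma msmooth_vs_const:
  assumes "finite_dim TYPE('f::real_normed_vector)" "mopen \<A> W"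
  shows "msmooth_on W \<A> vs_atlas (\<lambda>x. c :: 'f)"
  using assms by (simp add: msmooth_on_vs_iff A smooth_on_const)

lemma msmooth_vs_add:
  fixes f g :: "'x \<Rightarrow> 'f::real_normed_vector"
  assumes "finite_dim TYPE('f)" "msmooth_on W \<A> vs_atlas f" "msmooth_on W \<A> vs_atlas g"
  shows "msmooth_on W \<A> vs_atlas (\<lambda>x. f x + g x)"
  using assms by (simp add: msmooth_on_vs_iff A smooth_on_add)

lemma msmooth_vs_scaleR:
  fixes f :: "'x \<Rightarrow> 'f::real_normed_vector"
  assumes "finite_dim TYPE('f)" "msmooth_on W \<A> vs_atlas a" "msmooth_on W \<A> vs_atlas f"
  shows "msmooth_on W \<A> vs_atlas (\<lambda>x. a x *\<^sub>R f x)"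
  using assms by (simp add: msmooth_on_vs_iff A smooth_on_scaleR finite_dim_real)

lemma msmooth_vs_mult:
  fixes f g :: "'x \<Rightarrow> real"
  assumes "msmooth_on W \<A> vs_atlas f" "msmooth_on W \<A> vs_atlas g"
  shows "msmooth_on W \<A> vs_atlas (\<lambda>x. f x * g x)"
  using msmooth_vs_scaleR[OF finite_dim_real assms] by simp

lemma msmooth_vs_inverse:
  fixes f :: "'x \<Rightarrow> real"
  assumes f: "msmooth_on W \<A> vs_atlas f" and nz: "\<And>x. x \<in> W \<Longrightarrow> f x \<noteq> 0"
  shows "msmooth_on W \<A> vs_atlas (\<lambda>x. inverse (f x))"
proof -
  have "smooth_on (\<phi> ` (U \<inter> W)) (\<lambda>p. inverse (f (inv_into U \<phi> p)))" if U: "(U, \<phi>) \<in> \<A>" for U \<phi>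
    using f U nz charts_compatD(2)[OF A U]
    by (intro smooth_on_inverse) (auto simp: msmooth_on_vs_iff A finite_dim_real inv_into_f_f)
  then show ?thesis using f by (simp add: msmooth_on_vs_iff A finite_dim_real)
qed

lemma msmooth_vs_sum:
  fixes f :: "'i \<Rightarrow> 'x \<Rightarrow> 'f::real_normed_vector"
  assumes "finite_dim TYPE('f)" "mopen \<A> W" "\<And>i. i \<in> I \<Longrightarrow> msmooth_on W \<A> vs_atlas (f i)"
  shows "msmooth_on W \<A> vs_atlas (\<lambda>x. \<Sum>i\<in>I. f i x)"
  using assms(3)
  by (induction I rule: infinite_finite_induct) (auto intro: msmooth_vs_const msmooth_vs_add assms(1,2))

lemma msmooth_vs_linear:
  fixes f :: "'x \<Rightarrow> 'f::real_normed_vector" and h :: "'f \<Rightarrow> 'g::real_normed_vector"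
  assumes "finite_dim TYPE('f)" "finite_dim TYPE('g)" "linear h" "msmooth_on W \<A> vs_atlas f"
  shows "msmooth_on W \<A> vs_atlas (\<lambda>x. h (f x))"
  using assms(1,2,4) smooth_on_bounded_linear[OF linear_bounded_finite_dim[OF assms(1,3)]]
  by (auto simp: msmooth_on_vs_iff A)

end

subsection \<open>Products\<close>

lemma product_atlasI: "(U, \<phi>) \<in> \<A> \<Longrightarrow> (V, \<psi>) \<in> \<B> \<Longrightarrow> (U \<times> V, map_prod \<phi> \<psi>) \<in> product_atlas \<A> \<B>"
  unfolding product_atlas_def by blast

lemma product_atlasE:
  assumes "(W, \<xi>) \<in> product_atlas \<A> \<B>"
  obtains U \<phi> V \<psi> where "W = U \<times> V" "\<xi> = map_prod \<phi> \<psi>" "(U, \<phi>) \<in> \<A>" "(V, \<psi>) \<in> \<B>"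
  using assms unfolding product_atlas_def by blast

lemma points_product: "points (product_atlas \<A> \<B>) = points \<A> \<times> points \<B>"
  unfolding points_def product_atlas_def by (auto; blast)

lemma map_prod_image_Int:
  "map_prod \<phi> \<psi> ` ((U \<times> V) \<inter> (U' \<times> V')) = \<phi> ` (U \<inter> U') \<times> \<psi> ` (V \<inter> V')"
  unfolding Times_Int_Times by (rule map_prod_image)

lemma inv_into_map_prod:
  assumes "inj_on \<phi> U" "inj_on \<psi> V" "x \<in> U" "y \<in> V"
  shows "inv_into (U \<times> V) (map_prod \<phi> \<psi>) (\<phi> x, \<psi> y) = (x, y)"
  using inv_into_f_f[OF map_prod_inj_on[OF assms(1,2)], of "(x, y)"] assms by simp

lemma smooth_on_fst_snd:
  fixes f :: "'e::real_normed_vector \<Rightarrow> 'g::real_normed_vector" and g :: "'f::real_normed_vector \<Rightarrow> 'h::real_normed_vector"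
  assumes "finite_dim TYPE('e)" "finite_dim TYPE('f)"
  shows "smooth_on S f \<Longrightarrow> smooth_on (S \<times> T) (\<lambda>z. f (fst z))"
    and "smooth_on T g \<Longrightarrow> smooth_on (S \<times> T) (\<lambda>z. g (snd z))"
  using assms
  by (auto intro!: smooth_on_compose[of "S \<times> T" fst] smooth_on_compose[of "S \<times> T" snd]
      smooth_on_bounded_linear[of fst] smooth_on_bounded_linear[of snd] smooth_on_id
      bounded_linear_fst bounded_linear_snd)

lemma charts_compat_product:
  assumes A: "charts_compat (\<A> :: ('x, 'e::real_normed_vector) atlas)"
    and B: "charts_compat (\<B> :: ('y, 'f::real_normed_vector) atlas)"
  shows "charts_compat (product_atlas \<A> \<B>)"
proof -
  have fd: "finite_dim TYPE('e)" "finite_dim TYPE('f)" using charts_compatD(1) A B by auto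
  have 1: "inj_on \<xi> W \<and> open (\<xi> ` W)" if "(W, \<xi>) \<in> product_atlas \<A> \<B>" for W \<xi>
    using that
  proof (rule product_atlasE)
    fix U \<phi> V \<psi> assume *: "W = U \<times> V" "\<xi> = map_prod \<phi> \<psi>" "(U, \<phi>) \<in> \<A>" "(V, \<psi>) \<in> \<B>"
    then show ?thesis
      using charts_compatD(2,3)[OF A *(3)] charts_compatD(2,3)[OF B *(4)]
      by (auto intro: map_prod_inj_on open_Times simp: map_prod_image)
  qed
  have 2: "open (\<xi> ` (W \<inter> W')) \<and> smooth_on (\<xi> ` (W \<inter> W')) (\<xi>' \<circ> inv_into W \<xi>)"
    if W: "(W, \<xi>) \<in> product_atlas \<A> \<B>" "(W', \<xi>') \<in> product_atlas \<A> \<B>" for W \<xi> W' \<xi>'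
  proof -
    obtain U \<phi> V \<psi> where *: "W = U \<times> V" "\<xi> = map_prod \<phi> \<psi>" "(U, \<phi>) \<in> \<A>" "(V, \<psi>) \<in> \<B>"
      using W(1) by (rule product_atlasE)
    obtain U' \<phi>' V' \<psi>' where **: "W' = U' \<times> V'" "\<xi>' = map_prod \<phi>' \<psi>'" "(U', \<phi>') \<in> \<A>" "(V', \<psi>') \<in> \<B>"
      using W(2) by (rule product_atlasE)
    have im: "\<xi> ` (W \<inter> W') = \<phi> ` (U \<inter> U') \<times> \<psi> ` (V \<inter> V')"
      unfolding * ** by (rule map_prod_image_Int)
    have op: "open (\<xi> ` (W \<inter> W'))" unfolding im
      by (intro open_Times charts_compatD(4)[OF A *(3) **(3)] charts_compatD(4)[OF B *(4) **(4)])
    have inj: "inj_on \<phi> U" "inj_on \<psi> V" using charts_compatD(2) A B * by blast+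
    have "smooth_on (\<xi> ` (W \<inter> W')) (\<lambda>z. ((\<phi>' \<circ> inv_into U \<phi>) (fst z), (\<psi>' \<circ> inv_into V \<psi>) (snd z)))"
      unfolding im
      by (intro smooth_on_Pair smooth_on_fst_snd fd charts_compatD(5)[OF A *(3) **(3)] charts_compatD(5)[OF B *(4) **(4)])
    then have "smooth_on (\<xi> ` (W \<inter> W')) (\<xi>' \<circ> inv_into W \<xi>)"
      by (rule smooth_on_cong[OF op, rotated])
        (auto simp: im inv_into_map_prod[OF inj] inv_into_f_f inj *(1,2) **(2))
    then show ?thesis using op by blast
  qed
  show ?thesis
    unfolding charts_compat_def using finite_dim_Pair[OF fd] 1 2
    by (intro conjI) (blast, fast, fast)
qed

lemma mopen_product:
  assumes A: "charts_compat \<A>" and B: "charts_compat \<B>" and "mopen \<A> X" "mopen \<B> Y"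
  shows "mopen (product_atlas \<A> \<B>) (X \<times> Y)"
proof (rule mopenI)
  show "X \<times> Y \<subseteq> points (product_atlas \<A> \<B>)"
    using mopen_subset_points[OF assms(3)] mopen_subset_points[OF assms(4)] by (auto simp: points_product)
  fix W \<xi> assume "(W, \<xi>) \<in> product_atlas \<A> \<B>"
  then obtain U \<phi> V \<psi> where *: "W = U \<times> V" "\<xi> = map_prod \<phi> \<psi>" "(U, \<phi>) \<in> \<A>" "(V, \<psi>) \<in> \<B>"
    by (rule product_atlasE)
  show "open (\<xi> ` (W \<inter> X \<times> Y))" unfolding * map_prod_image_Int
    by (intro open_Times mopenD[OF assms(3) *(3)] mopenD[OF assms(4) *(4)])
qed

lemma msmooth_on_Pair:
  assumes A: "charts_compat \<A>" and B: "charts_compat \<B>" and C: "charts_compat \<C>"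
    and f: "msmooth_on W \<A> \<B> f" and g: "msmooth_on W \<A> \<C> g"
  shows "msmooth_on W \<A> (product_atlas \<B> \<C>) (\<lambda>x. (f x, g x))"
proof (rule msmooth_onI)
  show W: "mopen \<A> W" using f msmooth_on_mopen by blast
  fix x assume x: "x \<in> W"
  obtain U \<phi> where U: "(U, \<phi>) \<in> \<A>" "x \<in> U"
    using points_chart[OF subsetD[OF mopen_subset_points[OF W] x]] by auto
  obtain V \<psi> where V: "(V, \<psi>) \<in> \<B>" "f x \<in> V"
    using points_chart[OF msmooth_on_points[OF f x]] by auto
  obtain Z \<zeta> where Z: "(Z, \<zeta>) \<in> \<C>" "g x \<in> Z"
    using points_chart[OF msmooth_on_points[OF g x]] by auto
  let ?N = "U \<inter> ({x \<in> W. f x \<in> V} \<inter> {x \<in> W. g x \<in> Z})"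
  have N: "mopen \<A> ?N"
    by (intro mopen_Int A mopen_chart[OF A U(1)] msmooth_on_preimage[OF A B f]
        msmooth_on_preimage[OF A C g] mopen_chart[OF C Z(1)] mopen_chart[OF B V(1)])
  have 1: "smooth_on (\<phi> ` ?N) (\<psi> \<circ> f \<circ> inv_into U \<phi>)"
    by (rule msmooth_on_any_charts[OF A B f U(1) V(1) N]) auto
  have 2: "smooth_on (\<phi> ` ?N) (\<zeta> \<circ> g \<circ> inv_into U \<phi>)"
    by (rule msmooth_on_any_charts[OF A C g U(1) Z(1) N]) auto
  have "smooth_on (\<phi> ` ?N) (map_prod \<psi> \<zeta> \<circ> (\<lambda>x. (f x, g x)) \<circ> inv_into U \<phi>)"
    using smooth_on_Pair[OF 1 2] by (simp add: o_def)
  then show "\<exists>U \<phi> V \<psi> U'. (U, \<phi>) \<in> \<A> \<and> (V, \<psi>) \<in> product_atlas \<B> \<C> \<and> mopen \<A> U' \<and> x \<in> U' \<and> U' \<subseteq> W \<and>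
       U' \<subseteq> U \<and> (\<lambda>x. (f x, g x)) ` U' \<subseteq> V \<and> smooth_on (\<phi> ` U') (\<psi> \<circ> (\<lambda>x. (f x, g x)) \<circ> inv_into U \<phi>)"
    using N U Z V x product_atlasI[OF V(1) Z(1)]
    by (intro exI[of _ U] exI[of _ \<phi>] exI[of _ "V \<times> Z"] exI[of _ "map_prod \<psi> \<zeta>"] exI[of _ ?N]) auto
qed

lemma msmooth_on_fst:
  assumes A: "charts_compat (\<A> :: ('x, 'e::real_normed_vector) atlas)"
    and B: "charts_compat (\<B> :: ('y, 'f::real_normed_vector) atlas)"
    and W: "mopen (product_atlas \<A> \<B>) W"
  shows "msmooth_on W (product_atlas \<A> \<B>) \<A> fst" "msmooth_on W (product_atlas \<A> \<B>) \<B> snd"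
proof -
  note AB = charts_compat_product[OF A B]
  have "\<exists>U \<phi> V \<psi>. (U, \<phi>) \<in> \<A> \<and> (V, \<psi>) \<in> \<B> \<and> mopen (product_atlas \<A> \<B>) ((U \<times> V) \<inter> W) \<and> z \<in> U \<times> V \<and>
     smooth_on (map_prod \<phi> \<psi> ` ((U \<times> V) \<inter> W)) (\<phi> \<circ> fst \<circ> inv_into (U \<times> V) (map_prod \<phi> \<psi>)) \<and>
     smooth_on (map_prod \<phi> \<psi> ` ((U \<times> V) \<inter> W)) (\<psi> \<circ> snd \<circ> inv_into (U \<times> V) (map_prod \<phi> \<psi>))"
    if z: "z \<in> W" for z
  proof -
    have "z \<in> points \<A> \<times> points \<B>" using mopen_subset_points[OF W] z points_product by blast
    then obtain U \<phi> V \<psi> where U: "(U, \<phi>) \<in> \<A>" "(V, \<psi>) \<in> \<B>" "z \<in> U \<times> V"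
      using points_chart[of "fst z" \<A>] points_chart[of "snd z" \<B>] by (metis mem_Times_iff)
    note UV = product_atlasI[OF U(1,2)]
    have N: "mopen (product_atlas \<A> \<B>) ((U \<times> V) \<inter> W)" by (intro mopen_Int AB W mopen_chart[OF AB UV])
    have op: "open (map_prod \<phi> \<psi> ` ((U \<times> V) \<inter> W))" using mopen_image[OF N UV] by blast
    have inj: "inj_on \<phi> U" "inj_on \<psi> V" using charts_compatD(2) A B U by blast+
    have "smooth_on (map_prod \<phi> \<psi> ` ((U \<times> V) \<inter> W)) (\<phi> \<circ> fst \<circ> inv_into (U \<times> V) (map_prod \<phi> \<psi>))"
      by (rule smooth_on_cong[OF op _ smooth_on_bounded_linear[OF bounded_linear_fst smooth_on_id]])
        (auto simp: inv_into_map_prod[OF inj])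
    moreover have "smooth_on (map_prod \<phi> \<psi> ` ((U \<times> V) \<inter> W)) (\<psi> \<circ> snd \<circ> inv_into (U \<times> V) (map_prod \<phi> \<psi>))"
      by (rule smooth_on_cong[OF op _ smooth_on_bounded_linear[OF bounded_linear_snd smooth_on_id]])
        (auto simp: inv_into_map_prod[OF inj])
    ultimately show ?thesis using U N by blast
  qed
  note * = this
  show "msmooth_on W (product_atlas \<A> \<B>) \<A> fst"
  proof (rule msmooth_onI[OF W])
    fix z assume z: "z \<in> W"
    from *[OF z] obtain U \<phi> V \<psi> where U: "(U, \<phi>) \<in> \<A>" "(V, \<psi>) \<in> \<B>" "mopen (product_atlas \<A> \<B>) ((U \<times> V) \<inter> W)" "z \<in> U \<times> V"
     "smooth_on (map_prod \<phi> \<psi> ` ((U \<times> V) \<inter> W)) (\<phi> \<circ> fst \<circ> inv_into (U \<times> V) (map_prod \<phi> \<psi>))"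
      by blast
    then show "\<exists>U \<phi> V \<psi> U'. (U, \<phi>) \<in> product_atlas \<A> \<B> \<and> (V, \<psi>) \<in> \<A> \<and> mopen (product_atlas \<A> \<B>) U' \<and> z \<in> U' \<and> U' \<subseteq> W \<and>
       U' \<subseteq> U \<and> fst ` U' \<subseteq> V \<and> smooth_on (\<phi> ` U') (\<psi> \<circ> fst \<circ> inv_into U \<phi>)"
      using z product_atlasI[OF U(1,2)]
      by (intro exI[of _ "U \<times> V"] exI[of _ "map_prod \<phi> \<psi>"] exI[of _ U] exI[of _ \<phi>] exI[of _ "(U \<times> V) \<inter> W"]) auto
  qed
  show "msmooth_on W (product_atlas \<A> \<B>) \<B> snd"
  proof (rule msmooth_onI[OF W])
    fix z assume z: "z \<in> W"
    from *[OF z] obtain U \<phi> V \<psi> where U: "(U, \<phi>) \<in> \<A>" "(V, \<psi>) \<in> \<B>" "mopen (product_atlas \<A> \<B>) ((U \<times> V) \<inter> W)" "z \<in> U \<times> V"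
     "smooth_on (map_prod \<phi> \<psi> ` ((U \<times> V) \<inter> W)) (\<psi> \<circ> snd \<circ> inv_into (U \<times> V) (map_prod \<phi> \<psi>))"
      by blast
    then show "\<exists>U \<phi> V \<psi> U'. (U, \<phi>) \<in> product_atlas \<A> \<B> \<and> (V, \<psi>) \<in> \<B> \<and> mopen (product_atlas \<A> \<B>) U' \<and> z \<in> U' \<and> U' \<subseteq> W \<and>
       U' \<subseteq> U \<and> snd ` U' \<subseteq> V \<and> smooth_on (\<phi> ` U') (\<psi> \<circ> snd \<circ> inv_into U \<phi>)"
      using z product_atlasI[OF U(1,2)]
      by (intro exI[of _ "U \<times> V"] exI[of _ "map_prod \<phi> \<psi>"] exI[of _ V] exI[of _ \<psi>] exI[of _ "(U \<times> V) \<inter> W"]) auto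
  qed
qed

text \<open>The derivative \<open>L x v\<close> of \<open>G\<close> at \<open>(x, 0)\<close> in the direction \<open>v\<close> is smooth in \<open>(x, v)\<close>: it is linear
  in \<open>v\<close>, and its values on a basis are partial derivatives of \<open>G\<close>.\<close>

lemma msmooth_vertical_derivative:
  fixes G :: "'x \<times> 'f::real_normed_vector \<Rightarrow> real"
  assumes A: "charts_compat (\<A> :: ('x, 'e::real_normed_vector) atlas)" and F: "finite_dim TYPE('f)"
    and G: "msmooth_on Q (product_atlas \<A> vs_atlas) vs_atlas G"
    and N: "mopen \<A> N" "\<And>x. x \<in> N \<Longrightarrow> (x, 0) \<in> Q"
  shows "\<exists>L. (\<forall>x\<in>N. linear (L x) \<and> (\<forall>v. ((\<lambda>t. G (x, t *\<^sub>R v)) has_real_derivative L x v) (at 0))) \<and>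
    msmooth_on (N \<times> UNIV) (product_atlas \<A> vs_atlas) vs_atlas (\<lambda>(x, v). L x v)"
proof -
  let ?P = "product_atlas \<A> (vs_atlas :: ('f, 'f) atlas)"
  note V = charts_compat_vs[OF F]
  note P = charts_compat_product[OF A V]
  define L where "L x v = deriv (\<lambda>t. G (x, t *\<^sub>R v)) 0" for x v
  have chart: "\<exists>L'. (\<forall>p\<in>\<phi> ` (U \<inter> N). linear (L' p) \<and>
        (\<forall>v. ((\<lambda>t. G (inv_into U \<phi> p, t *\<^sub>R v)) has_real_derivative L' p v) (at 0))) \<and>
        smooth_on (\<phi> ` (U \<inter> N) \<times> UNIV) (\<lambda>z. L' (fst z) (snd z))"
    if U: "(U, \<phi>) \<in> \<A>" for U \<phi>
  proof -
    have UV: "(U \<times> UNIV, map_prod \<phi> id) \<in> ?P" using product_atlasI[OF U] by (auto simp: vs_atlas_def)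
    have inj: "inj_on \<phi> U" using charts_compatD(2)[OF A U] .
    let ?T = "map_prod \<phi> id ` ((U \<times> UNIV) \<inter> Q)"
    have Q: "mopen ?P ((U \<times> UNIV) \<inter> Q)"
      by (intro mopen_Int P mopen_chart[OF P UV] msmooth_on_mopen[OF G])
    have oT: "open ?T" using mopen_image[OF Q UV] by blast
    define H where "H z = G (inv_into (U \<times> UNIV) (map_prod \<phi> id) z)" for z
    have "smooth_on ?T H" unfolding H_def
      using G UV by (simp add: msmooth_on_vs_iff[OF P finite_dim_real])
    then obtain H' where H': "\<And>z. z \<in> ?T \<Longrightarrow> (H has_derivative H' z) (at z)"
      "\<And>w. smooth_on ?T (\<lambda>z. H' z w)"
      using smooth_on_has_derivative[OF _ oT] by blast
    obtain B and crd :: "'f \<Rightarrow> 'f \<Rightarrow> real" where "coord_basis B crd"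
      using finite_dim_coordinates[OF F] by blast
    then have B: "\<And>b. b \<in> B \<Longrightarrow> bounded_linear (crd b)" "\<And>v. (\<Sum>b\<in>B. crd b v *\<^sub>R b) = v"
      unfolding coord_basis_def by auto
    let ?L' = "\<lambda>p v. H' (p, 0) (0, v)"
    have inT: "(p, 0) \<in> ?T" if "p \<in> \<phi> ` (U \<inter> N)" for p
    proof -
      obtain x where "x \<in> U" "x \<in> N" "p = \<phi> x" using \<open>p \<in> \<phi> ` (U \<inter> N)\<close> by blast
      then show ?thesis using N(2) by (intro image_eqI[of _ _ "(x, 0)"]) auto
    qed
    have lin: "linear (?L' p)" if "p \<in> \<phi> ` (U \<inter> N)" for p
    proof -
      have l: "linear (H' (p, 0))" using H'(1)[OF inT[OF that]] by (rule has_derivative_linear)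
      show ?thesis
      proof (rule linearI)
        fix v w and r :: real
        have "H' (p, 0) ((0, v) + (0, w)) = H' (p, 0) (0, v) + H' (p, 0) (0, w)" by (rule linear_add[OF l])
        then show "?L' p (v + w) = ?L' p v + ?L' p w" by simp
        have "H' (p, 0) (r *\<^sub>R (0, v)) = r *\<^sub>R H' (p, 0) (0, v)" by (rule linear_cmul[OF l])
        then show "?L' p (r *\<^sub>R v) = r *\<^sub>R ?L' p v" by simp
      qed
    qed
    have der: "((\<lambda>t. G (inv_into U \<phi> p, t *\<^sub>R v)) has_real_derivative ?L' p v) (at 0)"
      if p: "p \<in> \<phi> ` (U \<inter> N)" for p v
    proof -
      have "((\<lambda>t. (p, t *\<^sub>R v)) has_derivative (\<lambda>t. (0, t *\<^sub>R v))) (at 0)"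
        by (auto intro!: derivative_eq_intros)
      then have "((\<lambda>t. H (p, t *\<^sub>R v)) has_derivative (\<lambda>t. H' (p, 0) (0, t *\<^sub>R v))) (at 0)"
        using has_derivative_compose[of "\<lambda>t. (p, t *\<^sub>R v)" "\<lambda>t. (0, t *\<^sub>R v)" 0 UNIV H "H' (p, 0)"] H'(1)[OF inT[OF p]]
        by simp
      moreover have "H' (p, 0) (0, t *\<^sub>R v) = ?L' p v * t" for t
        using linear_cmul[OF lin[OF p], of t v] by simp
      moreover have "H (p, t *\<^sub>R v) = G (inv_into U \<phi> p, t *\<^sub>R v)" for t
      proof -
        obtain x where x: "x \<in> U" "p = \<phi> x" using p by blast
        then show ?thesis
          using inv_into_map_prod[of \<phi> U id UNIV x "t *\<^sub>R v"] inj inv_into_f_f[OF inj x(1)]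
          by (simp add: H_def)
      qed
      ultimately show ?thesis by (simp add: has_field_derivative_def)
    qed
    let ?X = "\<phi> ` (U \<inter> N) \<times> (UNIV :: 'f set)"
    have sm: "smooth_on ?X (\<lambda>z. crd b (snd z) *\<^sub>R H' (fst z, 0) (0, b))" if b: "b \<in> B" for b
    proof (rule smooth_on_scaleR)
      show "smooth_on ?X (\<lambda>z. crd b (snd z))"
        by (intro smooth_on_bounded_linear[OF B(1)[OF b]] smooth_on_bounded_linear[OF bounded_linear_snd] smooth_on_id)
      have "smooth_on ?X (\<lambda>z. (fst z, 0 :: 'f))"
        by (intro smooth_on_Pair smooth_on_const smooth_on_bounded_linear[OF bounded_linear_fst] smooth_on_id)
      then show "smooth_on ?X (\<lambda>z. H' (fst z, 0) (0, b))"
        by (rule smooth_on_compose[OF charts_compatD(1)[OF P] _ H'(2)]) (use inT in auto)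
    qed
    have "smooth_on ?X (\<lambda>z. \<Sum>b\<in>B. crd b (snd z) *\<^sub>R H' (fst z, 0) (0, b))"
      using sm unfolding smooth_on_def by (auto intro!: Ck_on_sum)
    then have "smooth_on ?X (\<lambda>z. ?L' (fst z) (snd z))"
    proof (rule smooth_on_cong[rotated 2])
      show "open ?X" using mopenD[OF N(1) U] by (intro open_Times) auto
      fix z assume z: "z \<in> ?X"
      then have "?L' (fst z) (\<Sum>b\<in>B. crd b (snd z) *\<^sub>R b) = (\<Sum>b\<in>B. crd b (snd z) *\<^sub>R ?L' (fst z) b)"
      proof -
        have l: "linear (?L' (fst z))" using lin[of "fst z"] z by auto
        show ?thesis unfolding linear_sum[OF l] linear_cmul[OF l] by (rule refl)
      qed
      then show "(\<Sum>b\<in>B. crd b (snd z) *\<^sub>R H' (fst z, 0) (0, b)) = ?L' (fst z) (snd z)"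
        unfolding B(2) by simp
    qed
    then show ?thesis using lin der by (intro exI[of _ ?L']) blast
  qed
  have L: "linear (L x)" "((\<lambda>t. G (x, t *\<^sub>R v)) has_real_derivative L x v) (at 0)" if x: "x \<in> N" for x v
  proof -
    obtain U \<phi> where U: "(U, \<phi>) \<in> \<A>" "x \<in> U" 
      using points_chart[OF subsetD[OF mopen_subset_points[OF N(1)] x]] by auto
    obtain L' where L': "\<And>p. p\<in>\<phi> ` (U \<inter> N) \<Longrightarrow> linear (L' p)"
        "\<And>p v. p\<in>\<phi> ` (U \<inter> N) \<Longrightarrow> ((\<lambda>t. G (inv_into U \<phi> p, t *\<^sub>R v)) has_real_derivative L' p v) (at 0)"
      using chart[OF U(1)] by blast
    have i: "inv_into U \<phi> (\<phi> x) = x" "\<phi> x \<in> \<phi> ` (U \<inter> N)"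
      using inv_into_f_f[OF charts_compatD(2)[OF A U(1)] U(2)] U x by auto
    have "L x = L' (\<phi> x)" unfolding L_def using L'(2)[OF i(2)] i(1) by (auto intro!: DERIV_imp_deriv)
    then show "linear (L x)" "((\<lambda>t. G (x, t *\<^sub>R v)) has_real_derivative L x v) (at 0)"
      using L'(1)[OF i(2)] L'(2)[OF i(2), of v] i(1) by auto
  qed
  have "msmooth_on (N \<times> UNIV) ?P vs_atlas (\<lambda>(x, v). L x v)"
    unfolding msmooth_on_vs_iff[OF P finite_dim_real]
  proof (intro conjI allI impI)
    show "mopen ?P (N \<times> UNIV)" by (intro mopen_product A V N(1)) simp
    fix W \<xi> assume "(W, \<xi>) \<in> ?P"
    then obtain U \<phi> where U: "W = U \<times> UNIV" "\<xi> = map_prod \<phi> id" "(U, \<phi>) \<in> \<A>"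
      by (rule product_atlasE) (auto simp: vs_atlas_def)
    obtain L' where L': "\<And>p v. p\<in>\<phi> ` (U \<inter> N) \<Longrightarrow> ((\<lambda>t. G (inv_into U \<phi> p, t *\<^sub>R v)) has_real_derivative L' p v) (at 0)"
      "smooth_on (\<phi> ` (U \<inter> N) \<times> UNIV) (\<lambda>z. L' (fst z) (snd z))"
      using chart[OF U(3)] by blast
    have inj: "inj_on \<phi> U" using charts_compatD(2)[OF A U(3)] .
    have im: "\<xi> ` (W \<inter> N \<times> UNIV) = \<phi> ` (U \<inter> N) \<times> UNIV"
      unfolding U(1,2) map_prod_image_Int by simp
    have "open (\<phi> ` (U \<inter> N) \<times> (UNIV :: 'f set))" using mopenD[OF N(1) U(3)] by (intro open_Times) auto
    then show "smooth_on (\<xi> ` (W \<inter> N \<times> UNIV)) (\<lambda>p. case inv_into W \<xi> p of (x, v) \<Rightarrow> L x v)"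
      unfolding im
    proof (rule smooth_on_cong[OF _ _ L'(2)])
      fix z :: "'e \<times> 'f" assume "z \<in> \<phi> ` (U \<inter> N) \<times> UNIV"
      then obtain x where x: "x \<in> U \<inter> N" "z = (\<phi> x, snd z)" by (cases z) auto
      have "inv_into W \<xi> z = (x, snd z)"
        using inv_into_map_prod[of \<phi> U id UNIV x "snd z"] inj x U by simp
      moreover have "L x (snd z) = L' (\<phi> x) (snd z)"
        unfolding L_def using L'(1)[of "\<phi> x"] inv_into_f_f[OF inj, of x] x by (auto intro!: DERIV_imp_deriv)
      moreover have "fst z = \<phi> x" using x(2) by (metis fst_conv)
      ultimately show "L' (fst z) (snd z) = (case inv_into W \<xi> z of (x, v) \<Rightarrow> L x v)" by simp
    qed
  qed
  then show ?thesis using L by (intro exI[of _ L]) blast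
qed

section \<open>Local trivialisations of vector bundles\<close>

text \<open>A local trivialisation \<open>\<Psi>\<close> over \<open>U\<close> together with its inverse \<open>\<tau>\<close>, where \<open>\<tau> m v\<close> is the
  point over \<open>m\<close> with coordinate \<open>v\<close>.\<close>

definition local_triv :: "('x, 'e::real_normed_vector, 'm, 'n::real_normed_vector) vbundle \<Rightarrow> 'm set \<Rightarrow>
    ('x \<Rightarrow> 'f::real_normed_vector) \<Rightarrow> ('m \<Rightarrow> 'f \<Rightarrow> 'x) \<Rightarrow> bool" where
  "local_triv E U \<Psi> \<tau> \<longleftrightarrow> mopen (base_atlas E) U \<and>
     (\<forall>x\<in>over E U. \<tau> (proj E x) (\<Psi> x) = x) \<and>
     (\<forall>m\<in>U. \<forall>v. \<tau> m v \<in> tot E \<and> proj E (\<tau> m v) = m \<and> \<Psi> (\<tau> m v) = v) \<and>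
     (\<forall>m\<in>U. linear_map (fibre E m) type_vs \<Psi>) \<and>
     msmooth_on (over E U) (tot_atlas E) vs_atlas \<Psi> \<and>
     msmooth_on (U \<times> UNIV) (product_atlas (base_atlas E) vs_atlas) (tot_atlas E) (\<lambda>(m, v). \<tau> m v)"

lemma carr_fibre: "carr (fibre E m) = {x \<in> tot E. proj E x = m}"
  and vzero_fibre: "vzero (fibre E m) = fzero E m"
  and vadd_fibre: "vadd (fibre E m) = fadd E"
  and vscl_fibre: "vscl (fibre E m) = fscl E"
  unfolding fibre_def over_def by auto

lemmas fibre_simps = carr_fibre vzero_fibre vadd_fibre vscl_fibre

lemma type_vs_simps: "carr type_vs = UNIV" "vzero type_vs = 0" "vadd type_vs = (+)" "vscl type_vs = (*\<^sub>R)"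
  unfolding type_vs_def by auto

lemma linear_mapD:
  assumes "linear_map V W f" "x \<in> carr V"
  shows "f x \<in> carr W" "y \<in> carr V \<Longrightarrow> f (vadd V x y) = vadd W (f x) (f y)" "f (vscl V r x) = vscl W r (f x)"
  using assms unfolding linear_map_def by auto

lemma real_vsD:
  assumes "real_vs V"
  shows "vzero V \<in> carr V" "x \<in> carr V \<Longrightarrow> y \<in> carr V \<Longrightarrow> vadd V x y \<in> carr V"
    "x \<in> carr V \<Longrightarrow> vscl V r x \<in> carr V" "x \<in> carr V \<Longrightarrow> y \<in> carr V \<Longrightarrow> vadd V x y = vadd V y x"
    "x \<in> carr V \<Longrightarrow> y \<in> carr V \<Longrightarrow> z \<in> carr V \<Longrightarrow> vadd V (vadd V x y) z = vadd V x (vadd V y z)"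
    "x \<in> carr V \<Longrightarrow> vadd V (vzero V) x = x" "x \<in> carr V \<Longrightarrow> vadd V x (vzero V) = x"
    "x \<in> carr V \<Longrightarrow> vscl V (r + s) x = vadd V (vscl V r x) (vscl V s x)"
    "x \<in> carr V \<Longrightarrow> vscl V (r * s) x = vscl V r (vscl V s x)" "x \<in> carr V \<Longrightarrow> vscl V 1 x = x"
proof -
  show 0: "vzero V \<in> carr V" using assms unfolding real_vs_def by simp
  show "x \<in> carr V \<Longrightarrow> y \<in> carr V \<Longrightarrow> vadd V x y \<in> carr V"
    "x \<in> carr V \<Longrightarrow> vscl V r x \<in> carr V"
    "x \<in> carr V \<Longrightarrow> y \<in> carr V \<Longrightarrow> z \<in> carr V \<Longrightarrow> vadd V (vadd V x y) z = vadd V x (vadd V y z)"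
    "x \<in> carr V \<Longrightarrow> vscl V (r + s) x = vadd V (vscl V r x) (vscl V s x)"
    "x \<in> carr V \<Longrightarrow> vscl V (r * s) x = vscl V r (vscl V s x)" "x \<in> carr V \<Longrightarrow> vscl V 1 x = x"
    using assms unfolding real_vs_def by meson+
  show 1: "x \<in> carr V \<Longrightarrow> y \<in> carr V \<Longrightarrow> vadd V x y = vadd V y x" for x y
    using assms unfolding real_vs_def by meson
  show 2: "x \<in> carr V \<Longrightarrow> vadd V (vzero V) x = x" using assms unfolding real_vs_def by meson
  show "x \<in> carr V \<Longrightarrow> vadd V x (vzero V) = x" using 1[OF _ 0, of x] 2 by argo
qed

lemma real_vs_cancel:
  assumes V: "real_vs V" and "x \<in> carr V" "y \<in> carr V" "vadd V x y = y"
  shows "x = vzero V"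
proof -
  obtain z where z: "z \<in> carr V" "vadd V y z = vzero V" using assms unfolding real_vs_def by meson
  have "x = vadd V x (vadd V y z)" using z real_vsD(7)[OF V] assms by simp
  also have "\<dots> = vadd V (vadd V x y) z"
    by (rule real_vsD(5)[OF V assms(2,3) z(1), symmetric])
  also have "\<dots> = vzero V" using assms(4) z(2) by simp
  finally show ?thesis .
qed

lemma real_vs_scl_0: "real_vs V \<Longrightarrow> x \<in> carr V \<Longrightarrow> vscl V 0 x = vzero V"
  using real_vs_cancel[of V "vscl V 0 x" "vscl V 0 x"] real_vsD(3)[of V x 0] real_vsD(8)[of V x 0 0] by simp

lemma real_vs_minus: "real_vs V \<Longrightarrow> x \<in> carr V \<Longrightarrow> vadd V x (vscl V (- 1) x) = vzero V"
  using real_vsD(8)[of V x 1 "-1"] real_vsD(10)[of V x] real_vs_scl_0[of V x] by simp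

lemma real_vs_scl_zero: "real_vs V \<Longrightarrow> vscl V r (vzero V) = vzero V"
  using real_vs_scl_0[of V "vzero V"] real_vsD(1)[of V] real_vsD(9)[of V "vzero V" r 0] by simp

lemma linear_map_zero:
  assumes "real_vs V" "real_vs W" "linear_map V W f"
  shows "f (vzero V) = vzero W"
  using real_vs_scl_0[OF assms(1) real_vsD(1)[OF assms(1)]] real_vs_scl_0[OF assms(2)]
    linear_mapD[OF assms(3) real_vsD(1)[OF assms(1)]] by metis

lemma real_vs_type_vs: "real_vs type_vs"
  unfolding real_vs_def type_vs_simps by (auto simp: algebra_simps intro: exI[of _ "- x" for x])

lemma vector_bundleD:
  assumes "vector_bundle TYPE('f::real_normed_vector) (E :: ('x, 'e::real_normed_vector, 'm, 'n::real_normed_vector) vbundle)"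
  shows "finite_dim TYPE('f)" "charts_compat (tot_atlas E)" "tot E = points (tot_atlas E)"
    "charts_compat (base_atlas E)" "base E = points (base_atlas E)"
    "msmooth_on (tot E) (tot_atlas E) (base_atlas E) (proj E)"
    "m \<in> base E \<Longrightarrow> real_vs (fibre E m)"
  using assms unfolding vector_bundle_def by (auto intro: smooth_manifold_charts_compat)

lemma vb_proj_base:
  assumes "vector_bundle TYPE('f::real_normed_vector) E" "x \<in> tot E"
  shows "proj E x \<in> base E"
  using msmooth_on_points[OF vector_bundleD(6)[OF assms(1)] assms(2)] vector_bundleD(5)[OF assms(1)] by simp

lemma vb_mopen_over:
  assumes "vector_bundle TYPE('f::real_normed_vector) E" "mopen (base_atlas E) U"
  shows "mopen (tot_atlas E) (over E U)"
  using msmooth_on_preimage[OF vector_bundleD(2,4)[OF assms(1)] vector_bundleD(6)[OF assms(1)] assms(2)]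
  unfolding over_def .

lemma vb_local_triv:
  fixes E :: "('x, 'e::real_normed_vector, 'm, 'n::real_normed_vector) vbundle"
  assumes E: "vector_bundle TYPE('f::real_normed_vector) E" and m: "m \<in> base E"
  shows "\<exists>U (\<Psi> :: 'x \<Rightarrow> 'f) \<tau>. m \<in> U \<and> local_triv E U \<Psi> \<tau>"
proof -
  have "\<forall>m\<in>base E. \<exists>U. \<exists>\<Psi>::'x \<Rightarrow> 'f. mopen (base_atlas E) U \<and> m \<in> U \<and>
        (\<forall>x\<in>U. linear_iso (fibre E x) type_vs \<Psi>) \<and>
        msmooth_on (over E U) (tot_atlas E) (product_atlas (base_atlas E) vs_atlas)
          (\<lambda>x. (proj E x, \<Psi> x)) \<and>
        msmooth_on (U \<times> UNIV) (product_atlas (base_atlas E) vs_atlas) (tot_atlas E)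
          (inv_into (over E U) (\<lambda>x. (proj E x, \<Psi> x)))"
    using E unfolding vector_bundle_def by blast
  with m obtain U and \<Psi> :: "'x \<Rightarrow> 'f" where U: "mopen (base_atlas E) U" "m \<in> U"
    and iso: "\<And>x. x \<in> U \<Longrightarrow> linear_iso (fibre E x) type_vs \<Psi>"
    and sm: "msmooth_on (over E U) (tot_atlas E) (product_atlas (base_atlas E) vs_atlas) (\<lambda>x. (proj E x, \<Psi> x))"
    and sm': "msmooth_on (U \<times> UNIV) (product_atlas (base_atlas E) vs_atlas) (tot_atlas E)
          (inv_into (over E U) (\<lambda>x. (proj E x, \<Psi> x)))" by blast
  note V = charts_compat_vs[OF vector_bundleD(1)[OF E]]
  note P = charts_compat_product[OF vector_bundleD(4)[OF E] V]
  define \<tau> where "\<tau> m v = inv_into (over E U) (\<lambda>x. (proj E x, \<Psi> x)) (m, v)" for m v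
  have bij: "bij_betw \<Psi> (carr (fibre E x)) UNIV" if "x \<in> U" for x
    using iso[OF that] unfolding linear_iso_def type_vs_simps by blast
  have inj: "inj_on (\<lambda>x. (proj E x, \<Psi> x)) (over E U)"
  proof (rule inj_onI)
    fix x y assume *: "x \<in> over E U" "y \<in> over E U" "(proj E x, \<Psi> x) = (proj E y, \<Psi> y)"
    then have "proj E x \<in> U" "x \<in> carr (fibre E (proj E x))" "y \<in> carr (fibre E (proj E x))"
      by (auto simp: over_def carr_fibre)
    then show "x = y" using bij * unfolding bij_betw_def inj_on_def by blast
  qed
  have t1: "\<tau> (proj E x) (\<Psi> x) = x" if "x \<in> over E U" for x
    unfolding \<tau>_def using inv_into_f_f[OF inj that] .
  have t2: "\<tau> m v \<in> tot E \<and> proj E (\<tau> m v) = m \<and> \<Psi> (\<tau> m v) = v" if m: "m \<in> U" for m v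
  proof -
    have "v \<in> \<Psi> ` carr (fibre E m)" using bij_betw_imp_surj_on[OF bij[OF m]] by simp
    then obtain x where x: "x \<in> tot E" "proj E x = m" "\<Psi> x = v"
      unfolding carr_fibre by auto
    then have "x \<in> over E U" using m unfolding over_def by simp
    then have "\<tau> m v = x" using t1 x by blast
    then show ?thesis using x by simp
  qed
  have "msmooth_on (over E U) (tot_atlas E) vs_atlas (\<lambda>x. snd (proj E x, \<Psi> x))"
  proof (rule msmooth_on_compose[OF vector_bundleD(2)[OF E] P V sm msmooth_on_fst(2)[OF vector_bundleD(4)[OF E] V]])
    show "mopen (product_atlas (base_atlas E) vs_atlas) (U \<times> (UNIV :: 'f set))"
      by (intro mopen_product vector_bundleD(4)[OF E] V U) simp
  qed (auto simp: over_def)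
  moreover have "(\<lambda>(m, v). \<tau> m v) = inv_into (over E U) (\<lambda>x. (proj E x, \<Psi> x))"
    unfolding \<tau>_def by auto
  ultimately have "local_triv E U \<Psi> \<tau>"
    unfolding local_triv_def using U t1 t2 sm' iso unfolding linear_iso_def by auto
  then show ?thesis using U(2) by blast
qed

context
  fixes E :: "('x, 'e::real_normed_vector, 'm, 'n::real_normed_vector) vbundle"
    and U and \<Psi> :: "'x \<Rightarrow> 'f::real_normed_vector" and \<tau>
  assumes T: "local_triv E U \<Psi> \<tau>"
begin

lemma triv_mopen: "mopen (base_atlas E) U"
  and triv_inv: "x \<in> tot E \<Longrightarrow> proj E x \<in> U \<Longrightarrow> \<tau> (proj E x) (\<Psi> x) = x"
  and triv_tau: "m \<in> U \<Longrightarrow> \<tau> m v \<in> tot E" "m \<in> U \<Longrightarrow> proj E (\<tau> m v) = m" "m \<in> U \<Longrightarrow> \<Psi> (\<tau> m v) = v"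
  and triv_smooth: "msmooth_on (over E U) (tot_atlas E) vs_atlas \<Psi>"
  and triv_tau_smooth: "msmooth_on (U \<times> UNIV) (product_atlas (base_atlas E) vs_atlas) (tot_atlas E) (\<lambda>(m, v). \<tau> m v)"
  using T unfolding local_triv_def over_def by auto

lemma triv_add: "x \<in> tot E \<Longrightarrow> y \<in> tot E \<Longrightarrow> proj E x \<in> U \<Longrightarrow> proj E y = proj E x \<Longrightarrow> \<Psi> (fadd E x y) = \<Psi> x + \<Psi> y"
  and triv_scl: "x \<in> tot E \<Longrightarrow> proj E x \<in> U \<Longrightarrow> \<Psi> (fscl E r x) = r *\<^sub>R \<Psi> x"
  using T unfolding local_triv_def linear_map_def fibre_simps type_vs_simps by auto

lemma triv_inj: "x \<in> tot E \<Longrightarrow> y \<in> tot E \<Longrightarrow> proj E x \<in> U \<Longrightarrow> proj E x = proj E y \<Longrightarrow> \<Psi> x = \<Psi> y \<Longrightarrow> x = y"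
  using triv_inv by metis

end

lemma vb_section:
  assumes E: "vector_bundle TYPE('f::real_normed_vector) E" and x: "x \<in> tot E"
  shows "\<exists>U s. mopen (base_atlas E) U \<and> proj E x \<in> U \<and> s (proj E x) = x \<and>
    msmooth_on U (base_atlas E) (tot_atlas E) s \<and> (\<forall>m\<in>U. s m \<in> tot E \<and> proj E (s m) = m)"
proof -
  obtain U and \<Psi> :: "_ \<Rightarrow> 'f" and \<tau> where U: "proj E x \<in> U" and T: "local_triv E U \<Psi> \<tau>"
    using vb_local_triv[OF E vb_proj_base[OF E x]] by blast
  note V = charts_compat_vs[OF vector_bundleD(1)[OF E]]
  note B = vector_bundleD(4)[OF E]
  have "msmooth_on U (base_atlas E) (product_atlas (base_atlas E) vs_atlas) (\<lambda>m. (m, \<Psi> x))"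
    by (intro msmooth_on_Pair B V msmooth_on_id msmooth_vs_const vector_bundleD(1)[OF E] triv_mopen[OF T])
  then have "msmooth_on U (base_atlas E) (tot_atlas E) (\<lambda>m. (\<lambda>(m, v). \<tau> m v) (m, \<Psi> x))"
    by (rule msmooth_on_compose[OF B charts_compat_product[OF B V] vector_bundleD(2)[OF E] _ triv_tau_smooth[OF T]]) auto
  then have "msmooth_on U (base_atlas E) (tot_atlas E) (\<lambda>m. \<tau> m (\<Psi> x))" by simp
  then show ?thesis
    using triv_mopen[OF T] U triv_inv[OF T x U] triv_tau[OF T]
    by (intro exI[of _ U] exI[of _ "\<lambda>m. \<tau> m (\<Psi> x)"]) auto
qed

lemma vb_closed:
  assumes E: "vector_bundle TYPE('f::real_normed_vector) E"
  shows "x \<in> tot E \<Longrightarrow> y \<in> tot E \<Longrightarrow> proj E x = proj E y \<Longrightarrow> fadd E x y \<in> tot E"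
    "x \<in> tot E \<Longrightarrow> y \<in> tot E \<Longrightarrow> proj E x = proj E y \<Longrightarrow> proj E (fadd E x y) = proj E y"
    "x \<in> tot E \<Longrightarrow> fscl E r x \<in> tot E" "x \<in> tot E \<Longrightarrow> proj E (fscl E r x) = proj E x"
    "m \<in> base E \<Longrightarrow> fzero E m \<in> tot E" "m \<in> base E \<Longrightarrow> proj E (fzero E m) = m"
  using real_vsD(1,2,3)[OF vector_bundleD(7)[OF E]] vb_proj_base[OF E] unfolding fibre_simps by blast+

lemma vb_scl_tau:
  assumes E: "vector_bundle TYPE('f::real_normed_vector) E" and T: "local_triv E U (\<Psi> :: _ \<Rightarrow> 'f) \<tau>"
    and x: "x \<in> tot E" "proj E x \<in> U"
  shows "fscl E t x = \<tau> (proj E x) (t *\<^sub>R \<Psi> x)"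
  using triv_inv[OF T vb_closed(3)[OF E x(1)], of t] triv_scl[OF T x, of t] vb_closed(4)[OF E x(1), of t] x(2) by simp

lemma vb_zero_tau:
  assumes E: "vector_bundle TYPE('f::real_normed_vector) E" and T: "local_triv E U (\<Psi> :: _ \<Rightarrow> 'f) \<tau>"
    and m: "m \<in> U"
  shows "fzero E m = \<tau> m 0"
proof -
  have "m \<in> base E" using mopen_subset_points[OF triv_mopen[OF T]] m vector_bundleD(5)[OF E] by auto
  note m = m this
  have "fscl E 0 (fzero E m) = fzero E m"
    using real_vs_scl_0[OF vector_bundleD(7)[OF E m(2)], of "fzero E m"] vb_closed(5,6)[OF E m(2)]
    by (simp add: fibre_simps)
  then show ?thesis using vb_scl_tau[OF E T, of "fzero E m" 0] vb_closed(5,6)[OF E m(2)] m(1) by simp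
qed

lemma vb_curve_smooth:
  assumes E: "vector_bundle TYPE('f::real_normed_vector) E" and x: "x \<in> tot E"
  shows "msmooth_on UNIV vs_atlas (tot_atlas E) (\<lambda>t. fscl E t x)"
proof -
  obtain U and \<Psi> :: "_ \<Rightarrow> 'f" and \<tau> where U: "proj E x \<in> U" and T: "local_triv E U \<Psi> \<tau>"
    using vb_local_triv[OF E vb_proj_base[OF E x]] by blast
  note V = charts_compat_vs[OF vector_bundleD(1)[OF E]]
  note B = vector_bundleD(4)[OF E]
  note R = charts_compat_vs[OF finite_dim_real]
  have c: "msmooth_on UNIV (vs_atlas :: (real, real) atlas) (base_atlas E) (\<lambda>t. proj E x)"
  proof (rule msmooth_onI)
    fix t :: real
    obtain W \<phi> where W: "(W, \<phi>) \<in> base_atlas E" "proj E x \<in> W"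
      using points_chart[of "proj E x" "base_atlas E"] vb_proj_base[OF E x] vector_bundleD(5)[OF E] by auto
    show "\<exists>U \<phi> V \<psi> U'. (U, \<phi>) \<in> (vs_atlas :: (real, real) atlas) \<and> (V, \<psi>) \<in> base_atlas E \<and> mopen vs_atlas U' \<and> t \<in> U' \<and>
       U' \<subseteq> UNIV \<and> U' \<subseteq> U \<and> (\<lambda>t. proj E x) ` U' \<subseteq> V \<and> smooth_on (\<phi> ` U') (\<psi> \<circ> (\<lambda>t. proj E x) \<circ> inv_into U \<phi>)"
      by (rule exI[of _ UNIV], rule exI[of _ id], rule exI[of _ W], rule exI[of _ \<phi>], rule exI[of _ UNIV])
        (use W in \<open>auto simp: o_def smooth_on_const\<close>, simp add: vs_atlas_def)
  qed simp
  have "msmooth_on UNIV vs_atlas vs_atlas (\<lambda>t. t *\<^sub>R \<Psi> x)"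
    using msmooth_vs_scaleR[OF R vector_bundleD(1)[OF E] msmooth_on_id[OF R] msmooth_vs_const[OF R vector_bundleD(1)[OF E]], of UNIV]
    by simp
  then have "msmooth_on UNIV vs_atlas (product_atlas (base_atlas E) vs_atlas) (\<lambda>t. (proj E x, t *\<^sub>R \<Psi> x))"
    by (intro msmooth_on_Pair B V R c)
  then have "msmooth_on UNIV vs_atlas (tot_atlas E) (\<lambda>t. (\<lambda>(m, v). \<tau> m v) (proj E x, t *\<^sub>R \<Psi> x))"
    by (rule msmooth_on_compose[OF R charts_compat_product[OF B V] vector_bundleD(2)[OF E] _ triv_tau_smooth[OF T]])
      (use U in auto)
  then show ?thesis using vb_scl_tau[OF E T x U] by simp
qed

text \<open>A smooth function near the zero section is turned into a function that is linear on the
  fibres by differentiating it at the zero section along the fibres.\<close>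

lemma vb_fibre_derivative:
  fixes f :: "'x \<Rightarrow> real" and E :: "('x, 'e::real_normed_vector, 'm, 'n::real_normed_vector) vbundle"
  assumes E: "vector_bundle TYPE('f::real_normed_vector) E"
    and f: "msmooth_on Q (tot_atlas E) vs_atlas f"
    and N: "mopen (base_atlas E) N" "\<And>m. m \<in> N \<Longrightarrow> fzero E m \<in> Q"
  shows "\<exists>L. msmooth_on (over E N) (tot_atlas E) vs_atlas L \<and>
    (\<forall>x\<in>over E N. ((\<lambda>t. f (fscl E t x)) has_real_derivative L x) (at 0)) \<and>
    (\<forall>m\<in>N. linear_map (fibre E m) type_vs L)"
proof -
  note V = charts_compat_vs[OF vector_bundleD(1)[OF E]]
  note B = vector_bundleD(4)[OF E]
  note A = vector_bundleD(2)[OF E]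
  note P = charts_compat_product[OF B V]
  note R = charts_compat_vs[OF finite_dim_real]
  define L where "L x = deriv (\<lambda>t. f (fscl E t x)) 0" for x
  have loc: "\<exists>N' L'. mopen (base_atlas E) N' \<and> m \<in> N' \<and> N' \<subseteq> N \<and>
      msmooth_on (over E N') (tot_atlas E) vs_atlas L' \<and>
      (\<forall>x\<in>over E N'. ((\<lambda>t. f (fscl E t x)) has_real_derivative L' x) (at 0)) \<and>
      (\<forall>m\<in>N'. linear_map (fibre E m) type_vs L')" if m: "m \<in> N" for m
  proof -
    have "m \<in> base E" using mopen_subset_points[OF N(1)] m vector_bundleD(5)[OF E] by auto
    then obtain U and \<Psi> :: "_ \<Rightarrow> 'f" and \<tau> where U: "m \<in> U" and T: "local_triv E U \<Psi> \<tau>"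
      using vb_local_triv[OF E] by blast
    let ?Q = "{z \<in> U \<times> UNIV. (\<lambda>(m, v). \<tau> m v) z \<in> Q}"
    have Q: "mopen (product_atlas (base_atlas E) vs_atlas) ?Q"
      by (rule msmooth_on_preimage[OF P A triv_tau_smooth[OF T] msmooth_on_mopen[OF f]])
    have "msmooth_on ?Q (product_atlas (base_atlas E) vs_atlas) (tot_atlas E) (\<lambda>(m, v). \<tau> m v)"
      by (rule msmooth_on_subset[OF P triv_tau_smooth[OF T] Q]) auto
    then have G: "msmooth_on ?Q (product_atlas (base_atlas E) vs_atlas) vs_atlas (\<lambda>z. f ((\<lambda>(m, v). \<tau> m v) z))"
      by (rule msmooth_on_compose[OF P A R _ f]) auto
    have N': "mopen (base_atlas E) (N \<inter> U)" by (intro mopen_Int B N(1) triv_mopen[OF T])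
    have "(x, 0) \<in> ?Q" if "x \<in> N \<inter> U" for x
      using that N(2)[of x] vb_zero_tau[OF E T, of x] by auto
    from msmooth_vertical_derivative[OF B vector_bundleD(1)[OF E] G N' this]
    obtain L' where L': "\<And>x. x \<in> N \<inter> U \<Longrightarrow> linear (L' x)"
      "\<And>x v. x \<in> N \<inter> U \<Longrightarrow> ((\<lambda>t. f ((\<lambda>(m, v). \<tau> m v) (x, t *\<^sub>R v))) has_real_derivative L' x v) (at 0)"
      "msmooth_on ((N \<inter> U) \<times> UNIV) (product_atlas (base_atlas E) vs_atlas) vs_atlas (\<lambda>(x, v). L' x v)"
      by blast
    let ?L = "\<lambda>x. L' (proj E x) (\<Psi> x)"
    have ov: "mopen (tot_atlas E) (over E (N \<inter> U))" by (rule vb_mopen_over[OF E N'])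
    have "msmooth_on (over E (N \<inter> U)) (tot_atlas E) (product_atlas (base_atlas E) vs_atlas) (\<lambda>x. (proj E x, \<Psi> x))"
      by (intro msmooth_on_Pair A B V msmooth_on_subset[OF A vector_bundleD(6)[OF E] ov]
          msmooth_on_subset[OF A triv_smooth[OF T] ov]) (auto simp: over_def)
    then have "msmooth_on (over E (N \<inter> U)) (tot_atlas E) vs_atlas (\<lambda>x. (\<lambda>(x, v). L' x v) (proj E x, \<Psi> x))"
      by (rule msmooth_on_compose[OF A P R _ L'(3)]) (auto simp: over_def)
    then have 1: "msmooth_on (over E (N \<inter> U)) (tot_atlas E) vs_atlas ?L" by simp
    have 2: "((\<lambda>t. f (fscl E t x)) has_real_derivative ?L x) (at 0)" if "x \<in> over E (N \<inter> U)" for x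
    proof -
      have x: "x \<in> tot E" "proj E x \<in> U" "proj E x \<in> N \<inter> U" using that by (auto simp: over_def)
      show ?thesis using L'(2)[OF x(3), of "\<Psi> x"] vb_scl_tau[OF E T x(1,2)] by simp
    qed
    have 3: "linear_map (fibre E m) type_vs ?L" if "m \<in> N \<inter> U" for m
      unfolding linear_map_def fibre_simps type_vs_simps
    proof (intro conjI ballI allI)
      fix x y assume xy: "x \<in> {x \<in> tot E. proj E x = m}" "y \<in> {x \<in> tot E. proj E x = m}"
      then show "?L (fadd E x y) = ?L x + ?L y"
        using linear_add[OF L'(1)[OF that], of "\<Psi> x" "\<Psi> y"] triv_add[OF T, of x y] vb_closed(2)[OF E, of x y] that
        by simp
    next
      fix r x assume xy: "x \<in> {x \<in> tot E. proj E x = m}"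
      then show "?L (fscl E r x) = r *\<^sub>R ?L x"
        using linear_cmul[OF L'(1)[OF that], of r "\<Psi> x"] triv_scl[OF T, of x r] vb_closed(4)[OF E, of x r] that
        by simp
    qed simp
    show ?thesis using N' U m 1 2 3 by (intro exI[of _ "N \<inter> U"] exI[of _ ?L]) auto
  qed
  have L: "\<exists>N'. mopen (base_atlas E) N' \<and> m \<in> N' \<and> N' \<subseteq> N \<and>
      msmooth_on (over E N') (tot_atlas E) vs_atlas L \<and>
      (\<forall>x\<in>over E N'. ((\<lambda>t. f (fscl E t x)) has_real_derivative L x) (at 0)) \<and>
      linear_map (fibre E m) type_vs L" if m: "m \<in> N" for m
  proof -
    obtain N' L' where *: "mopen (base_atlas E) N'" "m \<in> N'" "N' \<subseteq> N"
      "msmooth_on (over E N') (tot_atlas E) vs_atlas L'"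
      "\<And>x. x\<in>over E N' \<Longrightarrow> ((\<lambda>t. f (fscl E t x)) has_real_derivative L' x) (at 0)"
      "\<And>m. m\<in>N' \<Longrightarrow> linear_map (fibre E m) type_vs L'" using loc[OF m] by blast
    have eq: "L x = L' x" if "x \<in> over E N'" for x
      unfolding L_def using *(5)[OF that] by (rule DERIV_imp_deriv)
    have "msmooth_on (over E N') (tot_atlas E) vs_atlas L"
      by (rule msmooth_on_cong[OF A *(4)]) (simp add: eq)
    moreover have "linear_map (fibre E m) type_vs L"
    proof -
      have "x \<in> over E N'" if "x \<in> carr (fibre E m)" for x
        using that *(2) by (simp add: carr_fibre over_def)
      then have e: "L x = L' x" if "x \<in> carr (fibre E m)" for x using eq that by blast
      have cl: "vadd (fibre E m) x y \<in> carr (fibre E m)" "vscl (fibre E m) r x \<in> carr (fibre E m)"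
        if "x \<in> carr (fibre E m)" "y \<in> carr (fibre E m)" for x y r
        using that vb_closed(1-4)[OF E] by (auto simp: fibre_simps)
      show ?thesis using *(6)[OF *(2)] e cl unfolding linear_map_def by simp
    qed
    ultimately show ?thesis using * eq by (intro exI[of _ N']) auto
  qed
  have "msmooth_on (over E N) (tot_atlas E) vs_atlas L"
  proof (rule msmooth_on_local)
    fix x assume "x \<in> over E N"
    then have x: "x \<in> tot E" "proj E x \<in> N" by (auto simp: over_def)
    then obtain N' where "mopen (base_atlas E) N'" "proj E x \<in> N'" "N' \<subseteq> N"
      "msmooth_on (over E N') (tot_atlas E) vs_atlas L" using L by blast
    then show "\<exists>M. x \<in> M \<and> M \<subseteq> over E N \<and> msmooth_on M (tot_atlas E) vs_atlas L"
      using x by (intro exI[of _ "over E N'"]) (auto simp: over_def)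
  qed
  moreover have "((\<lambda>t. f (fscl E t x)) has_real_derivative L x) (at 0)" if "x \<in> over E N" for x
    using L[of "proj E x"] that unfolding over_def by auto
  moreover have "linear_map (fibre E m) type_vs L" if "m \<in> N" for m using L[OF that] by blast
  ultimately show ?thesis by (intro exI[of _ L]) blast
qed

section \<open>Linear algebra\<close>

lemma linear_extension_from_subspace:
  fixes g :: "'v::real_vector \<Rightarrow> real"
  assumes K: "subspace K" and add: "\<And>x y. x \<in> K \<Longrightarrow> y \<in> K \<Longrightarrow> g (x + y) = g x + g y"
    and scl: "\<And>r x. x \<in> K \<Longrightarrow> g (r *\<^sub>R x) = r * g x"
  shows "\<exists>h. linear h \<and> (\<forall>x\<in>K. h x = g x)"
proof -
  obtain B where B: "B \<subseteq> K" "independent B" "K \<subseteq> span B"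
    using maximal_independent_subset[of K] by auto
  obtain h where h: "linear h" "\<And>b. b \<in> B \<Longrightarrow> h b = g b"
    using linear_independent_extend[OF B(2), of g] by blast
  have sub: "subspace {x \<in> K. h x = g x}"
  proof (rule subspaceI)
    have "g (0 *\<^sub>R 0) = 0 * g 0" by (rule scl[OF subspace_0[OF K]])
    then show "0 \<in> {x \<in> K. h x = g x}" using subspace_0[OF K] linear_0[OF h(1)] by simp
  qed (use subspace_add[OF K] subspace_scale[OF K] add scl linear_add[OF h(1)] linear_cmul[OF h(1)] in auto)
  have "span B \<subseteq> {x \<in> K. h x = g x}"
    by (rule span_minimal[OF _ sub]) (use B h in auto)
  then show ?thesis using B h(1) by blast
qed

lemma linear_functional_separating:
  fixes x :: "'v::real_vector"
  assumes "x \<notin> span N"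
  shows "\<exists>h :: 'v \<Rightarrow> real. linear h \<and> (\<forall>y\<in>span N. h y = 0) \<and> h x = 1"
proof -
  obtain B where B: "B \<subseteq> N" "independent B" "N \<subseteq> span B"
    using maximal_independent_subset[of N] by auto
  have sp: "span N = span B" using B by (metis span_mono span_span subset_antisym)
  then have "x \<notin> B" "x \<notin> span B" using assms span_base by auto
  then have "independent (insert x B)" using B(2) by (simp add: independent_insert)
  then obtain h :: "'v \<Rightarrow> real" where h: "linear h" "\<And>b. b \<in> insert x B \<Longrightarrow> h b = (if b = x then 1 else 0)"
    using linear_independent_extend[of "insert x B" "\<lambda>b. if b = x then 1 else 0"] by blast
  have "x \<notin> B" using assms sp span_base by blast
  then have "\<And>b. b \<in> B \<Longrightarrow> h b = 0" using h(2) by auto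
  then have "h y = 0" if "y \<in> span B" for y
    using linear_eq_0_on_span[OF h(1)] that by blast
  then show ?thesis using h sp by (intro exI[of _ h]) auto
qed

lemma coord_basis_finite_dimensional:
  "coord_basis B crd \<Longrightarrow> finite_dimensional_vector_space scaleR B"
  unfolding coord_basis_def
  by unfold_locales (auto simp: dependent_raw_def[symmetric] span_raw_def[symmetric])

lemma finite_dim_injective_imp_surjective:
  assumes fd: "finite_dim TYPE('e::real_normed_vector)" and f: "linear (f :: 'e \<Rightarrow> 'e)"
    and inj: "\<And>v. f v = 0 \<Longrightarrow> v = 0"
  shows "\<exists>v. f v = w"
proof -
  obtain B and crd :: "'e \<Rightarrow> 'e \<Rightarrow> real" where B: "coord_basis B crd"
    using finite_dim_coordinates[OF fd] by blast
  have "inj f" using inj linear_injective_0[OF f] by blast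
  then have "surj f"
    using finite_dimensional_vector_space.linear_inj_imp_surj[OF coord_basis_finite_dimensional[OF B]] f
    unfolding linear_def by blast
  then show ?thesis by (metis surjD)
qed

text \<open>The kernel of a split surjection \<open>L\<close> has a finite basis with dual functionals, and its
  cardinality is the difference of the dimensions.\<close>

lemma kernel_dual_basis:
  fixes L :: "'e::real_normed_vector \<Rightarrow> 'f::real_normed_vector"
  assumes fd: "finite_dim TYPE('e)" and G: "coord_basis (G :: 'f set) crd"
    and L: "linear L" and Z: "linear Z" and LZ: "\<And>w. L (Z w) = w"
  shows "\<exists>C \<epsilon>. finite C \<and> card C + card G = dim (UNIV :: 'e set) \<and> (\<forall>c\<in>C. L c = 0 \<and> linear (\<epsilon> c)) \<and>
    (\<forall>c\<in>C. \<forall>c'\<in>C. \<epsilon> c c' = (if c = c' then 1 else (0::real))) \<and>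
    (\<forall>v. L v = 0 \<longrightarrow> v = (\<Sum>c\<in>C. \<epsilon> c v *\<^sub>R c))"
proof -
  have G': "finite G" "independent G" "span G = UNIV" using G unfolding coord_basis_def by auto
  let ?K = "{v. L v = 0}"
  have K: "subspace ?K" using linear_subspace_kernel[OF L] .
  obtain B where B: "B \<subseteq> ?K" "independent B" "?K \<subseteq> span B"
    using maximal_independent_subset[of ?K] by auto
  have spB: "span B = ?K" using B K by (metis span_minimal subset_antisym)
  obtain E and crdE :: "'e \<Rightarrow> 'e \<Rightarrow> real" where cE: "coord_basis E crdE"
    using finite_dim_coordinates[OF fd] by blast
  then have E: "finite E" "span E = UNIV" unfolding coord_basis_def by auto
  have fB: "finite B" using independent_span_bound[OF E(1) B(2)] E(2) by auto
  have injZ: "inj Z" using LZ by (metis injI)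
  have indZ: "independent (Z ` G)"
    using linear_independent_injective_image[OF Z G'(2)] injZ by (meson inj_on_subset subset_UNIV)
  have spZ: "span (Z ` G) = range Z" using span_linear_image[OF Z, of G] G'(3) by simp
  have int: "?K \<inter> range Z = {0}"
    using LZ linear_0[OF Z] linear_0[OF L] by (auto intro: image_eqI[of _ _ 0])
  have sum: "{x + y |x y. x \<in> ?K \<and> y \<in> range Z} = UNIV"
  proof -
    have "v \<in> {x + y |x y. x \<in> ?K \<and> y \<in> range Z}" for v
    proof -
      have "v = (v - Z (L v)) + Z (L v)" "v - Z (L v) \<in> ?K" "Z (L v) \<in> range Z"
        using linear_diff[OF L, of v "Z (L v)"] LZ by auto
      then show ?thesis by blast
    qed
    then show ?thesis by blast
  qed
  have "dim {x + y |x y. x \<in> ?K \<and> y \<in> range Z} + dim (?K \<inter> range Z) = dim ?K + dim (range Z)"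
    using finite_dimensional_vector_space.dim_sums_Int[OF coord_basis_finite_dimensional[OF cE], of ?K "range Z"]
      K subspace_span[of "Z ` G"] unfolding spZ dim_raw_def[symmetric] subspace_raw_def[symmetric] by blast
  moreover have "dim ?K = card B" using dim_eq_card[OF _ B(2), of ?K] spB K by (simp add: span_eq_iff[THEN iffD2])
  moreover have "dim (range Z) = card G"
    using dim_eq_card_independent[OF indZ] dim_span[of "Z ` G"] spZ card_image[OF inj_on_subset[OF injZ, of G]] by simp
  moreover have "dim ({0} :: 'e set) = 0"
    using dim_eq_card_independent[OF independent_empty] dim_span[of "{} :: 'e set"] by simp
  ultimately have card: "card B + card G = dim (UNIV :: 'e set)" unfolding sum int by simp
  have "\<exists>e. linear e \<and> (\<forall>b\<in>B. e b = (if c = b then 1 else (0::real)))" for c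
    using linear_independent_extend[OF B(2), of "\<lambda>b. if c = b then 1 else (0::real)"] by blast
  then obtain \<epsilon> where \<epsilon>: "\<And>c. linear (\<epsilon> c)" "\<And>c b. b \<in> B \<Longrightarrow> \<epsilon> c b = (if c = b then 1 else (0::real))"
    by metis
  have "v = (\<Sum>c\<in>B. \<epsilon> c v *\<^sub>R c)" if v: "L v = 0" for v
  proof (rule linear_eq_on_span[of "\<lambda>v. v" "\<lambda>v. \<Sum>c\<in>B. \<epsilon> c v *\<^sub>R c" B])
    show "linear (\<lambda>v. \<Sum>c\<in>B. \<epsilon> c v *\<^sub>R c)"
      by (rule linearI) (simp_all add: linear_add[OF \<epsilon>(1)] linear_cmul[OF \<epsilon>(1)] scaleR_left_distrib sum.distrib scaleR_sum_right)
    show "v \<in> span B" using v spB by blast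
    show "b = (\<Sum>c\<in>B. \<epsilon> c b *\<^sub>R c)" if "b \<in> B" for b
      using fB that \<epsilon>(2)[OF that] by (simp add: if_distrib[of "\<lambda>r. r *\<^sub>R _"] sum.delta cong: if_cong)
  qed (rule linear_ident)
  then show ?thesis
    using fB card B(1) \<epsilon> by (intro exI[of _ B] exI[of _ \<epsilon>]) auto
qed

text \<open>An additive function that is differentiable at \<open>0\<close> is linear: \<open>g (1/n) / (1/n)\<close> equals \<open>g 1\<close> for
  all \<open>n\<close> and tends to the derivative.\<close>

lemma additive_derivative_eq:
  fixes g :: "real \<Rightarrow> real"
  assumes add: "\<And>s t. g (s + t) = g s + g t" and d: "(g has_real_derivative l) (at 0)"
  shows "g 1 = l"
proof -
  have g0: "g 0 = 0" using add[of 0 0] by simp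
  have mul: "g (real n * x) = real n * g x" for n x
    by (induction n) (simp_all add: g0 add algebra_simps)
  have "(\<lambda>h. g h / h) \<midarrow>0\<rightarrow> l" using d g0 unfolding DERIV_def by simp
  moreover have "filterlim (\<lambda>n. inverse (real (Suc n))) (at 0) sequentially"
    by (rule filterlim_atI[OF LIMSEQ_inverse_real_of_nat]) simp
  ultimately have "(\<lambda>n. g (inverse (real (Suc n))) / inverse (real (Suc n))) \<longlonglongrightarrow> l"
    by (rule filterlim_compose)
  moreover have "g (inverse (real (Suc n))) / inverse (real (Suc n)) = g 1" for n
    using mul[of "Suc n" "inverse (real (Suc n))"] by (simp add: field_simps del: of_nat_Suc)
  ultimately show ?thesis using LIMSEQ_unique[of "\<lambda>n. g 1" "g 1" l] by simp
qed

section \<open>The algebra of double vector bundles\<close>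

lemma structure_maps_linearD:
  assumes "structure_maps_linear E E' A B"
  shows "vb_morphism E' A (proj E) (proj B)" "vb_morphism A E' (fzero E) (fzero B)"
    "family_morphism (fibre_product E E' B) E' (\<lambda>(x, y). fadd E x y) (\<lambda>(b, c). fadd B b c)"
    "vb_morphism E' E' (fscl E r) (fscl B r)"
  using assms unfolding structure_maps_linear_def by auto

lemma family_morphismD:
  assumes "family_morphism E E' F f" "x \<in> tot E" "proj E x \<in> base E"
  shows "f (proj E x) \<in> base E'" "F x \<in> tot E'" "proj E' (F x) = f (proj E x)"
    "y \<in> tot E \<Longrightarrow> proj E y = proj E x \<Longrightarrow> F (fadd E x y) = fadd E' (F x) (F y)"
    "F (fscl E r x) = fscl E' r (F x)"
  using assms(1)[unfolded family_morphism_def, rule_format, OF assms(3)] assms(2)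
    linear_mapD[of "fibre E (proj E x)" "fibre E' (f (proj E x))" F x]
  by (auto simp: fibre_simps)

text \<open>A fixed double vector bundle, with these names for its structure maps: \<open>qA\<close>, \<open>qB\<close> are the
  projections of \<open>D\<close> and \<open>pA\<close>, \<open>pB\<close> those of the side bundles; \<open>zA\<close>, \<open>zB\<close> are the zero sections of
  \<open>D\<close> and \<open>nA\<close>, \<open>nB\<close> those of the side bundles; \<open>addA\<close>, \<open>sclA\<close> belong to \<open>D \<rightarrow> A\<close> and \<open>addB\<close>, \<open>sclB\<close> to
  \<open>D \<rightarrow> B\<close>.\<close>

locale dvb =
  fixes D :: "('d, 'ed::real_normed_vector, 'a, 'ea::real_normed_vector,
               'b, 'eb::real_normed_vector, 'm, 'em::real_normed_vector) dvb"
  assumes dvb: "double_vector_bundle TYPE('fa::real_normed_vector) TYPE('fb::real_normed_vector)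
             TYPE('fda::real_normed_vector) TYPE('fdb::real_normed_vector) D"
begin

abbreviation "T \<equiv> tot (DA D)"
abbreviation "qA \<equiv> proj (DA D)"
abbreviation "qB \<equiv> proj (DB D)"
abbreviation "pA \<equiv> proj (sideA D)"
abbreviation "pB \<equiv> proj (sideB D)"
abbreviation "zA \<equiv> fzero (DA D)"
abbreviation "zB \<equiv> fzero (DB D)"
abbreviation "nA \<equiv> fzero (sideA D)"
abbreviation "nB \<equiv> fzero (sideB D)"
abbreviation "addA \<equiv> fadd (DA D)"
abbreviation "addB \<equiv> fadd (DB D)"
abbreviation "sclA \<equiv> fscl (DA D)"
abbreviation "sclB \<equiv> fscl (DB D)"

lemma vbs: "vector_bundle TYPE('fa) (sideA D)" "vector_bundle TYPE('fb) (sideB D)"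
    "vector_bundle TYPE('fda) (DA D)" "vector_bundle TYPE('fdb) (DB D)"
  and atlases: "base_atlas (sideB D) = M_atlas D" "tot_atlas (DB D) = D_atlas D"
    "base_atlas (DA D) = tot_atlas (sideA D)" "base_atlas (DB D) = tot_atlas (sideB D)"
  and square: "d \<in> T \<Longrightarrow> pB (qB d) = pA (qA d)"
  and structA: "structure_maps_linear (DA D) (DB D) (sideA D) (sideB D)"
  and structB: "structure_maps_linear (DB D) (DA D) (sideB D) (sideA D)"
  using dvb unfolding double_vector_bundle_def by auto

lemma tots: "tot (DB D) = T" "base (DA D) = tot (sideA D)" "base (DB D) = tot (sideB D)"
    "base (sideA D) = points (M_atlas D)" "base (sideB D) = points (M_atlas D)"
  using vector_bundleD(3,5)[OF vbs(1)] vector_bundleD(3,5)[OF vbs(2)] vector_bundleD(3,5)[OF vbs(3)]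
    vector_bundleD(3,5)[OF vbs(4)] atlases by auto

lemma projT: "d \<in> T \<Longrightarrow> qA d \<in> tot (sideA D)" "d \<in> T \<Longrightarrow> qB d \<in> tot (sideB D)"
  using vb_proj_base[OF vbs(3)] vb_proj_base[OF vbs(4)] tots by auto

lemma side_base: "a \<in> tot (sideA D) \<Longrightarrow> pA a \<in> points (M_atlas D)" "b \<in> tot (sideB D) \<Longrightarrow> pB b \<in> points (M_atlas D)"
  using vb_proj_base[OF vbs(1)] vb_proj_base[OF vbs(2)] tots by auto

lemma closedA:
  "x \<in> T \<Longrightarrow> y \<in> T \<Longrightarrow> qA x = qA y \<Longrightarrow> addA x y \<in> T"
  "x \<in> T \<Longrightarrow> y \<in> T \<Longrightarrow> qA x = qA y \<Longrightarrow> qA (addA x y) = qA y"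
  "x \<in> T \<Longrightarrow> sclA r x \<in> T" "x \<in> T \<Longrightarrow> qA (sclA r x) = qA x"
  "a \<in> tot (sideA D) \<Longrightarrow> zA a \<in> T" "a \<in> tot (sideA D) \<Longrightarrow> qA (zA a) = a"
  using vb_closed[OF vbs(3)] unfolding tots by auto

lemma closedB:
  "x \<in> T \<Longrightarrow> y \<in> T \<Longrightarrow> qB x = qB y \<Longrightarrow> addB x y \<in> T"
  "x \<in> T \<Longrightarrow> y \<in> T \<Longrightarrow> qB x = qB y \<Longrightarrow> qB (addB x y) = qB y"
  "x \<in> T \<Longrightarrow> sclB r x \<in> T" "x \<in> T \<Longrightarrow> qB (sclB r x) = qB x"
  "b \<in> tot (sideB D) \<Longrightarrow> zB b \<in> T" "b \<in> tot (sideB D) \<Longrightarrow> qB (zB b) = b"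
  using vb_closed[OF vbs(4)] unfolding tots by auto

lemma vb_morphism_family: "vb_morphism E E' F f \<Longrightarrow> family_morphism E E' F f"
  unfolding vb_morphism_def by blast

lemma proj_linear:
  "x \<in> T \<Longrightarrow> y \<in> T \<Longrightarrow> qB x = qB y \<Longrightarrow> qA (addB x y) = fadd (sideA D) (qA x) (qA y)"
  "x \<in> T \<Longrightarrow> qA (sclB r x) = fscl (sideA D) r (qA x)"
  "x \<in> T \<Longrightarrow> y \<in> T \<Longrightarrow> qA x = qA y \<Longrightarrow> qB (addA x y) = fadd (sideB D) (qB x) (qB y)"
  "x \<in> T \<Longrightarrow> qB (sclA r x) = fscl (sideB D) r (qB x)"
  using family_morphismD(4,5)[OF vb_morphism_family[OF structure_maps_linearD(1)[OF structA]]]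
    family_morphismD(4,5)[OF vb_morphism_family[OF structure_maps_linearD(1)[OF structB]]] projT
  unfolding tots by auto

lemma zero_proj:
  "a \<in> tot (sideA D) \<Longrightarrow> qB (zA a) = nB (pA a)"
  "b \<in> tot (sideB D) \<Longrightarrow> qA (zB b) = nA (pB b)"
  using family_morphismD(3)[OF vb_morphism_family[OF structure_maps_linearD(2)[OF structA]]]
    family_morphismD(3)[OF vb_morphism_family[OF structure_maps_linearD(2)[OF structB]]] side_base
  unfolding tots by auto

lemma zero_linear:
  "a \<in> tot (sideA D) \<Longrightarrow> a' \<in> tot (sideA D) \<Longrightarrow> pA a' = pA a \<Longrightarrow> zA (fadd (sideA D) a a') = addB (zA a) (zA a')"
  "a \<in> tot (sideA D) \<Longrightarrow> zA (fscl (sideA D) r a) = sclB r (zA a)"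
  "b \<in> tot (sideB D) \<Longrightarrow> b' \<in> tot (sideB D) \<Longrightarrow> pB b' = pB b \<Longrightarrow> zB (fadd (sideB D) b b') = addA (zB b) (zB b')"
  "b \<in> tot (sideB D) \<Longrightarrow> zB (fscl (sideB D) r b) = sclA r (zB b)"
  using family_morphismD(4,5)[OF vb_morphism_family[OF structure_maps_linearD(2)[OF structA]]]
    family_morphismD(4,5)[OF vb_morphism_family[OF structure_maps_linearD(2)[OF structB]]] side_base
  unfolding tots by auto

lemma scl_interchange:
  "x \<in> T \<Longrightarrow> y \<in> T \<Longrightarrow> qA x = qA y \<Longrightarrow> sclB r (addA x y) = addA (sclB r x) (sclB r y)"
  "x \<in> T \<Longrightarrow> sclB r (sclA s x) = sclA s (sclB r x)"
  "x \<in> T \<Longrightarrow> y \<in> T \<Longrightarrow> qB x = qB y \<Longrightarrow> sclA r (addB x y) = addB (sclA r x) (sclA r y)"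
  using family_morphismD(4,5)[OF vb_morphism_family[OF structure_maps_linearD(4)[OF structA]]]
    family_morphismD(4,5)[OF vb_morphism_family[OF structure_maps_linearD(4)[OF structB]]] projT
  unfolding tots by auto

lemma interchange:
  assumes "x \<in> T" "y \<in> T" "x' \<in> T" "y' \<in> T" "qB x = qB x'" "qB y = qB y'" "qA x = qA y" "qA x' = qA y'"
  shows "addA (addB x x') (addB y y') = addB (addA x y) (addA x' y')"
proof -
  let ?P = "fibre_product (DA D) (DB D) (sideB D)"
  have p: "proj ?P (x, y) = (qB x, qB y)" "tot ?P = {(x, y). x \<in> T \<and> y \<in> T \<and> qA x = qA y}"
    "base ?P = {(b, c). b \<in> tot (sideB D) \<and> c \<in> tot (sideB D) \<and> pB b = pB c}"
    "fadd ?P (x, y) (x', y') = (addB x x', addB y y')" "proj ?P (x', y') = (qB x', qB y')"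
    unfolding fibre_product_def by auto
  have "pB (qB x) = pB (qB y)" using square assms by metis
  then have h: "(x, y) \<in> tot ?P" "proj ?P (x, y) \<in> base ?P" "(x', y') \<in> tot ?P" "proj ?P (x', y') = proj ?P (x, y)"
    unfolding p using assms projT(2) by auto
  show ?thesis
    using family_morphismD(4)[OF structure_maps_linearD(3)[OF structA] h] unfolding p(4) by simp
qed

lemma zero_add: "x \<in> T \<Longrightarrow> addA (zA (qA x)) x = x" "x \<in> T \<Longrightarrow> addB (zB (qB x)) x = x"
  and add_zero: "x \<in> T \<Longrightarrow> addA x (zA (qA x)) = x" "x \<in> T \<Longrightarrow> addB x (zB (qB x)) = x"
  and scl_zero: "x \<in> T \<Longrightarrow> sclA 0 x = zA (qA x)" "x \<in> T \<Longrightarrow> sclB 0 x = zB (qB x)"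
  and minus_add: "x \<in> T \<Longrightarrow> addB (sclB (- 1) x) x = zB (qB x)"
  and scl_one: "x \<in> T \<Longrightarrow> sclA 1 x = x" "x \<in> T \<Longrightarrow> sclB 1 x = x"
  and add_assocB: "x \<in> T \<Longrightarrow> y \<in> T \<Longrightarrow> z \<in> T \<Longrightarrow> qB y = qB x \<Longrightarrow> qB z = qB x \<Longrightarrow> addB (addB x y) z = addB x (addB y z)"
  and scl_addB: "x \<in> T \<Longrightarrow> sclB (r + s) x = addB (sclB r x) (sclB s x)"
proof -
  have A: "real_vs (fibre (DA D) (qA x))" "x \<in> carr (fibre (DA D) (qA x))" if "x \<in> T" for x
    using vector_bundleD(7)[OF vbs(3)] projT that by (auto simp: tots fibre_simps)
  have B: "real_vs (fibre (DB D) (qB x))" "x \<in> carr (fibre (DB D) (qB x))" if "x \<in> T" for x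
    using vector_bundleD(7)[OF vbs(4)] projT that by (auto simp: tots fibre_simps)
  show "x \<in> T \<Longrightarrow> addA (zA (qA x)) x = x" "x \<in> T \<Longrightarrow> addA x (zA (qA x)) = x" "x \<in> T \<Longrightarrow> sclA 1 x = x"
    using real_vsD(6,7,10)[OF A] by (auto simp: fibre_simps)
  show "x \<in> T \<Longrightarrow> addB (zB (qB x)) x = x" "x \<in> T \<Longrightarrow> addB x (zB (qB x)) = x" "x \<in> T \<Longrightarrow> sclB 1 x = x"
    "x \<in> T \<Longrightarrow> sclB (r + s) x = addB (sclB r x) (sclB s x)"
    using real_vsD(6,7,8,10)[OF B] by (auto simp: fibre_simps)
  show "x \<in> T \<Longrightarrow> sclA 0 x = zA (qA x)" "x \<in> T \<Longrightarrow> sclB 0 x = zB (qB x)"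
    using real_vs_scl_0[OF A] real_vs_scl_0[OF B] by (auto simp: fibre_simps)
  show "x \<in> T \<Longrightarrow> addB (sclB (- 1) x) x = zB (qB x)"
    using real_vs_minus[OF B] real_vsD(4)[OF B(1), of x x "sclB (- 1) x"] closedB(3,4)[of x "-1"]
    by (auto simp: fibre_simps tots)
  show "x \<in> T \<Longrightarrow> y \<in> T \<Longrightarrow> z \<in> T \<Longrightarrow> qB y = qB x \<Longrightarrow> qB z = qB x \<Longrightarrow> addB (addB x y) z = addB x (addB y z)"
    using real_vsD(5)[OF B(1), of x x y z] by (auto simp: fibre_simps tots)
qed

subsection \<open>The core\<close>

text \<open>The set of elements of \<open>D\<close> that lie over the zeros of both side bundles at \<open>m\<close>.\<close>

definition core :: "'m \<Rightarrow> 'd set" where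
  "core m = {c \<in> T. qA c = nA m \<and> qB c = nB m}"

lemma zero_side: "m \<in> points (M_atlas D) \<Longrightarrow> nA m \<in> tot (sideA D)" "m \<in> points (M_atlas D) \<Longrightarrow> nB m \<in> tot (sideB D)"
  "m \<in> points (M_atlas D) \<Longrightarrow> pA (nA m) = m" "m \<in> points (M_atlas D) \<Longrightarrow> pB (nB m) = m"
  using vb_closed(5,6)[OF vbs(1)] vb_closed(5,6)[OF vbs(2)] tots by auto

text \<open>The zero of \<open>D \<rightarrow> A\<close> over \<open>0\<close> is the zero of \<open>D \<rightarrow> B\<close> over \<open>0\<close>, because the zero section of the
  former is linear.\<close>

lemma double_zero: "m \<in> points (M_atlas D) \<Longrightarrow> zA (nA m) = zB (nB m)"
proof -
  assume m: "m \<in> points (M_atlas D)"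
  have "linear_map (fibre (sideA D) m) (fibre (DB D) (nB m)) zA"
    using vb_morphism_family[OF structure_maps_linearD(2)[OF structA]] m tots unfolding family_morphism_def by auto
  then have "zA (vzero (fibre (sideA D) m)) = vzero (fibre (DB D) (nB m))"
    by (rule linear_map_zero[rotated 2])
      (use vector_bundleD(7)[OF vbs(1)] vector_bundleD(7)[OF vbs(4)] m zero_side tots in auto)
  then show ?thesis by (simp add: fibre_simps)
qed

text \<open>The Eckmann--Hilton argument: on the core the interchange law makes the two additions agree.\<close>

lemma core_add_eq:
  assumes m: "m \<in> points (M_atlas D)" and c: "c \<in> core m" "c' \<in> core m"
  shows "addA c c' = addB c c'"
proof -
  let ?z = "zA (nA m)"
  have z: "?z \<in> T" "qA ?z = nA m" "qB ?z = nB m" using closedA(5,6) zero_proj(1) zero_side[OF m] by auto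
  have cc: "c \<in> T" "c' \<in> T" "qA c = nA m" "qB c = nB m" "qA c' = nA m" "qB c' = nB m" using c unfolding core_def by auto
  have "addA (addB c ?z) (addB ?z c') = addB (addA c ?z) (addA ?z c')"
    by (rule interchange) (use cc z in auto)
  moreover have "addB c ?z = c" "addB ?z c' = c'" using zero_add(2)[of c'] add_zero(2)[of c] cc double_zero[OF m] by auto
  moreover have "addA c ?z = c" "addA ?z c' = c'" using zero_add(1)[of c'] add_zero(1)[of c] cc by auto
  ultimately show ?thesis by simp
qed

lemma core_closed:
  assumes m: "m \<in> points (M_atlas D)"
  shows "c \<in> core m \<Longrightarrow> c' \<in> core m \<Longrightarrow> addA c c' \<in> core m" "c \<in> core m \<Longrightarrow> sclA r c \<in> core m"
    "c \<in> core m \<Longrightarrow> sclB r c \<in> core m" "zA (nA m) \<in> core m"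
proof -
  have z: "zA (nA m) \<in> T" "qA (zA (nA m)) = nA m" "qB (zA (nA m)) = nB m"
    using closedA(5,6) zero_proj(1) zero_side[OF m] by auto
  then show "zA (nA m) \<in> core m" unfolding core_def by auto
  have s0: "fscl (sideB D) r (nB m) = nB m" "fscl (sideA D) r (nA m) = nA m" for r
    using real_vs_scl_zero[OF vector_bundleD(7)[OF vbs(2)], of m r] real_vs_scl_zero[OF vector_bundleD(7)[OF vbs(1)], of m r]
      m tots by (auto simp: fibre_simps)
  show "c \<in> core m \<Longrightarrow> c' \<in> core m \<Longrightarrow> addA c c' \<in> core m"
    using core_add_eq[OF m, of c c'] closedA(1,2)[of c c'] closedB(2)[of c c'] unfolding core_def by auto
  show "c \<in> core m \<Longrightarrow> sclA r c \<in> core m"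
    using closedA(3,4)[of c r] proj_linear(4)[of c r] s0 unfolding core_def by auto
  show "c \<in> core m \<Longrightarrow> sclB r c \<in> core m"
    using closedB(3,4)[of c r] proj_linear(2)[of c r] s0 unfolding core_def by auto
qed

end

lemma triv_tau_linear:
  assumes E: "vector_bundle TYPE('f::real_normed_vector) E" and T: "local_triv E U (\<Psi> :: _ \<Rightarrow> 'f) \<tau>" and m: "m \<in> U"
  shows "\<tau> m (v + w) = fadd E (\<tau> m v) (\<tau> m w)" "\<tau> m (r *\<^sub>R v) = fscl E r (\<tau> m v)"
proof -
  note t = triv_tau[OF T m]
  have a: "fadd E (\<tau> m v) (\<tau> m w) \<in> tot E" "proj E (fadd E (\<tau> m v) (\<tau> m w)) = m"
    using vb_closed(1,2)[OF E t(1) t(1)] t(2) by auto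
  show "\<tau> m (v + w) = fadd E (\<tau> m v) (\<tau> m w)"
    using triv_inj[OF T t(1) a(1)] a(2) t m triv_add[OF T t(1) t(1)] by simp
  have s: "fscl E r (\<tau> m v) \<in> tot E" "proj E (fscl E r (\<tau> m v)) = m"
    using vb_closed(3,4)[OF E t(1)] t(2) by auto
  show "\<tau> m (r *\<^sub>R v) = fscl E r (\<tau> m v)"
    using triv_inj[OF T t(1) s(1)] s(2) t m triv_scl[OF T t(1)] by simp
qed

lemma local_triv_subset:
  assumes E: "vector_bundle TYPE('f::real_normed_vector) E" and T: "local_triv E U (\<Psi> :: _ \<Rightarrow> 'f) \<tau>"
    and V: "mopen (base_atlas E) V" "V \<subseteq> U"
  shows "local_triv E V \<Psi> \<tau>"
proof -
  note VS = charts_compat_vs[OF vector_bundleD(1)[OF E]]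
  have "msmooth_on (over E V) (tot_atlas E) vs_atlas \<Psi>"
    by (rule msmooth_on_subset[OF vector_bundleD(2)[OF E] triv_smooth[OF T] vb_mopen_over[OF E V(1)]])
      (use V(2) in \<open>auto simp: over_def\<close>)
  moreover have "msmooth_on (V \<times> UNIV) (product_atlas (base_atlas E) vs_atlas) (tot_atlas E) (\<lambda>(m, v). \<tau> m v)"
    by (rule msmooth_on_subset[OF charts_compat_product[OF vector_bundleD(4)[OF E] VS] triv_tau_smooth[OF T]])
      (use V in \<open>auto intro!: mopen_product vector_bundleD(4)[OF E] VS\<close>)
  ultimately show ?thesis using T V unfolding local_triv_def over_def by blast
qed

lemma mopen_finite_Inter:
  assumes A: "charts_compat \<A>" and "finite C" "\<And>c. c \<in> C \<Longrightarrow> mopen \<A> (U c)" "mopen \<A> V"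
  shows "mopen \<A> (V \<inter> (\<Inter>c\<in>C. U c))"
  using assms(2,3)
proof (induction C)
  case (insert c C)
  have "V \<inter> (\<Inter>c\<in>insert c C. U c) = U c \<inter> (V \<inter> (\<Inter>c\<in>C. U c))" by auto
  then show ?case using insert mopen_Int[OF A] by simp
qed (use assms(4) in simp)

context dvb
begin

section \<open>Double-linear functions\<close>

lemma mem_D_over: "d \<in> D_over D U \<longleftrightarrow> d \<in> T \<and> pA (qA d) \<in> U"
  unfolding D_over_def projM_def by simp

lemma D_over_alt: "D_over D U = over (DB D) {b \<in> tot (sideB D). pB b \<in> U}"
  unfolding over_def using square projT by (auto simp: mem_D_over tots)

lemma mopen_D_over:
  assumes "mopen (M_atlas D) U"
  shows "mopen (D_atlas D) (D_over D U)"
proof -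
  have "mopen (tot_atlas (sideA D)) (over (sideA D) U)" by (rule vb_mopen_over[OF vbs(1) assms])
  then have "mopen (D_atlas D) (over (DA D) (over (sideA D) U))"
    by (intro vb_mopen_over[OF vbs(3)]) (simp add: atlases)
  moreover have "over (DA D) (over (sideA D) U) = D_over D U"
    using projT unfolding over_def by (auto simp: mem_D_over)
  ultimately show ?thesis by simp
qed

lemmas compat = vector_bundleD(4)[OF vbs(1)] vector_bundleD(2)[OF vbs(1)]
  vector_bundleD(2)[OF vbs(2)] vector_bundleD(2)[OF vbs(3)]

lemmas compat_real = charts_compat_vs[OF finite_dim_real]

lemma double_linearD:
  assumes "double_linear D m \<sigma>" "x \<in> T" "pA (qA x) = m"
  shows "y \<in> T \<Longrightarrow> qA x = qA y \<Longrightarrow> \<sigma> (addA x y) = \<sigma> x + \<sigma> y"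
    "y \<in> T \<Longrightarrow> qB x = qB y \<Longrightarrow> \<sigma> (addB x y) = \<sigma> x + \<sigma> y"
    "\<sigma> (sclA r x) = r * \<sigma> x" "\<sigma> (sclB r x) = r * \<sigma> x"
proof -
  have x: "x \<in> slice D m" using assms by (simp add: mem_D_over)
  have y: "y \<in> T \<Longrightarrow> qA x = qA y \<Longrightarrow> y \<in> slice D m" "y \<in> T \<Longrightarrow> qB x = qB y \<Longrightarrow> y \<in> slice D m"
    using assms(2,3) square[of x] square[of y] by (auto simp: mem_D_over)
  show "y \<in> T \<Longrightarrow> qA x = qA y \<Longrightarrow> \<sigma> (addA x y) = \<sigma> x + \<sigma> y"
    "y \<in> T \<Longrightarrow> qB x = qB y \<Longrightarrow> \<sigma> (addB x y) = \<sigma> x + \<sigma> y"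
    "\<sigma> (sclA r x) = r * \<sigma> x" "\<sigma> (sclB r x) = r * \<sigma> x"
    using assms(1) x y unfolding double_linear_def by blast+
qed

lemma double_linearI:
  assumes "\<And>x y. x \<in> T \<Longrightarrow> y \<in> T \<Longrightarrow> pA (qA x) = m \<Longrightarrow> qA x = qA y \<Longrightarrow> \<sigma> (addA x y) = \<sigma> x + \<sigma> y"
    "\<And>x y. x \<in> T \<Longrightarrow> y \<in> T \<Longrightarrow> pA (qA x) = m \<Longrightarrow> qB x = qB y \<Longrightarrow> \<sigma> (addB x y) = \<sigma> x + \<sigma> y"
    "\<And>r x. x \<in> T \<Longrightarrow> pA (qA x) = m \<Longrightarrow> \<sigma> (sclA r x) = r * \<sigma> x"
    "\<And>r x. x \<in> T \<Longrightarrow> pA (qA x) = m \<Longrightarrow> \<sigma> (sclB r x) = r * \<sigma> x"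
  shows "double_linear D m \<sigma>"
  using assms unfolding double_linear_def by (simp add: mem_D_over)

lemma slice_closed:
  assumes "x \<in> slice D m"
  shows "y \<in> slice D m \<Longrightarrow> qA x = qA y \<Longrightarrow> addA x y \<in> slice D m"
    "y \<in> slice D m \<Longrightarrow> qB x = qB y \<Longrightarrow> addB x y \<in> slice D m"
    "sclA r x \<in> slice D m" "sclB r x \<in> slice D m"
proof -
  show "y \<in> slice D m \<Longrightarrow> qA x = qA y \<Longrightarrow> addA x y \<in> slice D m" "sclA r x \<in> slice D m"
    using assms closedA by (auto simp: mem_D_over)
  show "y \<in> slice D m \<Longrightarrow> qB x = qB y \<Longrightarrow> addB x y \<in> slice D m" "sclB r x \<in> slice D m"
    using assms closedB square[of "addB x y"] square[of "sclB r x"] square[of x] square[of y]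
    by (auto simp: mem_D_over)
qed

lemma double_linear_zero:
  assumes "double_linear D m \<sigma>" "a \<in> tot (sideA D)" "pA a = m"
  shows "\<sigma> (zA a) = 0"
  using double_linearD(3)[OF assms(1), of "zA a" 0] closedA(5,6)[OF assms(2)] assms(3) scl_zero(1)[of "zA a"] by simp

lemma double_linear_product:
  assumes f: "linear_map (fibre (sideA D) m) type_vs f" and g: "linear_map (fibre (sideB D) m) type_vs g"
  shows "double_linear D m (\<lambda>d. f (qA d) * g (qB d))"
proof (rule double_linearI)
  note F = linear_mapD[OF f, unfolded fibre_simps type_vs_simps]
  note G = linear_mapD[OF g, unfolded fibre_simps type_vs_simps]
  fix x y r assume x: "x \<in> T" "pA (qA x) = m"
  have sx: "pB (qB x) = m" using square x by simp
  show "f (qA (sclA r x)) * g (qB (sclA r x)) = r * (f (qA x) * g (qB x))"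
    using x sx projT[of x] G(3)[of "qB x" r] closedA(4)[of x r] proj_linear(4)[of x r] by simp
  show "f (qA (sclB r x)) * g (qB (sclB r x)) = r * (f (qA x) * g (qB x))"
    using x sx projT[of x] F(3)[of "qA x" r] closedB(4)[of x r] proj_linear(2)[of x r] by simp
  assume y: "y \<in> T"
  show "f (qA (addA x y)) * g (qB (addA x y)) = f (qA x) * g (qB x) + f (qA y) * g (qB y)" if q: "qA x = qA y"
    using x sx y projT[of x] projT[of y] G(2)[of "qB x" "qB y"] closedA(2)[of x y] proj_linear(3)[of x y] square[of y] q
    by (simp add: algebra_simps)
  show "f (qA (addB x y)) * g (qB (addB x y)) = f (qA x) * g (qB x) + f (qA y) * g (qB y)" if q: "qB x = qB y"
  proof -
    have "pA (qA y) = m" using square[of y] sx q y by simp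
    then show ?thesis
      using x sx y projT[of x] projT[of y] F(2)[of "qA x" "qA y"] closedB(2)[of x y] proj_linear(1)[of x y] q
      by (simp add: algebra_simps)
  qed
qed

lemma core_fib_simps: "carr (core_fib D m) = core m" "vzero (core_fib D m) = zA (nA m)"
    "vadd (core_fib D m) = addA" "vscl (core_fib D m) = sclA"
  unfolding core_fib_def core_def by simp_all

subsection \<open>Extension of functionals from the core\<close>

text \<open>Every linear functional \<open>\<xi>\<close> on the core of one slice extends to a smooth double-linear function
  near that slice. In a trivialisation of \<open>D \<rightarrow> A\<close> near the zero of \<open>A\<close>, extend \<open>\<xi>\<close> to a functional of
  the fibre coordinate; this gives a function \<open>f\<close> that is linear over \<open>A\<close> but defined only near the
  zero section of \<open>D \<rightarrow> B\<close>. Its derivative \<open>L\<close> along the fibres of \<open>D \<rightarrow> B\<close> at the zero section is linear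
  over \<open>B\<close>, and still linear over \<open>A\<close> because the scalar multiplication of \<open>D \<rightarrow> B\<close> is.

  It remains to see that \<open>L\<close> is \<open>\<xi>\<close> on the core. There the two additions agree, but for the two scalar
  multiplications this needs an argument by continuity; it is provided by
  \<open>additive_derivative_eq\<close>.\<close>

lemma core_extension:
  assumes m0: "m0 \<in> points (M_atlas D)" and \<xi>: "linear_map (core_fib D m0) type_vs \<xi>"
  shows "\<exists>U L. mopen (M_atlas D) U \<and> m0 \<in> U \<and> msmooth_on (D_over D U) (D_atlas D) vs_atlas L \<and>
    (\<forall>m\<in>U. double_linear D m L) \<and> (\<forall>c\<in>core m0. L c = \<xi> c)"
proof -
  have n0: "nA m0 \<in> base (DA D)" using zero_side(1)[OF m0] tots by simp
  obtain W and \<Psi> :: "'d \<Rightarrow> 'fda" and \<tau> where W: "nA m0 \<in> W" and Tr: "local_triv (DA D) W \<Psi> \<tau>"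
    using vb_local_triv[OF vbs(3) n0] by blast
  \<comment> \<open>The functional on the core, as a functional on a subspace of the typical fibre.\<close>
  let ?K = "\<Psi> ` core m0"
  have cT: "c \<in> T" "qA c = nA m0" "qB c = nB m0" if "c \<in> core m0" for c using that unfolding core_def by auto
  have tau: "\<tau> (nA m0) (\<Psi> c) = c" if "c \<in> core m0" for c
    using triv_inv[OF Tr, of c] cT[OF that] W by simp
  have addK: "\<Psi> c + \<Psi> c' = \<Psi> (addA c c')" if "c \<in> core m0" "c' \<in> core m0" for c c'
    using triv_add[OF Tr, of c c'] cT that W by simp
  have sclK: "r *\<^sub>R \<Psi> c = \<Psi> (sclA r c)" if "c \<in> core m0" for c r
    using triv_scl[OF Tr, of c r] cT that W by simp
  have K: "subspace ?K"
  proof (rule subspaceI)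
    have "0 *\<^sub>R \<Psi> (zA (nA m0)) \<in> ?K" using sclK[OF core_closed(4)[OF m0]] core_closed(2,4)[OF m0] by auto
    then show "0 \<in> ?K" by simp
  qed (use addK sclK core_closed[OF m0] in auto)
  have \<xi>D: "\<xi> (addA c c') = \<xi> c + \<xi> c'" "\<xi> (sclA r c) = r * \<xi> c" if "c \<in> core m0" "c' \<in> core m0" for c c' r
    using linear_mapD(2,3)[OF \<xi>, unfolded core_fib_simps type_vs_simps] that by auto
  have "\<exists>h. linear h \<and> (\<forall>x\<in>?K. h x = (\<lambda>v. \<xi> (\<tau> (nA m0) v)) x)"
  proof (rule linear_extension_from_subspace[OF K])
    fix x y r assume "x \<in> ?K" "y \<in> ?K"
    then obtain c c' where c: "c \<in> core m0" "c' \<in> core m0" "x = \<Psi> c" "y = \<Psi> c'" by blast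
    show "\<xi> (\<tau> (nA m0) (x + y)) = \<xi> (\<tau> (nA m0) x) + \<xi> (\<tau> (nA m0) y)"
      unfolding c(3,4) addK[OF c(1,2)] tau[OF c(1)] tau[OF c(2)] tau[OF core_closed(1)[OF m0 c(1,2)]]
      by (rule \<xi>D(1)[OF c(1,2)])
  next
    fix x r assume "x \<in> ?K"
    then obtain c where c: "c \<in> core m0" "x = \<Psi> c" by blast
    show "\<xi> (\<tau> (nA m0) (r *\<^sub>R x)) = r * \<xi> (\<tau> (nA m0) x)"
      unfolding c(2) sclK[OF c(1)] tau[OF c(1)] tau[OF core_closed(2)[OF m0 c(1)]]
      by (rule \<xi>D(2)[OF c(1) c(1)])
  qed
  then obtain h where h: "linear h" "\<And>c. c \<in> core m0 \<Longrightarrow> h (\<Psi> c) = \<xi> c" using tau by force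
  define f where "f d = h (\<Psi> d)" for d
  have f: "msmooth_on (over (DA D) W) (tot_atlas (DB D)) vs_atlas f"
    unfolding f_def atlases
    by (rule msmooth_vs_linear[OF compat(4) vector_bundleD(1)[OF vbs(3)] finite_dim_real h(1) triv_smooth[OF Tr]])
  have fA: "f (addA x y) = f x + f y" if "x \<in> T" "y \<in> T" "qA x = qA y" "qA x \<in> W" for x y
    unfolding f_def triv_add[OF Tr that(1,2,4) that(3)[symmetric]] by (rule linear_add[OF h(1)])
  have fS: "f (sclA r x) = r * f x" if "x \<in> T" "qA x \<in> W" for x r
    unfolding f_def triv_scl[OF Tr that] linear_cmul[OF h(1)] by simp
  define U where "U = {m \<in> points (M_atlas D). nA m \<in> W}"
  have nA: "msmooth_on (points (M_atlas D)) (M_atlas D) (tot_atlas (sideA D)) nA"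
    using structure_maps_linearD(2)[OF structB] unfolding vb_morphism_def by (simp add: tots atlases)
  have oW: "mopen (tot_atlas (sideA D)) W" using triv_mopen[OF Tr] atlases by simp
  have U: "mopen (M_atlas D) U" "m0 \<in> U"
    unfolding U_def using msmooth_on_preimage[OF compat(1,2) nA oW] m0 W by auto
  let ?N = "{b \<in> tot (sideB D). pB b \<in> U}"
  have N: "mopen (base_atlas (DB D)) ?N"
    using vb_mopen_over[OF vbs(2), of U] U(1) unfolding over_def by (simp add: atlases)
  have "fzero (DB D) b \<in> over (DA D) W" if "b \<in> ?N" for b
    using that closedB(5) zero_proj(2)[of b] unfolding over_def U_def by simp
  from vb_fibre_derivative[OF vbs(4) f N this]
  obtain L where L: "msmooth_on (over (DB D) ?N) (tot_atlas (DB D)) vs_atlas L"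
    "\<And>x. x\<in>over (DB D) ?N \<Longrightarrow> ((\<lambda>t. f (sclB t x)) has_real_derivative L x) (at 0)"
    "\<And>b. b\<in>?N \<Longrightarrow> linear_map (fibre (DB D) b) type_vs L" by auto
  have LD: "((\<lambda>t. f (sclB t x)) has_real_derivative L x) (at 0)" if "x \<in> T" "pA (qA x) \<in> U" for x
    using L(2)[of x] that square[of x] projT[of x] unfolding over_def by (simp add: tots)
  \<comment> \<open>For small \<open>t\<close> the point \<open>t \<cdot> a\<close> lies in \<open>W\<close>, where \<open>f\<close> is defined.\<close>
  have near: "\<exists>S. open S \<and> 0 \<in> S \<and> (\<forall>t\<in>S. fscl (sideA D) t a \<in> W)" if a: "a \<in> tot (sideA D)" "pA a \<in> U" for a
  proof -
    have "mopen vs_atlas {t \<in> UNIV. fscl (sideA D) t a \<in> W}"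
      by (rule msmooth_on_preimage[OF compat_real compat(2) vb_curve_smooth[OF vbs(1) a(1)] oW])
    moreover have "fscl (sideA D) 0 a \<in> W"
      using real_vs_scl_0[OF vector_bundleD(7)[OF vbs(1)], of "pA a" a] a side_base tots unfolding U_def by (simp add: fibre_simps)
    ultimately show ?thesis by (intro exI[of _ "{t. fscl (sideA D) t a \<in> W}"]) auto
  qed
  have dl: "double_linear D m L" if m: "m \<in> U" for m
  proof (rule double_linearI)
    fix x assume x: "x \<in> T" "pA (qA x) = m"
    have b: "qB x \<in> ?N" using x m square[of x] projT[of x] by simp
    obtain S where S: "open S" "0 \<in> S" "\<And>t. t \<in> S \<Longrightarrow> fscl (sideA D) t (qA x) \<in> W"
      using near[of "qA x"] projT[of x] x m by blast
    have qS: "qA (sclB t x) \<in> W" if "t \<in> S" for t using S(3)[OF that] proj_linear(2)[of x t] x by simp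
    note lin = linear_mapD[OF L(3)[OF b], unfolded fibre_simps type_vs_simps tots]
    show "L (sclB r x) = r * L x" for r using lin(3)[of x r] x by simp
    show "L (addB x y) = L x + L y" if "y \<in> T" "qB x = qB y" for y using lin(2)[of x y] x that by simp
    show "L (addA x y) = L x + L y" if y: "y \<in> T" "qA x = qA y" for y
    proof -
      have "((\<lambda>t. f (sclB t x) + f (sclB t y)) has_real_derivative L x + L y) (at 0)"
        using LD[of x] LD[of y] x y m by (intro DERIV_add) auto
      then have "((\<lambda>t. f (sclB t (addA x y))) has_real_derivative L x + L y) (at 0)"
      proof (rule has_field_derivative_transform_within_open[OF _ S(1,2)])
        fix t assume t: "t \<in> S"
        have "f (sclB t (addA x y)) = f (addA (sclB t x) (sclB t y))"
          using scl_interchange(1)[of x y t] x y by simp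
        also have "\<dots> = f (sclB t x) + f (sclB t y)"
          using fA[of "sclB t x" "sclB t y"] closedB(3)[of x t] closedB(3)[of y t] qS[OF t] proj_linear(2)[of x t]
            proj_linear(2)[of y t] x y by simp
        finally show "f (sclB t x) + f (sclB t y) = f (sclB t (addA x y))" by simp
      qed
      moreover have "((\<lambda>t. f (sclB t (addA x y))) has_real_derivative L (addA x y)) (at 0)"
        using LD[of "addA x y"] closedA(1,2)[of x y] x y m by simp
      ultimately show ?thesis by (rule DERIV_unique[symmetric])
    qed
    show "L (sclA r x) = r * L x" for r
    proof -
      have "((\<lambda>t. r * f (sclB t x)) has_real_derivative r * L x) (at 0)"
        using LD[of x] x m by (intro DERIV_cmult) auto
      then have "((\<lambda>t. f (sclB t (sclA r x))) has_real_derivative r * L x) (at 0)"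
      proof (rule has_field_derivative_transform_within_open[OF _ S(1,2)])
        fix t assume t: "t \<in> S"
        show "r * f (sclB t x) = f (sclB t (sclA r x))"
          using scl_interchange(2)[of x t r] fS[of "sclB t x" r] closedB(3)[of x t] qS[OF t] x by simp
      qed
      moreover have "((\<lambda>t. f (sclB t (sclA r x))) has_real_derivative L (sclA r x)) (at 0)"
        using LD[of "sclA r x"] closedA(3,4)[of x r] x m by simp
      ultimately show ?thesis by (rule DERIV_unique[symmetric])
    qed
  qed
  have "L c = \<xi> c" if c: "c \<in> core m0" for c
  proof -
    have der: "((\<lambda>t. f (sclB t c)) has_real_derivative L c) (at 0)"
      using LD[of c] cT[OF c] zero_side(3)[OF m0] U(2) by simp
    have add: "f (sclB (s + t) c) = f (sclB s c) + f (sclB t c)" for s t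
    proof -
      have cs: "sclB s c \<in> core m0" "sclB t c \<in> core m0" using core_closed(3)[OF m0 c] by auto
      have "sclB (s + t) c = addA (sclB s c) (sclB t c)"
        using scl_addB[of c s t] core_add_eq[OF m0 cs] cT[OF c] by simp
      moreover have "qA (sclB s c) = qA (sclB t c)" "qA (sclB s c) \<in> W"
        using cT(2)[OF cs(1)] cT(2)[OF cs(2)] W by auto
      ultimately show ?thesis using fA[OF cT(1)[OF cs(1)] cT(1)[OF cs(2)]] by simp
    qed
    have "f (sclB 1 c) = L c"
      by (rule additive_derivative_eq[of "\<lambda>t. f (sclB t c)" "L c", OF add der])
    then show ?thesis using scl_one(2)[of c] cT[OF c] h(2)[OF c] unfolding f_def by simp
  qed
  moreover have "msmooth_on (D_over D U) (D_atlas D) vs_atlas L"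
    using L(1) unfolding D_over_alt atlases .
  ultimately show ?thesis using U dl by (intro exI[of _ U] exI[of _ L]) blast
qed

subsection \<open>Elements of the double vector bundle with given projections\<close>

text \<open>Subtracting a zero moves an element over \<open>(a, 0)\<close> to the core without changing the values of
  double-linear functions.\<close>

lemma kernel_core:
  assumes d: "d \<in> T" "qB d = nB (pA (qA d))"
  defines "e \<equiv> addB d (sclB (- 1) (zA (qA d)))"
  shows "e \<in> core (pA (qA d))" "d = addB e (zA (qA d))"
    "double_linear D (pA (qA d)) \<sigma> \<Longrightarrow> \<sigma> e = \<sigma> d"
proof -
  let ?m = "pA (qA d)" and ?z = "zA (qA d)"
  have a: "qA d \<in> tot (sideA D)" using projT d by blast
  have m: "?m \<in> points (M_atlas D)" using side_base(1)[OF a] .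
  have z: "?z \<in> T" "qA ?z = qA d" "qB ?z = nB ?m" using closedA(5,6)[OF a] zero_proj(1)[OF a] by auto
  have z': "sclB (- 1) ?z \<in> T" "qB (sclB (- 1) ?z) = nB ?m" using closedB(3,4)[OF z(1), of "-1"] z by auto
  have e: "e \<in> T" "qB e = nB ?m" unfolding e_def using closedB(1,2)[OF d(1) z'(1)] d z' by auto
  have "qA e = fadd (sideA D) (qA d) (fscl (sideA D) (- 1) (qA d))"
    unfolding e_def using proj_linear(1)[OF d(1) z'(1)] proj_linear(2)[OF z(1), of "-1"] d z z' by simp
  also have "\<dots> = nA ?m"
    using real_vs_minus[OF vector_bundleD(7)[OF vbs(1)], of ?m "qA d"] a m tots by (simp add: fibre_simps)
  finally show "e \<in> core ?m" using e unfolding core_def by simp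
  have "addB e ?z = addB d (addB (sclB (- 1) ?z) ?z)"
    unfolding e_def by (rule add_assocB) (use d z z' in auto)
  also have "\<dots> = addB d (zB (qB d))" using minus_add[OF z(1)] z d by simp
  also have "\<dots> = d" using add_zero(2)[OF d(1)] .
  finally show "d = addB e ?z" by simp
  assume \<sigma>: "double_linear D ?m \<sigma>"
  show "\<sigma> e = \<sigma> d"
    unfolding e_def using double_linearD(2)[OF \<sigma> d(1) refl z'(1)] double_linearD(4)[OF \<sigma> z(1), of "-1"]
      double_linear_zero[OF \<sigma> a refl] d z z' by simp
qed

text \<open>If \<open>d\<close> and \<open>d'\<close> have the same projections, their difference lies over \<open>(a, 0)\<close>.\<close>

lemma double_linear_determined:
  assumes \<sigma>: "double_linear D m \<sigma>" and core: "\<And>c. c \<in> core m \<Longrightarrow> \<sigma> c = 0"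
    and d: "d \<in> T" "pA (qA d) = m" "d' \<in> T" "qA d' = qA d" "qB d' = qB d"
  shows "\<sigma> d = \<sigma> d'"
proof -
  let ?e = "addA d (sclA (- 1) d')"
  have s: "sclA (- 1) d' \<in> T" "qA (sclA (- 1) d') = qA d" using closedA(3,4)[OF d(3), of "-1"] d by auto
  have e: "?e \<in> T" "qA ?e = qA d" using closedA(1,2)[OF d(1) s(1)] s by auto
  have b: "qB d \<in> tot (sideB D)" "pB (qB d) = m" using projT(2)[OF d(1)] square[OF d(1)] d by auto
  then have m: "m \<in> base (sideB D)" using side_base(2)[OF b(1)] tots by simp
  have "qB ?e = fadd (sideB D) (qB d) (fscl (sideB D) (- 1) (qB d))"
    using proj_linear(3)[OF d(1) s(1)] proj_linear(4)[OF d(3), of "-1"] s d by simp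
  also have "\<dots> = nB m"
    using real_vs_minus[OF vector_bundleD(7)[OF vbs(2) m], of "qB d"] b by (simp add: fibre_simps)
  finally have qe: "qB ?e = nB m" .
  have pm: "pA (qA ?e) = m" using e d by simp
  have qe': "qB ?e = nB (pA (qA ?e))" using qe pm by simp
  have "\<sigma> ?e = 0"
    using core[OF kernel_core(1)[OF e(1) qe', unfolded pm]] kernel_core(3)[OF e(1) qe', unfolded pm, OF \<sigma>] by simp
  then show ?thesis
    using double_linearD(1)[OF \<sigma> d(1,2) s(1)] double_linearD(3)[OF \<sigma> d(3), of "-1"] s d by simp
qed

text \<open>A double vector bundle splits at every point \<open>m\<close> of the base: there are smooth double-linear
  functions \<open>L c\<close> whose restrictions to the core at \<open>m\<close> are a basis of its dual, with dual basis
  \<open>cc c\<close>, and over every pair \<open>(a, b)\<close> there is an element \<open>dd a b\<close> on which all \<open>L c\<close> vanish.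

  The zero section of \<open>D \<rightarrow> B\<close> splits the fibre of \<open>D \<rightarrow> A\<close> over \<open>0\<close> into the core and \<open>B\<close>, which gives
  the rank of the core. On the fibre of \<open>D \<rightarrow> A\<close> over \<open>a\<close>, \<open>q\<^sub>B\<close> and the \<open>L c\<close> together are injective
  by \<open>kernel_core\<close>; since all these fibres have the same dimension, they are also surjective, and this
  provides \<open>dd a b\<close>.\<close>

lemma fibre_splitting:
  assumes m: "m \<in> points (M_atlas D)" and BB: "coord_basis (BB :: 'fb set) crdB"
  shows "\<exists>U (\<Psi>A :: 'a \<Rightarrow> 'fa) \<tau>A (\<Psi>B :: 'b \<Rightarrow> 'fb) \<tau>B (C :: 'fda set) L cc dd.
    m \<in> U \<and> local_triv (sideA D) U \<Psi>A \<tau>A \<and> local_triv (sideB D) U \<Psi>B \<tau>B \<and>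
    finite C \<and> card C + card BB = dim (UNIV :: 'fda set) \<and>
    (\<forall>c\<in>C. msmooth_on (D_over D U) (D_atlas D) vs_atlas (L c) \<and> (\<forall>m'\<in>U. double_linear D m' (L c)) \<and> cc c \<in> core m) \<and>
    (\<forall>c\<in>C. \<forall>c'\<in>C. L c (cc c') = (if c = c' then 1 else 0)) \<and>
    (\<forall>x\<in>core m. \<forall>\<sigma>. double_linear D m \<sigma> \<longrightarrow> \<sigma> x = (\<Sum>c\<in>C. L c x * \<sigma> (cc c))) \<and>
    (\<forall>a b. a \<in> tot (sideA D) \<and> b \<in> tot (sideB D) \<and> pA a = m \<and> pB b = m \<longrightarrow>
      dd a b \<in> T \<and> qA (dd a b) = a \<and> qB (dd a b) = b \<and> (\<forall>c\<in>C. L c (dd a b) = 0))"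
proof -
  obtain UA and \<Psi>A :: "'a \<Rightarrow> 'fa" and \<tau>A where UA: "m \<in> UA" and TA: "local_triv (sideA D) UA \<Psi>A \<tau>A"
    using vb_local_triv[OF vbs(1)] m tots by metis
  obtain UB and \<Psi>B :: "'b \<Rightarrow> 'fb" and \<tau>B where UB: "m \<in> UB" and TB: "local_triv (sideB D) UB \<Psi>B \<tau>B"
    using vb_local_triv[OF vbs(2)] m tots by metis
  have n0: "nA m \<in> base (DA D)" using zero_side(1)[OF m] tots by simp
  obtain W and \<Psi> :: "'d \<Rightarrow> 'fda" and \<tau> where W: "nA m \<in> W" and Tr: "local_triv (DA D) W \<Psi> \<tau>"
    using vb_local_triv[OF vbs(3) n0] by blast
  note zs = zero_side[OF m]
  note t = triv_tau[OF Tr W]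
  note tB = triv_tau[OF TB UB]
  note t_lin = triv_tau_linear[OF vbs(3) Tr W]
  have zero: "\<Psi>B (nB m) = 0" using vb_zero_tau[OF vbs(2) TB UB] tB by simp
  have zeroB: "b = nB m" if "b \<in> tot (sideB D)" "pB b = m" "\<Psi>B b = 0" for b
    using triv_inj[OF TB that(1) zs(2)] that zs zero UB by simp
  \<comment> \<open>In coordinates: \<open>q\<^sub>B\<close> on the fibre of \<open>D \<rightarrow> A\<close> over \<open>0\<close>, and its right inverse, the zero section
    of \<open>D \<rightarrow> B\<close>.\<close>
  define Lm where "Lm v = \<Psi>B (qB (\<tau> (nA m) v))" for v
  define Zm where "Zm w = \<Psi> (zB (\<tau>B m w))" for w
  have pq: "pB (qB (\<tau> (nA m) v)) = m" for v using square[OF t(1)] t(2) zs by simp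
  have Lm: "linear Lm"
  proof (rule linearI)
    fix v w r
    show "Lm (v + w) = Lm v + Lm w"
      unfolding Lm_def t_lin using proj_linear(3)[OF t(1) t(1), of v w] t(2) pq projT(2)[OF t(1)] UB
        triv_add[OF TB projT(2)[OF t(1)] projT(2)[OF t(1)], of v w] by simp
    show "Lm (r *\<^sub>R v) = r *\<^sub>R Lm v"
      unfolding Lm_def t_lin using proj_linear(4)[OF t(1), of r v] pq UB
        triv_scl[OF TB projT(2)[OF t(1)], of v r] by simp
  qed
  have zq: "zB (\<tau>B m w) \<in> T" "qA (zB (\<tau>B m w)) = nA m" for w
    using closedB(5)[OF tB(1)] zero_proj(2)[OF tB(1)] tB(2) by auto
  have Zm: "linear Zm"
  proof (rule linearI)
    fix v w r
    show "Zm (v + w) = Zm v + Zm w"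
      unfolding Zm_def triv_tau_linear[OF vbs(2) TB UB]
      using zero_linear(3)[OF tB(1) tB(1), of w v] tB(2) triv_add[OF Tr zq(1) zq(1), of v w] zq(2) W by simp
    show "Zm (r *\<^sub>R v) = r *\<^sub>R Zm v"
      unfolding Zm_def triv_tau_linear[OF vbs(2) TB UB]
      using zero_linear(4)[OF tB(1), of r v] triv_scl[OF Tr zq(1), of v r] zq(2) W by simp
  qed
  have tz: "\<tau> (nA m) (Zm w) = zB (\<tau>B m w)" for w
    using triv_inv[OF Tr zq(1), of w] zq(2) W unfolding Zm_def by simp
  have LZ: "Lm (Zm w) = w" for w
    unfolding Lm_def tz using closedB(6)[OF tB(1)] tB(3) by simp
  obtain C \<epsilon> where C: "finite C" "card C + card BB = dim (UNIV :: 'fda set)"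
    "\<And>c. c \<in> C \<Longrightarrow> Lm c = 0" "\<And>c. c \<in> C \<Longrightarrow> linear (\<epsilon> c)"
    "\<And>c c'. c \<in> C \<Longrightarrow> c' \<in> C \<Longrightarrow> \<epsilon> c c' = (if c = c' then 1 else (0::real))"
    "\<And>v. Lm v = 0 \<Longrightarrow> v = (\<Sum>c\<in>C. \<epsilon> c v *\<^sub>R c)"
    using kernel_dual_basis[OF vector_bundleD(1)[OF vbs(3)] BB Lm Zm LZ] by (elim exE conjE) blast
  define cc where "cc c = \<tau> (nA m) c" for c
  have cc: "cc c \<in> core m" "\<Psi> (cc c) = c" if "c \<in> C" for c
    using zeroB[OF projT(2)[OF t(1)] pq, of c] C(3)[OF that] t unfolding core_def cc_def Lm_def by auto
  have coreD: "x \<in> T" "qA x = nA m" "qB x = nB m" "\<tau> (nA m) (\<Psi> x) = x" if "x \<in> core m" for x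
    using that triv_inv[OF Tr, of x] W unfolding core_def by auto
  have "\<exists>U L. mopen (M_atlas D) U \<and> m \<in> U \<and> msmooth_on (D_over D U) (D_atlas D) vs_atlas L \<and>
    (\<forall>m\<in>U. double_linear D m L) \<and> (\<forall>x\<in>core m. L x = \<epsilon> c (\<Psi> x))" if c: "c \<in> C" for c
  proof (rule core_extension[OF m])
    show "linear_map (core_fib D m) type_vs (\<lambda>x. \<epsilon> c (\<Psi> x))"
      unfolding linear_map_def core_fib_simps type_vs_simps
      using triv_add[OF Tr] triv_scl[OF Tr] coreD(1,2) W linear_add[OF C(4)[OF c]] linear_cmul[OF C(4)[OF c]] by simp
  qed
  then have "\<forall>c\<in>C. \<exists>U L. mopen (M_atlas D) U \<and> m \<in> U \<and> msmooth_on (D_over D U) (D_atlas D) vs_atlas L \<and>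
    (\<forall>m\<in>U. double_linear D m L) \<and> (\<forall>x\<in>core m. L x = \<epsilon> c (\<Psi> x))" by blast
  from bchoice[OF this] obtain Uc where "\<forall>c\<in>C. \<exists>L. mopen (M_atlas D) (Uc c) \<and> m \<in> Uc c \<and>
    msmooth_on (D_over D (Uc c)) (D_atlas D) vs_atlas L \<and>
    (\<forall>m\<in>Uc c. double_linear D m L) \<and> (\<forall>x\<in>core m. L x = \<epsilon> c (\<Psi> x))" by (elim exE)
  from bchoice[OF this] obtain L where "\<forall>c\<in>C. mopen (M_atlas D) (Uc c) \<and> m \<in> Uc c \<and>
    msmooth_on (D_over D (Uc c)) (D_atlas D) vs_atlas (L c) \<and>
    (\<forall>m\<in>Uc c. double_linear D m (L c)) \<and> (\<forall>x\<in>core m. L c x = \<epsilon> c (\<Psi> x))" by (elim exE)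
  then have L: "\<And>c. c \<in> C \<Longrightarrow> mopen (M_atlas D) (Uc c)" "\<And>c. c \<in> C \<Longrightarrow> m \<in> Uc c"
    "\<And>c. c \<in> C \<Longrightarrow> msmooth_on (D_over D (Uc c)) (D_atlas D) vs_atlas (L c)"
    "\<And>c m'. c \<in> C \<Longrightarrow> m' \<in> Uc c \<Longrightarrow> double_linear D m' (L c)"
    "\<And>c x. c \<in> C \<Longrightarrow> x \<in> core m \<Longrightarrow> L c x = \<epsilon> c (\<Psi> x)" by blast+
  define U where "U = (UA \<inter> UB) \<inter> (\<Inter>c\<in>C. Uc c)"
  have oAB: "mopen (M_atlas D) (UA \<inter> UB)"
    using mopen_Int[OF compat(1)] triv_mopen[OF TA] triv_mopen[OF TB] atlases by simp
  have oU: "mopen (M_atlas D) U" unfolding U_def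
    by (rule mopen_finite_Inter[OF compat(1) C(1) L(1) oAB])
  have mU: "m \<in> U" using UA UB L(2) unfolding U_def by auto
  have Lm_dl: "double_linear D m (L c)" if "c \<in> C" for c using L(2,4) that by blast
  have LU: "msmooth_on (D_over D U) (D_atlas D) vs_atlas (L c)" if "c \<in> C" for c
    by (rule msmooth_on_subset[OF compat(4) L(3)[OF that] mopen_D_over[OF oU]])
      (use that in \<open>auto simp: mem_D_over U_def\<close>)
  have TA': "local_triv (sideA D) U \<Psi>A \<tau>A" and TB': "local_triv (sideB D) U \<Psi>B \<tau>B"
    by (rule local_triv_subset[OF vbs(1) TA], use oU in \<open>auto simp: U_def\<close>)
      (rule local_triv_subset[OF vbs(2) TB], use oU atlases in \<open>auto simp: U_def\<close>)
  have exp: "\<sigma> x = (\<Sum>c\<in>C. L c x * \<sigma> (cc c))" if x: "x \<in> core m" and \<sigma>: "double_linear D m \<sigma>" for x \<sigma>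
  proof -
    have l: "linear (\<lambda>v. \<sigma> (\<tau> (nA m) v))"
    proof (rule linearI)
      fix v w :: 'fda and r :: real
      show "\<sigma> (\<tau> (nA m) (v + w)) = \<sigma> (\<tau> (nA m) v) + \<sigma> (\<tau> (nA m) w)"
        unfolding t_lin using double_linearD(1)[OF \<sigma> t(1) _ t(1), of v w] t(2) zs by simp
      show "\<sigma> (\<tau> (nA m) (r *\<^sub>R v)) = r *\<^sub>R \<sigma> (\<tau> (nA m) v)"
        unfolding t_lin using double_linearD(3)[OF \<sigma> t(1), of v r] t(2) zs by simp
    qed
    have "Lm (\<Psi> x) = 0" unfolding Lm_def coreD(4)[OF x] coreD(3)[OF x] by (rule zero)
    then have v: "\<Psi> x = (\<Sum>c\<in>C. \<epsilon> c (\<Psi> x) *\<^sub>R c)" by (rule C(6))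
    have "\<sigma> x = \<sigma> (\<tau> (nA m) (\<Psi> x))" using coreD(4)[OF x] by simp
    also have "\<dots> = \<sigma> (\<tau> (nA m) (\<Sum>c\<in>C. \<epsilon> c (\<Psi> x) *\<^sub>R c))" by (rule arg_cong[OF v])
    also have "\<dots> = (\<Sum>c\<in>C. \<epsilon> c (\<Psi> x) *\<^sub>R \<sigma> (\<tau> (nA m) c))"
      unfolding linear_sum[OF l] linear_cmul[OF l] by (rule refl)
    also have "\<dots> = (\<Sum>c\<in>C. L c x * \<sigma> (cc c))" using L(5) x by (simp add: cc_def)
    finally show ?thesis .
  qed
  have delta: "L c (cc c') = (if c = c' then 1 else 0)" if "c \<in> C" "c' \<in> C" for c c'
    using L(5)[OF that(1) cc(1)[OF that(2)]] cc(2)[OF that(2)] C(5)[OF that] by simp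
  have lift: "\<exists>d. d \<in> T \<and> qA d = a \<and> qB d = b \<and> (\<forall>c\<in>C. L c d = 0)"
    if ab: "a \<in> tot (sideA D)" "b \<in> tot (sideB D)" "pA a = m" "pB b = m" for a b
  proof -
    obtain W' and \<Psi>' :: "'d \<Rightarrow> 'fda" and \<tau>' where W': "a \<in> W'" and Tr': "local_triv (DA D) W' \<Psi>' \<tau>'"
      using vb_local_triv[OF vbs(3)] ab tots by metis
    note t' = triv_tau[OF Tr' W']
    note t'_lin = triv_tau_linear[OF vbs(3) Tr' W']
    have pq': "pB (qB (\<tau>' a v)) = m" for v using square[OF t'(1)] t'(2) ab by simp
    define F where "F v = \<Psi>B (qB (\<tau>' a v))" for v
    have F: "linear F"
    proof (rule linearI)
      fix v w r
      show "F (v + w) = F v + F w"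
        unfolding F_def t'_lin using proj_linear(3)[OF t'(1) t'(1), of v w] t'(2) pq' projT(2)[OF t'(1)] UB
          triv_add[OF TB projT(2)[OF t'(1)] projT(2)[OF t'(1)], of v w] by simp
      show "F (r *\<^sub>R v) = r *\<^sub>R F v"
        unfolding F_def t'_lin using proj_linear(4)[OF t'(1), of r v] pq' UB
          triv_scl[OF TB projT(2)[OF t'(1)], of v r] by simp
    qed
    have lL: "linear (\<lambda>v. L c (\<tau>' a v))" if c: "c \<in> C" for c
    proof (rule linearI)
      fix v w :: 'fda and r :: real
      show "L c (\<tau>' a (v + w)) = L c (\<tau>' a v) + L c (\<tau>' a w)"
        unfolding t'_lin using double_linearD(1)[OF Lm_dl[OF c] t'(1) _ t'(1), of v w] t'(2) ab by simp
      show "L c (\<tau>' a (r *\<^sub>R v)) = r *\<^sub>R L c (\<tau>' a v)"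
        unfolding t'_lin using double_linearD(3)[OF Lm_dl[OF c] t'(1), of v r] t'(2) ab by simp
    qed
    \<comment> \<open>\<open>q\<^sub>B\<close> and the \<open>L c\<close> on the fibre over \<open>a\<close>, followed by the isomorphism of their target with the
      fibre over \<open>0\<close>: an endomorphism of the typical fibre.\<close>
    define G where "G v = Zm (F v) + (\<Sum>c\<in>C. L c (\<tau>' a v) *\<^sub>R c)" for v
    have G: "linear G"
      unfolding G_def
    proof (rule linearI)
      fix v w r
      show "Zm (F (v + w)) + (\<Sum>c\<in>C. L c (\<tau>' a (v + w)) *\<^sub>R c) =
        Zm (F v) + (\<Sum>c\<in>C. L c (\<tau>' a v) *\<^sub>R c) + (Zm (F w) + (\<Sum>c\<in>C. L c (\<tau>' a w) *\<^sub>R c))"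
        using linear_add[OF lL] by (simp add: linear_add[OF F] linear_add[OF Zm] scaleR_left_distrib sum.distrib)
      show "Zm (F (r *\<^sub>R v)) + (\<Sum>c\<in>C. L c (\<tau>' a (r *\<^sub>R v)) *\<^sub>R c) =
        r *\<^sub>R (Zm (F v) + (\<Sum>c\<in>C. L c (\<tau>' a v) *\<^sub>R c))"
        using linear_cmul[OF lL] by (simp add: linear_cmul[OF F] linear_cmul[OF Zm] scaleR_right_distrib scaleR_sum_right)
    qed
    have sumL: "Lm (\<Sum>c\<in>C. x c *\<^sub>R c) = 0" for x
      unfolding linear_sum[OF Lm] linear_cmul[OF Lm] using C(3) by simp
    have LmG: "Lm (G v) = F v" for v unfolding G_def linear_add[OF Lm] LZ sumL by simp
    have coeff: "x c = 0" if "(\<Sum>c\<in>C. x c *\<^sub>R c) = 0" "c \<in> C" for x c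
    proof -
      have "0 = \<epsilon> c (\<Sum>c\<in>C. x c *\<^sub>R c)" using that linear_0[OF C(4)[OF that(2)]] by simp
      also have "\<dots> = (\<Sum>c'\<in>C. x c' *\<^sub>R \<epsilon> c c')"
        unfolding linear_sum[OF C(4)[OF that(2)]] linear_cmul[OF C(4)[OF that(2)]] by (rule refl)
      also have "\<dots> = (\<Sum>c'\<in>C. if c = c' then x c' else 0)" using C(5)[OF that(2)] by (intro sum.cong) auto
      also have "\<dots> = x c" using C(1) that(2) by simp
      finally show ?thesis by simp
    qed
    have GL: "L c (\<tau>' a v) = 0" if "G v = Zm (F v)" "c \<in> C" for v c
      using coeff[of "\<lambda>c. L c (\<tau>' a v)", OF _ that(2)] that(1) unfolding G_def by simp
    have inj: "v = 0" if v: "G v = 0" for v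
    proof -
      let ?d = "\<tau>' a v"
      have Fv: "F v = 0" using LmG[of v] v linear_0[OF Lm] by simp
      then have Ld: "L c ?d = 0" if "c \<in> C" for c using GL[of v c] v linear_0[OF Zm] that by simp
      have qd: "qB ?d = nB (pA (qA ?d))"
        using zeroB[OF projT(2)[OF t'(1)] pq'] Fv t'(2) ab unfolding F_def by simp
      have pm: "pA (qA ?d) = m" using t'(2) ab by simp
      define e where "e = addB ?d (sclB (- 1) (zA (qA ?d)))"
      have e: "e \<in> core m" "?d = addB e (zA (qA ?d))" using kernel_core(1,2)[OF t'(1) qd] pm unfolding e_def by auto
      have Le: "L c e = 0" if "c \<in> C" for c
        using kernel_core(3)[OF t'(1) qd, of "L c"] Lm_dl[OF that] Ld[OF that] pm unfolding e_def by simp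
      have "Lm (\<Psi> e) = 0" unfolding Lm_def coreD(4)[OF e(1)] coreD(3)[OF e(1)] by (rule zero)
      then have "\<Psi> e = (\<Sum>c\<in>C. \<epsilon> c (\<Psi> e) *\<^sub>R c)" by (rule C(6))
      also have "\<dots> = 0" using L(5) Le e(1) by simp
      finally have "\<Psi> e = 0" .
      then have "e = zA (nA m)" using coreD(4)[OF e(1)] vb_zero_tau[OF vbs(3) Tr W] by simp
      then have "e = zB (qB (zA (qA ?d)))"
        using double_zero[OF m] zero_proj(1)[OF ab(1)] t'(2) ab by simp
      then have "?d = zA a" using e(2) zero_add(2)[OF closedA(5)[OF ab(1)]] t'(2) by simp
      then show ?thesis using vb_zero_tau[OF vbs(3) Tr' W'] t'(3)[of v] t'(3)[of 0] by simp
    qed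
    obtain v where v: "G v = Zm (\<Psi>B b)"
      using finite_dim_injective_imp_surjective[OF vector_bundleD(1)[OF vbs(3)] G inj] by blast
    have Fv: "F v = \<Psi>B b" using LmG[of v] v LZ by simp
    have "qB (\<tau>' a v) = b"
      using triv_inj[OF TB projT(2)[OF t'(1)] ab(2)] pq' ab UB Fv unfolding F_def by simp
    moreover have "L c (\<tau>' a v) = 0" if "c \<in> C" for c using GL[of v c] v Fv that by simp
    ultimately show ?thesis using t' by blast
  qed
  define dd where "dd a b = (SOME d. d \<in> T \<and> qA d = a \<and> qB d = b \<and> (\<forall>c\<in>C. L c d = 0))" for a b
  have dd: "dd a b \<in> T \<and> qA (dd a b) = a \<and> qB (dd a b) = b \<and> (\<forall>c\<in>C. L c (dd a b) = 0)"
    if "a \<in> tot (sideA D) \<and> b \<in> tot (sideB D) \<and> pA a = m \<and> pB b = m" for a b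
    unfolding dd_def by (rule someI_ex[OF lift]) (use that in auto)
  have LU': "\<forall>c\<in>C. msmooth_on (D_over D U) (D_atlas D) vs_atlas (L c) \<and> (\<forall>m'\<in>U. double_linear D m' (L c)) \<and> cc c \<in> core m"
    using LU L(4) cc(1) unfolding U_def by blast
  have delta': "\<forall>c\<in>C. \<forall>c'\<in>C. L c (cc c') = (if c = c' then 1 else 0)" using delta by blast
  have exp': "\<forall>x\<in>core m. \<forall>\<sigma>. double_linear D m \<sigma> \<longrightarrow> \<sigma> x = (\<Sum>c\<in>C. L c x * \<sigma> (cc c))" using exp by blast
  have dd': "\<forall>a b. a \<in> tot (sideA D) \<and> b \<in> tot (sideB D) \<and> pA a = m \<and> pB b = m \<longrightarrow>
      dd a b \<in> T \<and> qA (dd a b) = a \<and> qB (dd a b) = b \<and> (\<forall>c\<in>C. L c (dd a b) = 0)" using dd by blast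
  show ?thesis
    by (rule exI[of _ U], rule exI[of _ \<Psi>A], rule exI[of _ \<tau>A], rule exI[of _ \<Psi>B], rule exI[of _ \<tau>B],
        rule exI[of _ C], rule exI[of _ L], rule exI[of _ cc], rule exI[of _ dd])
      (intro conjI mU TA' TB' C(1,2) LU' delta' exp' dd')
qed

text \<open>A double-linear function that vanishes on the core is a bilinear form in the two projections.\<close>

lemma double_linear_bilinear:
  assumes \<sigma>: "double_linear D m \<sigma>" and core: "\<And>c. c \<in> core m \<Longrightarrow> \<sigma> c = 0" and m: "m \<in> U"
    and TA: "local_triv (sideA D) U (\<Psi>A :: 'a \<Rightarrow> 'fa) \<tau>A" and TB: "local_triv (sideB D) U (\<Psi>B :: 'b \<Rightarrow> 'fb) \<tau>B"
    and BA: "coord_basis BA crdA" and BB: "coord_basis BB crdB"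
    and dd: "\<And>a b. a \<in> tot (sideA D) \<Longrightarrow> b \<in> tot (sideB D) \<Longrightarrow> pA a = m \<Longrightarrow> pB b = m \<Longrightarrow>
      dd a b \<in> T \<and> qA (dd a b) = a \<and> qB (dd a b) = b"
    and d: "d \<in> slice D m"
  shows "\<sigma> d = (\<Sum>i\<in>BA. \<Sum>j\<in>BB. crdA i (\<Psi>A (qA d)) * crdB j (\<Psi>B (qB d)) * \<sigma> (dd (\<tau>A m i) (\<tau>B m j)))"
proof -
  note tA = triv_tau[OF TA m] and tB = triv_tau[OF TB m]
  let ?d = "\<lambda>x y. dd (\<tau>A m x) (\<tau>B m y)"
  have D: "?d x y \<in> T" "qA (?d x y) = \<tau>A m x" "qB (?d x y) = \<tau>B m y" for x y
    using dd[OF tA(1) tB(1) tA(2) tB(2)] by auto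
  have pm: "pA (qA (?d x y)) = m" for x y using D tA by simp
  have l1: "linear (\<lambda>x. \<sigma> (?d x y))" for y
  proof (rule linearI)
    fix x x' r
    have e: "addB (?d x y) (?d x' y) \<in> T" "qB (addB (?d x y) (?d x' y)) = \<tau>B m y"
      using closedB(1,2)[OF D(1) D(1)] D(3) by auto
    have "\<sigma> (?d (x + x') y) = \<sigma> (addB (?d x y) (?d x' y))"
      by (rule double_linear_determined[OF \<sigma> core D(1) pm e(1)])
        (use e D(2,3) proj_linear(1)[OF D(1) D(1)] triv_tau_linear(1)[OF vbs(1) TA m, symmetric] in auto)
    then show "\<sigma> (?d (x + x') y) = \<sigma> (?d x y) + \<sigma> (?d x' y)"
      using double_linearD(2)[OF \<sigma> D(1) pm D(1)] D(3) by simp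
    have e: "sclB r (?d x y) \<in> T" "qB (sclB r (?d x y)) = \<tau>B m y"
      using closedB(3,4)[OF D(1)] D(3) by auto
    have "\<sigma> (?d (r *\<^sub>R x) y) = \<sigma> (sclB r (?d x y))"
      by (rule double_linear_determined[OF \<sigma> core D(1) pm e(1)])
        (use e D(2,3) proj_linear(2)[OF D(1)] triv_tau_linear(2)[OF vbs(1) TA m, symmetric] in auto)
    then show "\<sigma> (?d (r *\<^sub>R x) y) = r *\<^sub>R \<sigma> (?d x y)"
      using double_linearD(4)[OF \<sigma> D(1) pm] by simp
  qed
  have l2: "linear (\<lambda>y. \<sigma> (?d x y))" for x
  proof (rule linearI)
    fix y y' r
    have e: "addA (?d x y) (?d x y') \<in> T" "qA (addA (?d x y) (?d x y')) = \<tau>A m x"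
      using closedA(1,2)[OF D(1) D(1)] D(2) by auto
    have "\<sigma> (?d x (y + y')) = \<sigma> (addA (?d x y) (?d x y'))"
      by (rule double_linear_determined[OF \<sigma> core D(1) pm e(1)])
        (use e D(2,3) proj_linear(3)[OF D(1) D(1)] triv_tau_linear(1)[OF vbs(2) TB m, symmetric] in auto)
    then show "\<sigma> (?d x (y + y')) = \<sigma> (?d x y) + \<sigma> (?d x y')"
      using double_linearD(1)[OF \<sigma> D(1) pm D(1)] D(2) by simp
    have e: "sclA r (?d x y) \<in> T" "qA (sclA r (?d x y)) = \<tau>A m x"
      using closedA(3,4)[OF D(1)] D(2) by auto
    have "\<sigma> (?d x (r *\<^sub>R y)) = \<sigma> (sclA r (?d x y))"
      by (rule double_linear_determined[OF \<sigma> core D(1) pm e(1)])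
        (use e D(2,3) proj_linear(4)[OF D(1)] triv_tau_linear(2)[OF vbs(2) TB m, symmetric] in auto)
    then show "\<sigma> (?d x (r *\<^sub>R y)) = r *\<^sub>R \<sigma> (?d x y)"
      using double_linearD(3)[OF \<sigma> D(1) pm] by simp
  qed
  have sA: "(\<Sum>i\<in>BA. crdA i v *\<^sub>R i) = v" for v using BA unfolding coord_basis_def by blast
  have sB: "(\<Sum>j\<in>BB. crdB j v *\<^sub>R j) = v" for v using BB unfolding coord_basis_def by blast
  have d': "d \<in> T" "pA (qA d) = m" "pB (qB d) = m" using d square by (auto simp: mem_D_over)
  let ?x = "\<Psi>A (qA d)" and ?y = "\<Psi>B (qB d)"
  have tx: "\<tau>A m ?x = qA d" "\<tau>B m ?y = qB d"
    using triv_inv[OF TA projT(1)[OF d'(1)]] triv_inv[OF TB projT(2)[OF d'(1)]] d'(2,3) m by auto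
  have "\<sigma> d = \<sigma> (?d ?x ?y)"
    by (rule double_linear_determined[OF \<sigma> core d'(1,2) D(1)])
      (use D(2,3)[of ?x ?y] tx in simp_all)
  also have "\<dots> = \<sigma> (?d (\<Sum>i\<in>BA. crdA i ?x *\<^sub>R i) (\<Sum>j\<in>BB. crdB j ?y *\<^sub>R j))" unfolding sA sB by (rule refl)
  also have "\<dots> = (\<Sum>i\<in>BA. crdA i ?x *\<^sub>R \<sigma> (?d i (\<Sum>j\<in>BB. crdB j ?y *\<^sub>R j)))"
    unfolding linear_sum[OF l1] linear_cmul[OF l1] by (rule refl)
  also have "\<dots> = (\<Sum>i\<in>BA. crdA i ?x *\<^sub>R (\<Sum>j\<in>BB. crdB j ?y *\<^sub>R \<sigma> (?d i j)))"
    unfolding linear_sum[OF l2] linear_cmul[OF l2] by (rule refl)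
  also have "\<dots> = (\<Sum>i\<in>BA. \<Sum>j\<in>BB. crdA i ?x * crdB j ?y * \<sigma> (?d i j))"
    by (simp add: sum_distrib_left mult.assoc)
  finally show ?thesis .
qed

lemma msmooth_pullback:
  assumes "msmooth_on (over (sideA D) U) (tot_atlas (sideA D)) vs_atlas f" "mopen (M_atlas D) U"
    and "finite_dim TYPE('g::real_normed_vector)"
  shows "msmooth_on (D_over D U) (D_atlas D) vs_atlas (\<lambda>d. f (qA d) :: 'g)"
proof (rule msmooth_on_compose[OF compat(4,2) charts_compat_vs[OF assms(3)] _ assms(1)])
  have "msmooth_on T (D_atlas D) (tot_atlas (sideA D)) qA" using vector_bundleD(6)[OF vbs(3)] atlases by simp
  then show "msmooth_on (D_over D U) (D_atlas D) (tot_atlas (sideA D)) qA"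
    by (rule msmooth_on_subset[OF compat(4) _ mopen_D_over[OF assms(2)]]) (auto simp: mem_D_over)
qed (use projT in \<open>auto simp: mem_D_over over_def\<close>)

lemma msmooth_pullbackB:
  assumes "msmooth_on (over (sideB D) U) (tot_atlas (sideB D)) vs_atlas f" "mopen (M_atlas D) U"
    and "finite_dim TYPE('g::real_normed_vector)"
  shows "msmooth_on (D_over D U) (D_atlas D) vs_atlas (\<lambda>d. f (qB d) :: 'g)"
proof (rule msmooth_on_compose[OF compat(4,3) charts_compat_vs[OF assms(3)] _ assms(1)])
  have "msmooth_on T (D_atlas D) (tot_atlas (sideB D)) qB" using vector_bundleD(6)[OF vbs(4)] atlases tots by simp
  then show "msmooth_on (D_over D U) (D_atlas D) (tot_atlas (sideB D)) qB"
    by (rule msmooth_on_subset[OF compat(4) _ mopen_D_over[OF assms(2)]]) (auto simp: mem_D_over)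
qed (use projT square in \<open>auto simp: mem_D_over over_def\<close>)

text \<open>The fibre of the bundle of double-linear functions has a basis consisting of germs of smooth
  sections, dual to finitely many elements of the slice; the number of these is the same at all
  points of the base.\<close>

lemma fibre_dual_basis:
  assumes m: "m \<in> points (M_atlas D)" and BA: "coord_basis (BA :: 'fa set) crdA" and BB: "coord_basis (BB :: 'fb set) crdB"
    and k: "k = card BA * card BB + (dim (UNIV :: 'fda set) - card BB)"
  shows "\<exists>U s d. mopen (M_atlas D) U \<and> m \<in> U \<and>
    (\<forall>i<k. msmooth_on (D_over D U) (D_atlas D) vs_atlas (s i) \<and> (\<forall>m'\<in>U. double_linear D m' (s i)) \<and> d i \<in> slice D m) \<and>
    (\<forall>i<k. \<forall>j<k. s j (d i) = (if i = j then 1 else (0::real))) \<and>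
    (\<forall>\<sigma> x. double_linear D m \<sigma> \<and> x \<in> slice D m \<longrightarrow> \<sigma> x = (\<Sum>i<k. \<sigma> (d i) * s i x))"
proof -
  obtain U and \<Psi>A :: "'a \<Rightarrow> 'fa" and \<tau>A and \<Psi>B :: "'b \<Rightarrow> 'fb" and \<tau>B and C :: "'fda set" and L cc dd where
    U: "m \<in> U" and TA: "local_triv (sideA D) U \<Psi>A \<tau>A" and TB: "local_triv (sideB D) U \<Psi>B \<tau>B"
    and C: "finite C" "card C + card BB = dim (UNIV :: 'fda set)"
    and L: "\<forall>c\<in>C. msmooth_on (D_over D U) (D_atlas D) vs_atlas (L c) \<and> (\<forall>m'\<in>U. double_linear D m' (L c)) \<and> cc c \<in> core m"
    and delta: "\<forall>c\<in>C. \<forall>c'\<in>C. L c (cc c') = (if c = c' then 1 else 0)"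
    and exp: "\<forall>x\<in>core m. \<forall>\<sigma>. double_linear D m \<sigma> \<longrightarrow> \<sigma> x = (\<Sum>c\<in>C. L c x * \<sigma> (cc c))"
    and dd: "\<forall>a b. a \<in> tot (sideA D) \<and> b \<in> tot (sideB D) \<and> pA a = m \<and> pB b = m \<longrightarrow>
      dd a b \<in> T \<and> qA (dd a b) = a \<and> qB (dd a b) = b \<and> (\<forall>c\<in>C. L c (dd a b) = 0)"
    using fibre_splitting[OF m BB] by (elim exE conjE) (rule that)
  note tA = triv_tau[OF TA U] and tB = triv_tau[OF TB U]
  have bA: "finite BA" "\<And>i. i \<in> BA \<Longrightarrow> bounded_linear (crdA i)" "\<And>i j. i \<in> BA \<Longrightarrow> j \<in> BA \<Longrightarrow> crdA i j = (if i = j then 1 else 0)"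
    using BA unfolding coord_basis_def by auto
  have bB: "finite BB" "\<And>i. i \<in> BB \<Longrightarrow> bounded_linear (crdB i)" "\<And>i j. i \<in> BB \<Longrightarrow> j \<in> BB \<Longrightarrow> crdB i j = (if i = j then 1 else 0)"
    using BB unfolding coord_basis_def by auto
  have oU: "mopen (M_atlas D) U" using triv_mopen[OF TA] .
  have ddD: "dd (\<tau>A m x) (\<tau>B m y) \<in> T" "qA (dd (\<tau>A m x) (\<tau>B m y)) = \<tau>A m x" "qB (dd (\<tau>A m x) (\<tau>B m y)) = \<tau>B m y"
    "\<forall>c\<in>C. L c (dd (\<tau>A m x) (\<tau>B m y)) = 0" for x y
    using dd tA(1,2) tB(1,2) by blast+
  \<comment> \<open>The basis: the products of coordinates of the two side bundles and the functions \<open>L c\<close>.\<close>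
  define I where "I = (BA \<times> BB) <+> C"
  define S where "S q = (\<lambda>d. case q of Inl (i, j) \<Rightarrow> crdA i (\<Psi>A (qA d)) * crdB j (\<Psi>B (qB d)) | Inr c \<Rightarrow> L c d)" for q
  define E where "E q = (case q of Inl (i, j) \<Rightarrow> dd (\<tau>A m i) (\<tau>B m j) | Inr c \<Rightarrow> cc c)" for q
  have S_simps: "S (Inl (i, j)) = (\<lambda>d. crdA i (\<Psi>A (qA d)) * crdB j (\<Psi>B (qB d)))" "S (Inr c) = L c"
    "E (Inl (i, j)) = dd (\<tau>A m i) (\<tau>B m j)" "E (Inr c) = cc c" for i j c
    unfolding S_def E_def by auto
  have fI: "finite I" unfolding I_def using bA(1) bB(1) C(1) by simp
  have cI: "card I = k" unfolding I_def k using bA(1) bB(1) C by (simp add: card_Plus card_cartesian_product)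
  have coreD: "x \<in> T" "qA x = nA m" "qB x = nB m" if "x \<in> core m" for x using that unfolding core_def by auto
  have lin0: "linear_map (fibre (sideA D) m') type_vs (\<lambda>a. crdA i (\<Psi>A a))" "linear_map (fibre (sideB D) m') type_vs (\<lambda>a. crdB j (\<Psi>B a))"
    if "i \<in> BA" "j \<in> BB" "m' \<in> U" for i j m'
    using TA TB that bA(2)[OF that(1)] bB(2)[OF that(2)]
    unfolding local_triv_def linear_map_def type_vs_simps by (auto simp: linear_simps)
  have zA0: "\<Psi>A (nA m) = 0" "\<Psi>B (nB m) = 0"
    using vb_zero_tau[OF vbs(1) TA U] vb_zero_tau[OF vbs(2) TB U] tA(3) tB(3) by auto
  have S1: "msmooth_on (D_over D U) (D_atlas D) vs_atlas (S q) \<and> (\<forall>m'\<in>U. double_linear D m' (S q)) \<and> E q \<in> slice D m"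
    if qI: "q \<in> I" for q
  proof (cases q)
    case (Inl p)
    then obtain i j where q: "q = Inl (i, j)" "i \<in> BA" "j \<in> BB" using qI unfolding I_def by auto
    have 1: "msmooth_on (over (sideA D) U) (tot_atlas (sideA D)) vs_atlas (\<lambda>a. crdA i (\<Psi>A a))"
      by (rule msmooth_vs_linear[OF compat(2) vector_bundleD(1)[OF vbs(1)] finite_dim_real
            bounded_linear.linear[OF bA(2)[OF q(2)]] triv_smooth[OF TA]])
    have 2: "msmooth_on (over (sideB D) U) (tot_atlas (sideB D)) vs_atlas (\<lambda>a. crdB j (\<Psi>B a))"
      by (rule msmooth_vs_linear[OF compat(3) vector_bundleD(1)[OF vbs(2)] finite_dim_real
            bounded_linear.linear[OF bB(2)[OF q(3)]] triv_smooth[OF TB]])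
    have "msmooth_on (D_over D U) (D_atlas D) vs_atlas (S q)"
      unfolding q S_simps
      by (rule msmooth_vs_mult[OF compat(4) msmooth_pullback[OF 1 oU finite_dim_real] msmooth_pullbackB[OF 2 oU finite_dim_real]])
    moreover have "double_linear D m' (S q)" if "m' \<in> U" for m'
      unfolding q S_simps by (rule double_linear_product[OF lin0[OF q(2,3) that]])
    moreover have "E q \<in> slice D m" unfolding q S_simps mem_D_over using ddD tA by simp
    ultimately show ?thesis by blast
  next
    case (Inr c)
    then have "c \<in> C" using qI unfolding I_def by auto
    then show ?thesis using L coreD zero_side(3)[OF m] unfolding Inr S_simps by (auto simp: mem_D_over)
  qed
  have S2: "S q (E p) = (if p = q then 1 else 0)" if pq: "p \<in> I" "q \<in> I" for p q
  proof (cases q)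
    case q: (Inl ij)
    then obtain i j where q: "q = Inl (i, j)" "i \<in> BA" "j \<in> BB" using pq unfolding I_def by auto
    show ?thesis
    proof (cases p)
      case (Inl ij)
      then obtain i' j' where p: "p = Inl (i', j')" "i' \<in> BA" "j' \<in> BB" using pq unfolding I_def by auto
      show ?thesis unfolding p q S_simps using ddD tA(3) tB(3) bA(3)[OF q(2) p(2)] bB(3)[OF q(3) p(3)] by auto
    next
      case (Inr c)
      then have "c \<in> C" using pq unfolding I_def by auto
      then have "cc c \<in> core m" using L by blast
      then show ?thesis unfolding Inr q S_simps
        using coreD[of "cc c"] zA0 linear_0[OF bounded_linear.linear[OF bA(2)[OF q(2)]]] by simp
    qed
  next
    case q: (Inr c)
    then have c: "c \<in> C" using pq unfolding I_def by auto
    show ?thesis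
    proof (cases p)
      case (Inl ij)
      then obtain i' j' where p: "p = Inl (i', j')" using pq unfolding I_def by auto
      show ?thesis unfolding p q S_simps using ddD(4) c by simp
    next
      case (Inr c')
      then have "c' \<in> C" using pq unfolding I_def by auto
      then show ?thesis unfolding Inr q S_simps using delta c by auto
    qed
  qed
  have S3: "\<sigma> x = (\<Sum>q\<in>I. \<sigma> (E q) * S q x)" if \<sigma>: "double_linear D m \<sigma>" and x: "x \<in> slice D m" for \<sigma> x
  proof -
    \<comment> \<open>The part of \<open>\<sigma>\<close> that vanishes on the core.\<close>
    define \<rho> where "\<rho> y = \<sigma> y - (\<Sum>c\<in>C. \<sigma> (cc c) * L c y)" for y
    have Lm: "double_linear D m (L c)" if "c \<in> C" for c using L U that by blast
    have \<rho>: "double_linear D m \<rho>"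
    proof (rule double_linearI)
      fix y z r assume y: "y \<in> T" "pA (qA y) = m"
      show "\<rho> (sclA r y) = r * \<rho> y" "\<rho> (sclB r y) = r * \<rho> y"
        unfolding \<rho>_def double_linearD(3,4)[OF \<sigma> y] using double_linearD(3,4)[OF Lm y]
        by (simp_all add: right_diff_distrib sum_distrib_left algebra_simps)
      assume z: "z \<in> T"
      show "\<rho> (addA y z) = \<rho> y + \<rho> z" if q: "qA y = qA z"
        unfolding \<rho>_def double_linearD(1)[OF \<sigma> y z q] using double_linearD(1)[OF Lm y z q]
        by (simp add: sum.distrib algebra_simps)
      show "\<rho> (addB y z) = \<rho> y + \<rho> z" if q: "qB y = qB z"
        unfolding \<rho>_def double_linearD(2)[OF \<sigma> y z q] using double_linearD(2)[OF Lm y z q]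
        by (simp add: sum.distrib algebra_simps)
    qed
    have "\<rho> c = 0" if "c \<in> core m" for c
      using exp[rule_format, OF that \<sigma>] unfolding \<rho>_def by (simp add: mult.commute)
    from double_linear_bilinear[OF \<rho> this U TA TB BA BB _ x, of dd] dd
    have "\<rho> x = (\<Sum>i\<in>BA. \<Sum>j\<in>BB. crdA i (\<Psi>A (qA x)) * crdB j (\<Psi>B (qB x)) * \<rho> (dd (\<tau>A m i) (\<tau>B m j)))"
      by blast
    moreover have "\<rho> (dd (\<tau>A m i) (\<tau>B m j)) = \<sigma> (dd (\<tau>A m i) (\<tau>B m j))" for i j
      unfolding \<rho>_def using ddD(4) by simp
    ultimately have "\<sigma> x = (\<Sum>i\<in>BA. \<Sum>j\<in>BB. crdA i (\<Psi>A (qA x)) * crdB j (\<Psi>B (qB x)) * \<sigma> (dd (\<tau>A m i) (\<tau>B m j)))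
        + (\<Sum>c\<in>C. \<sigma> (cc c) * L c x)" unfolding \<rho>_def by simp
    also have "\<dots> = (\<Sum>q\<in>I. \<sigma> (E q) * S q x)"
      unfolding I_def sum.Plus[OF finite_cartesian_product[OF bA(1) bB(1)] C(1)] sum.cartesian_product
      by (simp add: S_simps case_prod_unfold S_def E_def mult.commute mult.left_commute)
    finally show ?thesis .
  qed
  obtain h where h: "bij_betw h {..<k} I"
    using ex_bij_betw_nat_finite[OF fI] unfolding cI by (auto simp: atLeast0LessThan)
  have hI: "h i \<in> I" if "i < k" for i using h that unfolding bij_betw_def by blast
  have hinj: "h i = h j \<longleftrightarrow> i = j" if "i < k" "j < k" for i j
    using h that unfolding bij_betw_def inj_on_def by blast
  have 1: "\<forall>i<k. msmooth_on (D_over D U) (D_atlas D) vs_atlas (S (h i)) \<and> (\<forall>m'\<in>U. double_linear D m' (S (h i))) \<and> E (h i) \<in> slice D m"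
    using S1 hI by blast
  have 2: "\<forall>i<k. \<forall>j<k. S (h j) (E (h i)) = (if i = j then 1 else (0::real))"
    using S2 hI hinj by simp
  have 3: "\<forall>\<sigma> x. double_linear D m \<sigma> \<and> x \<in> slice D m \<longrightarrow> \<sigma> x = (\<Sum>i<k. \<sigma> (E (h i)) * S (h i) x)"
    using S3 sum.reindex_bij_betw[OF h, of "\<lambda>q. \<sigma> (E q) * S q x" for \<sigma> x] by auto
  show ?thesis
    by (rule exI[of _ U], rule exI[of _ "\<lambda>i. S (h i)"], rule exI[of _ "\<lambda>i. E (h i)"]) (intro conjI oU U 1 2 3)
qed

end

section \<open>Free vector spaces, quotients and tensor products\<close>

lemma lookup_scaleR: "Poly_Mapping.lookup (r *\<^sub>R p) x = r *\<^sub>R Poly_Mapping.lookup p x"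
  by (transfer) simp

lemma lin_ext_superset:
  assumes "finite A" "Poly_Mapping.keys p \<subseteq> A"
  shows "lin_ext f p = (\<Sum>x\<in>A. Poly_Mapping.lookup p x *\<^sub>R f x)"
  unfolding lin_ext_def using assms by (intro sum.mono_neutral_left) (auto simp: in_keys_iff)

lemma linear_lin_ext: "linear (lin_ext f)"
proof (rule linearI)
  fix p q :: "'a \<Rightarrow>\<^sub>0 real" and r :: real
  let ?A = "Poly_Mapping.keys p \<union> Poly_Mapping.keys q"
  have "Poly_Mapping.keys (p + q) \<subseteq> ?A" by (rule keys_add)
  then show "lin_ext f (p + q) = lin_ext f p + lin_ext f q"
    using lin_ext_superset[of ?A p f] lin_ext_superset[of ?A q f] lin_ext_superset[of ?A "p + q" f]
    by (simp add: lookup_add scaleR_left_distrib sum.distrib)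
  have "Poly_Mapping.keys (r *\<^sub>R p) \<subseteq> Poly_Mapping.keys p" by (auto simp: in_keys_iff lookup_scaleR)
  then show "lin_ext f (r *\<^sub>R p) = r *\<^sub>R lin_ext f p"
    using lin_ext_superset[of "Poly_Mapping.keys p" p f] lin_ext_superset[of "Poly_Mapping.keys p" "r *\<^sub>R p" f]
    by (simp add: lookup_scaleR scaleR_sum_right)
qed

lemma lin_ext_gen [simp]: "lin_ext f (gen x) = f x"
  unfolding lin_ext_def by simp

lemmas lin_ext_add = linear_add[OF linear_lin_ext]
  and lin_ext_diff = linear_diff[OF linear_lin_ext]
  and lin_ext_scaleR = linear_cmul[OF linear_lin_ext]

lemma lin_ext_gen_self: "lin_ext gen p = p"
proof (rule poly_mapping_eqI)
  fix x
  have "Poly_Mapping.lookup (lin_ext gen p) x = (\<Sum>y\<in>Poly_Mapping.keys p. Poly_Mapping.lookup p y * (if y = x then 1 else 0))"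
    unfolding lin_ext_def by (simp add: lookup_sum lookup_scaleR lookup_single when_def)
  also have "\<dots> = Poly_Mapping.lookup p x" by (simp add: if_distrib in_keys_iff cong: if_cong)
  finally show "Poly_Mapping.lookup (lin_ext gen p) x = Poly_Mapping.lookup p x" .
qed

lemma linear_eq_lin_ext:
  assumes "linear h"
  shows "h p = lin_ext (\<lambda>x. h (gen x)) p"
proof -
  have "h p = h (lin_ext gen p)" by (simp only: lin_ext_gen_self)
  also have "\<dots> = lin_ext (\<lambda>x. h (gen x)) p"
    unfolding lin_ext_def linear_sum[OF assms] linear_cmul[OF assms] by (rule refl)
  finally show ?thesis .
qed

lemma lin_ext_cong: "p \<in> free_on S \<Longrightarrow> (\<And>x. x \<in> S \<Longrightarrow> f x = g x) \<Longrightarrow> lin_ext f p = lin_ext g p"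
  unfolding lin_ext_def free_on_def by (intro sum.cong) auto

lemma lin_ext_fun_add: "lin_ext (\<lambda>x. f x + g x) p = lin_ext f p + lin_ext g p"
  and lin_ext_fun_scaleR: "lin_ext (\<lambda>x. r *\<^sub>R f x) p = r *\<^sub>R lin_ext f p"
  unfolding lin_ext_def by (simp_all add: scaleR_right_distrib sum.distrib scaleR_sum_right mult.commute)

lemma subspace_free_on: "subspace (free_on S)"
proof (rule subspaceI)
  show "0 \<in> free_on S" by (simp add: free_on_def)
  show "p + q \<in> free_on S" if "p \<in> free_on S" "q \<in> free_on S" for p q
    using that keys_add[of p q] unfolding free_on_def by blast
  show "r *\<^sub>R p \<in> free_on S" if "p \<in> free_on S" for r p
    using that unfolding free_on_def by (auto simp: in_keys_iff lookup_scaleR)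
qed

lemma gen_free_on: "x \<in> S \<Longrightarrow> gen x \<in> free_on S"
  unfolding free_on_def by simp

lemma free_on_span: "free_on S = span (gen ` S)"
proof
  show "free_on S \<subseteq> span (gen ` S)"
  proof
    fix p assume p: "p \<in> free_on S"
    have "lin_ext gen p \<in> span (gen ` S)"
      unfolding lin_ext_def using p by (intro span_sum span_scale span_base) (auto simp: free_on_def)
    then show "p \<in> span (gen ` S)" by (simp only: lin_ext_gen_self)
  qed
  show "span (gen ` S) \<subseteq> free_on S"
    by (rule span_minimal[OF _ subspace_free_on]) (auto intro: gen_free_on)
qed

lemma mem_coset_iff: "q \<in> coset N p \<longleftrightarrow> q - p \<in> N"
  unfolding coset_def by (auto simp: algebra_simps intro: exI[of _ "q - p"])

lemma coset_eq_iff: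
  assumes "subspace N"
  shows "coset N p = coset N q \<longleftrightarrow> p - q \<in> N"
proof
  have "p \<in> coset N p" using subspace_0[OF assms] by (simp add: mem_coset_iff)
  then show "coset N p = coset N q \<Longrightarrow> p - q \<in> N" by (simp add: mem_coset_iff)
  assume *: "p - q \<in> N"
  show "coset N p = coset N q"
  proof (intro set_eqI)
    fix x
    have "x - p \<in> N \<longleftrightarrow> x - q \<in> N"
      using subspace_add[OF assms, of "x - p" "p - q"] subspace_diff[OF assms, of "x - q" "p - q"] * by auto
    then show "x \<in> coset N p \<longleftrightarrow> x \<in> coset N q" by (simp add: mem_coset_iff)
  qed
qed

lemma quot_vs_simps:
  assumes "subspace N"
  shows "carr (quot_vs F N) = coset N ` F" "vzero (quot_vs F N) = coset N 0"
    "vadd (quot_vs F N) (coset N p) (coset N q) = coset N (p + q)"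
    "vscl (quot_vs F N) r (coset N p) = coset N (r *\<^sub>R p)"
proof -
  show "carr (quot_vs F N) = coset N ` F" "vzero (quot_vs F N) = coset N 0"
    unfolding quot_vs_def by simp_all
  show "vadd (quot_vs F N) (coset N p) (coset N q) = coset N (p + q)"
  proof (intro set_eqI)
    fix x
    have "(\<exists>y z. x = y + z \<and> y - p \<in> N \<and> z - q \<in> N) \<longleftrightarrow> x - (p + q) \<in> N"
    proof
      assume "\<exists>y z. x = y + z \<and> y - p \<in> N \<and> z - q \<in> N"
      then obtain y z where "x = y + z" "y - p \<in> N" "z - q \<in> N" by blast
      then show "x - (p + q) \<in> N" using subspace_add[OF assms, of "y - p" "z - q"] by (simp add: algebra_simps)
    next
      assume "x - (p + q) \<in> N"
      then show "\<exists>y z. x = y + z \<and> y - p \<in> N \<and> z - q \<in> N"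
        using subspace_0[OF assms] by (intro exI[of _ "x - q"] exI[of _ q]) (simp add: algebra_simps)
    qed
    then show "x \<in> vadd (quot_vs F N) (coset N p) (coset N q) \<longleftrightarrow> x \<in> coset N (p + q)"
      unfolding quot_vs_def by (simp add: mem_coset_iff)
  qed
  show "vscl (quot_vs F N) r (coset N p) = coset N (r *\<^sub>R p)"
  proof (intro set_eqI)
    fix x
    have "(\<exists>y n. x = r *\<^sub>R y + n \<and> y - p \<in> N \<and> n \<in> N) \<longleftrightarrow> x - r *\<^sub>R p \<in> N"
    proof
      assume "\<exists>y n. x = r *\<^sub>R y + n \<and> y - p \<in> N \<and> n \<in> N"
      then obtain y n where *: "x = r *\<^sub>R y + n" "y - p \<in> N" "n \<in> N" by blast
      have "r *\<^sub>R (y - p) + n \<in> N" using * subspace_add[OF assms] subspace_scale[OF assms] by blast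
      then show "x - r *\<^sub>R p \<in> N" using * by (simp add: algebra_simps)
    next
      assume "x - r *\<^sub>R p \<in> N"
      then show "\<exists>y n. x = r *\<^sub>R y + n \<and> y - p \<in> N \<and> n \<in> N"
        using subspace_0[OF assms] by (intro exI[of _ p] exI[of _ "x - r *\<^sub>R p"]) simp
    qed
    then show "x \<in> vscl (quot_vs F N) r (coset N p) \<longleftrightarrow> x \<in> coset N (r *\<^sub>R p)"
      unfolding quot_vs_def by (simp add: mem_coset_iff)
  qed
qed

lemma real_vs_quot:
  assumes F: "subspace F" and N: "subspace N"
  shows "real_vs (quot_vs F N)"
proof -
  note q = quot_vs_simps[OF N]
  have inv: "\<exists>y\<in>carr (quot_vs F N). vadd (quot_vs F N) x y = vzero (quot_vs F N)" if "x \<in> carr (quot_vs F N)" for x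
  proof -
    obtain p where p: "x = coset N p" "p \<in> F" using \<open>x \<in> carr (quot_vs F N)\<close> unfolding q by blast
    then show ?thesis using subspace_neg[OF F p(2)] unfolding q
      by (intro bexI[of _ "coset N (- p)"]) (simp_all add: q)
  qed
  show ?thesis
    unfolding real_vs_def
  proof (intro conjI ballI allI)
    show "vzero (quot_vs F N) \<in> carr (quot_vs F N)" unfolding q using subspace_0[OF F] by blast
  next
    fix x assume "x \<in> carr (quot_vs F N)" then show "\<exists>y\<in>carr (quot_vs F N). vadd (quot_vs F N) x y = vzero (quot_vs F N)"
      by (rule inv)
  qed (use subspace_add[OF F] subspace_scale[OF F] in \<open>auto simp: q algebra_simps\<close>)
qed

lemma induced_coset:
  assumes "subspace N" "\<And>n. n \<in> N \<Longrightarrow> g (p + n) = g p"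
  shows "induced g (coset N p) = g p"
  unfolding induced_def
proof (rule the_equality)
  show "\<forall>x\<in>coset N p. g x = g p" using assms(2) unfolding coset_def by auto
  fix y assume "\<forall>x\<in>coset N p. g x = y"
  then show "y = g p" using subspace_0[OF assms(1)] by (simp add: mem_coset_iff)
qed

lemma induced_linear_coset:
  assumes "linear g" "\<And>n. n \<in> R \<Longrightarrow> g n = 0"
  shows "induced g (coset (span R) p) = g p"
  by (rule induced_coset[OF subspace_span])
    (use linear_add[OF assms(1)] linear_eq_0_on_span[OF assms(1,2)] in auto)

lemma real_vs_fun_vs:
  assumes "restrict (\<lambda>x. 0) S \<in> F"
    "\<And>f g. f \<in> extensional S \<Longrightarrow> g \<in> extensional S \<Longrightarrow> f \<in> F \<Longrightarrow> g \<in> F \<Longrightarrow> restrict (\<lambda>x. f x + g x) S \<in> F"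
    "\<And>f r. f \<in> extensional S \<Longrightarrow> f \<in> F \<Longrightarrow> restrict (\<lambda>x. r * f x) S \<in> F"
  shows "real_vs (fun_vs S F)"
proof -
  have e: "f = g" if "f \<in> extensional S" "g \<in> extensional S" "\<And>x. x \<in> S \<Longrightarrow> f x = g x" for f g :: "'a \<Rightarrow> real"
    using that by (intro extensionalityI) auto
  have inv: "\<exists>g\<in>extensional S \<inter> F. restrict (\<lambda>x. f x + g x) S = restrict (\<lambda>x. 0) S" if f: "f \<in> extensional S" "f \<in> F" for f
    using assms(3)[OF f, of "-1"] by (intro bexI[of _ "restrict (\<lambda>x. - 1 * f x) S"] e) auto
  show ?thesis
    unfolding real_vs_def fun_vs_def rvs.simps
  proof (intro conjI ballI allI)
    fix f assume "f \<in> {f \<in> extensional S. f \<in> F}"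
    then show "\<exists>y\<in>{f \<in> extensional S. f \<in> F}. restrict (\<lambda>x. f x + y x) S = restrict (\<lambda>x. 0) S" using inv[of f] by blast
  qed (use assms in \<open>auto intro!: e simp: algebra_simps\<close>)
qed

lemma real_vs_dual:
  assumes "real_vs V"
  shows "real_vs (dual_vs V)"
  unfolding dual_vs_def
  by (rule real_vs_fun_vs) (use real_vsD(2,3)[OF assms] in \<open>auto simp: linear_map_def type_vs_simps algebra_simps\<close>)

lemma dual_vs_simps: "carr (dual_vs V) = {f \<in> extensional (carr V). linear_map V type_vs f}"
  "vzero (dual_vs V) = restrict (\<lambda>x. 0) (carr V)"
  "vadd (dual_vs V) f g = restrict (\<lambda>x. f x + g x) (carr V)" "vscl (dual_vs V) r f = restrict (\<lambda>x. r * f x) (carr V)"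
  unfolding dual_vs_def fun_vs_def by auto

text \<open>On representatives the canonical pairing of \<open>V \<otimes> W\<close> with \<open>V\<^sup>* \<otimes> W\<^sup>*\<close> is the bilinear extension of
  \<open>((v, w), (f, g)) \<mapsto> f v * g w\<close>.\<close>

lemma bilin_rel_free:
  assumes "real_vs V" "real_vs W"
  shows "span (bilin_rel V W) \<subseteq> free_on (carr V \<times> carr W)"
proof (rule span_minimal[OF _ subspace_free_on])
  have "gen (x, y) \<in> free_on (carr V \<times> carr W)" if "x \<in> carr V" "y \<in> carr W" for x y
    using that by (intro gen_free_on) simp
  then show "bilin_rel V W \<subseteq> free_on (carr V \<times> carr W)"
    using real_vsD(2,3)[OF assms(1)] real_vsD(2,3)[OF assms(2)] unfolding bilin_rel_def
    by (auto intro!: subspace_diff[OF subspace_free_on] subspace_add[OF subspace_free_on] subspace_scale[OF subspace_free_on])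
qed

lemma lin_ext_bilin_rel:
  assumes "\<And>v v' w. v \<in> carr V \<Longrightarrow> v' \<in> carr V \<Longrightarrow> w \<in> carr W \<Longrightarrow> h (vadd V v v', w) = h (v, w) + h (v', w)"
    "\<And>v w w'. v \<in> carr V \<Longrightarrow> w \<in> carr W \<Longrightarrow> w' \<in> carr W \<Longrightarrow> h (v, vadd W w w') = h (v, w) + h (v, w')"
    "\<And>r v w. v \<in> carr V \<Longrightarrow> w \<in> carr W \<Longrightarrow> h (vscl V r v, w) = r *\<^sub>R h (v, w)"
    "\<And>r v w. v \<in> carr V \<Longrightarrow> w \<in> carr W \<Longrightarrow> h (v, vscl W r w) = r *\<^sub>R h (v, w)"
    "n \<in> bilin_rel V W"
  shows "lin_ext h n = 0"
  using assms(5) unfolding bilin_rel_def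
  by (auto simp: lin_ext_add lin_ext_diff lin_ext_scaleR assms(1-4))

lemma tensor_pairing_coset:
  fixes V :: "'v rvs" and W :: "'w rvs"
  assumes V: "real_vs V" and W: "real_vs W"
    and p: "p \<in> free_on (carr V \<times> carr W)" and u: "u \<in> free_on (carr (dual_vs V) \<times> carr (dual_vs W))"
  shows "tensor_pairing (coset (span (bilin_rel V W)) p) (coset (span (bilin_rel (dual_vs V) (dual_vs W))) u) =
    lin_ext (\<lambda>(v, w). lin_ext (\<lambda>(f, g). f v * g w) u) p"
proof -
  let ?h = "\<lambda>u (v, w). lin_ext (\<lambda>(f, g). f v * g w) u"
  have 1: "induced (lin_ext (?h u)) (coset (span (bilin_rel V W)) p) = lin_ext (?h u) p"
    if u: "u \<in> free_on (carr (dual_vs V) \<times> carr (dual_vs W))" for u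
  proof (rule induced_linear_coset[OF linear_lin_ext])
    fix n assume n: "n \<in> bilin_rel V W"
    have L: "y \<in> carr V \<Longrightarrow> f (vadd V x y) = f x + f y" "f (vscl V r x) = r * f x" if "f \<in> carr (dual_vs V)" "x \<in> carr V" for f x y r
      using linear_mapD[of V type_vs f x] that by (auto simp: dual_vs_simps type_vs_simps)
    have M: "y \<in> carr W \<Longrightarrow> f (vadd W x y) = f x + f y" "f (vscl W r x) = r * f x" if "f \<in> carr (dual_vs W)" "x \<in> carr W" for f x y r
      using linear_mapD[of W type_vs f x] that by (auto simp: dual_vs_simps type_vs_simps)
    show "lin_ext (?h u) n = 0"
    proof (rule lin_ext_bilin_rel[OF _ _ _ _ n])
      fix v v' w w' r assume *: "v \<in> carr V" "w \<in> carr W"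
      show "?h u (vscl V r v, w) = r *\<^sub>R ?h u (v, w)"
        unfolding prod.case lin_ext_fun_scaleR[symmetric]
      proof (rule lin_ext_cong[OF u], elim SigmaE, simp only: prod.case)
        fix f g assume f: "f \<in> carr (dual_vs V)" and g: "g \<in> carr (dual_vs W)"
        show "f (vscl V r v) * g w = r *\<^sub>R (f v * g w)" using L(2)[OF f *(1), of r] by (simp add: algebra_simps)
      qed
      show "?h u (v, vscl W r w) = r *\<^sub>R ?h u (v, w)"
        unfolding prod.case lin_ext_fun_scaleR[symmetric]
      proof (rule lin_ext_cong[OF u], elim SigmaE, simp only: prod.case)
        fix f g assume f: "f \<in> carr (dual_vs V)" and g: "g \<in> carr (dual_vs W)"
        show "f v * g (vscl W r w) = r *\<^sub>R (f v * g w)" using M(2)[OF g *(2), of r] by (simp add: algebra_simps)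
      qed
      show "?h u (vadd V v v', w) = ?h u (v, w) + ?h u (v', w)" if v': "v' \<in> carr V"
        unfolding prod.case lin_ext_fun_add[symmetric]
      proof (rule lin_ext_cong[OF u], elim SigmaE, simp only: prod.case)
        fix f g assume f: "f \<in> carr (dual_vs V)" and g: "g \<in> carr (dual_vs W)"
        show "f (vadd V v v') * g w = f v * g w + f v' * g w" using L(1)[OF f *(1) v'] by (simp add: algebra_simps)
      qed
      show "?h u (v, vadd W w w') = ?h u (v, w) + ?h u (v, w')" if w': "w' \<in> carr W"
        unfolding prod.case lin_ext_fun_add[symmetric]
      proof (rule lin_ext_cong[OF u], elim SigmaE, simp only: prod.case)
        fix f g assume f: "f \<in> carr (dual_vs V)" and g: "g \<in> carr (dual_vs W)"
        show "f v * g (vadd W w w') = f v * g w + f v * g w'" using M(1)[OF g *(2) w'] by (simp add: algebra_simps)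
      qed
    qed
  qed
  have 2: "lin_ext (?h n) p = 0" if n: "n \<in> span (bilin_rel (dual_vs V) (dual_vs W))" for n
  proof -
    have "?h n (v, w) = 0" if "v \<in> carr V" "w \<in> carr W" for v w
    proof -
      have "lin_ext (\<lambda>(f, g). f v * g w) n' = 0" if n': "n' \<in> bilin_rel (dual_vs V) (dual_vs W)" for n'
        by (rule lin_ext_bilin_rel[OF _ _ _ _ n'])
          (use \<open>v \<in> carr V\<close> \<open>w \<in> carr W\<close> in \<open>auto simp: dual_vs_simps algebra_simps\<close>)
      then show ?thesis unfolding prod.case by (rule linear_eq_0_on_span[OF linear_lin_ext _ n])
    qed
    then have "lin_ext (?h n) p = lin_ext (\<lambda>_. 0) p" by (intro lin_ext_cong[OF p]) auto
    then show ?thesis by (simp add: lin_ext_def)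
  qed
  have add: "lin_ext (?h (u + n)) p = lin_ext (?h u) p + lin_ext (?h n) p"
    for u n :: "('v \<Rightarrow> real) \<times> ('w \<Rightarrow> real) \<Rightarrow>\<^sub>0 real"
    unfolding lin_ext_fun_add[symmetric] by (rule arg_cong[where f = "\<lambda>h. lin_ext h p"]) (auto simp: lin_ext_add)
  have "tensor_pairing (coset (span (bilin_rel V W)) p) (coset (span (bilin_rel (dual_vs V) (dual_vs W))) u) =
    induced (lin_ext (?h u)) (coset (span (bilin_rel V W)) p)"
    unfolding tensor_pairing_def
  proof (rule induced_coset[OF subspace_span])
    fix n assume n: "n \<in> span (bilin_rel (dual_vs V) (dual_vs W))"
    then have un: "u + n \<in> free_on (carr (dual_vs V) \<times> carr (dual_vs W))"
      using bilin_rel_free[OF real_vs_dual[OF V] real_vs_dual[OF W]] u subspace_add[OF subspace_free_on] by blast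
    show "induced (lin_ext (?h (u + n))) (coset (span (bilin_rel V W)) p) =
      induced (lin_ext (?h u)) (coset (span (bilin_rel V W)) p)"
      unfolding 1[OF un] 1[OF u] add 2[OF n] by simp
  qed
  then show ?thesis using 1[OF u] by simp
qed

text \<open>In a tensor product, a tensor of linear combinations expands bilinearly.\<close>

lemma tensor_lincomb:
  assumes V: "real_vs V" and W: "real_vs W" and e: "\<And>i. i < n \<Longrightarrow> e i \<in> carr V" and w: "w \<in> carr W"
  shows "lincomb V c e n \<in> carr V"
    "gen (lincomb V c e n, w) - (\<Sum>i<n. c i *\<^sub>R gen (e i, w)) \<in> span (bilin_rel V W)"
    "gen (w, lincomb V c e n) - (\<Sum>i<n. c i *\<^sub>R gen (w, e i)) \<in> span (bilin_rel W V)"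
proof -
  let ?N = "span (bilin_rel V W)" and ?M = "span (bilin_rel W V)"
  have "lincomb V c e n \<in> carr V \<and> gen (lincomb V c e n, w) - (\<Sum>i<n. c i *\<^sub>R gen (e i, w)) \<in> ?N \<and>
    gen (w, lincomb V c e n) - (\<Sum>i<n. c i *\<^sub>R gen (w, e i)) \<in> ?M"
    using e
  proof (induction n)
    case 0
    have z: "vzero V \<in> carr V" "vscl V 0 (vzero V) = vzero V" using real_vsD(1)[OF V] real_vs_scl_zero[OF V] by auto
    have "0 *\<^sub>R gen (vzero V, w) - gen (vscl V 0 (vzero V), w) \<in> bilin_rel V W"
      unfolding bilin_rel_def using z(1) w by blast
    moreover have "0 *\<^sub>R gen (w, vzero V) - gen (w, vscl V 0 (vzero V)) \<in> bilin_rel W V"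
      unfolding bilin_rel_def using z(1) w by blast
    ultimately have "- (0 - gen (vzero V, w)) \<in> ?N" "- (0 - gen (w, vzero V)) \<in> ?M"
      using span_neg[OF span_base] unfolding z(2) scaleR_zero_left by blast+
    then show ?case using z by simp
  next
    case (Suc n)
    let ?l = "lincomb V c e n" and ?s = "vscl V (c n) (e n)"
    have l: "?l \<in> carr V" "gen (?l, w) - (\<Sum>i<n. c i *\<^sub>R gen (e i, w)) \<in> ?N"
      "gen (w, ?l) - (\<Sum>i<n. c i *\<^sub>R gen (w, e i)) \<in> ?M" and en: "e n \<in> carr V"
      using Suc by auto
    have s: "?s \<in> carr V" using real_vsD(3)[OF V en] .
    have "gen (?l, w) + gen (?s, w) - gen (vadd V ?l ?s, w) \<in> bilin_rel V W"
      unfolding bilin_rel_def using l(1) s w by blast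
    moreover have "c n *\<^sub>R gen (e n, w) - gen (?s, w) \<in> bilin_rel V W"
      unfolding bilin_rel_def using en w by blast
    ultimately have a: "gen (?l, w) + gen (?s, w) - gen (vadd V ?l ?s, w) \<in> ?N" "c n *\<^sub>R gen (e n, w) - gen (?s, w) \<in> ?N"
      by (auto intro: span_base)
    have "gen (w, ?l) + gen (w, ?s) - gen (w, vadd V ?l ?s) \<in> bilin_rel W V"
      unfolding bilin_rel_def using l(1) s w by blast
    moreover have "c n *\<^sub>R gen (w, e n) - gen (w, ?s) \<in> bilin_rel W V"
      unfolding bilin_rel_def using en w by blast
    ultimately have b: "gen (w, ?l) + gen (w, ?s) - gen (w, vadd V ?l ?s) \<in> ?M" "c n *\<^sub>R gen (w, e n) - gen (w, ?s) \<in> ?M"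
      by (auto intro: span_base)
    have "(gen (?l, w) - (\<Sum>i<n. c i *\<^sub>R gen (e i, w))) - (gen (?l, w) + gen (?s, w) - gen (vadd V ?l ?s, w)) -
      (c n *\<^sub>R gen (e n, w) - gen (?s, w)) \<in> ?N"
      using span_diff[OF span_diff[OF l(2) a(1)] a(2)] .
    moreover have "(gen (w, ?l) - (\<Sum>i<n. c i *\<^sub>R gen (w, e i))) - (gen (w, ?l) + gen (w, ?s) - gen (w, vadd V ?l ?s)) -
      (c n *\<^sub>R gen (w, e n) - gen (w, ?s)) \<in> ?M"
      using span_diff[OF span_diff[OF l(3) b(1)] b(2)] .
    ultimately show ?case using real_vsD(2)[OF V l(1) s] by (simp add: algebra_simps)
  qed
  then show "lincomb V c e n \<in> carr V"
    "gen (lincomb V c e n, w) - (\<Sum>i<n. c i *\<^sub>R gen (e i, w)) \<in> ?N"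
    "gen (w, lincomb V c e n) - (\<Sum>i<n. c i *\<^sub>R gen (w, e i)) \<in> ?M" by auto
qed

section \<open>Bundles given by their smooth sections\<close>

lemma lincomb_cong: "(\<And>i. i < n \<Longrightarrow> c i = c' i) \<Longrightarrow> (\<And>i. i < n \<Longrightarrow> e i = e' i) \<Longrightarrow> lincomb V c e n = lincomb V c' e' n"
  by (induction n) auto

lemma lincomb_closed: "real_vs V \<Longrightarrow> (\<And>i. i < n \<Longrightarrow> e i \<in> carr V) \<Longrightarrow> lincomb V c e n \<in> carr V"
  by (induction n) (auto intro: real_vsD)

lemma linear_map_lincomb:
  assumes "real_vs V" "real_vs W" "linear_map V W f" "\<And>i. i < n \<Longrightarrow> e i \<in> carr V"
  shows "f (lincomb V c e n) = lincomb W c (\<lambda>i. f (e i)) n"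
  using assms(4)
proof (induction n)
  case 0
  then show ?case using linear_map_zero[OF assms(1-3)] by simp
next
  case (Suc n)
  then have "lincomb V c e n \<in> carr V" "vscl V (c n) (e n) \<in> carr V" "e n \<in> carr V"
    using lincomb_closed[OF assms(1)] real_vsD(3)[OF assms(1)] by auto
  then show ?case using Suc linear_mapD(2,3)[OF assms(3)] by simp
qed

text \<open>A frame is recognised by its dual coordinate functions \<open>\<epsilon>\<close>.\<close>

lemma smooth_frameI:
  assumes A: "charts_compat \<A>"
    and e: "\<And>i x. i < k \<Longrightarrow> x \<in> U \<Longrightarrow> e i x \<in> carr (fib S x)"
    and dual: "\<And>c i x. i < k \<Longrightarrow> x \<in> U \<Longrightarrow> \<epsilon> i x (lincomb (fib S x) c (\<lambda>i. e i x) k) = c i"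
    and exp: "\<And>x v. x \<in> U \<Longrightarrow> v \<in> carr (fib S x) \<Longrightarrow> v = lincomb (fib S x) (\<lambda>i. \<epsilon> i x v) (\<lambda>i. e i x) k"
    and sm: "\<And>V s. mopen \<A> V \<Longrightarrow> V \<subseteq> U \<Longrightarrow> is_section S V s \<Longrightarrow>
      smooth_sec S V s \<longleftrightarrow> (\<forall>i<k. smooth_fun \<A> V (\<lambda>x. \<epsilon> i x (s x)))"
  shows "smooth_frame \<A> S U k e"
  unfolding smooth_frame_def
proof (intro conjI allI impI ballI)
  fix i assume "i < k"
  then show "is_section S U (e i)" unfolding is_section_def using e by blast
next
  fix x v assume x: "x \<in> U" and v: "v \<in> carr (fib S x)"
  show "\<exists>!c. c \<in> extensional {..<k} \<and> v = lincomb (fib S x) c (\<lambda>i. e i x) k"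
  proof (rule ex1I[of _ "restrict (\<lambda>i. \<epsilon> i x v) {..<k}"])
    have "lincomb (fib S x) (restrict (\<lambda>i. \<epsilon> i x v) {..<k}) (\<lambda>i. e i x) k = v"
      by (subst exp[OF x v], rule lincomb_cong) auto
    then show "restrict (\<lambda>i. \<epsilon> i x v) {..<k} \<in> extensional {..<k} \<and>
      v = lincomb (fib S x) (restrict (\<lambda>i. \<epsilon> i x v) {..<k}) (\<lambda>i. e i x) k" by simp
    fix c assume c: "c \<in> extensional {..<k} \<and> v = lincomb (fib S x) c (\<lambda>i. e i x) k"
    show "c = restrict (\<lambda>i. \<epsilon> i x v) {..<k}"
    proof (rule extensionalityI[of _ "{..<k}"])
      fix i assume i: "i \<in> {..<k}"
      then have "\<epsilon> i x v = c i" using dual[of i x c] x c by simp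
      then show "c i = restrict (\<lambda>i. \<epsilon> i x v) {..<k} i" using i by simp
    qed (use c in auto)
  qed
next
  fix V s assume *: "mopen \<A> V \<and> V \<subseteq> U \<and> is_section S V s"
  then have sm': "smooth_sec S V s \<longleftrightarrow> (\<forall>i<k. smooth_fun \<A> V (\<lambda>x. \<epsilon> i x (s x)))" using sm by blast
  show "smooth_sec S V s \<longleftrightarrow> (\<exists>c. (\<forall>i<k. smooth_fun \<A> V (c i)) \<and>
    (\<forall>x\<in>V. s x = lincomb (fib S x) (\<lambda>i. c i x) (\<lambda>i. e i x) k))"
  proof
    assume "smooth_sec S V s"
    then show "\<exists>c. (\<forall>i<k. smooth_fun \<A> V (c i)) \<and> (\<forall>x\<in>V. s x = lincomb (fib S x) (\<lambda>i. c i x) (\<lambda>i. e i x) k)"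
      using sm' * exp unfolding is_section_def by (intro exI[of _ "\<lambda>i x. \<epsilon> i x (s x)"]) auto
  next
    assume "\<exists>c. (\<forall>i<k. smooth_fun \<A> V (c i)) \<and> (\<forall>x\<in>V. s x = lincomb (fib S x) (\<lambda>i. c i x) (\<lambda>i. e i x) k)"
    then obtain c where c: "\<And>i. i < k \<Longrightarrow> smooth_fun \<A> V (c i)"
      "\<And>x. x \<in> V \<Longrightarrow> s x = lincomb (fib S x) (\<lambda>i. c i x) (\<lambda>i. e i x) k" by blast
    have "smooth_fun \<A> V (\<lambda>x. \<epsilon> i x (s x))" if i: "i < k" for i
    proof (rule msmooth_on_cong[OF A c(1)[OF i]])
      fix x assume "x \<in> V"
      then show "c i x = \<epsilon> i x (s x)" using c(2) dual[OF i, of x "\<lambda>i. c i x"] * by auto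
    qed
    then show "smooth_sec S V s" using sm' by blast
  qed
qed

text \<open>A fibrewise isomorphism under which smooth sections correspond carries a vector bundle structure
  over; \<open>cong\<close> says that smoothness of a section over \<open>U\<close> only depends on its values on \<open>U\<close>.\<close>

lemma is_vb_transport:
  assumes S: "is_vb \<A> S" and real: "\<And>m. m \<in> points \<A> \<Longrightarrow> real_vs (fib T m)"
    and iso: "\<And>m. m \<in> points \<A> \<Longrightarrow> linear_iso (fib S m) (fib T m) (\<Phi> m)"
    and sec: "\<And>U s. smooth_sec T U s \<Longrightarrow> mopen \<A> U \<and> is_section T U s"
    and sm: "\<And>U s. mopen \<A> U \<Longrightarrow> is_section S U s \<Longrightarrow> smooth_sec S U s \<longleftrightarrow> smooth_sec T U (\<lambda>x. \<Phi> x (s x))"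
    and cong: "\<And>U s s'. smooth_sec T U s \<Longrightarrow> (\<And>x. x \<in> U \<Longrightarrow> s x = s' x) \<Longrightarrow> smooth_sec T U s'"
  shows "is_vb \<A> T"
proof -
  define \<Psi> where "\<Psi> x = inv_into (carr (fib S x)) (\<Phi> x)" for x
  have lin: "linear_map (fib S m) (fib T m) (\<Phi> m)" and bij: "bij_betw (\<Phi> m) (carr (fib S m)) (carr (fib T m))"
    if "m \<in> points \<A>" for m using iso[OF that] unfolding linear_iso_def by auto
  have \<Psi>: "\<Psi> m v \<in> carr (fib S m)" "\<Phi> m (\<Psi> m v) = v" if "m \<in> points \<A>" "v \<in> carr (fib T m)" for m v
    using bij[OF that(1)] that(2) unfolding \<Psi>_def by (auto simp: bij_betw_def intro: inv_into_into f_inv_into_f)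
  have \<Psi>': "\<Psi> m (\<Phi> m v) = v" if "m \<in> points \<A>" "v \<in> carr (fib S m)" for m v
    using bij[OF that(1)] that(2) unfolding \<Psi>_def by (auto simp: bij_betw_def)
  have sec\<Psi>: "is_section S U (\<lambda>x. \<Psi> x (s x))" if "mopen \<A> U" "is_section T U s" for U s
    using that \<Psi> mopen_subset_points[OF that(1)] unfolding is_section_def by blast
  have sm\<Psi>: "smooth_sec T U s \<longleftrightarrow> smooth_sec S U (\<lambda>x. \<Psi> x (s x))" if "mopen \<A> U" "is_section T U s" for U s
  proof -
    have eq: "\<Phi> x (\<Psi> x (s x)) = s x" if "x \<in> U" for x
      using \<Psi>(2) mopen_subset_points[OF \<open>mopen \<A> U\<close>] \<open>is_section T U s\<close> that unfolding is_section_def by blast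
    have "smooth_sec T U s \<longleftrightarrow> smooth_sec T U (\<lambda>x. \<Phi> x (\<Psi> x (s x)))"
    proof
      assume "smooth_sec T U s"
      then show "smooth_sec T U (\<lambda>x. \<Phi> x (\<Psi> x (s x)))" by (rule cong) (simp add: eq)
    next
      assume "smooth_sec T U (\<lambda>x. \<Phi> x (\<Psi> x (s x)))"
      then show "smooth_sec T U s" by (rule cong) (simp add: eq)
    qed
    then show ?thesis using sm[OF that(1) sec\<Psi>[OF that]] by simp
  qed
  have locS: "\<And>U s. mopen \<A> U \<Longrightarrow> smooth_sec S U s \<longleftrightarrow> (\<forall>x\<in>U. \<exists>V. x \<in> V \<and> V \<subseteq> U \<and> smooth_sec S V s)"
    and realS: "\<And>m. m \<in> points \<A> \<Longrightarrow> real_vs (fib S m)"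
    using S unfolding is_vb_def by blast+
  have locT: "smooth_sec T U s \<longleftrightarrow> (\<forall>x\<in>U. \<exists>V. x \<in> V \<and> V \<subseteq> U \<and> smooth_sec T V s)" if U: "mopen \<A> U" for U s
  proof
    assume R: "\<forall>x\<in>U. \<exists>V. x \<in> V \<and> V \<subseteq> U \<and> smooth_sec T V s"
    have s: "is_section T U s" unfolding is_section_def
    proof
      fix x assume "x \<in> U"
      then obtain V where V: "x \<in> V" "smooth_sec T V s" using bspec[OF R] by blast
      then show "s x \<in> carr (fib T x)" using sec[OF V(2)] unfolding is_section_def by blast
    qed
    have "\<exists>V. x \<in> V \<and> V \<subseteq> U \<and> smooth_sec S V (\<lambda>x. \<Psi> x (s x))" if xU: "x \<in> U" for x
    proof -
      obtain V where V: "x \<in> V" "V \<subseteq> U" "smooth_sec T V s" using bspec[OF R xU] by (elim exE conjE)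
      then have "smooth_sec S V (\<lambda>x. \<Psi> x (s x))" using sm\<Psi>[of V s] sec[OF V(3)] by simp
      then show ?thesis using V by (intro exI[of _ V] conjI)
    qed
    then have "smooth_sec S U (\<lambda>x. \<Psi> x (s x))" using locS[OF U] by simp
    then show "smooth_sec T U s" using sm\<Psi>[OF U s] by simp
  next
    assume L: "smooth_sec T U s"
    show "\<forall>x\<in>U. \<exists>V. x \<in> V \<and> V \<subseteq> U \<and> smooth_sec T V s"
      by (intro ballI exI[of _ U] conjI L) auto
  qed
  have fr: "smooth_frame \<A> T U k (\<lambda>i x. \<Phi> x (e i x))" if f: "smooth_frame \<A> S U k e" and U: "mopen \<A> U" for U k e
    unfolding smooth_frame_def
  proof (intro conjI allI impI ballI)
    have f1: "\<And>i. i < k \<Longrightarrow> is_section S U (e i)"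
      and f2: "\<And>x v. x \<in> U \<Longrightarrow> v \<in> carr (fib S x) \<Longrightarrow>
        \<exists>!c. c \<in> extensional {..<k} \<and> v = lincomb (fib S x) c (\<lambda>i. e i x) k"
      and f3: "\<And>V s. mopen \<A> V \<and> V \<subseteq> U \<and> is_section S V s \<Longrightarrow>
        smooth_sec S V s \<longleftrightarrow> (\<exists>c. (\<forall>i<k. smooth_fun \<A> V (c i)) \<and>
               (\<forall>x\<in>V. s x = lincomb (fib S x) (\<lambda>i. c i x) (\<lambda>i. e i x) k))"
      using f unfolding smooth_frame_def by simp_all
    have eS: "e i x \<in> carr (fib S x)" if "i < k" "x \<in> U" for i x
      using f1[OF that(1)] that(2) unfolding is_section_def by blast
    have UA: "x \<in> points \<A>" if "x \<in> U" for x using mopen_subset_points[OF U] that by blast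
    have lc: "\<Phi> x (lincomb (fib S x) c (\<lambda>i. e i x) k) = lincomb (fib T x) c (\<lambda>i. \<Phi> x (e i x)) k" if "x \<in> U" for x c
      by (rule linear_map_lincomb[OF realS real lin]) (use that UA eS in auto)
    have lS: "lincomb (fib S x) c (\<lambda>i. e i x) k \<in> carr (fib S x)" if "x \<in> U" for x c
      by (rule lincomb_closed[OF realS]) (use that UA eS in auto)
    have lT: "v = lincomb (fib T x) c (\<lambda>i. \<Phi> x (e i x)) k \<longleftrightarrow> \<Psi> x v = lincomb (fib S x) c (\<lambda>i. e i x) k"
      if "x \<in> U" "v \<in> carr (fib T x)" for x v c
    proof
      assume "v = lincomb (fib T x) c (\<lambda>i. \<Phi> x (e i x)) k"
      then have "v = \<Phi> x (lincomb (fib S x) c (\<lambda>i. e i x) k)" using lc[OF that(1), of c] by simp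
      then show "\<Psi> x v = lincomb (fib S x) c (\<lambda>i. e i x) k" using \<Psi>'[OF UA[OF that(1)] lS[OF that(1)], of c] by simp
    next
      assume "\<Psi> x v = lincomb (fib S x) c (\<lambda>i. e i x) k"
      then have "\<Phi> x (\<Psi> x v) = lincomb (fib T x) c (\<lambda>i. \<Phi> x (e i x)) k" using lc[OF that(1), of c] by simp
      then show "v = lincomb (fib T x) c (\<lambda>i. \<Phi> x (e i x)) k" using \<Psi>(2)[OF UA[OF that(1)] that(2)] by simp
    qed
    show "is_section T U (\<lambda>x. \<Phi> x (e i x))" if "i < k" for i
      unfolding is_section_def using linear_mapD(1)[OF lin] UA eS[OF that] by blast
    show "\<exists>!c. c \<in> extensional {..<k} \<and> v = lincomb (fib T x) c (\<lambda>i. \<Phi> x (e i x)) k"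
      if "x \<in> U" "v \<in> carr (fib T x)" for x v
      unfolding lT[OF that] by (rule f2[OF that(1) \<Psi>(1)[OF UA[OF that(1)] that(2)]])
    show "smooth_sec T V s \<longleftrightarrow> (\<exists>c. (\<forall>i<k. smooth_fun \<A> V (c i)) \<and>
               (\<forall>x\<in>V. s x = lincomb (fib T x) (\<lambda>i. c i x) (\<lambda>i. \<Phi> x (e i x)) k))"
      if "mopen \<A> V \<and> V \<subseteq> U \<and> is_section T V s" for V s
    proof -
      have "smooth_sec T V s \<longleftrightarrow> smooth_sec S V (\<lambda>x. \<Psi> x (s x))" using that sm\<Psi>[of V s] by blast
      also have "\<dots> \<longleftrightarrow> (\<exists>c. (\<forall>i<k. smooth_fun \<A> V (c i)) \<and>
               (\<forall>x\<in>V. \<Psi> x (s x) = lincomb (fib S x) (\<lambda>i. c i x) (\<lambda>i. e i x) k))"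
        by (rule f3) (use that sec\<Psi>[of V s] in blast)
      also have "\<dots> \<longleftrightarrow> (\<exists>c. (\<forall>i<k. smooth_fun \<A> V (c i)) \<and>
               (\<forall>x\<in>V. s x = lincomb (fib T x) (\<lambda>i. c i x) (\<lambda>i. \<Phi> x (e i x)) k))"
      proof -
        have "s x = lincomb (fib T x) (\<lambda>i. c i x) (\<lambda>i. \<Phi> x (e i x)) k \<longleftrightarrow>
          \<Psi> x (s x) = lincomb (fib S x) (\<lambda>i. c i x) (\<lambda>i. e i x) k" if "x \<in> V" for x c
          using lT[of x "s x" "\<lambda>i. c i x"] \<open>mopen \<A> V \<and> V \<subseteq> U \<and> is_section T V s\<close> that
          unfolding is_section_def by blast
        then show ?thesis by simp
      qed
      finally show ?thesis .
    qed
  qed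
  have "\<exists>k. \<forall>m\<in>points \<A>. \<exists>U e. mopen \<A> U \<and> m \<in> U \<and> smooth_frame \<A> S U k e"
    using S unfolding is_vb_def by (elim conjE)
  then obtain k where k: "\<forall>m\<in>points \<A>. \<exists>U e. mopen \<A> U \<and> m \<in> U \<and> smooth_frame \<A> S U k e" by (elim exE)
  have k': "\<forall>m\<in>points \<A>. \<exists>U e. mopen \<A> U \<and> m \<in> U \<and> smooth_frame \<A> T U k e"
  proof
    fix m assume "m \<in> points \<A>"
    from bspec[OF k this] obtain U e where *: "mopen \<A> U" "m \<in> U" "smooth_frame \<A> S U k e" by (elim exE conjE)
    show "\<exists>U e. mopen \<A> U \<and> m \<in> U \<and> smooth_frame \<A> T U k e"
      by (rule exI[of _ U], rule exI[of _ "\<lambda>i x. \<Phi> x (e i x)"]) (intro conjI * fr)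
  qed
  show ?thesis
    unfolding is_vb_def
  proof (intro conjI)
    show "\<forall>m\<in>points \<A>. real_vs (fib T m)" using real by blast
    show "\<forall>U s. smooth_sec T U s \<longrightarrow> mopen \<A> U \<and> is_section T U s" using sec by blast
    show "\<forall>U s. mopen \<A> U \<longrightarrow> smooth_sec T U s = (\<forall>x\<in>U. \<exists>V. x \<in> V \<and> V \<subseteq> U \<and> smooth_sec T V s)"
      using locT by (intro allI impI)
    show "\<exists>k. \<forall>m\<in>points \<A>. \<exists>U e. mopen \<A> U \<and> m \<in> U \<and> smooth_frame \<A> T U k e"
      using k' by (rule exI)
  qed
qed

section \<open>Fibres of the two bundles and their pairing\<close>

text \<open>The function \<open>\<sigma>\<close> on generators, extended linearly and induced on the quotient.\<close>

definition cls_pairing :: "('d \<Rightarrow>\<^sub>0 real) set \<Rightarrow> ('d \<Rightarrow> real) \<Rightarrow> real" where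
  "cls_pairing \<omega> \<sigma> = induced (lin_ext \<sigma>) \<omega>"

context dvb
begin

lemma CD_simps: "carr (CD_fib D m) = coset (span (dvb_rel D m)) ` free_on (slice D m)"
  "vzero (CD_fib D m) = coset (span (dvb_rel D m)) 0"
  "vadd (CD_fib D m) (coset (span (dvb_rel D m)) p) (coset (span (dvb_rel D m)) q) = coset (span (dvb_rel D m)) (p + q)"
  "vscl (CD_fib D m) r (coset (span (dvb_rel D m)) p) = coset (span (dvb_rel D m)) (r *\<^sub>R p)"
  unfolding CD_fib_def by (rule quot_vs_simps[OF subspace_span])+

lemma real_vs_CD: "real_vs (CD_fib D m)"
  unfolding CD_fib_def by (rule real_vs_quot[OF subspace_free_on subspace_span])

lemma cls_carr: "d \<in> slice D m \<Longrightarrow> cls D m d \<in> carr (CD_fib D m)"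
  unfolding cls_def CD_simps by (intro imageI gen_free_on)

lemma dvb_relI:
  assumes "x \<in> slice D m"
  shows "y \<in> slice D m \<Longrightarrow> qA x = qA y \<Longrightarrow> gen x + gen y - gen (addA x y) \<in> dvb_rel D m"
    "y \<in> slice D m \<Longrightarrow> qB x = qB y \<Longrightarrow> gen x + gen y - gen (addB x y) \<in> dvb_rel D m"
    "r *\<^sub>R gen x - gen (sclA r x) \<in> dvb_rel D m" "r *\<^sub>R gen x - gen (sclB r x) \<in> dvb_rel D m"
  unfolding dvb_rel_def using assms by blast+

lemma cls_linear:
  assumes "x \<in> slice D m"
  shows "y \<in> slice D m \<Longrightarrow> qA x = qA y \<Longrightarrow> cls D m (addA x y) = vadd (CD_fib D m) (cls D m x) (cls D m y)"
    "y \<in> slice D m \<Longrightarrow> qB x = qB y \<Longrightarrow> cls D m (addB x y) = vadd (CD_fib D m) (cls D m x) (cls D m y)"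
    "cls D m (sclA r x) = vscl (CD_fib D m) r (cls D m x)"
    "cls D m (sclB r x) = vscl (CD_fib D m) r (cls D m x)"
proof -
  have eq: "coset (span (dvb_rel D m)) q = coset (span (dvb_rel D m)) p" if "p - q \<in> dvb_rel D m" for p q
    using span_base[OF that] coset_eq_iff[OF subspace_span, of "dvb_rel D m" p q] by auto
  show "y \<in> slice D m \<Longrightarrow> qA x = qA y \<Longrightarrow> cls D m (addA x y) = vadd (CD_fib D m) (cls D m x) (cls D m y)"
    "y \<in> slice D m \<Longrightarrow> qB x = qB y \<Longrightarrow> cls D m (addB x y) = vadd (CD_fib D m) (cls D m x) (cls D m y)"
    "cls D m (sclA r x) = vscl (CD_fib D m) r (cls D m x)"
    "cls D m (sclB r x) = vscl (CD_fib D m) r (cls D m x)"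
    unfolding cls_def CD_simps using eq[OF dvb_relI(1)[OF assms]] eq[OF dvb_relI(2)[OF assms]]
      eq[OF dvb_relI(3)[OF assms]] eq[OF dvb_relI(4)[OF assms]] by simp_all
qed

lemma CD_linear_map:
  assumes f: "linear_map (CD_fib D m) type_vs f" and p: "p \<in> free_on (slice D m)"
  shows "f (coset (span (dvb_rel D m)) p) = lin_ext (\<lambda>d. f (cls D m d)) p"
proof -
  let ?c = "coset (span (dvb_rel D m))" and ?l = "lin_ext (\<lambda>d. f (cls D m d))"
  let ?G = "{p \<in> free_on (slice D m). f (?c p) = ?l p}"
  have fD: "f (?c (p + q)) = f (?c p) + f (?c q)" "f (?c (r *\<^sub>R p)) = r *\<^sub>R f (?c p)"
    if "p \<in> free_on (slice D m)" "q \<in> free_on (slice D m)" for p q r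
    using linear_mapD(2)[OF f, of "?c p" "?c q"] linear_mapD(3)[OF f, of "?c p" r] that
    unfolding CD_simps type_vs_simps by auto
  have "subspace ?G"
  proof (rule subspaceI)
    have "0 \<in> free_on (slice D m)" by (rule subspace_0[OF subspace_free_on])
    moreover have "?l 0 = 0" by (rule linear_0[OF linear_lin_ext])
    ultimately show "0 \<in> ?G" using fD(2)[of 0 0 0] by simp
    show "p + q \<in> ?G" if "p \<in> ?G" "q \<in> ?G" for p q
      using that fD(1)[of p q] subspace_add[OF subspace_free_on] by (auto simp: lin_ext_add)
    show "r *\<^sub>R p \<in> ?G" if "p \<in> ?G" for r p
      using that fD(2)[of p p r] subspace_scale[OF subspace_free_on] by (auto simp: lin_ext_scaleR)
  qed
  moreover have "gen ` slice D m \<subseteq> ?G" by (auto intro: gen_free_on simp: cls_def)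
  ultimately have "span (gen ` slice D m) \<subseteq> ?G" by (intro span_minimal)
  then show ?thesis using p unfolding free_on_span by blast
qed

lemma XD_simps: "carr (XD_fib D m) = {\<sigma> \<in> extensional (slice D m). double_linear D m \<sigma>}"
  "vzero (XD_fib D m) = restrict (\<lambda>x. 0) (slice D m)"
  "vadd (XD_fib D m) f g = restrict (\<lambda>x. f x + g x) (slice D m)"
  "vscl (XD_fib D m) r f = restrict (\<lambda>x. r * f x) (slice D m)"
  unfolding XD_fib_def fun_vs_def by auto

lemma double_linear_cong:
  assumes "double_linear D m \<sigma>" "\<And>x. x \<in> slice D m \<Longrightarrow> \<sigma> x = \<rho> x"
  shows "double_linear D m \<rho>"
  using assms(1) unfolding double_linear_def by (simp add: assms(2)[symmetric] slice_closed)

lemma double_linear_restrict: "double_linear D m \<sigma> \<Longrightarrow> double_linear D m (restrict \<sigma> (slice D m))"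
  by (rule double_linear_cong) auto

lemma restrict_XD: "double_linear D m \<sigma> \<Longrightarrow> restrict \<sigma> (slice D m) \<in> carr (XD_fib D m)"
  unfolding XD_simps using double_linear_restrict by auto

lemma double_linear_add: "double_linear D m \<sigma> \<Longrightarrow> double_linear D m \<rho> \<Longrightarrow> double_linear D m (\<lambda>x. \<sigma> x + \<rho> x)"
  and double_linear_scale: "double_linear D m \<sigma> \<Longrightarrow> double_linear D m (\<lambda>x. r * \<sigma> x)"
  and double_linear_const0: "double_linear D m (\<lambda>x. 0)"
  unfolding double_linear_def by (auto simp: algebra_simps)

lemma double_linear_sum: "(\<And>i. i \<in> I \<Longrightarrow> double_linear D m (\<sigma> i)) \<Longrightarrow> double_linear D m (\<lambda>x. \<Sum>i\<in>I. \<sigma> i x)"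
  by (induction I rule: infinite_finite_induct) (auto intro: double_linear_add double_linear_const0)

lemma real_vs_XD: "real_vs (XD_fib D m)"
  unfolding XD_fib_def
  by (rule real_vs_fun_vs) (auto intro: double_linear_restrict double_linear_add double_linear_scale double_linear_const0)

lemma XD_ext: "\<sigma> \<in> carr (XD_fib D m) \<Longrightarrow> \<rho> \<in> carr (XD_fib D m) \<Longrightarrow> (\<And>d. d \<in> slice D m \<Longrightarrow> \<sigma> d = \<rho> d) \<Longrightarrow> \<sigma> = \<rho>"
  unfolding XD_simps by (auto intro: extensionalityI)

lemma cls_pairing_coset:
  assumes "double_linear D m \<sigma>"
  shows "cls_pairing (coset (span (dvb_rel D m)) p) \<sigma> = lin_ext \<sigma> p"
  unfolding cls_pairing_def
proof (rule induced_linear_coset[OF linear_lin_ext])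
  show "lin_ext \<sigma> n = 0" if "n \<in> dvb_rel D m" for n
    using that assms unfolding dvb_rel_def double_linear_def
    by (auto simp: lin_ext_add lin_ext_diff lin_ext_scaleR)
qed

lemma cls_pairing_cls: "double_linear D m \<sigma> \<Longrightarrow> cls_pairing (cls D m d) \<sigma> = \<sigma> d"
  unfolding cls_def by (simp add: cls_pairing_coset)

lemma cls_pairing_bilinear: "bilinear_form (CD_fib D m) (XD_fib D m) cls_pairing"
  unfolding bilinear_form_def linear_map_def type_vs_simps
proof (intro conjI ballI allI)
  fix \<sigma> assume \<sigma>: "\<sigma> \<in> carr (XD_fib D m)"
  then have dl: "double_linear D m \<sigma>" unfolding XD_simps by blast
  fix \<omega> r assume \<omega>: "\<omega> \<in> carr (CD_fib D m)"
  then obtain p where p: "\<omega> = coset (span (dvb_rel D m)) p" "p \<in> free_on (slice D m)" unfolding CD_simps by blast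
  show "cls_pairing (vscl (CD_fib D m) r \<omega>) \<sigma> = r *\<^sub>R cls_pairing \<omega> \<sigma>"
    unfolding p CD_simps cls_pairing_coset[OF dl] by (rule lin_ext_scaleR)
  show "cls_pairing \<omega> (vscl (XD_fib D m) r \<sigma>) = r *\<^sub>R cls_pairing \<omega> \<sigma>"
    unfolding p(1) XD_simps cls_pairing_coset[OF dl] cls_pairing_coset[OF double_linear_restrict[OF double_linear_scale[OF dl]]]
      lin_ext_fun_scaleR[symmetric] by (rule lin_ext_cong[OF p(2)]) simp
  show "cls_pairing (vadd (CD_fib D m) \<omega> \<omega>') \<sigma> = cls_pairing \<omega> \<sigma> + cls_pairing \<omega>' \<sigma>"
    if \<omega>': "\<omega>' \<in> carr (CD_fib D m)" for \<omega>'
  proof -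
    obtain q where q: "\<omega>' = coset (span (dvb_rel D m)) q" using \<omega>' unfolding CD_simps by blast
    show ?thesis unfolding p q CD_simps cls_pairing_coset[OF dl] by (rule lin_ext_add)
  qed
  show "cls_pairing \<omega> (vadd (XD_fib D m) \<sigma> \<rho>) = cls_pairing \<omega> \<sigma> + cls_pairing \<omega> \<rho>"
    if "\<rho> \<in> carr (XD_fib D m)" for \<rho>
  proof -
    have dl': "double_linear D m \<rho>" using that unfolding XD_simps by blast
    show ?thesis
      unfolding p(1) XD_simps cls_pairing_coset[OF dl] cls_pairing_coset[OF dl']
        cls_pairing_coset[OF double_linear_restrict[OF double_linear_add[OF dl dl']]]
        lin_ext_fun_add[symmetric] by (rule lin_ext_cong[OF p(2)]) simp
  qed
qed simp_all

lemma cls_pairing_unique: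
  assumes b: "bilinear_form (CD_fib D m) (XD_fib D m) b"
    and eq: "\<And>d \<sigma>. d \<in> slice D m \<Longrightarrow> \<sigma> \<in> carr (XD_fib D m) \<Longrightarrow> b (cls D m d) \<sigma> = \<sigma> d"
    and \<omega>: "\<omega> \<in> carr (CD_fib D m)" and \<sigma>: "\<sigma> \<in> carr (XD_fib D m)"
  shows "b \<omega> \<sigma> = cls_pairing \<omega> \<sigma>"
proof -
  obtain p where p: "\<omega> = coset (span (dvb_rel D m)) p" "p \<in> free_on (slice D m)" using \<omega> unfolding CD_simps by blast
  have dl: "double_linear D m \<sigma>" using \<sigma> unfolding XD_simps by blast
  have "linear_map (CD_fib D m) type_vs (\<lambda>\<omega>. b \<omega> \<sigma>)" using b \<sigma> unfolding bilinear_form_def by blast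
  then have "b \<omega> \<sigma> = lin_ext (\<lambda>d. b (cls D m d) \<sigma>) p" unfolding p(1) using CD_linear_map p(2) by blast
  also have "\<dots> = lin_ext \<sigma> p" using eq \<sigma> by (intro lin_ext_cong[OF p(2)])
  finally show ?thesis unfolding p(1) cls_pairing_coset[OF dl] .
qed

text \<open>A vector outside the span of the relations is separated from them by a linear functional, whose
  values on generators are a double-linear function.\<close>

lemma cls_pairing_nondegenerate: "nondegenerate (CD_fib D m) (XD_fib D m) cls_pairing"
  unfolding nondegenerate_def
proof (intro conjI ballI impI)
  fix \<omega> assume \<omega>: "\<omega> \<in> carr (CD_fib D m)" and 0: "\<forall>\<sigma>\<in>carr (XD_fib D m). cls_pairing \<omega> \<sigma> = 0"
  obtain p where p: "\<omega> = coset (span (dvb_rel D m)) p" "p \<in> free_on (slice D m)" using \<omega> unfolding CD_simps by blast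
  have "p \<in> span (dvb_rel D m)"
  proof (rule ccontr)
    assume "p \<notin> span (dvb_rel D m)"
    then obtain h :: "('d \<Rightarrow>\<^sub>0 real) \<Rightarrow> real" where h: "linear h" "\<And>n. n \<in> span (dvb_rel D m) \<Longrightarrow> h n = 0" "h p = 1"
      using linear_functional_separating by blast
    have hR: "h a = h b" if "a - b \<in> dvb_rel D m" for a b
      using h(2)[OF span_base[OF that]] linear_diff[OF h(1)] by simp
    have dl: "double_linear D m (\<lambda>d. h (gen d))"
      unfolding double_linear_def
    proof (intro conjI ballI allI impI)
      fix x y assume *: "x \<in> slice D m" "y \<in> slice D m" "qA x = qA y"
      have "h (gen x + gen y) = h (gen (addA x y))" by (rule hR[OF dvb_relI(1)[OF *]])
      then show "h (gen (addA x y)) = h (gen x) + h (gen y)" using linear_add[OF h(1)] by simp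
    next
      fix x y assume *: "x \<in> slice D m" "y \<in> slice D m" "qB x = qB y"
      have "h (gen x + gen y) = h (gen (addB x y))" by (rule hR[OF dvb_relI(2)[OF *]])
      then show "h (gen (addB x y)) = h (gen x) + h (gen y)" using linear_add[OF h(1)] by simp
    next
      fix r x assume x: "x \<in> slice D m"
      have "h (r *\<^sub>R gen x) = h (gen (sclA r x))" "h (r *\<^sub>R gen x) = h (gen (sclB r x))"
        using hR[OF dvb_relI(3)[OF x]] hR[OF dvb_relI(4)[OF x]] by auto
      then show "h (gen (sclA r x)) = r * h (gen x)" "h (gen (sclB r x)) = r * h (gen x)"
        using linear_cmul[OF h(1)] by simp_all
    qed
    have "cls_pairing \<omega> (restrict (\<lambda>d. h (gen d)) (slice D m)) = lin_ext (restrict (\<lambda>d. h (gen d)) (slice D m)) p"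
      unfolding p(1) by (rule cls_pairing_coset[OF double_linear_restrict[OF dl]])
    also have "\<dots> = lin_ext (\<lambda>d. h (gen d)) p" by (rule lin_ext_cong[OF p(2)]) simp
    also have "\<dots> = 1" using linear_eq_lin_ext[OF h(1), of p] h(3) by simp
    finally show False using 0 restrict_XD[OF dl] by simp
  qed
  then show "\<omega> = vzero (CD_fib D m)" unfolding p CD_simps using coset_eq_iff[OF subspace_span, of _ p 0] by simp
next
  fix \<sigma> assume \<sigma>: "\<sigma> \<in> carr (XD_fib D m)" and 0: "\<forall>\<omega>\<in>carr (CD_fib D m). cls_pairing \<omega> \<sigma> = 0"
  then have "\<sigma> d = 0" if "d \<in> slice D m" for d
    using cls_pairing_cls[of m \<sigma> d] cls_carr[OF that] unfolding XD_simps by auto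
  then show "\<sigma> = vzero (XD_fib D m)"
    using \<sigma> unfolding XD_simps by (auto intro!: extensionalityI)
qed

text \<open>A double-linear function is the same as a linear functional on \<open>\<CC>(D)\<close>.\<close>

lemma XD_dual_iso: "linear_iso (XD_fib D m) (dual_vs (CD_fib D m)) (\<lambda>\<sigma>. restrict (\<lambda>\<omega>. cls_pairing \<omega> \<sigma>) (carr (CD_fib D m)))"
proof -
  let ?\<Phi> = "\<lambda>\<sigma>. restrict (\<lambda>\<omega>. cls_pairing \<omega> \<sigma>) (carr (CD_fib D m))"
  have bil: "linear_map (CD_fib D m) type_vs (\<lambda>\<omega>. cls_pairing \<omega> \<sigma>)" if "\<sigma> \<in> carr (XD_fib D m)" for \<sigma>
    using cls_pairing_bilinear that unfolding bilinear_form_def by blast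
  have bil': "linear_map (XD_fib D m) type_vs (cls_pairing \<omega>)" if "\<omega> \<in> carr (CD_fib D m)" for \<omega>
    using cls_pairing_bilinear that unfolding bilinear_form_def by blast
  have cl: "?\<Phi> \<sigma> \<in> carr (dual_vs (CD_fib D m))" if "\<sigma> \<in> carr (XD_fib D m)" for \<sigma>
    using bil[OF that] real_vsD(2,3)[OF real_vs_CD] unfolding dual_vs_simps linear_map_def by auto
  have "linear_map (XD_fib D m) (dual_vs (CD_fib D m)) ?\<Phi>"
    unfolding linear_map_def
  proof (intro conjI ballI allI)
    fix \<sigma> \<rho> r assume \<sigma>: "\<sigma> \<in> carr (XD_fib D m)"
    show "?\<Phi> (vscl (XD_fib D m) r \<sigma>) = vscl (dual_vs (CD_fib D m)) r (?\<Phi> \<sigma>)"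
      unfolding dual_vs_simps using linear_mapD(3)[OF bil' \<sigma>] by (auto simp: type_vs_simps restrict_def)
    show "?\<Phi> (vadd (XD_fib D m) \<sigma> \<rho>) = vadd (dual_vs (CD_fib D m)) (?\<Phi> \<sigma>) (?\<Phi> \<rho>)" if "\<rho> \<in> carr (XD_fib D m)"
      unfolding dual_vs_simps using linear_mapD(2)[OF bil' \<sigma> that] by (auto simp: type_vs_simps restrict_def)
  qed (rule cl)
  moreover have "bij_betw ?\<Phi> (carr (XD_fib D m)) (carr (dual_vs (CD_fib D m)))"
  proof (rule bij_betwI')
    fix \<sigma> \<rho> assume *: "\<sigma> \<in> carr (XD_fib D m)" "\<rho> \<in> carr (XD_fib D m)"
    have "\<sigma> = \<rho>" if eq: "?\<Phi> \<sigma> = ?\<Phi> \<rho>"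
    proof (rule XD_ext[OF *])
      fix d assume d: "d \<in> slice D m"
      have "?\<Phi> \<sigma> (cls D m d) = ?\<Phi> \<rho> (cls D m d)" using eq by simp
      then show "\<sigma> d = \<rho> d" using cls_carr[OF d] * cls_pairing_cls[of m _ d] unfolding XD_simps by simp
    qed
    then show "?\<Phi> \<sigma> = ?\<Phi> \<rho> \<longleftrightarrow> \<sigma> = \<rho>" by blast
  next
    fix \<xi> assume "\<xi> \<in> carr (dual_vs (CD_fib D m))"
    then have \<xi>: "\<xi> \<in> extensional (carr (CD_fib D m))" "linear_map (CD_fib D m) type_vs \<xi>"
      unfolding dual_vs_simps by auto
    have dl: "double_linear D m (\<lambda>d. \<xi> (cls D m d))"
      unfolding double_linear_def
      using linear_mapD(2,3)[OF \<xi>(2) cls_carr] cls_carr by (simp add: cls_linear type_vs_simps)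
    have "\<xi> = ?\<Phi> (restrict (\<lambda>d. \<xi> (cls D m d)) (slice D m))"
    proof (rule extensionalityI[OF \<xi>(1)])
      fix \<omega> assume \<omega>: "\<omega> \<in> carr (CD_fib D m)"
      then obtain p where p: "\<omega> = coset (span (dvb_rel D m)) p" "p \<in> free_on (slice D m)" unfolding CD_simps by blast
      have "\<xi> \<omega> = lin_ext (\<lambda>d. \<xi> (cls D m d)) p" unfolding p(1) by (rule CD_linear_map[OF \<xi>(2) p(2)])
      also have "\<dots> = lin_ext (restrict (\<lambda>d. \<xi> (cls D m d)) (slice D m)) p" by (rule lin_ext_cong[OF p(2)]) simp
      also have "\<dots> = cls_pairing \<omega> (restrict (\<lambda>d. \<xi> (cls D m d)) (slice D m))"
        unfolding p(1) by (rule cls_pairing_coset[OF double_linear_restrict[OF dl], symmetric])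
      finally show "\<xi> \<omega> = ?\<Phi> (restrict (\<lambda>d. \<xi> (cls D m d)) (slice D m)) \<omega>" using \<omega> by simp
    qed simp
    then show "\<exists>\<sigma>\<in>carr (XD_fib D m). \<xi> = ?\<Phi> \<sigma>" using restrict_XD[OF dl] by blast
  qed (rule cl)
  ultimately show ?thesis unfolding linear_iso_def by blast
qed

end

section \<open>Local frames\<close>

text \<open>For square matrices, \<open>A B = 1\<close> implies \<open>B A = 1\<close>: the rows \<open>w i\<close> of \<open>A\<close> are independent, hence a
  basis of the coordinate space, in which \<open>h j\<close> gives the coefficients.\<close>

lemma square_left_inverse:
  fixes A B :: "nat \<Rightarrow> nat \<Rightarrow> real"
  assumes AB: "\<And>i j. i < k \<Longrightarrow> j < k \<Longrightarrow> (\<Sum>l<k. A i l * B l j) = (if i = j then 1 else 0)"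
    and ij: "i < k" "j < k"
  shows "(\<Sum>l<k. B i l * A l j) = (if i = j then 1 else 0)"
proof -
  define w :: "nat \<Rightarrow> nat \<Rightarrow>\<^sub>0 real" where "w i = (\<Sum>l<k. A i l *\<^sub>R gen l)" for i
  define h where "h j = lin_ext (\<lambda>l. B l j)" for j
  have lh: "linear (h j)" for j unfolding h_def by (rule linear_lin_ext)
  have hw: "h j (w i) = (if i = j then 1 else 0)" if "i < k" "j < k" for i j
  proof -
    have "h j (w i) = (\<Sum>l<k. A i l * B l j)"
      unfolding w_def linear_sum[OF lh] linear_cmul[OF lh] by (simp add: h_def)
    then show ?thesis using AB that by simp
  qed
  have inj: "inj_on w {..<k}"
  proof (rule inj_onI)
    fix a b assume ab: "a \<in> {..<k}" "b \<in> {..<k}" "w a = w b"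
    have "h a (w a) = 1" "h a (w b) = (if b = a then 1 else 0)" using hw[of a a] hw[of b a] ab(1,2) by auto
    then show "a = b" unfolding ab(3) by (metis zero_neq_one)
  qed
  have w_span: "w ` {..<k} \<subseteq> span (gen ` {..<k})"
    unfolding w_def by (intro image_subsetI span_sum span_scale) (auto intro: span_base)
  have ind: "independent (w ` {..<k})"
    unfolding dependent_finite[OF finite_imageI[OF finite_lessThan]]
  proof
    assume "\<exists>u. (\<exists>v\<in>w ` {..<k}. u v \<noteq> 0) \<and> (\<Sum>v\<in>w ` {..<k}. u v *\<^sub>R v) = 0"
    then obtain u a where u: "(\<Sum>v\<in>w ` {..<k}. u v *\<^sub>R v) = 0" and a: "a \<in> {..<k}" "u (w a) \<noteq> 0" by blast
    have "0 = h a (\<Sum>v\<in>w ` {..<k}. u v *\<^sub>R v)" unfolding u by (rule linear_0[OF lh, symmetric])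
    also have "\<dots> = (\<Sum>b<k. u (w b) * h a (w b))"
      unfolding linear_sum[OF lh] sum.reindex[OF inj] by (simp add: linear_cmul[OF lh])
    also have "\<dots> = (\<Sum>b<k. if b = a then u (w b) else 0)" using hw[of _ a] a(1) by (intro sum.cong) simp_all
    also have "\<dots> = u (w a)" using a by simp
    finally show False using a by simp
  qed
  have sp: "gen l \<in> span (w ` {..<k})" if "l < k" for l
  proof (rule ccontr)
    assume n: "gen l \<notin> span (w ` {..<k})"
    then have n': "gen l \<notin> w ` {..<k}" by (rule contrapos_nn) (rule span_base)
    have "independent (insert (gen l) (w ` {..<k}))"
      unfolding independent_insert using ind n n' by simp
    moreover have "insert (gen l) (w ` {..<k}) \<subseteq> span (gen ` {..<k})"
      using w_span span_base[of "gen l" "gen ` {..<k}"] that by simp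
    ultimately have "card (insert (gen l) (w ` {..<k})) \<le> card ((gen :: nat \<Rightarrow> _) ` {..<k})"
      using independent_span_bound[OF finite_imageI[OF finite_lessThan]] by blast
    also have "\<dots> \<le> k" using card_image_le[of "{..<k}" "gen :: nat \<Rightarrow> _"] by simp
    finally show False using n' card_image[OF inj] by simp
  qed
  have "v = (\<Sum>l<k. h l v *\<^sub>R w l)" if "v \<in> span (w ` {..<k})" for v
  proof (rule linear_eq_on_span[of "\<lambda>v. v" "\<lambda>v. \<Sum>l<k. h l v *\<^sub>R w l" "w ` {..<k}"])
    show "linear (\<lambda>v. \<Sum>l<k. h l v *\<^sub>R w l)"
      by (rule linearI) (simp_all add: linear_add[OF lh] linear_cmul[OF lh] scaleR_left_distrib sum.distrib scaleR_sum_right)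
    fix v assume "v \<in> w ` {..<k}"
    then obtain a where a: "a < k" "v = w a" by auto
    have "(\<Sum>l<k. h l v *\<^sub>R w l) = (\<Sum>l<k. if l = a then w l else 0)"
      unfolding a(2) using hw[OF a(1)] by (intro sum.cong) auto
    then show "v = (\<Sum>l<k. h l v *\<^sub>R w l)" using a by simp
  qed (use that linear_ident in auto)
  from this[OF sp[OF ij(1)]] have g: "gen i = (\<Sum>l<k. B i l *\<^sub>R w l)" by (simp add: h_def)
  have "(if i = j then 1 else 0) = Poly_Mapping.lookup (gen i :: nat \<Rightarrow>\<^sub>0 real) j"
    by (simp add: lookup_single when_def)
  also have "\<dots> = (\<Sum>l<k. B i l * Poly_Mapping.lookup (w l) j)"
    unfolding g by (simp add: lookup_sum lookup_scaleR)
  also have "\<dots> = (\<Sum>l<k. B i l * A l j)"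
  proof (rule sum.cong)
    fix l
    have "Poly_Mapping.lookup (w l) j = (\<Sum>m<k. if m = j then A l m else 0)"
      unfolding w_def by (simp add: lookup_sum lookup_scaleR lookup_single when_def if_distrib cong: if_cong)
    then show "B i l * Poly_Mapping.lookup (w l) j = B i l * A l j" using ij by simp
  qed simp
  finally show ?thesis by simp
qed

context dvb
begin

lemma section_through:
  assumes d: "d \<in> slice D m"
  shows "\<exists>U t. mopen (M_atlas D) U \<and> m \<in> U \<and> msmooth_on U (M_atlas D) (D_atlas D) t \<and>
    (\<forall>x\<in>U. t x \<in> slice D x) \<and> t m = d"
proof -
  have d': "d \<in> T" "pA (qA d) = m" using d by (auto simp: mem_D_over)
  obtain V a where a: "mopen (M_atlas D) V" "m \<in> V" "a m = qA d" "msmooth_on V (M_atlas D) (tot_atlas (sideA D)) a"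
    "\<And>x. x \<in> V \<Longrightarrow> a x \<in> tot (sideA D)" "\<And>x. x \<in> V \<Longrightarrow> pA (a x) = x"
    using vb_section[OF vbs(1) projT(1)[OF d'(1)]] d' by auto
  obtain W s where s: "mopen (tot_atlas (sideA D)) W" "qA d \<in> W" "s (qA d) = d"
    "msmooth_on W (tot_atlas (sideA D)) (D_atlas D) s" "\<And>x. x \<in> W \<Longrightarrow> s x \<in> T" "\<And>x. x \<in> W \<Longrightarrow> qA (s x) = x"
    using vb_section[OF vbs(3) d'(1)] atlases by auto
  let ?U = "{x \<in> V. a x \<in> W}"
  have U: "mopen (M_atlas D) ?U" by (rule msmooth_on_preimage[OF compat(1,2) a(4) s(1)])
  have "msmooth_on ?U (M_atlas D) (tot_atlas (sideA D)) a" by (rule msmooth_on_subset[OF compat(1) a(4) U]) auto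
  then have "msmooth_on ?U (M_atlas D) (D_atlas D) (\<lambda>x. s (a x))"
    by (rule msmooth_on_compose[OF compat(1,2,4) _ s(4)]) auto
  then show ?thesis
    using U a(2,3,5,6) s(2,3,5,6) by (intro exI[of _ ?U] exI[of _ "\<lambda>x. s (a x)"]) (auto simp: mem_D_over)
qed

lemma smooth_projM: "mopen (M_atlas D) U \<Longrightarrow> msmooth_on (D_over D U) (D_atlas D) (M_atlas D) (projM D)"
proof -
  assume U: "mopen (M_atlas D) U"
  have "msmooth_on T (D_atlas D) (tot_atlas (sideA D)) qA" using vector_bundleD(6)[OF vbs(3)] atlases by simp
  then have "msmooth_on T (D_atlas D) (M_atlas D) (\<lambda>d. pA (qA d))"
    by (rule msmooth_on_compose[OF compat(4,2,1) _ vector_bundleD(6)[OF vbs(1)]]) (use projT in auto)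
  then have "msmooth_on (D_over D U) (D_atlas D) (M_atlas D) (\<lambda>d. pA (qA d))"
    by (rule msmooth_on_subset[OF compat(4) _ mopen_D_over[OF U]]) (auto simp: mem_D_over)
  then show ?thesis unfolding projM_def .
qed

lemma smooth_eval:
  assumes \<sigma>: "msmooth_on (D_over D U) (D_atlas D) vs_atlas \<sigma>" and t: "msmooth_on V (M_atlas D) (D_atlas D) t"
    and tV: "\<And>x. x \<in> V \<Longrightarrow> t x \<in> slice D x" and VU: "V \<subseteq> U"
  shows "smooth_fun (M_atlas D) V (\<lambda>x. \<sigma> (t x) :: real)"
  by (rule msmooth_on_compose[OF compat(1,4) compat_real t \<sigma>]) (use tV VU in \<open>auto simp: mem_D_over\<close>)

lemma smooth_pull_base:
  assumes "smooth_fun (M_atlas D) U f"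
  shows "smooth_fun (D_atlas D) (D_over D U) (\<lambda>d. f (projM D d) :: real)"
  by (rule msmooth_on_compose[OF compat(4,1) compat_real smooth_projM[OF msmooth_on_mopen[OF assms]] assms])
    (auto simp: D_over_def)

text \<open>Gauss--Jordan elimination with smooth functions as coefficients: functions \<open>s j\<close> that are dual to
  the sections \<open>t i\<close> at \<open>m0\<close> are changed into functions that are dual to them on a neighbourhood. After
  \<open>n\<close> steps duality to the first \<open>n\<close> sections holds, and nothing has changed at \<open>m0\<close>.\<close>

lemma frame_elimination:
  fixes k n :: nat
  assumes U: "mopen (M_atlas D) U" "m0 \<in> U"
    and t: "\<And>i. i < k \<Longrightarrow> msmooth_on U (M_atlas D) (D_atlas D) (t i)" "\<And>i x. i < k \<Longrightarrow> x \<in> U \<Longrightarrow> t i x \<in> slice D x"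
    and s: "\<And>i. i < k \<Longrightarrow> msmooth_on (D_over D U) (D_atlas D) vs_atlas (s i)" "\<And>i x. i < k \<Longrightarrow> x \<in> U \<Longrightarrow> double_linear D x (s i)"
    and delta: "\<And>i j. i < k \<Longrightarrow> j < k \<Longrightarrow> s j (t i m0) = (if i = j then 1 else (0::real))"
  shows "n \<le> k \<Longrightarrow> \<exists>U' s'. mopen (M_atlas D) U' \<and> m0 \<in> U' \<and> U' \<subseteq> U \<and>
    (\<forall>i<k. msmooth_on (D_over D U') (D_atlas D) vs_atlas (s' i) \<and> (\<forall>x\<in>U'. double_linear D x (s' i))) \<and>
    (\<forall>i<k. \<forall>j<k. s' j (t i m0) = (if i = j then 1 else (0::real))) \<and>
    (\<forall>i<n. \<forall>j<k. \<forall>x\<in>U'. s' j (t i x) = (if i = j then 1 else 0))"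
proof (induction n)
  case 0
  then show ?case using assms by (intro exI[of _ U] exI[of _ s]) auto
next
  case (Suc n)
  then have "n \<le> k" by simp
  from Suc.IH[OF this] obtain V r where V: "mopen (M_atlas D) V" "m0 \<in> V" "V \<subseteq> U"
    and r: "\<forall>i<k. msmooth_on (D_over D V) (D_atlas D) vs_atlas (r i) \<and> (\<forall>x\<in>V. double_linear D x (r i))"
      "\<forall>i<k. \<forall>j<k. r j (t i m0) = (if i = j then 1 else (0::real))"
      "\<forall>i<n. \<forall>j<k. \<forall>x\<in>V. r j (t i x) = (if i = j then 1 else 0)"
    by (elim exE conjE)
  have r1: "msmooth_on (D_over D V) (D_atlas D) vs_atlas (r i)" and r2: "x \<in> V \<Longrightarrow> double_linear D x (r i)" if "i < k" for i x
    using r(1) that by blast+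
  have r3: "r j (t i m0) = (if i = j then 1 else (0::real))" if "i < k" "j < k" for i j using r(2) that by blast
  have r4: "r j (t i x) = (if i = j then 1 else 0)" if "i < n" "j < k" "x \<in> V" for i j x using r(3) that by blast
  have n: "n < k" using Suc by simp
  have tV: "msmooth_on V (M_atlas D) (D_atlas D) (t n)"
    by (rule msmooth_on_subset[OF compat(1) t(1)[OF n] V(1,3)])
  have tn: "t n x \<in> slice D x" if "x \<in> V" for x using t(2)[OF n] that V(3) by blast
  have g: "smooth_fun (M_atlas D) V (\<lambda>x. r j (t n x))" if "j < k" for j
    by (rule smooth_eval[OF r1[OF that] tV tn]) auto
  let ?W = "{x \<in> V. r n (t n x) \<in> - {0}}"
  have W: "mopen (M_atlas D) ?W" by (rule msmooth_on_preimage[OF compat(1) compat_real g[OF n]]) (simp add: open_Compl)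
  have mW: "m0 \<in> ?W" using V r3[OF n n] by simp
  have gW: "smooth_fun (M_atlas D) ?W (\<lambda>x. r j (t n x))" if "j < k" for j
    by (rule msmooth_on_subset[OF compat(1) g[OF that] W]) auto
  have rW: "smooth_fun (D_atlas D) (D_over D ?W) (r j)" if "j < k" for j
    by (rule msmooth_on_subset[OF compat(4) r1[OF that] mopen_D_over[OF W]]) (auto simp: mem_D_over)
  \<comment> \<open>The new \<open>n\<close>-th function; the others are cleared at \<open>t n\<close> by subtracting a multiple of it.\<close>
  define p where "p d = inverse (r n (t n (projM D d))) * r n d" for d
  define q where "q j d = (if j = n then p d else r j d + (- 1) * (r j (t n (projM D d)) * p d))" for j d
  have p1: "smooth_fun (D_atlas D) (D_over D ?W) p"
    unfolding p_def
    by (intro msmooth_vs_mult[OF compat(4)] rW[OF n] smooth_pull_base[OF msmooth_vs_inverse[OF compat(1) gW[OF n]]]) auto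
  have q1: "smooth_fun (D_atlas D) (D_over D ?W) (q j)" if j: "j < k" for j
  proof (cases "j = n")
    case True
    then show ?thesis using p1 unfolding q_def by simp
  next
    case False
    have "smooth_fun (D_atlas D) (D_over D ?W) (\<lambda>d. r j d + (- 1) * (r j (t n (projM D d)) * p d))"
      by (intro msmooth_vs_add[OF compat(4) finite_dim_real] msmooth_vs_mult[OF compat(4)] rW[OF j] p1
          msmooth_vs_const[OF compat(4) finite_dim_real mopen_D_over[OF W]] smooth_pull_base[OF gW[OF j]])
    then show ?thesis using False unfolding q_def by simp
  qed
  have pr: "projM D d = x" if "d \<in> slice D x" for d x using that by (simp add: D_over_def)
  have p2: "double_linear D x p" if x: "x \<in> ?W" for x
    by (rule double_linear_cong[OF double_linear_scale[OF r2[OF n], of x "inverse (r n (t n x))"]])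
      (use x in \<open>auto simp: p_def pr\<close>)
  have q2: "double_linear D x (q j)" if x: "x \<in> ?W" and j: "j < k" for x j
  proof (cases "j = n")
    case True
    then show ?thesis using p2[OF x] unfolding q_def by simp
  next
    case False
    have "double_linear D x (\<lambda>d. r j d + (- r j (t n x)) * p d)"
      by (intro double_linear_add double_linear_scale p2[OF x] r2[OF j]) (use x in auto)
    then show ?thesis by (rule double_linear_cong) (auto simp: q_def pr False)
  qed
  have pv: "p (t i x) = (if i = n then 1 else 0)" if "x \<in> ?W" "i < Suc n \<or> x = m0 \<and> i < k" for i x
  proof -
    have i: "i < k" using that n by auto
    have "projM D (t i x) = x" using pr t(2)[OF i, of x] that V(3) by blast
    moreover have "r n (t i x) = 0" if "i \<noteq> n" using that r4[of i n x] r3[of i n] n i \<open>x \<in> ?W\<close> \<open>i < Suc n \<or> x = m0 \<and> i < k\<close> by auto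
    ultimately show ?thesis using that(1) unfolding p_def by auto
  qed
  have qv: "q j (t i x) = (if i = j then 1 else 0)" if x: "x \<in> ?W" and i: "i < Suc n \<or> x = m0 \<and> i < k" and j: "j < k" for i j x
  proof -
    have ik: "i < k" using i n by auto
    have P: "projM D (t i x) = x" using pr t(2)[OF ik, of x] x V(3) by blast
    have R: "r j (t i x) = (if i = j then 1 else 0)" if "i \<noteq> n \<or> x = m0"
      using that r4[of i j x] r3[of i j] i ik j x by auto
    show ?thesis unfolding q_def P pv[OF x i] using R x by auto
  qed
  show ?case
    using W mW V(3) q1 q2 qv
    by (intro exI[of _ ?W] exI[of _ q]) auto
qed

text \<open>Smooth sections \<open>t i\<close> of \<open>D \<rightarrow> M\<close> over \<open>U\<close> and smooth double-linear functions \<open>s i\<close> that are dual to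
  each other, the latter spanning the double-linear functions on every slice over \<open>U\<close>.\<close>

definition dual_frames :: "nat \<Rightarrow> 'm set \<Rightarrow> (nat \<Rightarrow> 'm \<Rightarrow> 'd) \<Rightarrow> (nat \<Rightarrow> 'd \<Rightarrow> real) \<Rightarrow> bool" where
  "dual_frames k U t s \<longleftrightarrow> mopen (M_atlas D) U \<and>
    (\<forall>i<k. msmooth_on U (M_atlas D) (D_atlas D) (t i) \<and> (\<forall>x\<in>U. t i x \<in> slice D x) \<and>
      smooth_fun (D_atlas D) (D_over D U) (s i) \<and> (\<forall>x\<in>U. double_linear D x (s i))) \<and>
    (\<forall>i<k. \<forall>j<k. \<forall>x\<in>U. s j (t i x) = (if i = j then 1 else (0::real))) \<and>
    (\<forall>x\<in>U. \<forall>\<sigma> d. double_linear D x \<sigma> \<and> d \<in> slice D x \<longrightarrow> \<sigma> d = (\<Sum>i<k. \<sigma> (t i x) * s i d))"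

text \<open>Extend dual bases at \<open>m0\<close> smoothly and make them dual nearby. That the resulting \<open>k\<close> functions
  still span at the neighbouring points follows from the existence there of dual bases with the same
  number \<open>k\<close> of elements, which is the rank of \<open>\<CC>(D)\<close> and of \<open>\<XX>(D)\<close>.\<close>

lemma local_dual_frames:
  assumes m0: "m0 \<in> points (M_atlas D)" and BA: "coord_basis (BA :: 'fa set) crdA" and BB: "coord_basis (BB :: 'fb set) crdB"
    and k: "k = card BA * card BB + (dim (UNIV :: 'fda set) - card BB)"
  shows "\<exists>U t s. m0 \<in> U \<and> dual_frames k U t s"
proof -
  obtain U s d where U: "mopen (M_atlas D) U" "m0 \<in> U"
    and s: "\<forall>i<k. msmooth_on (D_over D U) (D_atlas D) vs_atlas (s i) \<and> (\<forall>x\<in>U. double_linear D x (s i)) \<and> d i \<in> slice D m0"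
    and delta: "\<forall>i<k. \<forall>j<k. s j (d i) = (if i = j then 1 else (0::real))"
    using fibre_dual_basis[OF m0 BA BB k] by (elim exE conjE)
  have "\<forall>i\<in>{..<k}. \<exists>U t. mopen (M_atlas D) U \<and> m0 \<in> U \<and> msmooth_on U (M_atlas D) (D_atlas D) t \<and>
    (\<forall>x\<in>U. t x \<in> slice D x) \<and> t m0 = d i" using section_through s by simp
  from bchoice[OF this] obtain Ut where "\<forall>i\<in>{..<k}. \<exists>t. mopen (M_atlas D) (Ut i) \<and> m0 \<in> Ut i \<and>
    msmooth_on (Ut i) (M_atlas D) (D_atlas D) t \<and> (\<forall>x\<in>Ut i. t x \<in> slice D x) \<and> t m0 = d i" by (elim exE)
  from bchoice[OF this] obtain t where t: "\<forall>i\<in>{..<k}. mopen (M_atlas D) (Ut i) \<and> m0 \<in> Ut i \<and>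
    msmooth_on (Ut i) (M_atlas D) (D_atlas D) (t i) \<and> (\<forall>x\<in>Ut i. t i x \<in> slice D x) \<and> t i m0 = d i" by (elim exE)
  define V where "V = U \<inter> (\<Inter>i\<in>{..<k}. Ut i)"
  have V: "mopen (M_atlas D) V" unfolding V_def
    by (rule mopen_finite_Inter[OF compat(1)]) (use t U in auto)
  have mV: "m0 \<in> V" using U t unfolding V_def by auto
  have tV: "msmooth_on V (M_atlas D) (D_atlas D) (t i)" "\<And>x. x \<in> V \<Longrightarrow> t i x \<in> slice D x" if "i < k" for i
  proof -
    have "msmooth_on (Ut i) (M_atlas D) (D_atlas D) (t i)" using t that by blast
    then show "msmooth_on V (M_atlas D) (D_atlas D) (t i)"
      by (rule msmooth_on_subset[OF compat(1) _ V]) (use that in \<open>auto simp: V_def\<close>)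
    show "t i x \<in> slice D x" if "x \<in> V" for x using t \<open>i < k\<close> that unfolding V_def by auto
  qed
  have sV: "msmooth_on (D_over D V) (D_atlas D) vs_atlas (s i)" "\<And>x. x \<in> V \<Longrightarrow> double_linear D x (s i)" if "i < k" for i
  proof -
    have "msmooth_on (D_over D U) (D_atlas D) vs_atlas (s i)" using s that by blast
    then show "msmooth_on (D_over D V) (D_atlas D) vs_atlas (s i)"
      by (rule msmooth_on_subset[OF compat(4) _ mopen_D_over[OF V]]) (auto simp: V_def mem_D_over)
    show "double_linear D x (s i)" if "x \<in> V" for x using s \<open>i < k\<close> that unfolding V_def by blast
  qed
  have dl0: "s j (t i m0) = (if i = j then 1 else 0)" if "i < k" "j < k" for i j
    using delta t that by simp
  have "\<exists>U' s'. mopen (M_atlas D) U' \<and> m0 \<in> U' \<and> U' \<subseteq> V \<and>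
    (\<forall>i<k. msmooth_on (D_over D U') (D_atlas D) vs_atlas (s' i) \<and> (\<forall>x\<in>U'. double_linear D x (s' i))) \<and>
    (\<forall>i<k. \<forall>j<k. s' j (t i m0) = (if i = j then 1 else (0::real))) \<and>
    (\<forall>i<k. \<forall>j<k. \<forall>x\<in>U'. s' j (t i x) = (if i = j then 1 else 0))"
    by (rule frame_elimination[of V m0 k t s k]) (use V mV tV sV dl0 in simp_all)
  then obtain W r where W: "mopen (M_atlas D) W" "m0 \<in> W" "W \<subseteq> V"
    and r: "\<forall>i<k. msmooth_on (D_over D W) (D_atlas D) vs_atlas (r i) \<and> (\<forall>x\<in>W. double_linear D x (r i))"
    and "\<forall>i<k. \<forall>j<k. r j (t i m0) = (if i = j then 1 else (0::real))"
    and rt: "\<forall>i<k. \<forall>j<k. \<forall>x\<in>W. r j (t i x) = (if i = j then 1 else (0::real))"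
    by (elim exE conjE)
  have exp: "\<sigma> y = (\<Sum>i<k. \<sigma> (t i x) * r i y)" if x: "x \<in> W" and \<sigma>: "double_linear D x \<sigma>" and y: "y \<in> slice D x" for x \<sigma> y
  proof -
    have xM: "x \<in> points (M_atlas D)" using mopen_subset_points[OF W(1)] x by blast
    obtain U' s' d' where U': "x \<in> U'"
      and s': "\<forall>i<k. msmooth_on (D_over D U') (D_atlas D) vs_atlas (s' i) \<and> (\<forall>x\<in>U'. double_linear D x (s' i)) \<and> d' i \<in> slice D x"
      and e: "\<forall>\<sigma> y. double_linear D x \<sigma> \<and> y \<in> slice D x \<longrightarrow> \<sigma> y = (\<Sum>i<k. \<sigma> (d' i) * s' i y)"
      using fibre_dual_basis[OF xM BA BB k] by (elim exE conjE)
    have tx: "t i x \<in> slice D x" if "i < k" for i using tV(2)[OF that] x W(3) by blast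
    \<comment> \<open>The two matrices comparing the sections \<open>t i\<close> and the functions \<open>r j\<close> with dual bases at \<open>x\<close>.\<close>
    define A where "A i l = s' l (t i x)" for i l
    define B where "B l j = r j (d' l)" for l j
    have AB: "(\<Sum>l<k. A i l * B l j) = (if i = j then 1 else 0)" if "i < k" "j < k" for i j
    proof -
      have "r j (t i x) = (\<Sum>l<k. r j (d' l) * s' l (t i x))" using e r x tx[OF that(1)] that(2) by blast
      then show ?thesis using rt that x unfolding A_def B_def by (simp add: mult.commute)
    qed
    have BA': "(\<Sum>l<k. B i l * A l j) = (if i = j then 1 else 0)" if "i < k" "j < k" for i j
      by (rule square_left_inverse[OF AB that])
    have st: "\<sigma> (t i x) = (\<Sum>l<k. \<sigma> (d' l) * A i l)" if "i < k" for i
      using e \<sigma> tx[OF that] unfolding A_def by blast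
    have "(\<Sum>i<k. \<sigma> (t i x) * r i y) = (\<Sum>i<k. (\<Sum>l<k. \<sigma> (d' l) * A i l) * (\<Sum>m<k. B m i * s' m y))"
    proof (rule sum.cong)
      fix i assume "i \<in> {..<k}"
      then have i: "i < k" by simp
      have "r i y = (\<Sum>m<k. B m i * s' m y)" unfolding B_def using e r x y i by blast
      then show "\<sigma> (t i x) * r i y = (\<Sum>l<k. \<sigma> (d' l) * A i l) * (\<Sum>m<k. B m i * s' m y)" using st[OF i] by simp
    qed simp
    also have "\<dots> = (\<Sum>i<k. \<Sum>m<k. \<Sum>l<k. s' m y * \<sigma> (d' l) * (B m i * A i l))"
      unfolding sum_product by (subst sum.swap[of _ "{..<k}" "{..<k}"]) (simp add: mult_ac)
    also have "\<dots> = (\<Sum>m<k. \<Sum>l<k. \<Sum>i<k. s' m y * \<sigma> (d' l) * (B m i * A i l))"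
      by (subst sum.swap) (intro sum.cong refl sum.swap)
    also have "\<dots> = (\<Sum>m<k. \<Sum>l<k. s' m y * \<sigma> (d' l) * (if m = l then 1 else 0))"
      using BA' by (intro sum.cong refl) (simp add: sum_distrib_left[symmetric])
    also have "\<dots> = (\<Sum>m<k. \<sigma> (d' m) * s' m y)"
      by (intro sum.cong refl) (simp add: if_distrib cong: if_cong)
    also have "\<dots> = \<sigma> y" using e \<sigma> y by simp
    finally show ?thesis by simp
  qed
  have 1: "\<forall>i<k. msmooth_on W (M_atlas D) (D_atlas D) (t i) \<and> (\<forall>x\<in>W. t i x \<in> slice D x) \<and>
      smooth_fun (D_atlas D) (D_over D W) (r i) \<and> (\<forall>x\<in>W. double_linear D x (r i))"
    using r tV msmooth_on_subset[OF compat(1) tV(1) W(1,3)] W(3) by blast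
  have 2: "\<forall>x\<in>W. \<forall>\<sigma> d. double_linear D x \<sigma> \<and> d \<in> slice D x \<longrightarrow> \<sigma> d = (\<Sum>i<k. \<sigma> (t i x) * r i d)"
    using exp by blast
  show ?thesis
    unfolding dual_frames_def
    by (rule exI[of _ W], rule exI[of _ t], rule exI[of _ r]) (intro conjI W(1,2) 1 rt 2)
qed


section \<open>Frames of the two bundles\<close>

lemma lincomb_CD: "lincomb (CD_fib D x) c (\<lambda>i. cls D x (t i)) n = coset (span (dvb_rel D x)) (\<Sum>i<n. c i *\<^sub>R gen (t i))"
  by (induction n) (simp_all add: CD_simps cls_def)

lemma lincomb_XD: "lincomb (XD_fib D x) c e n = restrict (\<lambda>d. \<Sum>i<n. c i * e i d) (slice D x)"
  by (induction n) (auto simp: XD_simps restrict_def)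

lemma CD_fib_simps: "fib (CD D) = CD_fib D" "fib (XD D) = XD_fib D"
  unfolding CD_def XD_def by simp_all

lemma XD_sec: "smooth_sec (XD D) U s \<longleftrightarrow> mopen (M_atlas D) U \<and> (\<forall>x\<in>U. s x \<in> carr (XD_fib D x)) \<and>
       smooth_fun (D_atlas D) (D_over D U) (\<lambda>d. s (projM D d) d)"
  unfolding XD_def by simp

lemma CD_sec: "smooth_sec (CD D) U s \<longleftrightarrow> mopen (M_atlas D) U \<and> (\<forall>x\<in>U. \<exists>V n f t.
       mopen (M_atlas D) V \<and> x \<in> V \<and> V \<subseteq> U \<and>
       (\<forall>i<n. smooth_fun (M_atlas D) V (f i) \<and> msmooth_on V (M_atlas D) (D_atlas D) (t i) \<and>
          (\<forall>y\<in>V. projM D (t i y) = y)) \<and>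
       (\<forall>y\<in>V. s y = lincomb (CD_fib D y) (\<lambda>i. f i y) (\<lambda>i. cls D y (t i y)) n))"
  unfolding CD_def by simp

lemma projM_slice:
  assumes "msmooth_on V (M_atlas D) (D_atlas D) t" "y \<in> V" "projM D (t y) = y"
  shows "t y \<in> slice D y"
  using msmooth_on_points[OF assms(1,2)] assms(3) vector_bundleD(3)[OF vbs(3)] unfolding D_over_def by simp

lemma cls_pairing_lincomb:
  assumes "double_linear D x \<sigma>"
  shows "cls_pairing (lincomb (CD_fib D x) c (\<lambda>i. cls D x (t i)) n) \<sigma> = (\<Sum>i<n. c i * \<sigma> (t i))"
  unfolding lincomb_CD cls_pairing_coset[OF assms] linear_sum[OF linear_lin_ext] by (simp add: lin_ext_scaleR)

lemma D_over_projM: "d \<in> D_over D U \<Longrightarrow> d \<in> slice D (projM D d) \<and> projM D d \<in> U"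
  by (simp add: D_over_def)

text \<open>The pairing of a smooth section of \<open>\<CC>(D)\<close> with a smooth double-linear function is smooth.\<close>

lemma smooth_cls_pairing:
  assumes s: "smooth_sec (CD D) V s" and \<sigma>: "smooth_fun (D_atlas D) (D_over D V) \<sigma>"
    and dl: "\<And>x. x \<in> V \<Longrightarrow> double_linear D x \<sigma>"
  shows "smooth_fun (M_atlas D) V (\<lambda>x. cls_pairing (s x) \<sigma>)"
proof (rule msmooth_on_local)
  fix x assume x: "x \<in> V"
  obtain N n f t where N: "mopen (M_atlas D) N" "x \<in> N" "N \<subseteq> V"
    and ft: "\<forall>i<n. smooth_fun (M_atlas D) N (f i) \<and> msmooth_on N (M_atlas D) (D_atlas D) (t i) \<and> (\<forall>y\<in>N. projM D (t i y) = y)"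
    and eq: "\<forall>y\<in>N. s y = lincomb (CD_fib D y) (\<lambda>i. f i y) (\<lambda>i. cls D y (t i y)) n"
    using bspec[OF conjunct2[OF s[unfolded CD_sec]] x] by (elim exE conjE)
  have "smooth_fun (M_atlas D) N (\<lambda>y. f i y * \<sigma> (t i y))" if i: "i < n" for i
  proof (rule msmooth_vs_mult[OF compat(1)])
    show "smooth_fun (M_atlas D) N (f i)" using ft i by blast
    have t: "msmooth_on N (M_atlas D) (D_atlas D) (t i)" using ft i by blast
    show "smooth_fun (M_atlas D) N (\<lambda>y. \<sigma> (t i y))"
      by (rule smooth_eval[OF \<sigma> t projM_slice[OF t] N(3)]) (use ft i in auto)
  qed
  then have "smooth_fun (M_atlas D) N (\<lambda>y. \<Sum>i<n. f i y * \<sigma> (t i y))"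
    by (intro msmooth_vs_sum[OF compat(1) finite_dim_real N(1)]) auto
  then have "smooth_fun (M_atlas D) N (\<lambda>y. cls_pairing (s y) \<sigma>)"
    by (rule msmooth_on_cong[OF compat(1)]) (use eq cls_pairing_lincomb dl N(3) in auto)
  then show "\<exists>N. x \<in> N \<and> N \<subseteq> V \<and> smooth_fun (M_atlas D) N (\<lambda>x. cls_pairing (s x) \<sigma>)" using N by blast
qed

lemma smooth_cls_pairing_sections:
  assumes s: "smooth_sec (CD D) U s" and \<sigma>: "smooth_sec (XD D) U \<sigma>"
  shows "smooth_fun (M_atlas D) U (\<lambda>x. cls_pairing (s x) (\<sigma> x))"
proof -
  have dl: "double_linear D x (\<sigma> x)" if "x \<in> U" for x using \<sigma> that unfolding XD_sec XD_simps by blast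
  have dl': "double_linear D x (\<lambda>d. \<sigma> (projM D d) d)" if "x \<in> U" for x
    by (rule double_linear_cong[OF dl[OF that]]) (simp add: D_over_def)
  have "smooth_fun (M_atlas D) U (\<lambda>x. cls_pairing (s x) (\<lambda>d. \<sigma> (projM D d) d))"
    by (rule smooth_cls_pairing[OF s _ dl']) (use \<sigma> in \<open>simp_all add: XD_sec\<close>)
  then show ?thesis
  proof (rule msmooth_on_cong[OF compat(1)])
    fix x assume x: "x \<in> U"
    then obtain N n f t where "x \<in> N"
      and ft: "\<forall>i<n. smooth_fun (M_atlas D) N (f i) \<and> msmooth_on N (M_atlas D) (D_atlas D) (t i) \<and> (\<forall>y\<in>N. projM D (t i y) = y)"
      and eq: "\<forall>y\<in>N. s y = lincomb (CD_fib D y) (\<lambda>i. f i y) (\<lambda>i. cls D y (t i y)) n"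
      using bspec[OF conjunct2[OF s[unfolded CD_sec]] x] by (elim exE conjE)
    then show "cls_pairing (s x) (\<lambda>d. \<sigma> (projM D d) d) = cls_pairing (s x) (\<sigma> x)"
      using cls_pairing_lincomb[OF dl[OF x]] cls_pairing_lincomb[OF dl'[OF x]] by simp
  qed
qed

lemma CD_section_carr:
  assumes s: "smooth_sec (CD D) U s" and x: "x \<in> U"
  shows "s x \<in> carr (CD_fib D x)"
proof -
  obtain N n f t where N: "x \<in> N"
    and ft: "\<forall>i<n. smooth_fun (M_atlas D) N (f i) \<and> msmooth_on N (M_atlas D) (D_atlas D) (t i) \<and> (\<forall>y\<in>N. projM D (t i y) = y)"
    and eq: "\<forall>y\<in>N. s y = lincomb (CD_fib D y) (\<lambda>i. f i y) (\<lambda>i. cls D y (t i y)) n"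
    using bspec[OF conjunct2[OF s[unfolded CD_sec]] x] by (elim exE conjE)
  have "lincomb (CD_fib D x) (\<lambda>i. f i x) (\<lambda>i. cls D x (t i x)) n \<in> carr (CD_fib D x)"
    by (rule lincomb_closed[OF real_vs_CD]) (use ft N projM_slice in \<open>blast intro: cls_carr\<close>)
  then show ?thesis using eq N by simp
qed

context
  fixes U t s and k :: nat
  assumes dual: "dual_frames k U t s"
begin

lemma frames_mopen: "mopen (M_atlas D) U"
    and frames_smooth: "\<forall>i<k. msmooth_on U (M_atlas D) (D_atlas D) (t i) \<and> (\<forall>x\<in>U. t i x \<in> slice D x) \<and>
      smooth_fun (D_atlas D) (D_over D U) (s i) \<and> (\<forall>x\<in>U. double_linear D x (s i))"
    and frames_dual: "\<forall>i<k. \<forall>j<k. \<forall>x\<in>U. s j (t i x) = (if i = j then 1 else (0::real))"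
    and frames_expand: "\<forall>x\<in>U. \<forall>\<sigma> d. double_linear D x \<sigma> \<and> d \<in> slice D x \<longrightarrow> \<sigma> d = (\<Sum>i<k. \<sigma> (t i x) * s i d)"
  using dual unfolding dual_frames_def by blast+

lemma sum_delta:
  assumes "i < k"
  shows "(\<Sum>j<k. c j * (if j = i then 1 else 0)) = (c i :: real)" "(\<Sum>j<k. c j * (if i = j then 1 else 0)) = (c i :: real)"
  using assms by (simp_all add: if_distrib cong: if_cong)

lemma XD_smooth_iff:
  assumes V: "mopen (M_atlas D) V" "V \<subseteq> U" and r: "is_section (XD D) V r"
  shows "smooth_sec (XD D) V r \<longleftrightarrow> (\<forall>i<k. smooth_fun (M_atlas D) V (\<lambda>x. r x (t i x)))"
proof -
  have r': "r x \<in> carr (XD_fib D x)" if "x \<in> V" for x using r that unfolding is_section_def CD_fib_simps by blast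
  have tV: "msmooth_on V (M_atlas D) (D_atlas D) (t i)" if "i < k" for i
    using msmooth_on_subset[OF compat(1) _ V] frames_smooth that by blast
  have ts: "t i x \<in> slice D x" if "i < k" "x \<in> V" for i x using frames_smooth that V(2) by blast
  show ?thesis
  proof
    assume "smooth_sec (XD D) V r"
    then have sm: "smooth_fun (D_atlas D) (D_over D V) (\<lambda>d. r (projM D d) d)" unfolding XD_sec by blast
    show "\<forall>i<k. smooth_fun (M_atlas D) V (\<lambda>x. r x (t i x))"
    proof (intro allI impI)
      fix i assume i: "i < k"
      have "smooth_fun (M_atlas D) V (\<lambda>x. r (projM D (t i x)) (t i x))"
        by (rule smooth_eval[OF sm tV[OF i] ts[OF i]]) auto
      then show "smooth_fun (M_atlas D) V (\<lambda>x. r x (t i x))"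
        by (rule msmooth_on_cong[OF compat(1)]) (use ts[OF i] in \<open>auto simp: D_over_def\<close>)
    qed
  next
    assume sm: "\<forall>i<k. smooth_fun (M_atlas D) V (\<lambda>x. r x (t i x))"
    have "smooth_fun (D_atlas D) (D_over D V) (\<lambda>d. r (projM D d) (t i (projM D d)) * s i d)" if i: "i < k" for i
    proof (rule msmooth_vs_mult[OF compat(4)])
      show "smooth_fun (D_atlas D) (D_over D V) (\<lambda>d. r (projM D d) (t i (projM D d)))"
        using smooth_pull_base[of V "\<lambda>x. r x (t i x)"] sm i by blast
      have "smooth_fun (D_atlas D) (D_over D U) (s i)" using frames_smooth i by blast
      then show "smooth_fun (D_atlas D) (D_over D V) (s i)"
        by (rule msmooth_on_subset[OF compat(4) _ mopen_D_over[OF V(1)]]) (use V(2) in \<open>auto simp: D_over_def\<close>)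
    qed
    then have "smooth_fun (D_atlas D) (D_over D V) (\<lambda>d. \<Sum>i<k. r (projM D d) (t i (projM D d)) * s i d)"
      by (intro msmooth_vs_sum[OF compat(4) finite_dim_real mopen_D_over[OF V(1)]]) auto
    then have "smooth_fun (D_atlas D) (D_over D V) (\<lambda>d. r (projM D d) d)"
    proof (rule msmooth_on_cong[OF compat(4)])
      fix d assume "d \<in> D_over D V"
      then have d: "d \<in> slice D (projM D d)" "projM D d \<in> V" using D_over_projM by auto
      then have "double_linear D (projM D d) (r (projM D d))" using r' unfolding XD_simps by blast
      then show "(\<Sum>i<k. r (projM D d) (t i (projM D d)) * s i d) = r (projM D d) d" using frames_expand d V(2) by auto
    qed
    then show "smooth_sec (XD D) V r" unfolding XD_sec using V r' by blast
  qed
qed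

lemma XD_frame: "smooth_frame (M_atlas D) (XD D) U k (\<lambda>i x. restrict (s i) (slice D x))"
proof (rule smooth_frameI[where \<epsilon> = "\<lambda>i x \<sigma>. \<sigma> (t i x)", OF compat(1)])
  fix i x assume "i < k" "x \<in> U"
  then show "restrict (s i) (slice D x) \<in> carr (fib (XD D) x)" unfolding CD_fib_simps using frames_smooth by (intro restrict_XD) blast
next
  fix c i x assume i: "i < k" and x: "x \<in> U"
  then have tx: "t i x \<in> slice D x" using frames_smooth by blast
  then have "lincomb (fib (XD D) x) c (\<lambda>i. restrict (s i) (slice D x)) k (t i x) = (\<Sum>j<k. c j * (if i = j then 1 else 0))"
    unfolding CD_fib_simps lincomb_XD using frames_dual i x by simp
  then show "lincomb (fib (XD D) x) c (\<lambda>i. restrict (s i) (slice D x)) k (t i x) = c i" using sum_delta[OF i] by simp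
next
  fix x \<sigma> assume x: "x \<in> U" and \<sigma>: "\<sigma> \<in> carr (fib (XD D) x)"
  show "\<sigma> = lincomb (fib (XD D) x) (\<lambda>i. \<sigma> (t i x)) (\<lambda>i. restrict (s i) (slice D x)) k"
    unfolding CD_fib_simps lincomb_XD
  proof (rule extensionalityI)
    show "\<sigma> \<in> extensional (slice D x)" using \<sigma> unfolding CD_fib_simps XD_simps by blast
    fix d assume d: "d \<in> slice D x"
    have "double_linear D x \<sigma>" using \<sigma> unfolding CD_fib_simps XD_simps by blast
    then show "\<sigma> d = restrict (\<lambda>d. \<Sum>i<k. \<sigma> (t i x) * restrict (s i) (slice D x) d) (slice D x) d" using frames_expand x d by simp
  qed simp
next
  fix V r assume "mopen (M_atlas D) V" "V \<subseteq> U" "is_section (XD D) V r"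
  then show "smooth_sec (XD D) V r \<longleftrightarrow> (\<forall>i<k. smooth_fun (M_atlas D) V (\<lambda>x. r x (t i x)))" by (rule XD_smooth_iff)
qed

lemma CD_expand:
  assumes x: "x \<in> U" and \<omega>: "\<omega> \<in> carr (fib (CD D) x)"
  shows "\<omega> = lincomb (fib (CD D) x) (\<lambda>i. cls_pairing \<omega> (s i)) (\<lambda>i. cls D x (t i x)) k"
proof -
  obtain p where p: "\<omega> = coset (span (dvb_rel D x)) p" "p \<in> free_on (slice D x)" using \<omega> unfolding CD_fib_simps CD_simps by blast
  let ?q = "\<Sum>i<k. cls_pairing \<omega> (s i) *\<^sub>R gen (t i x)"
  have q: "?q \<in> free_on (slice D x)"
    using frames_smooth x by (intro subspace_sum[OF subspace_free_on] subspace_scale[OF subspace_free_on] gen_free_on) auto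
  have 0: "cls_pairing (coset (span (dvb_rel D x)) (p - ?q)) \<sigma> = 0" if \<sigma>: "\<sigma> \<in> carr (XD_fib D x)" for \<sigma>
  proof -
    have dl: "double_linear D x \<sigma>" using \<sigma> unfolding XD_simps by blast
    have "lin_ext \<sigma> p = lin_ext (\<lambda>d. \<Sum>i<k. \<sigma> (t i x) *\<^sub>R s i d) p"
      by (rule lin_ext_cong[OF p(2)]) (use frames_expand x dl in simp)
    also have "\<dots> = (\<Sum>i<k. \<sigma> (t i x) *\<^sub>R lin_ext (s i) p)"
      unfolding lin_ext_def scaleR_sum_right by (subst sum.swap) (simp add: mult_ac)
    also have "\<dots> = (\<Sum>i<k. cls_pairing \<omega> (s i) * \<sigma> (t i x))"
    proof (rule sum.cong)
      fix i assume "i \<in> {..<k}"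
      then have "double_linear D x (s i)" using frames_smooth x by simp
      then show "\<sigma> (t i x) *\<^sub>R lin_ext (s i) p = cls_pairing \<omega> (s i) * \<sigma> (t i x)"
        unfolding p(1) by (simp add: cls_pairing_coset)
    qed simp
    finally show ?thesis
      unfolding cls_pairing_coset[OF dl] lin_ext_diff linear_sum[OF linear_lin_ext] by (simp add: lin_ext_scaleR)
  qed
  have "coset (span (dvb_rel D x)) (p - ?q) \<in> carr (CD_fib D x)"
    unfolding CD_simps using subspace_diff[OF subspace_free_on p(2) q] by (rule imageI)
  then have "coset (span (dvb_rel D x)) (p - ?q) = vzero (CD_fib D x)"
    using cls_pairing_nondegenerate[of x] 0 unfolding nondegenerate_def by blast
  then have "p - ?q \<in> span (dvb_rel D x)" unfolding CD_simps using coset_eq_iff[OF subspace_span, of "dvb_rel D x" "p - ?q" 0] by simp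
  then show "\<omega> = lincomb (fib (CD D) x) (\<lambda>i. cls_pairing \<omega> (s i)) (\<lambda>i. cls D x (t i x)) k"
    unfolding CD_fib_simps lincomb_CD using coset_eq_iff[OF subspace_span, of "dvb_rel D x" p ?q] p(1) by simp
qed

lemma CD_frame: "smooth_frame (M_atlas D) (CD D) U k (\<lambda>i x. cls D x (t i x))"
proof (rule smooth_frameI[where \<epsilon> = "\<lambda>i x \<omega>. cls_pairing \<omega> (s i)", OF compat(1)])
  fix i x assume "i < k" "x \<in> U"
  then show "cls D x (t i x) \<in> carr (fib (CD D) x)" unfolding CD_fib_simps using frames_smooth by (intro cls_carr) blast
next
  fix c i x assume i: "i < k" and x: "x \<in> U"
  then have dl: "double_linear D x (s i)" using frames_smooth by blast
  have "cls_pairing (lincomb (fib (CD D) x) c (\<lambda>i. cls D x (t i x)) k) (s i) = (\<Sum>j<k. c j * (if j = i then 1 else 0))"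
    unfolding CD_fib_simps cls_pairing_lincomb[OF dl] using frames_dual i x by simp
  then show "cls_pairing (lincomb (fib (CD D) x) c (\<lambda>i. cls D x (t i x)) k) (s i) = c i" using sum_delta[OF i] by simp
next
  fix x \<omega> assume "x \<in> U" "\<omega> \<in> carr (fib (CD D) x)"
  then show "\<omega> = lincomb (fib (CD D) x) (\<lambda>i. cls_pairing \<omega> (s i)) (\<lambda>i. cls D x (t i x)) k" by (rule CD_expand)
next
  fix V r assume V: "mopen (M_atlas D) V" "V \<subseteq> U" and r: "is_section (CD D) V r"
  have r': "r x \<in> carr (CD_fib D x)" if "x \<in> V" for x using r that unfolding is_section_def CD_fib_simps by blast
  show "smooth_sec (CD D) V r \<longleftrightarrow> (\<forall>i<k. smooth_fun (M_atlas D) V (\<lambda>x. cls_pairing (r x) (s i)))"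
  proof
    assume sm: "smooth_sec (CD D) V r"
    show "\<forall>i<k. smooth_fun (M_atlas D) V (\<lambda>x. cls_pairing (r x) (s i))"
    proof (intro allI impI)
      fix i assume i: "i < k"
      have "smooth_fun (D_atlas D) (D_over D U) (s i)" using frames_smooth i by blast
      then have "smooth_fun (D_atlas D) (D_over D V) (s i)"
        by (rule msmooth_on_subset[OF compat(4) _ mopen_D_over[OF V(1)]]) (use V(2) in \<open>auto simp: D_over_def\<close>)
      then show "smooth_fun (M_atlas D) V (\<lambda>x. cls_pairing (r x) (s i))"
        by (rule smooth_cls_pairing[OF sm]) (use frames_smooth i V(2) in blast)
    qed
  next
    assume sm: "\<forall>i<k. smooth_fun (M_atlas D) V (\<lambda>x. cls_pairing (r x) (s i))"
    have t: "\<forall>i<k. msmooth_on V (M_atlas D) (D_atlas D) (t i) \<and> (\<forall>y\<in>V. projM D (t i y) = y)"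
    proof (intro allI impI conjI ballI)
      fix i assume i: "i < k"
      have "msmooth_on U (M_atlas D) (D_atlas D) (t i)" using frames_smooth i by blast
      then show "msmooth_on V (M_atlas D) (D_atlas D) (t i)" by (rule msmooth_on_subset[OF compat(1) _ V])
      fix y assume "y \<in> V"
      then have "t i y \<in> slice D y" using frames_smooth i V(2) by blast
      then show "projM D (t i y) = y" by (simp add: D_over_def)
    qed
    have eq: "\<forall>y\<in>V. r y = lincomb (CD_fib D y) (\<lambda>i. cls_pairing (r y) (s i)) (\<lambda>i. cls D y (t i y)) k"
      using CD_expand[unfolded CD_fib_simps] r' V(2) by blast
    show "smooth_sec (CD D) V r"
      unfolding CD_sec
    proof (intro conjI V(1) ballI)
      fix x assume x: "x \<in> V"
      show "\<exists>N n f t. mopen (M_atlas D) N \<and> x \<in> N \<and> N \<subseteq> V \<and>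
       (\<forall>i<n. smooth_fun (M_atlas D) N (f i) \<and> msmooth_on N (M_atlas D) (D_atlas D) (t i) \<and>
          (\<forall>y\<in>N. projM D (t i y) = y)) \<and>
       (\<forall>y\<in>N. r y = lincomb (CD_fib D y) (\<lambda>i. f i y) (\<lambda>i. cls D y (t i y)) n)"
        by (rule exI[of _ V], rule exI[of _ k], rule exI[of _ "\<lambda>i x. cls_pairing (r x) (s i)"], rule exI[of _ t])
          (use V(1) x sm t eq in simp)
    qed
  qed
qed

end

lemma dual_frames_exist: "\<exists>k. \<forall>m\<in>points (M_atlas D). \<exists>U t s. m \<in> U \<and> dual_frames k U t s"
proof -
  obtain BA :: "'fa set" and crdA where BA: "coord_basis BA crdA"
    using finite_dim_coordinates[OF vector_bundleD(1)[OF vbs(1)]] by blast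
  obtain BB :: "'fb set" and crdB where BB: "coord_basis BB crdB"
    using finite_dim_coordinates[OF vector_bundleD(1)[OF vbs(2)]] by blast
  show ?thesis
  proof (rule exI, rule ballI)
    fix m assume m: "m \<in> points (M_atlas D)"
    show "\<exists>U t s. m \<in> U \<and> dual_frames (card BA * card BB + (dim (UNIV :: 'fda set) - card BB)) U t s"
      by (rule local_dual_frames[OF m BA BB refl])
  qed
qed


section \<open>The bundle structures\<close>

text \<open>What \<open>\<CC>(D)\<close> and \<open>\<XX>(D)\<close> have in common: a local notion of smooth section, and a frame for every
  pair of dual frames.\<close>

lemma dual_frame_bundle:
  assumes fr: "\<And>k U t s. dual_frames k U t s \<Longrightarrow> smooth_frame (M_atlas D) S U k (e k U t s)"
    and real: "\<And>m. real_vs (fib S m)"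
    and sec: "\<And>U s. smooth_sec S U s \<Longrightarrow> mopen (M_atlas D) U \<and> is_section S U s"
    and loc: "\<And>U s. mopen (M_atlas D) U \<Longrightarrow> (\<And>x. x \<in> U \<Longrightarrow> \<exists>V. x \<in> V \<and> V \<subseteq> U \<and> smooth_sec S V s) \<Longrightarrow> smooth_sec S U s"
  shows "is_vb (M_atlas D) S"
  unfolding is_vb_def
proof (intro conjI)
  show "\<forall>m\<in>points (M_atlas D). real_vs (fib S m)" using real by blast
  show "\<forall>U s. smooth_sec S U s \<longrightarrow> mopen (M_atlas D) U \<and> is_section S U s" using sec by blast
  show "\<forall>U s. mopen (M_atlas D) U \<longrightarrow> smooth_sec S U s = (\<forall>x\<in>U. \<exists>V. x \<in> V \<and> V \<subseteq> U \<and> smooth_sec S V s)"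
  proof (intro allI impI iffI ballI)
    fix U s x assume "smooth_sec S U s" "x \<in> U"
    then show "\<exists>V. x \<in> V \<and> V \<subseteq> U \<and> smooth_sec S V s" by (intro exI[of _ U]) simp
  qed (rule loc, assumption, blast)
  obtain k where k: "\<forall>m\<in>points (M_atlas D). \<exists>U t s. m \<in> U \<and> dual_frames k U t s"
    using dual_frames_exist by (elim exE)
  show "\<exists>k. \<forall>m\<in>points (M_atlas D). \<exists>U e. mopen (M_atlas D) U \<and> m \<in> U \<and> smooth_frame (M_atlas D) S U k e"
  proof (rule exI[of _ k], rule ballI)
    fix m assume "m \<in> points (M_atlas D)"
    from bspec[OF k this] obtain U t s where *: "m \<in> U" "dual_frames k U t s" by (elim exE conjE)
    show "\<exists>U e. mopen (M_atlas D) U \<and> m \<in> U \<and> smooth_frame (M_atlas D) S U k e"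
      by (rule exI[of _ U], rule exI[of _ "e k U t s"]) (intro conjI *(1) fr[OF *(2)] frames_mopen[OF *(2)])
  qed
qed

lemma is_vb_XD: "is_vb (M_atlas D) (XD D)"
proof (rule dual_frame_bundle[where e = "\<lambda>k U t s i x. restrict (s i) (slice D x)", OF XD_frame])
  show "real_vs (fib (XD D) m)" for m unfolding CD_fib_simps by (rule real_vs_XD)
  show "smooth_sec (XD D) U s \<Longrightarrow> mopen (M_atlas D) U \<and> is_section (XD D) U s" for U s
    unfolding XD_sec is_section_def CD_fib_simps by blast
  fix U s assume U: "mopen (M_atlas D) U" and loc: "\<And>x. x \<in> U \<Longrightarrow> \<exists>V. x \<in> V \<and> V \<subseteq> U \<and> smooth_sec (XD D) V s"
  have "smooth_fun (D_atlas D) (D_over D U) (\<lambda>d. s (projM D d) d)"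
  proof (rule msmooth_on_local)
    fix d assume "d \<in> D_over D U"
    then have d: "d \<in> slice D (projM D d)" "projM D d \<in> U" using D_over_projM by auto
    from loc[OF d(2)] obtain V where V: "projM D d \<in> V" "V \<subseteq> U" "smooth_sec (XD D) V s" by (elim exE conjE)
    then show "\<exists>N. d \<in> N \<and> N \<subseteq> D_over D U \<and> smooth_fun (D_atlas D) N (\<lambda>d. s (projM D d) d)"
      unfolding XD_sec using d by (intro exI[of _ "D_over D V"]) (auto simp: D_over_def)
  qed
  moreover have "s x \<in> carr (XD_fib D x)" if "x \<in> U" for x
    using loc[OF that] unfolding XD_sec by blast
  ultimately show "smooth_sec (XD D) U s" unfolding XD_sec using U by blast
qed

lemma is_vb_CD: "is_vb (M_atlas D) (CD D)"
proof (rule dual_frame_bundle[where e = "\<lambda>k U t s i x. cls D x (t i x)", OF CD_frame])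
  show "real_vs (fib (CD D) m)" for m unfolding CD_fib_simps by (rule real_vs_CD)
  show "smooth_sec (CD D) U s \<Longrightarrow> mopen (M_atlas D) U \<and> is_section (CD D) U s" for U s
    unfolding is_section_def CD_fib_simps using CD_section_carr[of U s] by (auto simp: CD_sec)
  fix U s assume U: "mopen (M_atlas D) U" and loc: "\<And>x. x \<in> U \<Longrightarrow> \<exists>V. x \<in> V \<and> V \<subseteq> U \<and> smooth_sec (CD D) V s"
  show "smooth_sec (CD D) U s"
    unfolding CD_sec
  proof (intro conjI U ballI)
    fix x assume "x \<in> U"
    from loc[OF this] obtain V where V: "x \<in> V" "V \<subseteq> U" "smooth_sec (CD D) V s" by (elim exE conjE)
    obtain N n f t where N: "mopen (M_atlas D) N" "x \<in> N" "N \<subseteq> V"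
      and ft: "\<forall>i<n. smooth_fun (M_atlas D) N (f i) \<and> msmooth_on N (M_atlas D) (D_atlas D) (t i) \<and> (\<forall>y\<in>N. projM D (t i y) = y)"
      and eq: "\<forall>y\<in>N. s y = lincomb (CD_fib D y) (\<lambda>i. f i y) (\<lambda>i. cls D y (t i y)) n"
      using bspec[OF conjunct2[OF V(3)[unfolded CD_sec]] V(1)] by (elim exE conjE)
    show "\<exists>N n f t. mopen (M_atlas D) N \<and> x \<in> N \<and> N \<subseteq> U \<and>
       (\<forall>i<n. smooth_fun (M_atlas D) N (f i) \<and> msmooth_on N (M_atlas D) (D_atlas D) (t i) \<and>
          (\<forall>y\<in>N. projM D (t i y) = y)) \<and>
       (\<forall>y\<in>N. s y = lincomb (CD_fib D y) (\<lambda>i. f i y) (\<lambda>i. cls D y (t i y)) n)"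
      by (rule exI[of _ N], rule exI[of _ n], rule exI[of _ f], rule exI[of _ t])
        (intro conjI N(1,2) subset_trans[OF N(3) V(2)] ft eq)
  qed
qed

lemma cls_pairing_smooth: "vb_pairing (M_atlas D) (CD D) (XD D) (\<lambda>m. cls_pairing)"
  unfolding vb_pairing_def CD_fib_simps
  using is_vb_CD is_vb_XD cls_pairing_bilinear smooth_cls_pairing_sections by blast

text \<open>The map \<open>\<XX>(D) \<rightarrow> \<CC>(D)\<^sup>*\<close> defined by the pairing; off the fibre its values are \<open>undefined\<close>, as for
  all elements of \<^const>\<open>dual_vs\<close>.\<close>

definition to_dual :: "'m \<Rightarrow> ('d \<Rightarrow> real) \<Rightarrow> (('d \<Rightarrow>\<^sub>0 real) set \<Rightarrow> real)" where
  "to_dual m \<sigma> = restrict (\<lambda>\<omega>. cls_pairing \<omega> \<sigma>) (carr (CD_fib D m))"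

lemma to_dual_iso: "linear_iso (XD_fib D m) (dual_vs (CD_fib D m)) (to_dual m)"
  unfolding to_dual_def by (rule XD_dual_iso)

lemma dual_sec: "smooth_sec (dual_bundle (M_atlas D) (CD D)) U \<xi> \<longleftrightarrow>
    mopen (M_atlas D) U \<and> (\<forall>x\<in>U. \<xi> x \<in> carr (dual_vs (CD_fib D x))) \<and>
       (\<forall>V s. V \<subseteq> U \<and> smooth_sec (CD D) V s \<longrightarrow> smooth_fun (M_atlas D) V (\<lambda>x. \<xi> x (s x)))"
  and dual_fib: "fib (dual_bundle (M_atlas D) (CD D)) = (\<lambda>m. dual_vs (CD_fib D m))"
  unfolding dual_bundle_def CD_fib_simps by simp_all

text \<open>If \<open>to_dual\<close> of a section is smooth, then so are its values on the sections \<open>[t i]\<close>; these are the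
  coefficients of the section in the frame of \<open>\<XX>(D)\<close>.\<close>

lemma to_dual_smooth_iff:
  assumes U: "mopen (M_atlas D) U" and \<sigma>: "is_section (XD D) U \<sigma>"
  shows "smooth_sec (XD D) U \<sigma> \<longleftrightarrow> smooth_sec (dual_bundle (M_atlas D) (CD D)) U (\<lambda>x. to_dual x (\<sigma> x))"
proof
  have \<sigma>x: "\<sigma> x \<in> carr (XD_fib D x)" if "x \<in> U" for x using \<sigma> that unfolding is_section_def CD_fib_simps by blast
  have ev: "to_dual x (\<sigma> x) (s x) = cls_pairing (s x) (\<sigma> x)" if "smooth_sec (CD D) V s" "x \<in> V" for V s x
    using CD_section_carr[OF that] unfolding to_dual_def by simp
  show "smooth_sec (dual_bundle (M_atlas D) (CD D)) U (\<lambda>x. to_dual x (\<sigma> x))" if sm: "smooth_sec (XD D) U \<sigma>"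
    unfolding dual_sec
  proof (intro conjI U allI impI ballI)
    show "to_dual x (\<sigma> x) \<in> carr (dual_vs (CD_fib D x))" if "x \<in> U" for x
      using to_dual_iso[of x] \<sigma>x[OF that] unfolding linear_iso_def linear_map_def by blast
    fix V s assume V: "V \<subseteq> U \<and> smooth_sec (CD D) V s"
    then have oV: "mopen (M_atlas D) V" unfolding CD_sec by blast
    have "smooth_fun (D_atlas D) (D_over D U) (\<lambda>d. \<sigma> (projM D d) d)" using sm unfolding XD_sec by blast
    then have "smooth_fun (D_atlas D) (D_over D V) (\<lambda>d. \<sigma> (projM D d) d)"
      by (rule msmooth_on_subset[OF compat(4) _ mopen_D_over[OF oV]]) (use V in \<open>auto simp: D_over_def\<close>)
    then have "smooth_sec (XD D) V \<sigma>" unfolding XD_sec using oV \<sigma>x V by blast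
    then have "smooth_fun (M_atlas D) V (\<lambda>x. cls_pairing (s x) (\<sigma> x))" using smooth_cls_pairing_sections V by blast
    then show "smooth_fun (M_atlas D) V (\<lambda>x. to_dual x (\<sigma> x) (s x))"
      by (rule msmooth_on_cong[OF compat(1)]) (use ev V in auto)
  qed
  show "smooth_sec (XD D) U \<sigma>" if sm: "smooth_sec (dual_bundle (M_atlas D) (CD D)) U (\<lambda>x. to_dual x (\<sigma> x))"
  proof -
    obtain k where k: "\<forall>m\<in>points (M_atlas D). \<exists>U t s. m \<in> U \<and> dual_frames k U t s"
      using dual_frames_exist by (elim exE)
    have "\<exists>V. x \<in> V \<and> V \<subseteq> U \<and> smooth_sec (XD D) V \<sigma>" if x: "x \<in> U" for x
    proof -
      have "x \<in> points (M_atlas D)" using mopen_subset_points[OF U] x by blast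
      from bspec[OF k this] obtain W t s where W: "x \<in> W" "dual_frames k W t s" by (elim exE conjE)
      note dW = W(2)[unfolded dual_frames_def]
      let ?V = "U \<inter> W"
      have V: "mopen (M_atlas D) ?V" using mopen_Int[OF compat(1) U] dW by blast
      have r: "is_section (XD D) ?V \<sigma>" using \<sigma> unfolding is_section_def by blast
      have "smooth_fun (M_atlas D) ?V (\<lambda>x. \<sigma> x (t i x))" if i: "i < k" for i
      proof -
        have tW: "msmooth_on W (M_atlas D) (D_atlas D) (t i)" and ts: "\<And>x. x \<in> W \<Longrightarrow> t i x \<in> slice D x"
          using dW i by blast+
        have tV: "msmooth_on ?V (M_atlas D) (D_atlas D) (t i)" by (rule msmooth_on_subset[OF compat(1) tW V]) auto
        have "smooth_sec (CD D) ?V (\<lambda>x. cls D x (t i x))"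
          unfolding CD_sec
        proof (intro conjI V ballI)
          fix y assume y: "y \<in> ?V"
          have one: "smooth_fun (M_atlas D) ?V (\<lambda>x. 1)" by (rule msmooth_vs_const[OF compat(1) finite_dim_real V])
          have pr: "\<forall>y\<in>?V. projM D (t i y) = y" using ts by (auto simp: D_over_def)
          have eq: "\<forall>y\<in>?V. cls D y (t i y) = lincomb (CD_fib D y) (\<lambda>j. 1) (\<lambda>j. cls D y (t i y)) 1"
            unfolding lincomb_CD by (simp add: cls_def)
          show "\<exists>V' n f t'. mopen (M_atlas D) V' \<and> y \<in> V' \<and> V' \<subseteq> ?V \<and>
            (\<forall>i<n. smooth_fun (M_atlas D) V' (f i) \<and> msmooth_on V' (M_atlas D) (D_atlas D) (t' i) \<and>
              (\<forall>y\<in>V'. projM D (t' i y) = y)) \<and>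
            (\<forall>y\<in>V'. cls D y (t i y) = lincomb (CD_fib D y) (\<lambda>i. f i y) (\<lambda>i. cls D y (t' i y)) n)"
            by (rule exI[of _ ?V], rule exI[of _ 1], rule exI[of _ "\<lambda>j x. 1"], rule exI[of _ "\<lambda>j. t i"])
              (intro conjI allI impI V y subset_refl one tV pr eq)
        qed
        then have "smooth_fun (M_atlas D) ?V (\<lambda>x. to_dual x (\<sigma> x) (cls D x (t i x)))"
          using sm unfolding dual_sec by blast
        then show ?thesis
        proof (rule msmooth_on_cong[OF compat(1)])
          fix y assume y: "y \<in> ?V"
          then have "double_linear D y (\<sigma> y)" "t i y \<in> slice D y" using \<sigma>x ts unfolding XD_simps by auto
          then show "to_dual y (\<sigma> y) (cls D y (t i y)) = \<sigma> y (t i y)"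
            unfolding to_dual_def using cls_carr cls_pairing_cls by simp
        qed
      qed
      then have "smooth_sec (XD D) ?V \<sigma>" using XD_smooth_iff[OF W(2) V _ r] by simp
      then show ?thesis using W(1) x by (intro exI[of _ ?V]) simp
    qed
    then show ?thesis using is_vb_XD U unfolding is_vb_def by blast
  qed
qed

lemma to_dual_vb_iso: "vb_iso (M_atlas D) (XD D) (dual_bundle (M_atlas D) (CD D)) to_dual"
proof -
  have "is_vb (M_atlas D) (dual_bundle (M_atlas D) (CD D))"
  proof (rule is_vb_transport[OF is_vb_XD, where \<Phi> = to_dual])
    show "real_vs (fib (dual_bundle (M_atlas D) (CD D)) m)" for m
      unfolding dual_fib by (rule real_vs_dual[OF real_vs_CD])
    show "linear_iso (fib (XD D) m) (fib (dual_bundle (M_atlas D) (CD D)) m) (to_dual m)" for m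
      unfolding dual_fib CD_fib_simps by (rule to_dual_iso)
    show "smooth_sec (dual_bundle (M_atlas D) (CD D)) U s \<Longrightarrow>
        mopen (M_atlas D) U \<and> is_section (dual_bundle (M_atlas D) (CD D)) U s" for U s
      unfolding dual_sec is_section_def dual_fib by blast
    show "mopen (M_atlas D) U \<Longrightarrow> is_section (XD D) U s \<Longrightarrow>
      smooth_sec (XD D) U s \<longleftrightarrow> smooth_sec (dual_bundle (M_atlas D) (CD D)) U (\<lambda>x. to_dual x (s x))" for U s
      by (rule to_dual_smooth_iff)
    fix U s s' assume s: "smooth_sec (dual_bundle (M_atlas D) (CD D)) U s" and eq: "\<And>x. x \<in> U \<Longrightarrow> s x = s' x"
    have "smooth_fun (M_atlas D) V (\<lambda>x. s' x (r x))" if V: "V \<subseteq> U \<and> smooth_sec (CD D) V r" for V r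
    proof (rule msmooth_on_cong[OF compat(1)])
      show "smooth_fun (M_atlas D) V (\<lambda>x. s x (r x))" using s V unfolding dual_sec by blast
    qed (use eq V in auto)
    then show "smooth_sec (dual_bundle (M_atlas D) (CD D)) U s'" using s eq unfolding dual_sec by auto
  qed
  then show ?thesis
    unfolding vb_iso_def dual_fib CD_fib_simps using is_vb_XD to_dual_iso to_dual_smooth_iff by blast
qed

end

section \<open>The exact sequences\<close>

lemma short_exact_transport:
  assumes ex: "short_exact U V W f g" and V: "real_vs V" and iso: "linear_iso V V' \<Phi>"
    and f': "\<And>u. u \<in> carr U \<Longrightarrow> f' u = \<Phi> (f u)" and g': "\<And>v. v \<in> carr V \<Longrightarrow> g' (\<Phi> v) = g v"
    and U: "real_vs U"
  shows "short_exact U V' W f' g'"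
proof -
  have f: "linear_map U V f" "inj_on f (carr U)" "f ` carr U = {x \<in> carr V. g x = vzero W}"
    and g: "linear_map V W g" "g ` carr V = carr W" using ex unfolding short_exact_def by auto
  have \<Phi>: "linear_map V V' \<Phi>" "inj_on \<Phi> (carr V)" "carr V' = \<Phi> ` carr V"
    using iso unfolding linear_iso_def bij_betw_def by auto
  have fV: "f u \<in> carr V" if "u \<in> carr U" for u using linear_mapD(1)[OF f(1) that] .
  have 1: "linear_map U V' f'"
    unfolding linear_map_def
    using linear_mapD[OF f(1)] linear_mapD[OF \<Phi>(1) fV] real_vsD(2,3)[OF U] fV f' by simp
  have 2: "linear_map V' W g'"
    unfolding linear_map_def \<Phi>(3) ball_simps
    using linear_mapD[OF g(1)] linear_mapD(2,3)[OF \<Phi>(1), symmetric] real_vsD(2,3)[OF V] g' by simp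
  have 3: "inj_on f' (carr U)"
    using f(2) \<Phi>(2) fV unfolding inj_on_def by (metis f')
  have "f' ` carr U = \<Phi> ` (f ` carr U)" using f' by (auto simp: image_image)
  also have "\<dots> = {x \<in> carr V'. g' x = vzero W}" unfolding f(3) \<Phi>(3) using g' by auto
  finally have 4: "f' ` carr U = {x \<in> carr V'. g' x = vzero W}" .
  have "g' ` carr V' = g ` carr V" unfolding \<Phi>(3) image_image using g' by (intro image_cong) auto
  then show ?thesis unfolding short_exact_def using 1 2 3 4 g(2) by simp
qed

text \<open>If \<open>V\<close> has a linear coordinate map \<open>\<psi>\<close> to a finite-dimensional space, with inverse \<open>\<tau>\<close>, then a
  functional on \<open>V\<close> is the combination of finitely many \<open>\<alpha> i\<close> with its values at points \<open>a i\<close> as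
  coefficients.\<close>

lemma dual_lincomb:
  fixes \<psi> :: "'v \<Rightarrow> 'f::real_normed_vector"
  assumes V: "real_vs V" and \<psi>: "linear_map V type_vs \<psi>" and B: "coord_basis (B :: 'f set) crd"
    and inv: "\<forall>v\<in>carr V. \<tau> (\<psi> v) = v" "\<forall>x. \<tau> x \<in> carr V" "\<forall>x. \<psi> (\<tau> x) = x"
  shows "\<exists>(n::nat) a \<alpha>. (\<forall>i<n. a i \<in> carr V \<and> \<alpha> i \<in> carr (dual_vs V)) \<and>
    (\<forall>f\<in>carr (dual_vs V). f = lincomb (dual_vs V) (\<lambda>i. f (a i)) \<alpha> n)"
proof -
  have \<tau>: "\<And>v. v \<in> carr V \<Longrightarrow> \<tau> (\<psi> v) = v" "\<And>x. \<tau> x \<in> carr V" "\<And>x. \<psi> (\<tau> x) = x"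
    using inv by auto
  have b: "finite B" "\<And>b. b \<in> B \<Longrightarrow> bounded_linear (crd b)" "\<And>v. (\<Sum>b\<in>B. crd b v *\<^sub>R b) = v"
    using B unfolding coord_basis_def by auto
  obtain h where h: "bij_betw h {..<card B} B"
    using ex_bij_betw_nat_finite[OF b(1)] by (auto simp: atLeast0LessThan)
  define a where "a i = \<tau> (h i)" for i
  define \<alpha> where "\<alpha> i = restrict (\<lambda>v. crd (h i) (\<psi> v)) (carr V)" for i
  have hB: "h i \<in> B" if "i < card B" for i using h that unfolding bij_betw_def by blast
  have \<alpha>: "\<alpha> i \<in> carr (dual_vs V)" if "i < card B" for i
    unfolding dual_vs_simps \<alpha>_def linear_map_def type_vs_simps
    using linear_mapD(2,3)[OF \<psi>, unfolded type_vs_simps] real_vsD(2,3)[OF V] b(2)[OF hB[OF that]]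
    by (simp add: linear_simps)
  have lc: "lincomb (dual_vs V) c \<alpha> n = restrict (\<lambda>v. \<Sum>i<n. c i * \<alpha> i v) (carr V)" for c n
    by (induction n) (auto simp: dual_vs_simps restrict_def)
  have "f = lincomb (dual_vs V) (\<lambda>i. f (a i)) \<alpha> (card B)" if f: "f \<in> carr (dual_vs V)" for f
    unfolding lc
  proof (rule extensionalityI)
    have f': "f \<in> extensional (carr V)" "linear_map V type_vs f" using f unfolding dual_vs_simps by auto
    show "f \<in> extensional (carr V)" by (rule f')
    have \<tau>l: "\<tau> (x + y) = vadd V (\<tau> x) (\<tau> y)" "\<tau> (r *\<^sub>R x) = vscl V r (\<tau> x)" for x y r
    proof -
      have "\<psi> (vadd V (\<tau> x) (\<tau> y)) = x + y" "\<psi> (vscl V r (\<tau> x)) = r *\<^sub>R x"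
        using linear_mapD(2,3)[OF \<psi> \<tau>(2)] \<tau>(2,3) by (auto simp: type_vs_simps)
      then show "\<tau> (x + y) = vadd V (\<tau> x) (\<tau> y)" "\<tau> (r *\<^sub>R x) = vscl V r (\<tau> x)"
        using \<tau>(1)[OF real_vsD(2)[OF V \<tau>(2) \<tau>(2)], of x y] \<tau>(1)[OF real_vsD(3)[OF V \<tau>(2)], of r x] by simp_all
    qed
    have l: "linear (\<lambda>x. f (\<tau> x))"
      by (rule linearI) (use linear_mapD(2,3)[OF f'(2) \<tau>(2)] \<tau>(2) in \<open>simp_all add: \<tau>l type_vs_simps\<close>)
    fix v assume v: "v \<in> carr V"
    have "f v = f (\<tau> (\<Sum>b\<in>B. crd b (\<psi> v) *\<^sub>R b))" unfolding b(3) using \<tau>(1)[OF v] by simp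
    also have "\<dots> = (\<Sum>b\<in>B. crd b (\<psi> v) * f (\<tau> b))"
      unfolding linear_sum[OF l] by (simp add: linear_cmul[OF l])
    also have "\<dots> = (\<Sum>i<card B. crd (h i) (\<psi> v) * f (\<tau> (h i)))"
      by (rule sum.reindex_bij_betw[OF h, symmetric])
    finally show "f v = restrict (\<lambda>v. \<Sum>i<card B. f (a i) * \<alpha> i v) (carr V) v"
      using v unfolding a_def \<alpha>_def by (simp add: mult.commute)
  qed simp
  then show ?thesis using \<alpha> \<tau>(2) unfolding a_def by (intro exI[of _ "card B"] exI[of _ "\<lambda>i. \<tau> (h i)"] exI[of _ \<alpha>]) blast
qed

text \<open>An element of \<open>V\<^sup>* \<otimes> W\<^sup>*\<close> that vanishes as a bilinear form is zero: modulo the relations its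
  representative \<open>w\<close> is the combination \<open>E\<close> of the tensors \<open>\<alpha> i \<otimes> \<beta> j\<close> whose coefficients are the values
  of the form.\<close>

lemma dual_tensor_eq_0:
  assumes V: "real_vs V" and W: "real_vs W"
    and a: "\<forall>i<n. a i \<in> carr V \<and> \<alpha> i \<in> carr (dual_vs V)" "\<forall>f\<in>carr (dual_vs V). f = lincomb (dual_vs V) (\<lambda>i. f (a i)) \<alpha> n"
    and b: "\<forall>j<n'. b j \<in> carr W \<and> \<beta> j \<in> carr (dual_vs W)" "\<forall>g\<in>carr (dual_vs W). g = lincomb (dual_vs W) (\<lambda>j. g (b j)) \<beta> n'"
    and w: "w \<in> free_on (carr (dual_vs V) \<times> carr (dual_vs W))"
    and 0: "\<And>v w'. v \<in> carr V \<Longrightarrow> w' \<in> carr W \<Longrightarrow> lin_ext (\<lambda>(f, g). f v * g w') w = 0"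
  shows "w \<in> span (bilin_rel (dual_vs V) (dual_vs W))"
proof -
  let ?N = "span (bilin_rel (dual_vs V) (dual_vs W))"
  define E where "E = (\<lambda>(f, g). \<Sum>i<n. \<Sum>j<n'. (f (a i) * g (b j)) *\<^sub>R gen (\<alpha> i, \<beta> j))"
  have E: "gen (f, g) - E (f, g) \<in> ?N" if f: "f \<in> carr (dual_vs V)" and g: "g \<in> carr (dual_vs W)" for f g
  proof -
    have 1: "gen (f, g) - (\<Sum>i<n. f (a i) *\<^sub>R gen (\<alpha> i, g)) \<in> ?N"
      using tensor_lincomb(2)[OF real_vs_dual[OF V] real_vs_dual[OF W] _ g, of n \<alpha> "\<lambda>i. f (a i)"] a f by simp
    have 2: "gen (\<alpha> i, g) - (\<Sum>j<n'. g (b j) *\<^sub>R gen (\<alpha> i, \<beta> j)) \<in> ?N" if "i < n" for i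
      using tensor_lincomb(3)[OF real_vs_dual[OF W] real_vs_dual[OF V], of n' \<beta> "\<alpha> i" "\<lambda>j. g (b j)"] a b g that by simp
    have "(\<Sum>i<n. f (a i) *\<^sub>R (gen (\<alpha> i, g) - (\<Sum>j<n'. g (b j) *\<^sub>R gen (\<alpha> i, \<beta> j)))) \<in> ?N"
      using 2 by (intro span_sum span_scale) auto
    from span_add[OF 1 this] show ?thesis
      unfolding E_def by (simp add: scaleR_right_diff_distrib sum_subtractf scaleR_sum_right)
  qed
  have "lin_ext (\<lambda>q. gen q - E q) w \<in> ?N"
    unfolding lin_ext_def using w E by (intro span_sum span_scale) (auto simp: free_on_def)
  moreover have "lin_ext (\<lambda>q. gen q - E q) w = w - lin_ext E w"
    using lin_ext_gen_self[of w] unfolding lin_ext_def by (simp add: scaleR_right_diff_distrib sum_subtractf)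
  moreover have "lin_ext E w = (\<Sum>i<n. \<Sum>j<n'. lin_ext (\<lambda>(f, g). f (a i) * g (b j)) w *\<^sub>R gen (\<alpha> i, \<beta> j))"
    unfolding lin_ext_def E_def
    by (simp add: scaleR_sum_right scaleR_sum_left case_prod_unfold sum.swap[of _ _ "Poly_Mapping.keys w"])
  ultimately show ?thesis using 0 a(1) b(1) by simp
qed

context dvb
begin

lemma real_vs_sides:
  assumes "m \<in> points (M_atlas D)"
  shows "real_vs (fibre (sideA D) m)" "real_vs (fibre (sideB D) m)"
  using vector_bundleD(7)[OF vbs(1)] vector_bundleD(7)[OF vbs(2)] assms tots by auto

abbreviation "dualA m \<equiv> dual_vs (fibre (sideA D) m)"
abbreviation "dualB m \<equiv> dual_vs (fibre (sideB D) m)"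

lemma AB_dual_simps:
  "carr (AB_dual_fib D m) = coset (span (bilin_rel (dualA m) (dualB m))) ` free_on (carr (dualA m) \<times> carr (dualB m))"
  "vadd (AB_dual_fib D m) (coset (span (bilin_rel (dualA m) (dualB m))) p) (coset (span (bilin_rel (dualA m) (dualB m))) q) =
    coset (span (bilin_rel (dualA m) (dualB m))) (p + q)"
  "vscl (AB_dual_fib D m) r (coset (span (bilin_rel (dualA m) (dualB m))) p) =
    coset (span (bilin_rel (dualA m) (dualB m))) (r *\<^sub>R p)"
  unfolding AB_dual_fib_def tensor_vs_def by (rule quot_vs_simps[OF subspace_span])+

lemma real_vs_AB_dual: "real_vs (AB_dual_fib D m)"
  unfolding AB_dual_fib_def tensor_vs_def by (rule real_vs_quot[OF subspace_free_on subspace_span])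

lemma slice_sides:
  assumes "d \<in> slice D m"
  shows "d \<in> T" "m \<in> points (M_atlas D)" "qA d \<in> carr (fibre (sideA D) m)" "qB d \<in> carr (fibre (sideB D) m)"
  using assms projT[of d] square[of d] side_base(1)[of "qA d"] by (auto simp: mem_D_over carr_fibre)

lemma map_i_coset:
  assumes u: "u \<in> free_on (carr (dualA m) \<times> carr (dualB m))"
  shows "map_i D m (coset (span (bilin_rel (dualA m) (dualB m))) u) =
    restrict (\<lambda>d. lin_ext (\<lambda>(f, g). f (qA d) * g (qB d)) u) (slice D m)"
  unfolding map_i_def
proof (rule restrict_ext)
  fix d assume d: "d \<in> slice D m"
  note s = slice_sides[OF d]
  show "tensor_pairing (AB_tensor D m d) (coset (span (bilin_rel (dualA m) (dualB m))) u) =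
    lin_ext (\<lambda>(f, g). f (qA d) * g (qB d)) u"
    unfolding AB_tensor_def tensor_def
    using tensor_pairing_coset[OF real_vs_sides[OF s(2)] _ u, of "gen (qA d, qB d)"] gen_free_on[of "(qA d, qB d)"] s(3,4)
    by simp
qed

lemma double_linear_tensor:
  assumes u: "u \<in> free_on (carr (dualA m) \<times> carr (dualB m))"
  shows "double_linear D m (\<lambda>d. lin_ext (\<lambda>(f, g). f (qA d) * g (qB d)) u)"
  unfolding lin_ext_def
proof (rule double_linear_sum)
  fix q assume "q \<in> Poly_Mapping.keys u"
  then obtain f g where q: "q = (f, g)" "f \<in> carr (dualA m)" "g \<in> carr (dualB m)" using u unfolding free_on_def by auto
  have "double_linear D m (\<lambda>d. Poly_Mapping.lookup u q * (f (qA d) * g (qB d)))"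
    by (intro double_linear_scale double_linear_product) (use q in \<open>auto simp: dual_vs_simps\<close>)
  then show "double_linear D m (\<lambda>d. Poly_Mapping.lookup u q *\<^sub>R (case q of (f, g) \<Rightarrow> f (qA d) * g (qB d)))"
    unfolding q(1) by simp
qed

lemma map_i_carr: "\<theta> \<in> carr (AB_dual_fib D m) \<Longrightarrow> map_i D m \<theta> \<in> carr (XD_fib D m)"
  unfolding AB_dual_simps using map_i_coset restrict_XD[OF double_linear_tensor] by auto

lemma map_i_linear: "linear_map (AB_dual_fib D m) (XD_fib D m) (map_i D m)"
  unfolding linear_map_def
proof (intro conjI ballI allI)
  fix \<theta> assume \<theta>: "\<theta> \<in> carr (AB_dual_fib D m)"
  then show "map_i D m \<theta> \<in> carr (XD_fib D m)" by (rule map_i_carr)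
  obtain u where u: "\<theta> = coset (span (bilin_rel (dualA m) (dualB m))) u" "u \<in> free_on (carr (dualA m) \<times> carr (dualB m))"
    using \<theta> unfolding AB_dual_simps by blast
  show "map_i D m (vscl (AB_dual_fib D m) r \<theta>) = vscl (XD_fib D m) r (map_i D m \<theta>)" for r
    unfolding u(1) AB_dual_simps map_i_coset[OF u(2)] map_i_coset[OF subspace_scale[OF subspace_free_on u(2)]] XD_simps
    by (auto simp: lin_ext_scaleR restrict_def)
  show "map_i D m (vadd (AB_dual_fib D m) \<theta> \<theta>') = vadd (XD_fib D m) (map_i D m \<theta>) (map_i D m \<theta>')"
    if \<theta>': "\<theta>' \<in> carr (AB_dual_fib D m)" for \<theta>'
  proof -
    obtain v where v: "\<theta>' = coset (span (bilin_rel (dualA m) (dualB m))) v" "v \<in> free_on (carr (dualA m) \<times> carr (dualB m))"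
      using \<theta>' unfolding AB_dual_simps by blast
    show ?thesis
      unfolding u(1) v(1) AB_dual_simps map_i_coset[OF u(2)] map_i_coset[OF v(2)]
        map_i_coset[OF subspace_add[OF subspace_free_on u(2) v(2)]] XD_simps
      by (auto simp: lin_ext_add restrict_def)
  qed
qed

lemma core_slice: "m \<in> points (M_atlas D) \<Longrightarrow> c \<in> core m \<Longrightarrow> c \<in> slice D m"
  unfolding core_def mem_D_over using zero_side(3) by auto

lemma map_j_linear:
  assumes m: "m \<in> points (M_atlas D)"
  shows "linear_map (XD_fib D m) (dual_vs (core_fib D m)) (map_j D m)"
  unfolding linear_map_def map_j_def dual_vs_simps core_fib_simps type_vs_simps XD_simps
proof (intro conjI ballI allI)
  fix \<sigma> r assume \<sigma>: "\<sigma> \<in> {\<sigma> \<in> extensional (slice D m). double_linear D m \<sigma>}"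
  then have dl: "double_linear D m \<sigma>" by blast
  have c: "x \<in> T" "pA (qA x) = m" "qA x = nA m" if "x \<in> core m" for x
    using that zero_side(3)[OF m] unfolding core_def by auto
  show "restrict \<sigma> (core m) \<in> {f \<in> extensional (core m). (\<forall>x\<in>core m. f x \<in> UNIV) \<and>
      (\<forall>x\<in>core m. \<forall>y\<in>core m. f (addA x y) = f x + f y) \<and> (\<forall>r. \<forall>x\<in>core m. f (sclA r x) = r *\<^sub>R f x)}"
    using core_closed(1,2)[OF m] double_linearD(1)[OF dl c(1,2)] double_linearD(3)[OF dl c(1,2)] c by simp
  show "restrict (restrict (\<lambda>x. r * \<sigma> x) (slice D m)) (core m) = restrict (\<lambda>x. r * restrict \<sigma> (core m) x) (core m)"
    using core_slice[OF m] by (auto simp: restrict_def)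
  show "restrict (restrict (\<lambda>x. \<sigma> x + \<rho> x) (slice D m)) (core m) =
      restrict (\<lambda>x. restrict \<sigma> (core m) x + restrict \<rho> (core m) x) (core m)" for \<rho>
    using core_slice[OF m] by (auto simp: restrict_def)
qed

text \<open>Injectivity of \<open>i\<close> uses that there is an element of \<open>D\<close> over every pair \<open>(a, b)\<close>; a double-linear
  function in the kernel of \<open>j\<close> is a bilinear form in the projections, hence a sum of products of
  coordinates; and \<open>j\<close> is surjective because functionals on the core extend.\<close>

lemma exact_sequence:
  assumes m: "m \<in> points (M_atlas D)"
  shows "short_exact (AB_dual_fib D m) (XD_fib D m) (dual_vs (core_fib D m)) (map_i D m) (map_j D m)"
proof -
  let ?N = "span (bilin_rel (dualA m) (dualB m))"
  note V = real_vs_sides(1)[OF m] and W = real_vs_sides(2)[OF m]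
  obtain BA :: "'fa set" and crdA where BA: "coord_basis BA crdA"
    using finite_dim_coordinates[OF vector_bundleD(1)[OF vbs(1)]] by blast
  obtain BB :: "'fb set" and crdB where BB: "coord_basis BB crdB"
    using finite_dim_coordinates[OF vector_bundleD(1)[OF vbs(2)]] by blast
  have bA: "\<And>i. i \<in> BA \<Longrightarrow> bounded_linear (crdA i)" and bB: "\<And>j. j \<in> BB \<Longrightarrow> bounded_linear (crdB j)"
    using BA BB unfolding coord_basis_def by auto
  obtain U and \<Psi>A :: "'a \<Rightarrow> 'fa" and \<tau>A and \<Psi>B :: "'b \<Rightarrow> 'fb" and \<tau>B and C :: "'fda set" and L cc dd where
    U: "m \<in> U" and TA: "local_triv (sideA D) U \<Psi>A \<tau>A" and TB: "local_triv (sideB D) U \<Psi>B \<tau>B"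
    and "finite C" "card C + card BB = dim (UNIV :: 'fda set)"
    and "\<forall>c\<in>C. msmooth_on (D_over D U) (D_atlas D) vs_atlas (L c) \<and> (\<forall>m'\<in>U. double_linear D m' (L c)) \<and> cc c \<in> core m"
    and "\<forall>c\<in>C. \<forall>c'\<in>C. L c (cc c') = (if c = c' then 1 else 0)"
    and "\<forall>x\<in>core m. \<forall>\<sigma>. double_linear D m \<sigma> \<longrightarrow> \<sigma> x = (\<Sum>c\<in>C. L c x * \<sigma> (cc c))"
    and dd: "\<forall>a b. a \<in> tot (sideA D) \<and> b \<in> tot (sideB D) \<and> pA a = m \<and> pB b = m \<longrightarrow>
      dd a b \<in> T \<and> qA (dd a b) = a \<and> qB (dd a b) = b \<and> (\<forall>c\<in>C. L c (dd a b) = 0)"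
    using fibre_splitting[OF m BB] by (elim exE conjE) (rule that)
  have dd': "dd a b \<in> slice D m" "qA (dd a b) = a" "qB (dd a b) = b"
    if "a \<in> carr (fibre (sideA D) m)" "b \<in> carr (fibre (sideB D) m)" for a b
    using dd that by (auto simp: carr_fibre mem_D_over)
  have lA: "linear_map (fibre (sideA D) m) type_vs \<Psi>A" and lB: "linear_map (fibre (sideB D) m) type_vs \<Psi>B"
    using TA TB U unfolding local_triv_def by blast+
  have tA: "\<forall>v\<in>carr (fibre (sideA D) m). \<tau>A m (\<Psi>A v) = v" "\<forall>x. \<tau>A m x \<in> carr (fibre (sideA D) m)"
      "\<forall>x. \<Psi>A (\<tau>A m x) = x"
    using triv_inv[OF TA] triv_tau[OF TA U] U by (auto simp: carr_fibre)
  have tB: "\<forall>v\<in>carr (fibre (sideB D) m). \<tau>B m (\<Psi>B v) = v" "\<forall>x. \<tau>B m x \<in> carr (fibre (sideB D) m)"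
      "\<forall>x. \<Psi>B (\<tau>B m x) = x"
    using triv_inv[OF TB] triv_tau[OF TB U] U by (auto simp: carr_fibre)
  have inj: "inj_on (map_i D m) (carr (AB_dual_fib D m))"
  proof (rule inj_onI)
    fix \<theta> \<theta>' assume "\<theta> \<in> carr (AB_dual_fib D m)" "\<theta>' \<in> carr (AB_dual_fib D m)" and eq: "map_i D m \<theta> = map_i D m \<theta>'"
    then obtain u v where u: "\<theta> = coset ?N u" "u \<in> free_on (carr (dualA m) \<times> carr (dualB m))"
      and v: "\<theta>' = coset ?N v" "v \<in> free_on (carr (dualA m) \<times> carr (dualB m))" unfolding AB_dual_simps by blast
    obtain n a \<alpha> where a: "\<forall>i<(n::nat). a i \<in> carr (fibre (sideA D) m) \<and> \<alpha> i \<in> carr (dualA m)"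
      "\<forall>f\<in>carr (dualA m). f = lincomb (dualA m) (\<lambda>i. f (a i)) \<alpha> n"
      using dual_lincomb[OF V lA BA tA] by (elim exE conjE)
    obtain n' b \<beta> where b: "\<forall>i<(n'::nat). b i \<in> carr (fibre (sideB D) m) \<and> \<beta> i \<in> carr (dualB m)"
      "\<forall>f\<in>carr (dualB m). f = lincomb (dualB m) (\<lambda>i. f (b i)) \<beta> n'"
      using dual_lincomb[OF W lB BB tB] by (elim exE conjE)
    have "u - v \<in> ?N"
    proof (rule dual_tensor_eq_0[OF V W a b])
      show "u - v \<in> free_on (carr (dualA m) \<times> carr (dualB m))" by (rule subspace_diff[OF subspace_free_on u(2) v(2)])
      fix x y assume xy: "x \<in> carr (fibre (sideA D) m)" "y \<in> carr (fibre (sideB D) m)"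
      have "map_i D m \<theta> (dd x y) = map_i D m \<theta>' (dd x y)" using eq by simp
      then show "lin_ext (\<lambda>(f, g). f x * g y) (u - v) = 0"
        unfolding u(1) v(1) map_i_coset[OF u(2)] map_i_coset[OF v(2)] using dd'[OF xy] by (simp add: lin_ext_diff)
    qed
    then show "\<theta> = \<theta>'" unfolding u v using coset_eq_iff[OF subspace_span] by blast
  qed
  have ker: "map_i D m ` carr (AB_dual_fib D m) = {\<sigma> \<in> carr (XD_fib D m). map_j D m \<sigma> = vzero (dual_vs (core_fib D m))}"
  proof (intro equalityI subsetI)
    fix \<sigma> assume "\<sigma> \<in> map_i D m ` carr (AB_dual_fib D m)"
    then obtain u where u: "\<sigma> = map_i D m (coset ?N u)" "u \<in> free_on (carr (dualA m) \<times> carr (dualB m))"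
      unfolding AB_dual_simps by blast
    have "\<sigma> c = 0" if c: "c \<in> core m" for c
    proof -
      have "f (qA c) = 0" if "f \<in> carr (dualA m)" for f
        using linear_map_zero[OF V real_vs_type_vs, of f] that c
        by (auto simp: dual_vs_simps fibre_simps type_vs_simps core_def)
      then have "lin_ext (\<lambda>(f, g). f (qA c) * g (qB c)) u = lin_ext (\<lambda>_. 0) u"
        by (intro lin_ext_cong[OF u(2)]) auto
      then show ?thesis unfolding u(1) map_i_coset[OF u(2)] using core_slice[OF m c] by (simp add: lin_ext_def)
    qed
    then have "map_j D m \<sigma> = vzero (dual_vs (core_fib D m))"
      unfolding map_j_def dual_vs_simps core_fib_simps by (auto simp: restrict_def)
    moreover have "\<sigma> \<in> carr (XD_fib D m)" unfolding u(1) by (rule map_i_carr) (use u(2) in \<open>simp add: AB_dual_simps\<close>)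
    ultimately show "\<sigma> \<in> {\<sigma> \<in> carr (XD_fib D m). map_j D m \<sigma> = vzero (dual_vs (core_fib D m))}" by blast
  next
    fix \<sigma> assume "\<sigma> \<in> {\<sigma> \<in> carr (XD_fib D m). map_j D m \<sigma> = vzero (dual_vs (core_fib D m))}"
    then have \<sigma>: "\<sigma> \<in> carr (XD_fib D m)" "map_j D m \<sigma> = vzero (dual_vs (core_fib D m))" by auto
    then have dl: "double_linear D m \<sigma>" unfolding XD_simps by blast
    have c0: "\<sigma> c = 0" if "c \<in> core m" for c
      using fun_cong[OF \<sigma>(2), of c] that unfolding map_j_def dual_vs_simps core_fib_simps by simp
    define \<alpha> where "\<alpha> i = restrict (\<lambda>v. crdA i (\<Psi>A v)) (carr (fibre (sideA D) m))" for i
    define \<beta> where "\<beta> j = restrict (\<lambda>v. crdB j (\<Psi>B v)) (carr (fibre (sideB D) m))" for j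
    have \<alpha>: "\<alpha> i \<in> carr (dualA m)" if "i \<in> BA" for i
      unfolding dual_vs_simps \<alpha>_def linear_map_def type_vs_simps
      using linear_mapD(2,3)[OF lA, unfolded type_vs_simps] real_vsD(2,3)[OF V] bA[OF that]
      by (simp add: linear_simps)
    have \<beta>: "\<beta> j \<in> carr (dualB m)" if "j \<in> BB" for j
      unfolding dual_vs_simps \<beta>_def linear_map_def type_vs_simps
      using linear_mapD(2,3)[OF lB, unfolded type_vs_simps] real_vsD(2,3)[OF W] bB[OF that]
      by (simp add: linear_simps)
    define u where "u = (\<Sum>i\<in>BA. \<Sum>j\<in>BB. \<sigma> (dd (\<tau>A m i) (\<tau>B m j)) *\<^sub>R gen (\<alpha> i, \<beta> j))"
    have u: "u \<in> free_on (carr (dualA m) \<times> carr (dualB m))"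
      unfolding u_def using \<alpha> \<beta>
      by (intro subspace_sum[OF subspace_free_on] subspace_scale[OF subspace_free_on] gen_free_on) auto
    have "map_i D m (coset ?N u) = \<sigma>"
      unfolding map_i_coset[OF u]
    proof (rule extensionalityI)
      show "\<sigma> \<in> extensional (slice D m)" using \<sigma> unfolding XD_simps by blast
      fix d assume d: "d \<in> slice D m"
      note s = slice_sides[OF d]
      have "lin_ext (\<lambda>(f, g). f (qA d) * g (qB d)) u =
        (\<Sum>i\<in>BA. \<Sum>j\<in>BB. \<sigma> (dd (\<tau>A m i) (\<tau>B m j)) * (\<alpha> i (qA d) * \<beta> j (qB d)))"
        unfolding u_def linear_sum[OF linear_lin_ext] lin_ext_scaleR by simp
      also have "\<dots> = (\<Sum>i\<in>BA. \<Sum>j\<in>BB. crdA i (\<Psi>A (qA d)) * crdB j (\<Psi>B (qB d)) * \<sigma> (dd (\<tau>A m i) (\<tau>B m j)))"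
        unfolding \<alpha>_def \<beta>_def using s by (simp add: mult_ac)
      also have "\<dots> = \<sigma> d"
        by (rule double_linear_bilinear[OF dl c0 U TA TB BA BB _ d, symmetric]) (use dd in blast)+
      finally show "restrict (\<lambda>d. lin_ext (\<lambda>(f, g). f (qA d) * g (qB d)) u) (slice D m) d = \<sigma> d" using d by simp
    qed simp
    then show "\<sigma> \<in> map_i D m ` carr (AB_dual_fib D m)" unfolding AB_dual_simps using u by blast
  qed
  have surj: "map_j D m ` carr (XD_fib D m) = carr (dual_vs (core_fib D m))"
  proof (intro equalityI subsetI)
    fix \<xi> assume "\<xi> \<in> map_j D m ` carr (XD_fib D m)"
    then show "\<xi> \<in> carr (dual_vs (core_fib D m))" using linear_mapD(1)[OF map_j_linear[OF m]] by blast
  next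
    fix \<xi> assume "\<xi> \<in> carr (dual_vs (core_fib D m))"
    then have \<xi>: "\<xi> \<in> extensional (core m)" "linear_map (core_fib D m) type_vs \<xi>"
      unfolding dual_vs_simps core_fib_simps by auto
    obtain K where K: "double_linear D m K" "\<forall>c\<in>core m. K c = \<xi> c"
      using core_extension[OF m \<xi>(2)] by blast
    have "\<xi> = map_j D m (restrict K (slice D m))"
      unfolding map_j_def core_fib_simps
      by (rule extensionalityI[OF \<xi>(1)]) (use K(2) core_slice[OF m] in auto)
    then show "\<xi> \<in> map_j D m ` carr (XD_fib D m)" using restrict_XD[OF K(1)] by blast
  qed
  show ?thesis unfolding short_exact_def using map_i_linear map_j_linear[OF m] inj ker surj by blast
qed

lemma map_p_coset:
  assumes m: "m \<in> points (M_atlas D)"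
  shows "map_p D m (coset (span (dvb_rel D m)) p) =
    coset (span (bilin_rel (fibre (sideA D) m) (fibre (sideB D) m))) (lin_ext (\<lambda>d. gen (qA d, qB d)) p)"
  unfolding map_p_def
proof (rule induced_coset[OF subspace_span])
  let ?R = "bilin_rel (fibre (sideA D) m) (fibre (sideB D) m)" and ?G = "lin_ext (\<lambda>d. gen (qA d, qB d))"
  fix n assume n: "n \<in> span (dvb_rel D m)"
  have sub: "subspace {n. ?G n \<in> span ?R}"
    by (rule subspaceI) (auto simp: linear_0[OF linear_lin_ext] lin_ext_add lin_ext_scaleR span_zero intro: span_add span_scale)
  have "?G r \<in> ?R" if r: "r \<in> dvb_rel D m" for r
  proof -
    consider x y where "r = gen x + gen y - gen (addA x y)" "x \<in> slice D m" "y \<in> slice D m" "qA x = qA y"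
      | x y where "r = gen x + gen y - gen (addB x y)" "x \<in> slice D m" "y \<in> slice D m" "qB x = qB y"
      | c x where "r = c *\<^sub>R gen x - gen (sclA c x)" "x \<in> slice D m"
      | c x where "r = c *\<^sub>R gen x - gen (sclB c x)" "x \<in> slice D m"
      using r unfolding dvb_rel_def by blast
    then show ?thesis
    proof cases
      case 1
      note s = slice_sides[OF 1(2)] slice_sides[OF 1(3)]
      have "?G r = gen (qA x, qB x) + gen (qA x, qB y) - gen (qA x, vadd (fibre (sideB D) m) (qB x) (qB y))"
        unfolding 1(1) lin_ext_diff lin_ext_add
        using closedA(2)[OF s(1,5) 1(4)] proj_linear(3)[OF s(1,5) 1(4)] 1(4) by (simp add: vadd_fibre)
      then show ?thesis unfolding bilin_rel_def using s by blast
    next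
      case 2
      note s = slice_sides[OF 2(2)] slice_sides[OF 2(3)]
      have "?G r = gen (qA x, qB x) + gen (qA y, qB x) - gen (vadd (fibre (sideA D) m) (qA x) (qA y), qB x)"
        unfolding 2(1) lin_ext_diff lin_ext_add
        using closedB(2)[OF s(1,5) 2(4)] proj_linear(1)[OF s(1,5) 2(4)] 2(4) by (simp add: vadd_fibre)
      then show ?thesis unfolding bilin_rel_def using s by blast
    next
      case 3
      note s = slice_sides[OF 3(2)]
      have "?G r = c *\<^sub>R gen (qA x, qB x) - gen (qA x, vscl (fibre (sideB D) m) c (qB x))"
        unfolding 3(1) lin_ext_diff lin_ext_scaleR
        using closedA(4)[OF s(1), of c] proj_linear(4)[OF s(1), of c] by (simp add: vscl_fibre)
      then show ?thesis unfolding bilin_rel_def using s by blast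
    next
      case 4
      note s = slice_sides[OF 4(2)]
      have "?G r = c *\<^sub>R gen (qA x, qB x) - gen (vscl (fibre (sideA D) m) c (qA x), qB x)"
        unfolding 4(1) lin_ext_diff lin_ext_scaleR
        using closedB(4)[OF s(1), of c] proj_linear(2)[OF s(1), of c] by (simp add: vscl_fibre)
      then show ?thesis unfolding bilin_rel_def using s by blast
    qed
  qed
  then have "dvb_rel D m \<subseteq> {n. ?G n \<in> span ?R}" using span_base by blast
  then have "?G n \<in> span ?R" using span_minimal[OF _ sub] n by blast
  then show "coset (span ?R) (?G (p + n)) = coset (span ?R) (?G p)"
    using coset_eq_iff[OF subspace_span, of ?R "?G (p + n)" "?G p"] by (simp add: lin_ext_add)
qed

lemma pairing_map_i:
  assumes m: "m \<in> points (M_atlas D)" and \<omega>: "\<omega> \<in> carr (CD_fib D m)" and \<theta>: "\<theta> \<in> carr (AB_dual_fib D m)"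
  shows "cls_pairing \<omega> (map_i D m \<theta>) = tensor_pairing (map_p D m \<omega>) \<theta>"
proof -
  obtain p where p: "\<omega> = coset (span (dvb_rel D m)) p" "p \<in> free_on (slice D m)" using \<omega> unfolding CD_simps by blast
  obtain u where u: "\<theta> = coset (span (bilin_rel (dualA m) (dualB m))) u" "u \<in> free_on (carr (dualA m) \<times> carr (dualB m))"
    using \<theta> unfolding AB_dual_simps by blast
  let ?G = "lin_ext (\<lambda>d. gen (qA d, qB d))" and ?H = "\<lambda>(v, w). lin_ext (\<lambda>(f, g). f v * g w) u"
  have Gp: "?G p \<in> free_on (carr (fibre (sideA D) m) \<times> carr (fibre (sideB D) m))"
    unfolding lin_ext_def using p(2) slice_sides(3,4)
    by (intro subspace_sum[OF subspace_free_on] subspace_scale[OF subspace_free_on] gen_free_on) (auto simp: free_on_def)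
  have "tensor_pairing (map_p D m \<omega>) \<theta> = lin_ext ?H (?G p)"
    unfolding p(1) u(1) map_p_coset[OF m] by (rule tensor_pairing_coset[OF real_vs_sides[OF m] Gp u(2)])
  also have "\<dots> = lin_ext (\<lambda>d. lin_ext ?H (?G (gen d))) p"
    by (rule linear_eq_lin_ext[OF linear_compose[OF linear_lin_ext linear_lin_ext, unfolded o_def]])
  also have "\<dots> = lin_ext (map_i D m \<theta>) p"
    unfolding u(1) map_i_coset[OF u(2)] by (rule lin_ext_cong[OF p(2)]) simp
  also have "\<dots> = cls_pairing \<omega> (map_i D m \<theta>)"
    unfolding p(1) using map_i_carr[OF \<theta>] by (intro cls_pairing_coset[symmetric]) (simp add: XD_simps)
  finally show ?thesis by simp
qed

lemma pairing_map_e: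
  assumes "m \<in> points (M_atlas D)" "c \<in> carr (core_fib D m)" "\<sigma> \<in> carr (XD_fib D m)"
  shows "cls_pairing (map_e D m c) \<sigma> = map_j D m \<sigma> c"
  using assms cls_pairing_cls[of m \<sigma> c] unfolding map_e_def map_j_def XD_simps by simp

lemma to_dual_map_i:
  assumes "m \<in> points (M_atlas D)" "\<theta> \<in> carr (AB_dual_fib D m)"
  shows "to_dual m (map_i D m \<theta>) = map_p_dual D m \<theta>"
  unfolding to_dual_def map_p_dual_def transpose_map_def
  by (rule restrict_ext) (rule pairing_map_i[OF assms(1) _ assms(2)])

lemma map_e_dual_to_dual:
  assumes "m \<in> points (M_atlas D)" "\<sigma> \<in> carr (XD_fib D m)"
  shows "map_e_dual D m (to_dual m \<sigma>) = map_j D m \<sigma>"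
  unfolding map_e_dual_def transpose_map_def map_j_def[of D m \<sigma>]
proof (rule restrict_ext)
  fix c assume c: "c \<in> carr (core_fib D m)"
  then have "map_e D m c \<in> carr (CD_fib D m)"
    unfolding map_e_def using core_slice[OF assms(1)] by (intro cls_carr) (simp add: core_fib_simps)
  then show "to_dual m \<sigma> (map_e D m c) = \<sigma> c"
    using pairing_map_e[OF assms(1) c assms(2)] c unfolding to_dual_def map_j_def by simp
qed

text \<open>Under \<open>to_dual\<close> the maps \<open>i\<close> and \<open>j\<close> become \<open>\<pp>\<^sup>*\<close> and \<open>\<ee>\<^sup>*\<close>, so this sequence is exact because that of
  double-linear functions is.\<close>

lemma dual_exact_sequence:
  assumes m: "m \<in> points (M_atlas D)"
  shows "short_exact (AB_dual_fib D m) (dual_vs (CD_fib D m)) (dual_vs (core_fib D m)) (map_p_dual D m) (map_e_dual D m)"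
  by (rule short_exact_transport[OF exact_sequence[OF m] real_vs_XD to_dual_iso])
    (use to_dual_map_i[OF m] map_e_dual_to_dual[OF m] real_vs_AB_dual in auto)

end

theorem mainTheorem4:
  fixes D :: "('d, 'ed::real_normed_vector, 'a, 'ea::real_normed_vector,
               'b, 'eb::real_normed_vector, 'm, 'em::real_normed_vector) dvb"
  assumes "double_vector_bundle TYPE('fa::real_normed_vector) TYPE('fb::real_normed_vector)
             TYPE('fda::real_normed_vector) TYPE('fdb::real_normed_vector) D"
  shows "\<exists>pair :: 'm \<Rightarrow> ('d \<Rightarrow>\<^sub>0 real) set \<Rightarrow> ('d \<Rightarrow> real) \<Rightarrow> real.
    vb_pairing (M_atlas D) (CD D) (XD D) pair \<and>
    (\<forall>m\<in>points (M_atlas D).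
      (\<forall>d\<in>slice D m. \<forall>\<sigma>\<in>carr (XD_fib D m). pair m (cls D m d) \<sigma> = \<sigma> d) \<and>
      (\<forall>b. bilinear_form (CD_fib D m) (XD_fib D m) b \<and>
           (\<forall>d\<in>slice D m. \<forall>\<sigma>\<in>carr (XD_fib D m). b (cls D m d) \<sigma> = \<sigma> d) \<longrightarrow>
         (\<forall>\<omega>\<in>carr (CD_fib D m). \<forall>\<sigma>\<in>carr (XD_fib D m). b \<omega> \<sigma> = pair m \<omega> \<sigma>)) \<and>
      nondegenerate (CD_fib D m) (XD_fib D m) (pair m) \<and>
      (\<forall>\<omega>\<in>carr (CD_fib D m). \<forall>\<theta>\<in>carr (AB_dual_fib D m).
         pair m \<omega> (map_i D m \<theta>) = tensor_pairing (map_p D m \<omega>) \<theta>) \<and>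
      (\<forall>c\<in>carr (core_fib D m). \<forall>\<sigma>\<in>carr (XD_fib D m).
         pair m (map_e D m c) \<sigma> = map_j D m \<sigma> c)) \<and>
    (let \<Phi> = (\<lambda>m \<sigma>. restrict (\<lambda>\<omega>. pair m \<omega> \<sigma>) (carr (CD_fib D m))) in
      vb_iso (M_atlas D) (XD D) (dual_bundle (M_atlas D) (CD D)) \<Phi> \<and>
      (\<forall>m\<in>points (M_atlas D).
        short_exact (AB_dual_fib D m) (XD_fib D m) (dual_vs (core_fib D m))
          (map_i D m) (map_j D m) \<and>
        short_exact (AB_dual_fib D m) (dual_vs (CD_fib D m)) (dual_vs (core_fib D m))
          (map_p_dual D m) (map_e_dual D m) \<and>
        (\<forall>\<theta>\<in>carr (AB_dual_fib D m). \<Phi> m (map_i D m \<theta>) = map_p_dual D m \<theta>) \<and>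
        (\<forall>\<sigma>\<in>carr (XD_fib D m). map_e_dual D m (\<Phi> m \<sigma>) = map_j D m \<sigma>)))"
proof -
  interpret dvb D by (rule dvb.intro[OF assms])
  let ?pair = "\<lambda>m :: 'm. cls_pairing :: ('d \<Rightarrow>\<^sub>0 real) set \<Rightarrow> ('d \<Rightarrow> real) \<Rightarrow> real"
  have dl: "\<sigma> \<in> carr (XD_fib D m) \<Longrightarrow> double_linear D m \<sigma>" for \<sigma> m unfolding XD_simps by blast
  show ?thesis
    unfolding Let_def
  proof (rule exI[of _ ?pair], unfold to_dual_def[symmetric], intro conjI ballI allI impI)
    show "vb_pairing (M_atlas D) (CD D) (XD D) ?pair" by (rule cls_pairing_smooth)
    show "vb_iso (M_atlas D) (XD D) (dual_bundle (M_atlas D) (CD D)) to_dual" by (rule to_dual_vb_iso)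
    fix m assume m: "m \<in> points (M_atlas D)"
    show "nondegenerate (CD_fib D m) (XD_fib D m) cls_pairing" by (rule cls_pairing_nondegenerate)
    show "short_exact (AB_dual_fib D m) (XD_fib D m) (dual_vs (core_fib D m)) (map_i D m) (map_j D m)"
      by (rule exact_sequence[OF m])
    show "short_exact (AB_dual_fib D m) (dual_vs (CD_fib D m)) (dual_vs (core_fib D m)) (map_p_dual D m) (map_e_dual D m)"
      by (rule dual_exact_sequence[OF m])
    show "to_dual m (map_i D m \<theta>) = map_p_dual D m \<theta>" if "\<theta> \<in> carr (AB_dual_fib D m)" for \<theta>
      by (rule to_dual_map_i[OF m that])
    show "cls_pairing \<omega> (map_i D m \<theta>) = tensor_pairing (map_p D m \<omega>) \<theta>"
      if "\<omega> \<in> carr (CD_fib D m)" "\<theta> \<in> carr (AB_dual_fib D m)" for \<omega> \<theta>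
      by (rule pairing_map_i[OF m that])
    fix \<sigma> assume \<sigma>: "\<sigma> \<in> carr (XD_fib D m)"
    show "cls_pairing (cls D m d) \<sigma> = \<sigma> d" for d by (rule cls_pairing_cls[OF dl[OF \<sigma>]])
    show "map_e_dual D m (to_dual m \<sigma>) = map_j D m \<sigma>" by (rule map_e_dual_to_dual[OF m \<sigma>])
    show "cls_pairing (map_e D m c) \<sigma> = map_j D m \<sigma> c" if "c \<in> carr (core_fib D m)" for c
      by (rule pairing_map_e[OF m that \<sigma>])
    show "b \<omega> \<sigma> = cls_pairing \<omega> \<sigma>"
      if b: "bilinear_form (CD_fib D m) (XD_fib D m) b \<and>
        (\<forall>d\<in>slice D m. \<forall>\<sigma>\<in>carr (XD_fib D m). b (cls D m d) \<sigma> = \<sigma> d)"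
        and \<omega>: "\<omega> \<in> carr (CD_fib D m)" for b \<omega>
      by (rule cls_pairing_unique[OF conjunct1[OF b] _ \<omega> \<sigma>]) (use b in simp)
  qed
qed

end
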